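(* Assume that there exist $m\ge 1$, $\epsilon_0>0$ and $C>0$ such that $V$ is holomorphic in $$\mathcal{D}:= \{ z= (z_1,z_2) \in \mathbb{C}^2 \mid |\operatorname{Im} z| \le \epsilon_0 \langle \operatorname{Re} z\rangle \}$$ and satisfies $|V(z)| \le C \langle \operatorname{Re} z\rangle^m$ for all $z\in\mathcal{D}$. Suppose in addition that there is a constant $C'>0$ such that $\frac{1}{C'}\langle x\rangle^m \le V(x)$ for all $x\in\mathbb{R}^2$ (in particular $V$ is real-valued on $\mathbb{R}^2$). Let $H_V:=-\Delta+V(x)$ on $L^2(\mathbb{R}^2)$. Then, for any $\epsilon\in]0,1[$, the length of $N(u)\cap\left(B_V(\lambda)\setminus B_V(\epsilon\lambda)\right)$ for an eigenpair $(u,\lambda)$ of $H_V$ is of the order of $\lambda^{\frac12+\frac2m}$ as $\lambda\to+\infty$; that is, there exist constants $K\ge 1$ and $\lambda_0>0$ such that, for every eigenpair $(u,\lambda)$ of $H_V$ ($u\ne0$ real-valued) with $\lambda\ge\lambda_0$, $$\frac1K\,\lambda^{\frac12+\frac2m}\le \mathrm{length}\left(N(u)\cap (B_V(\lambda)\setminus B_V(\epsilon\lambda))\right)\le K\,\lambda^{\frac12+\frac2m}.$$ Moreover, one can take $\epsilon=0$ when $V$ is a polynomial.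
   Context: $\langle x\rangle := \sqrt{1+|x|^2}$. $N(u)$ is the nodal set of $u$ in $\mathbb{R}^2$, i.e. the closure of $\{u=0\}$. For $\mu\in\mathbb{R}$, $B_V(\mu) := \{ x \in \mathbb{R}^2 \mid V(x) < \mu \}$. Length means one-dimensional Hausdorff measure. *)

theory Defs
  imports "HOL-Analysis.Analysis"
begin

definition japanese_bracket :: "'a::real_normed_vector \<Rightarrow> real" where
  "japanese_bracket x = sqrt (1 + (norm x)\<^sup>2)"

definition Re_vec :: "complex^'n \<Rightarrow> real^'n" where
  "Re_vec z = (\<chi> i. Re (z $ i))"

definition Im_vec :: "complex^'n \<Rightarrow> real^'n" where
  "Im_vec z = (\<chi> i. Im (z $ i))"

definition complex_vec :: "real^'n \<Rightarrow> complex^'n" where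
  "complex_vec x = (\<chi> i. complex_of_real (x $ i))"

text \<open>Several-variable analogue of \<^const>\<open>holomorphic_on\<close>: a complex-linear
  derivative within the set exists at every point of the set.\<close>

definition vec_holomorphic_on :: "(complex^'n \<Rightarrow> complex) \<Rightarrow> (complex^'n) set \<Rightarrow> bool" where
  "vec_holomorphic_on f S \<longleftrightarrow>
     (\<forall>z\<in>S. \<exists>f'. (f has_derivative f') (at z within S) \<and> (\<forall>c v. f' (c *s v) = c * f' v))"

definition conic_nbhd :: "real \<Rightarrow> (complex^2) set" where
  "conic_nbhd \<epsilon>\<^sub>0 = {z. norm (Im_vec z) \<le> \<epsilon>\<^sub>0 * japanese_bracket (Re_vec z)}"

definition partial :: "'n::finite \<Rightarrow> (real^'n \<Rightarrow> real) \<Rightarrow> real^'n \<Rightarrow> real" where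
  "partial i f x = frechet_derivative f (at x) (axis i 1)"

definition laplacian :: "(real^'n \<Rightarrow> real) \<Rightarrow> real^'n \<Rightarrow> real" where
  "laplacian f x = (\<Sum>i\<in>UNIV. partial i (partial i f) x)"

definition smooth :: "(real^'n \<Rightarrow> real) \<Rightarrow> bool" where
  "smooth f \<longleftrightarrow> (\<forall>is x. foldr partial is f differentiable (at x))"

definition test_function :: "(real^'n \<Rightarrow> real) \<Rightarrow> bool" where
  "test_function \<phi> \<longleftrightarrow> smooth \<phi> \<and> compact (closure {x. \<phi> x \<noteq> 0})"

definition L2 :: "(real^'n \<Rightarrow> real) set" where
  "L2 = {f \<in> borel_measurable lebesgue. integrable lebesgue (\<lambda>x. (f x)\<^sup>2)}"

text \<open>\<open>schroedinger_op V f g\<close> says that \<open>f\<close> belongs to the domain of \<open>H\<^sub>V = -\<Delta> + V\<close> and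
  \<open>H\<^sub>V f = g\<close>, where \<open>H\<^sub>V\<close> is the adjoint in \<open>L\<^sup>2\<close> of \<open>-\<Delta> + V\<close> on \<open>C\<^sub>c\<^sup>\<infinity>\<close>. For \<open>V\<close> continuous and
  bounded below the latter is essentially self-adjoint, so its adjoint is its closure, i.e. the
  (unique) self-adjoint realization. Elements of \<open>L\<^sup>2\<close> are represented by functions, so the relation
  is invariant under almost-everywhere changes of \<open>f\<close> and \<open>g\<close>.\<close>

definition schroedinger_op ::
    "(real^'n \<Rightarrow> real) \<Rightarrow> (real^'n \<Rightarrow> real) \<Rightarrow> (real^'n \<Rightarrow> real) \<Rightarrow> bool" where
  "schroedinger_op V f g \<longleftrightarrow> f \<in> L2 \<and> g \<in> L2 \<and>
     (\<forall>\<phi>. test_function \<phi> \<longrightarrow>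
        (LINT x|lebesgue. f x * (- laplacian \<phi> x + V x * \<phi> x)) = (LINT x|lebesgue. g x * \<phi> x))"

text \<open>An eigenfunction is taken to be its continuous representative, so that its zero set makes
  sense pointwise; for this representative \<open>u \<noteq> 0\<close> in \<open>L\<^sup>2\<close> means that \<open>u\<close> is not identically zero.\<close>

definition eigenpair :: "(real^'n \<Rightarrow> real) \<Rightarrow> (real^'n \<Rightarrow> real) \<Rightarrow> real \<Rightarrow> bool" where
  "eigenpair V u lam \<longleftrightarrow>
     continuous_on UNIV u \<and> (\<exists>x. u x \<noteq> 0) \<and> schroedinger_op V u (\<lambda>x. lam * u x)"

definition nodal_set :: "(real^'n \<Rightarrow> real) \<Rightarrow> (real^'n) set" where
  "nodal_set u = closure {x. u x = 0}"

definition sublevel :: "('a \<Rightarrow> real) \<Rightarrow> real \<Rightarrow> 'a set" where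
  "sublevel V \<mu> = {x. V x < \<mu>}"

text \<open>One-dimensional Hausdorff measure, normalized so that it is arc length on curves. The
  covering sets are required to be bounded because \<^const>\<open>diameter\<close> is unspecified on unbounded sets.\<close>

definition hausdorff1_content :: "real \<Rightarrow> 'a::metric_space set \<Rightarrow> ennreal" where
  "hausdorff1_content \<delta> A =
     (INF E\<in>{E :: nat \<Rightarrow> 'a set. A \<subseteq> (\<Union>i. E i) \<and> (\<forall>i. bounded (E i) \<and> diameter (E i) \<le> \<delta>)}.
        \<Sum>i. ennreal (diameter (E i)))"

definition hausdorff1 :: "'a::metric_space set \<Rightarrow> ennreal" where
  "hausdorff1 A = (SUP \<delta>\<in>{0<..}. hausdorff1_content \<delta> A)"

definition nodal_length_order :: "(real^2 \<Rightarrow> real) \<Rightarrow> real \<Rightarrow> real \<Rightarrow> bool" where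
  "nodal_length_order V m \<epsilon> \<longleftrightarrow>
     (\<exists>K\<ge>1. \<exists>lam0>0. \<forall>u lam. eigenpair V u lam \<and> lam \<ge> lam0 \<longrightarrow>
        ennreal (1 / K * lam powr (1/2 + 2/m))
          \<le> hausdorff1 (nodal_set u \<inter> (sublevel V lam - sublevel V (\<epsilon> * lam))) \<and>
        hausdorff1 (nodal_set u \<inter> (sublevel V lam - sublevel V (\<epsilon> * lam)))
          \<le> ennreal (K * lam powr (1/2 + 2/m)))"

end

theory Submission
  imports Defs "HOL-Complex_Analysis.Cauchy_Integral_Formula"
begin

text \<open>Write \<open>q = V - \<lambda>\<close> and \<open>\<lambda> = T powr m\<close>, so that \<open>\<Delta>u = q u\<close>. Since \<open>V\<close> grows, \<open>u\<close> attains its maximum \<open>M\<close> in the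
  region \<open>V \<le> \<lambda>\<close>, which lies in a disc of radius comparable to \<open>T\<close>. In a square of side \<open>R\<close>, comparable to \<open>T\<close>,
  on which \<open>V\<close> is analytic with radius comparable to \<open>T\<close>, iterating an interior gradient bound gives
  \<open>|\<partial>\<^sub>i\<^sup>n u| \<le> M e\<^sup>\<sigma> n! (const / R)\<^sup>n\<close> with \<open>\<sigma> = R sqrt \<Lambda>\<close> of order \<open>T sqrt \<lambda>\<close>. Lagrange interpolation with about
  \<open>\<sigma>\<close> nodes then shows on every line parallel to an axis that smallness on a set of positive measure propagates and that many zeros
  force smallness. Following chains of squares around an annulus, and crossing the central disc (where \<open>V\<close> need
  not be analytic at scale \<open>T\<close>) by Rellich's identity, one finds \<open>sup |u| \<ge> M e\<^sup>-\<^sup>S\<^sup>\<sigma>\<close> on every such square.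

  A nodal point in a square of side at most of order \<open>1 / sqrt \<lambda>\<close> is joined by the maximum principle to zeros on the boundary of
  every concentric square, so one of the two coordinate projections of the nodal set near that point is large. For the upper bound, the
  zero count on lines limits the number of small cells which meet the nodal set. For the lower bound, every square of side
  of order \<open>1 / sqrt \<lambda>\<close> in a part of the allowed region contains a zero, and there are about \<open>T\<^sup>2 \<lambda>\<close> disjoint ones, each
  contributing length of order \<open>1 / sqrt \<lambda>\<close>. Both bounds are of order \<open>T\<^sup>2 sqrt \<lambda>\<close>, which is the claimed power of \<open>\<lambda>\<close>.\<close>

section \<open>Partial derivatives and an interior gradient bound\<close>

text \<open>The argument is real-variable: a complex extension of \<open>u\<close> is replaced by
  bounds on its pure derivatives along each axis, and analyticity of \<open>V\<close> enters through
  the same derivatives of \<open>V\<close>. Hence sup-norm squares instead of discs, and two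
  one-dimensional steps for every two-dimensional one. All losses are measured in units of \<sigma>.
  One propagation step divides the exponent \<open>S\<close> in exp(-S \<sigma>) by a fixed factor.
  The final exponent is independent of \<lambda> because squares and annulus both have size of order
  \<open>T\<close>, which bounds the number of steps in a chain. The cone hypothesis gives
  \<open>V\<close> at x an analyticity radius proportional to <x>, far below \<open>T\<close> near
  the origin. This obstacle is behind \<epsilon> > 0: the central disc then lies below the level
  \<epsilon> \<lambda> and contains nothing to be counted, but it may contain the maximum point of
  \<open>u\<close> and so has to be crossed. There \<open>V\<close> and x . grad V are small against
  \<lambda>, which is the sign condition in Rellich's identity. For a polynomial the coefficients on
  lines are controlled by its size at scale \<open>T\<close>, so the disc can be shrunk to
  nothing.\<close>

definition square :: "real^2 \<Rightarrow> real \<Rightarrow> (real^2) set" where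
  "square x r = {y. \<forall>i. \<bar>y $ i - x $ i\<bar> \<le> r}"

text \<open>Differentiability is recorded along one coordinate line at a time, at all points of the
  plane: this is the notion that passes to locally uniform limits of mollifications.\<close>

definition has_partial :: "2 \<Rightarrow> (real^2 \<Rightarrow> real) \<Rightarrow> (real^2 \<Rightarrow> real) \<Rightarrow> bool" where
  "has_partial i f g \<longleftrightarrow>
     (\<forall>x. ((\<lambda>t. f (x + t *\<^sub>R axis i 1)) has_real_derivative g x) (at 0))"

lemma square_eq_cbox: "square x r = cbox (x - vec r) (x + vec r)"
  by (auto simp: square_def mem_box_cart abs_le_iff algebra_simps)

lemma compact_square: "compact (square x r)"
  unfolding square_eq_cbox by (rule compact_cbox)

lemma convex_square: "convex (square x r)"
  unfolding square_eq_cbox by (rule convex_box)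

lemma center_in_square: "r \<ge> 0 \<Longrightarrow> x \<in> square x r"
  by (simp add: square_def)

lemma square_mono: "r \<le> s \<Longrightarrow> square x r \<subseteq> square x s"
  unfolding square_def by (auto intro: order_trans)

lemma square_trans:
  assumes "y \<in> square x r" "z \<in> square y s" "r + s \<le> t"
  shows "z \<in> square x t"
  unfolding square_def
proof safe
  fix i
  have "\<bar>y $ i - x $ i\<bar> \<le> r" "\<bar>z $ i - y $ i\<bar> \<le> s" using assms by (auto simp: square_def)
  then show "\<bar>z $ i - x $ i\<bar> \<le> t" using assms(3) by linarith
qed

lemma square_commute: "y \<in> square x r \<longleftrightarrow> x \<in> square y r"
  by (simp add: square_def abs_minus_commute)

lemma square_add_axis: "\<bar>t\<bar> \<le> r \<Longrightarrow> x + t *\<^sub>R axis i 1 \<in> square x r"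
  by (auto simp: square_def axis_def)

lemma norm_le_square:
  assumes "y \<in> square x r"
  shows "norm (y - x) \<le> 2 * r"
proof -
  have "\<bar>y $ 1 - x $ 1\<bar> \<le> r" "\<bar>y $ 2 - x $ 2\<bar> \<le> r" using assms by (auto simp: square_def)
  then show ?thesis using norm_le_l1_cart[of "y - x"] by (simp add: sum_2)
qed

lemma norm_in_square: "norm (y - x) \<le> r \<Longrightarrow> y \<in> square x r"
  unfolding square_def using component_le_norm_cart[of "y - x"] by (auto intro: order_trans)

lemma axis_nth_2: "(x + t *\<^sub>R axis i 1) $ (j::2) = x $ j + (if j = i then t else (0::real))"
  by (simp add: axis_def)

lemma UNIV_2_pair: "j \<noteq> i \<Longrightarrow> UNIV = {i, j :: 2}"
  by (metis (full_types) UNIV_2 UNIV_eq_I exhaust_2 insertCI)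

lemma sum_2_pair: "j \<noteq> i \<Longrightarrow> (\<Sum>k\<in>UNIV. f k) = f i + f (j :: 2)"
  by (subst UNIV_2_pair[of j i]) auto

lemma ex_other_2: "\<exists>j::2. j \<noteq> i"
  by (cases "i = 1") (auto intro: exI[of _ 1] exI[of _ 2])

lemma has_partialD:
  assumes "has_partial i f g"
  shows "((\<lambda>t. f (x + t *\<^sub>R axis i 1)) has_real_derivative g (x + s *\<^sub>R axis i 1)) (at s)"
proof -
  have "((\<lambda>t. f ((x + s *\<^sub>R axis i 1) + t *\<^sub>R axis i 1)) has_real_derivative g (x + s *\<^sub>R axis i 1)) (at 0)"
    using assms unfolding has_partial_def by blast
  then have "((\<lambda>t. f (x + (t + s) *\<^sub>R axis i 1)) has_real_derivative g (x + s *\<^sub>R axis i 1)) (at 0)"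
    by (simp add: scaleR_add_left add_ac)
  then show ?thesis using DERIV_at_within_shift[of "\<lambda>t. f (x + t *\<^sub>R axis i 1)" _ s 0 UNIV]
    by (simp add: add.commute)
qed

lemma has_partial_add: "has_partial i f f' \<Longrightarrow> has_partial i g g' \<Longrightarrow> has_partial i (\<lambda>x. f x + g x) (\<lambda>x. f' x + g' x)"
  unfolding has_partial_def by (auto intro: DERIV_add)

lemma has_partial_diff: "has_partial i f f' \<Longrightarrow> has_partial i g g' \<Longrightarrow> has_partial i (\<lambda>x. f x - g x) (\<lambda>x. f' x - g' x)"
  unfolding has_partial_def by (auto intro: DERIV_diff)

lemma has_partial_minus: "has_partial i f f' \<Longrightarrow> has_partial i (\<lambda>x. - f x) (\<lambda>x. - f' x)"
  unfolding has_partial_def by (auto intro: DERIV_minus)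

lemma has_partial_cmult: "has_partial i f f' \<Longrightarrow> has_partial i (\<lambda>x. c * f x) (\<lambda>x. c * f' x)"
  unfolding has_partial_def by (auto intro: DERIV_cmult)

lemma has_partial_mult: "has_partial i f f' \<Longrightarrow> has_partial i g g' \<Longrightarrow>
    has_partial i (\<lambda>x. f x * g x) (\<lambda>x. f' x * g x + f x * g' x)"
  unfolding has_partial_def by (auto intro!: derivative_eq_intros)

lemma has_partial_const: "has_partial i (\<lambda>x. c) (\<lambda>x. 0)"
  unfolding has_partial_def by auto

lemma has_partial_sum: "(\<And>k. k \<in> A \<Longrightarrow> has_partial i (f k) (f' k)) \<Longrightarrow>
    has_partial i (\<lambda>x. \<Sum>k\<in>A. f k x) (\<lambda>x. \<Sum>k\<in>A. f' k x)"
  unfolding has_partial_def by (auto intro!: DERIV_sum)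

lemma has_partial_nth: "has_partial i (\<lambda>x. x $ j) (\<lambda>x. if j = i then 1 else 0)"
  unfolding has_partial_def axis_nth_2 by (auto intro!: derivative_eq_intros)

lemma has_partial_chain:
  assumes "has_partial i f f'" and "\<And>x. (h has_real_derivative h' x) (at (f x))"
  shows "has_partial i (\<lambda>x. h (f x)) (\<lambda>x. h' x * f' x)"
  unfolding has_partial_def
proof
  fix x
  have "((\<lambda>t. f (x + t *\<^sub>R axis i 1)) has_real_derivative f' x) (at 0)"
    using assms(1) unfolding has_partial_def by blast
  then show "((\<lambda>t. h (f (x + t *\<^sub>R axis i 1))) has_real_derivative h' x * f' x) (at 0)"
    using DERIV_chain2[of h "h' x" "\<lambda>t. f (x + t *\<^sub>R axis i 1)" 0] assms(2)[of x] by simp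
qed

lemma has_partial_unique: "has_partial i f g \<Longrightarrow> has_partial i f h \<Longrightarrow> g = h"
  unfolding has_partial_def by (auto intro: DERIV_unique)

lemma has_partial_cong: "has_partial i f g \<Longrightarrow> (\<And>x. f x = f2 x) \<Longrightarrow> (\<And>x. g x = g2 x) \<Longrightarrow> has_partial i f2 g2"
  by (metis ext)

lemma second_derivative_nonneg_at_min:
  fixes g :: "real \<Rightarrow> real"
  assumes g: "\<And>t. (g has_real_derivative g' t) (at t)"
    and g': "(g' has_real_derivative c) (at 0)"
    and d: "d > 0" and min: "\<And>t. \<bar>t\<bar> < d \<Longrightarrow> g 0 \<le> g t"
  shows "c \<ge> 0"
proof (rule ccontr)
  assume "\<not> c \<ge> 0"
  have z: "g' 0 = 0"
    using DERIV_local_min[OF g d] min by (simp add: abs_minus_commute)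
  obtain e where e: "e > 0" "\<And>h. 0 < h \<Longrightarrow> h < e \<Longrightarrow> g' (0 + h) < g' 0"
    using DERIV_neg_dec_right[OF g'] \<open>\<not> c \<ge> 0\<close> by (metis not_le)
  define t where "t = min e d / 2"
  have t: "0 < t" "t < e" "t < d" using e d by (auto simp: t_def)
  obtain z where "0 < z" "z < t" "g t - g 0 = (t - 0) * g' z"
    using MVT2[of 0 t g g'] t g by blast
  moreover have "g' z < 0" using e(2)[of z] \<open>z < t\<close> \<open>0 < z\<close> t z by simp
  ultimately have "g t < g 0" using t by (simp add: mult_less_0_iff) (smt (verit) mult_pos_neg)
  then show False using min[of t] t by simp
qed

lemma second_partial_nonneg_at_min:
  assumes "has_partial i v v1" "has_partial i v1 v2"
    and "r > 0" "\<And>y. y \<in> square x r \<Longrightarrow> v x \<le> v y"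
  shows "v2 x \<ge> 0"
proof (rule second_derivative_nonneg_at_min)
  show "((\<lambda>t. v (x + t *\<^sub>R axis i 1)) has_real_derivative v1 (x + t *\<^sub>R axis i 1)) (at t)" for t
    by (rule has_partialD) fact
  show "((\<lambda>t. v1 (x + t *\<^sub>R axis i 1)) has_real_derivative v2 x) (at 0)"
    using has_partialD[OF assms(2), of x 0] by simp
  show "v (x + 0 *\<^sub>R axis i 1) \<le> v (x + t *\<^sub>R axis i 1)" if "\<bar>t\<bar> < r" for t
    using assms(4)[OF square_add_axis] that by simp
qed fact

lemma has_partial_reflect:
  assumes w: "has_partial j w w'"
  shows "has_partial j (\<lambda>y. w (y + (2 * (c - y $ i)) *\<^sub>R axis i 1))
           (\<lambda>y. (if j = i then -1 else 1) * w' (y + (2 * (c - y $ i)) *\<^sub>R axis i 1))"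
  unfolding has_partial_def
proof
  fix x :: "real^2"
  let ?R = "\<lambda>y. y + (2 * (c - y $ i)) *\<^sub>R axis i (1::real)"
  define s :: real where "s = (if j = i then -1 else 1)"
  have R: "?R (x + t *\<^sub>R axis j 1) = ?R x + (s * t) *\<^sub>R axis j 1" for t
    by (auto simp: vec_eq_iff axis_def s_def algebra_simps)
  have "((\<lambda>t. w (?R x + t *\<^sub>R axis j 1)) has_real_derivative w' (?R x)) (at (s * 0))"
    using has_partialD[OF w, of "?R x" 0] by simp
  then have "((\<lambda>t. w (?R x + (s * t) *\<^sub>R axis j 1)) has_real_derivative w' (?R x) * s) (at 0)"
    by (rule DERIV_chain2) (auto intro!: derivative_eq_intros)
  then show "((\<lambda>t. w (?R (x + t *\<^sub>R axis j 1))) has_real_derivative s * w' (?R x)) (at 0)"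
    unfolding R by (simp add: mult.commute)
qed

text \<open>On the half square \<open>y\<^sub>i > x\<^sub>i\<close>, the difference of \<open>w\<close> and its reflection in \<open>y\<^sub>i = x\<^sub>i\<close> vanishes on the
  axis of reflection, so a maximum principle with the quadratic barrier \<open>p\<close> bounds the normal derivative at \<open>x\<close>.\<close>

lemma gradient_bound_aux:
  fixes w :: "real^2 \<Rightarrow> real"
  assumes cw: "continuous_on UNIV w"
    and w1: "\<And>i. has_partial i w (w1 i)" and w2: "\<And>i. has_partial i (w1 i) (w2 i)"
    and d: "d > 0" and M: "\<And>y. y \<in> square x d \<Longrightarrow> \<bar>w y\<bar> \<le> M"
    and N: "\<And>y. y \<in> square x d \<Longrightarrow> \<bar>\<Sum>i\<in>UNIV. w2 i y\<bar> \<le> N" and N': "N' > N"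
  shows "w1 i x \<le> 2 / d * M + d / 2 * N'"
proof -
  obtain j where ji: "j \<noteq> i" using ex_other_2 by metis
  have M0: "M \<ge> 0" using M[OF center_in_square] d by (smt (verit))
  have N0: "N' > 0" using N[OF center_in_square] d N' by (smt (verit))
  define R :: "real^2 \<Rightarrow> real^2" where "R y = y + (2 * (x $ i - y $ i)) *\<^sub>R axis i 1" for y
  \<comment> \<open>The first summand is harmonic and at least \<open>M\<close> on the three outer
    faces of the half square; the second is nonnegative there and has Laplacian \<open>- N'\<close>.
    The \<open>i\<close>-derivative of \<open>p\<close> at \<open>x\<close> is the asserted
    bound.\<close>
  define p where "p y = M / d\<^sup>2 * ((y $ j - x $ j)\<^sup>2 + (y $ i - x $ i) * (2 * d - (y $ i - x $ i)))
      + N' / 2 * ((y $ i - x $ i) * (d - (y $ i - x $ i)))" for y :: "real^2"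
  define p1 where "p1 k y = (if k = i then M / d\<^sup>2 * (2 * d - 2 * (y $ i - x $ i)) + N' / 2 * (d - 2 * (y $ i - x $ i))
      else M / d\<^sup>2 * (2 * (y $ j - x $ j)))" for k and y :: "real^2"
  define p2 where "p2 k y = (if k = i then - 2 * M / d\<^sup>2 - N' else 2 * M / d\<^sup>2)" for k and y :: "real^2"
  have k: "k = i \<or> k = j" for k using UNIV_2_pair[OF ji] by auto
  have hp1: "has_partial k p (p1 k)" for k
    unfolding has_partial_def p_def p1_def using k[of k] ji d
    by (auto simp: axis_def power2_eq_square intro!: derivative_eq_intros) (simp_all add: field_simps)
  have hp2: "has_partial k (p1 k) (p2 k)" for k
    unfolding has_partial_def p1_def p2_def using k[of k] ji d
    by (auto simp: axis_def intro!: derivative_eq_intros) (simp_all add: field_simps power2_eq_square power4_eq_xxxx)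
  \<comment> \<open>With the factor 1/2 the odd part of \<open>w\<close> is bounded by
    \<open>M\<close>, its Laplacian by \<open>N\<close>, and its \<open>i\<close>-derivative at
    \<open>x\<close> is exactly that of \<open>w\<close>.\<close>
  define v where "v y = p y - (1/2) * (w y - w (R y))" for y
  define sg where "sg k = (if k = i then -1 else (1::real))" for k
  define v1 where "v1 k y = p1 k y - (1/2) * (w1 k y - sg k * w1 k (R y))" for k y
  define v2 where "v2 k y = p2 k y - (1/2) * (w2 k y - sg k * (sg k * w2 k (R y)))" for k y
  have hv1: "has_partial k v (v1 k)" for k
    unfolding v_def v1_def sg_def R_def
    by (intro has_partial_diff has_partial_cmult hp1 w1 has_partial_reflect)
  have hv2: "has_partial k (v1 k) (v2 k)" for k
    unfolding v1_def v2_def sg_def R_def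
    by (intro has_partial_diff has_partial_cmult hp2 w2 has_partial_reflect)
  have cont: "continuous_on UNIV v"
    unfolding v_def p_def R_def
    by (intro continuous_intros continuous_on_compose2[OF cw]) (auto intro!: continuous_intros)
  define D where "D = square x d \<inter> {y. y $ i \<ge> x $ i}"
  have RD: "R y \<in> square x d" if "y \<in> D" for y
    using that by (auto simp: D_def square_def R_def axis_def abs_le_iff algebra_simps)
  have cD: "compact D" unfolding D_def
    by (intro compact_Int_closed compact_square closed_Collect_le continuous_intros)
  have xD: "x \<in> D" using d by (auto simp: D_def square_def)
  obtain y0 where y0: "y0 \<in> D" and ymin: "\<And>y. y \<in> D \<Longrightarrow> v y0 \<le> v y"
    using continuous_attains_inf[OF cD, of v] xD cont continuous_on_subset by blast
  have vy0: "v y0 \<ge> 0"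
  proof (rule ccontr)
    assume neg: "\<not> v y0 \<ge> 0"
    let ?a = "y0 $ i - x $ i" and ?b = "y0 $ j - x $ j"
    have ab: "0 \<le> ?a" "?a \<le> d" "\<bar>?b\<bar> \<le> d" using y0 by (auto simp: D_def square_def abs_le_iff)
    have y0s: "y0 \<in> square x d" using y0 by (simp add: D_def)
    have wle: "(1/2) * (w y0 - w (R y0)) \<le> M" using abs_le_D1[OF M[OF y0s]] abs_le_D2[OF M[OF RD[OF y0]]] by (simp add: field_simps)
    have t1: "0 \<le> N' / 2 * (?a * (d - ?a))" using N0 ab by simp
    have big: "v y0 \<ge> 0" if "?b\<^sup>2 + ?a * (2 * d - ?a) \<ge> d\<^sup>2"
    proof -
      have "M / d\<^sup>2 * (?b\<^sup>2 + ?a * (2 * d - ?a)) \<ge> M / d\<^sup>2 * d\<^sup>2"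
        using that M0 by (intro mult_left_mono) auto
      then have "M \<le> M / d\<^sup>2 * (?b\<^sup>2 + ?a * (2 * d - ?a))" using d by simp
      then show ?thesis unfolding v_def p_def using t1 wle by linarith
    qed
    have a0: "?a \<noteq> 0"
    proof
      assume a: "?a = 0"
      then have "R y0 = y0" by (simp add: R_def)
      then have "v y0 = M / d\<^sup>2 * ?b\<^sup>2" using a by (simp add: v_def p_def)
      then show False using neg M0 by simp
    qed
    have ad: "?a \<noteq> d" using big neg by (auto simp: power2_eq_square)
    have bd: "\<bar>?b\<bar> \<noteq> d"
    proof
      assume "\<bar>?b\<bar> = d"
      then have "?b\<^sup>2 = d\<^sup>2" by (metis power2_abs)
      moreover have "?a * (2 * d - ?a) \<ge> 0" using ab d by simp
      ultimately show False using big neg by simp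
    qed
    define r where "r = Min {?a, d - ?a, d - \<bar>?b\<bar>} / 2"
    have r: "r > 0" "2 * r \<le> ?a" "2 * r \<le> d - ?a" "2 * r \<le> d - \<bar>?b\<bar>"
      using ab a0 ad bd by (auto simp: r_def)
    have inD: "y \<in> D" if "y \<in> square y0 r" for y
    proof -
      have "\<bar>y $ i - y0 $ i\<bar> \<le> r" "\<bar>y $ j - y0 $ j\<bar> \<le> r" using that by (auto simp: square_def)
      then have "\<bar>y $ i - x $ i\<bar> \<le> d" "\<bar>y $ j - x $ j\<bar> \<le> d" "y $ i \<ge> x $ i" using r by linarith+
      then have "\<bar>y $ l - x $ l\<bar> \<le> d" for l using k[of l] by (elim disjE) simp_all
      with \<open>y $ i \<ge> x $ i\<close> show ?thesis by (simp add: D_def square_def)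
    qed
    have "v2 k y0 \<ge> 0" for k
      by (rule second_partial_nonneg_at_min[OF hv1 hv2 r(1)]) (use inD ymin in blast)
    then have "0 \<le> (\<Sum>k\<in>UNIV. v2 k y0)" by (intro sum_nonneg) auto
    also have "\<dots> = - N' - (1/2) * ((\<Sum>k\<in>UNIV. w2 k y0) - (\<Sum>k\<in>UNIV. w2 k (R y0)))"
      unfolding sum_2_pair[OF ji] v2_def p2_def sg_def using ji by (simp add: field_simps)
    \<comment> \<open>The strict inequality \<open>N < N'\<close> excludes a negative interior
      minimum.\<close>
    also have "\<dots> < 0"
      using abs_le_D2[OF N[OF y0s]] abs_le_D1[OF N[OF RD[OF y0]]] N' by (simp add: field_simps)
    finally show False by simp
  qed
  define h where "h t = 2 * v (x + t *\<^sub>R axis i 1)" for t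
  have hR: "R (x + t *\<^sub>R axis i 1) = x + (-t) *\<^sub>R axis i 1" for t
    by (simp add: R_def axis_nth_2 algebra_simps scaleR_add_left[symmetric])
  have "(h has_real_derivative 2 * v1 i x) (at 0)"
    unfolding h_def using has_partialD[OF hv1, of x i 0] by (auto intro!: DERIV_cmult)
  moreover have "h 0 = 0" using hR[of 0] by (simp add: h_def v_def p_def)
  moreover have "h t \<ge> 0" if "0 < t" "t < d" for t
  proof -
    have "x + t *\<^sub>R axis i 1 \<in> D" using that d by (auto simp: D_def square_def axis_def)
    then show ?thesis using ymin vy0 unfolding h_def by fastforce
  qed
  ultimately have "v1 i x \<ge> 0"
  proof (intro leI notI)
    assume hh: "(h has_real_derivative 2 * v1 i x) (at 0)" "h 0 = 0"
      and hp: "\<And>t. 0 < t \<Longrightarrow> t < d \<Longrightarrow> h t \<ge> 0" and "v1 i x < 0"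
    then obtain e where e: "e > 0" "\<And>t. 0 < t \<Longrightarrow> t < e \<Longrightarrow> h (0 + t) < h 0"
      using DERIV_neg_dec_right[OF hh(1)] by auto
    define t where "t = min e d / 2"
    have "0 < t" "t < e" "t < d" using e(1) d by (auto simp: t_def)
    then show False using e(2)[of t] hp[of t] hh(2) by simp
  qed
  moreover have "R x = x" by (simp add: R_def)
  ultimately have "w1 i x \<le> p1 i x" by (simp add: v1_def sg_def)
  also have "\<dots> = 2 / d * M + d / 2 * N'" using d by (simp add: p1_def field_simps power2_eq_square)
  finally show ?thesis .
qed

text \<open>Letting \<open>N'\<close> decrease to \<open>N\<close> removes the strictness, and
  applying the one-sided bound to \<open>- w\<close> as well gives the modulus.\<close>

lemma gradient_bound:
  fixes w :: "real^2 \<Rightarrow> real"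
  assumes cw: "continuous_on UNIV w"
    and w1: "\<And>i. has_partial i w (w1 i)" and w2: "\<And>i. has_partial i (w1 i) (w2 i)"
    and d: "d > 0" and M: "\<And>y. y \<in> square x d \<Longrightarrow> \<bar>w y\<bar> \<le> M"
    and N: "\<And>y. y \<in> square x d \<Longrightarrow> \<bar>\<Sum>i\<in>UNIV. w2 i y\<bar> \<le> N"
  shows "\<bar>w1 i x\<bar> \<le> 2 / d * M + d / 2 * N"
proof (rule field_le_epsilon)
  fix e :: real assume e: "e > 0"
  define N' where "N' = N + 2 * e / d"
  have N': "N' > N" and eq: "2 / d * M + d / 2 * N + e = 2 / d * M + d / 2 * N'"
    using e d by (auto simp: N'_def field_simps)
  have "w1 i x \<le> 2 / d * M + d / 2 * N'"
    by (rule gradient_bound_aux[OF cw w1 w2 d M N N'])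
  moreover have "- w1 i x \<le> 2 / d * M + d / 2 * N'"
    by (rule gradient_bound_aux[of "\<lambda>x. - w x" "\<lambda>i x. - w1 i x" "\<lambda>i x. - w2 i x", OF _ _ _ d _ _ N'])
      (use M N w1 w2 cw in \<open>auto intro: has_partial_minus continuous_intros simp: sum_negf\<close>)
  ultimately show "\<bar>w1 i x\<bar> \<le> 2 / d * M + d / 2 * N + e" unfolding eq by linarith
qed

section \<open>Smooth bump functions\<close>

text \<open>Pascal's rule, in the form that differentiates a Leibniz sum once more; it serves both
  for products of bump functions and for the derivatives of \<open>q * u\<close>.\<close>

lemma leibniz_sum:
  fixes a b :: "nat \<Rightarrow> real"
  shows "(\<Sum>j\<le>k. real (k choose j) * (a (Suc j) * b (k - j) + a j * b (Suc (k - j))))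
       = (\<Sum>j\<le>Suc k. real (Suc k choose j) * (a j * b (Suc k - j)))"
proof -
  have "(\<Sum>j\<le>Suc k. real (Suc k choose j) * (a j * b (Suc k - j)))
      = a 0 * b (Suc k) + (\<Sum>j\<le>k. real (Suc k choose Suc j) * (a (Suc j) * b (k - j)))"
    by (subst sum.atMost_Suc_shift) simp
  also have "(\<Sum>j\<le>k. real (Suc k choose Suc j) * (a (Suc j) * b (k - j)))
      = (\<Sum>j\<le>k. real (k choose j) * (a (Suc j) * b (k - j)))
        + (\<Sum>j\<le>k. real (k choose Suc j) * (a (Suc j) * b (k - j)))"
    by (simp add: sum.distrib[symmetric] algebra_simps)
  also have "a 0 * b (Suc k) + (\<dots>) = (\<Sum>j\<le>k. real (k choose j) * (a (Suc j) * b (k - j)))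
      + (\<Sum>j\<le>Suc k. real (k choose j) * (a j * b (Suc k - j)))"
  proof -
    have "(\<Sum>j\<le>Suc k. real (k choose j) * (a j * b (Suc k - j)))
        = a 0 * b (Suc k) + (\<Sum>j\<le>k. real (k choose Suc j) * (a (Suc j) * b (k - j)))"
      by (subst sum.atMost_Suc_shift) simp
    then show ?thesis by simp
  qed
  also have "(\<Sum>j\<le>Suc k. real (k choose j) * (a j * b (Suc k - j)))
      = (\<Sum>j\<le>k. real (k choose j) * (a j * b (Suc (k - j))))"
    by (simp add: Suc_diff_le)
  finally show ?thesis by (simp add: sum.distrib algebra_simps)
qed

text \<open>A smooth function is carried together with all its derivatives as one sequence,
  \<open>F 0\<close> being the function itself. Products, affine substitutions and differences then
  act on the whole sequence.\<close>

definition derivatives :: "(nat \<Rightarrow> real \<Rightarrow> real) \<Rightarrow> bool" where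
  "derivatives F \<longleftrightarrow> (\<forall>n t. (F n has_real_derivative F (Suc n) t) (at t))"

lemma derivatives_mult:
  assumes "derivatives F" "derivatives G"
  shows "derivatives (\<lambda>n t. \<Sum>j\<le>n. real (n choose j) * (F j t * G (n - j) t))"
  unfolding derivatives_def
proof (intro allI)
  fix n t
  have F: "(F k has_real_derivative F (Suc k) t) (at t)" and G: "(G k has_real_derivative G (Suc k) t) (at t)" for k
    using assms unfolding derivatives_def by auto
  have "((\<lambda>t. \<Sum>j\<le>n. real (n choose j) * (F j t * G (n - j) t)) has_real_derivative
     (\<Sum>j\<le>n. real (n choose j) * (F (Suc j) t * G (n - j) t + F j t * G (Suc (n - j)) t))) (at t)"
    by (auto intro!: derivative_eq_intros F G sum.cong simp: algebra_simps)
  then show "((\<lambda>t. \<Sum>j\<le>n. real (n choose j) * (F j t * G (n - j) t)) has_real_derivative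
     (\<Sum>j\<le>Suc n. real (Suc n choose j) * (F j t * G (Suc n - j) t))) (at t)"
    unfolding leibniz_sum[of n "\<lambda>j. F j t" "\<lambda>j. G j t"] .
qed

lemma derivatives_affine:
  assumes "derivatives F"
  shows "derivatives (\<lambda>n t. c * (b ^ n * F n (a + b * t)))"
  unfolding derivatives_def
proof (intro allI)
  fix n t
  have "(F n has_real_derivative F (Suc n) (a + b * t)) (at (a + b * t))"
    using assms unfolding derivatives_def by auto
  then have "((\<lambda>t. F n (a + b * t)) has_real_derivative F (Suc n) (a + b * t) * b) (at t)"
    by (rule DERIV_chain2) (auto intro!: derivative_eq_intros)
  then show "((\<lambda>t. c * (b ^ n * F n (a + b * t))) has_real_derivative c * (b ^ Suc n * F (Suc n) (a + b * t))) (at t)"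
    by (auto intro!: derivative_eq_intros simp: algebra_simps)
qed

text \<open>Differentiating p(1/t) exp(-1/t) gives (1/t^2) (p - p')(1/t) exp(-1/t), which is the
  recurrence. So \<open>flat n\<close> is the n-th derivative of the classical function that is flat
  at 0.\<close>

fun flat_poly :: "nat \<Rightarrow> real poly" where
  "flat_poly 0 = 1"
| "flat_poly (Suc n) = [:0, 0, 1:] * (flat_poly n - pderiv (flat_poly n))"

definition flat :: "nat \<Rightarrow> real \<Rightarrow> real" where
  "flat n t = (if t > 0 then poly (flat_poly n) (1 / t) * exp (- (1 / t)) else 0)"

lemma poly_times_exp_minus_tendsto_0:
  fixes p :: "real poly"
  shows "((\<lambda>s. poly p s * exp (- s)) \<longlongrightarrow> 0) at_top"
proof -
  have "((\<lambda>s. \<Sum>i\<le>degree p. coeff p i * (s ^ i / exp s)) \<longlongrightarrow> (\<Sum>i\<le>degree p. coeff p i * 0)) at_top"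
    by (intro tendsto_intros tendsto_power_div_exp_0)
  then show ?thesis
    by (simp add: poly_altdef sum_distrib_right exp_minus sum_divide_distrib field_simps)
qed

lemma derivatives_flat: "derivatives flat"
  unfolding derivatives_def
proof (intro allI)
  fix n and t :: real
  consider "t > 0" | "t < 0" | "t = 0" by linarith
  then show "(flat n has_real_derivative flat (Suc n) t) (at t)"
  proof cases
    case 1
    have "((\<lambda>t. poly (flat_poly n) (1 / t) * exp (- (1 / t))) has_real_derivative flat (Suc n) t) (at t)"
      using 1 by (auto simp: flat_def field_simps power2_eq_square intro!: derivative_eq_intros DERIV_chain2[OF poly_DERIV])
    moreover have "eventually (\<lambda>s. poly (flat_poly n) (1 / s) * exp (- (1 / s)) = flat n s) (nhds t)"
      using 1 eventually_nhds_in_open[of "{0<..}" t] by (auto simp: flat_def elim: eventually_mono)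
    ultimately show ?thesis using DERIV_cong_ev[OF refl _ refl, THEN iffD1] by metis
  next
    case 2
    have e: "eventually (\<lambda>s. 0 = flat n s) (nhds t)"
      using 2 eventually_nhds_in_open[of "{..<0}" t] by (auto simp: flat_def elim: eventually_mono)
    have d: "((\<lambda>s. 0) has_real_derivative flat (Suc n) t) (at t)" using 2 by (simp add: flat_def)
    show ?thesis by (rule DERIV_cong_ev[OF refl e refl, THEN iffD1, OF d])
  next
    case 3
    \<comment> \<open>The difference quotient at 0 from the right is s p(s) exp(-s) with s = 1/h,
      where p is \<open>flat_poly n\<close>.\<close>
    have "((\<lambda>h. poly ([:0,1:] * flat_poly n) (inverse h) * exp (- inverse h)) \<longlongrightarrow> 0) (at_right 0)"
      by (rule filterlim_compose[OF poly_times_exp_minus_tendsto_0 filterlim_inverse_at_top_right])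
    then have r: "((\<lambda>h. flat n h / h) \<longlongrightarrow> 0) (at_right 0)"
      by (rule Lim_transform_eventually)
        (auto simp: flat_def eventually_at_right_less eventually_at_topological field_simps intro!: exI[of _ UNIV])
    have l: "((\<lambda>h. flat n h / h) \<longlongrightarrow> 0) (at_left 0)"
      by (rule Lim_transform_eventually[of "\<lambda>_. 0"])
        (auto simp: flat_def eventually_at_topological intro!: exI[of _ UNIV])
    have "((\<lambda>h. flat n h / h) \<longlongrightarrow> 0) (at 0)" using l r by (simp add: filterlim_split_at)
    then show ?thesis using 3 by (simp add: has_field_derivative_iff flat_def)
  qed
qed

text \<open>\<open>H n\<close> being the n-th derivative of a bump on the line,
  \<open>kern H a\<close> is the partial derivative of multi-order \<open>a\<close> of the product
  bump. Every derivative of a mollifier thus stays in one family.\<close>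

definition kern :: "(nat \<Rightarrow> real \<Rightarrow> real) \<Rightarrow> (2 \<Rightarrow> nat) \<Rightarrow> real^2 \<Rightarrow> real" where
  "kern H a x = H (a 1) (x $ 1) * H (a 2) (x $ 2)"

definition mollifier :: "real \<Rightarrow> (nat \<Rightarrow> real \<Rightarrow> real) \<Rightarrow> bool" where
  "mollifier \<epsilon> H \<longleftrightarrow> derivatives H \<and> (\<forall>n t. \<bar>t\<bar> > \<epsilon> \<longrightarrow> H n t = 0) \<and> (\<forall>t. H 0 t \<ge> 0) \<and>
     integral UNIV (kern H (\<lambda>_. 0)) = 1"

lemma integral_eq_UNIV:
  fixes f :: "real^2 \<Rightarrow> real"
  assumes "\<And>x. x \<notin> S \<Longrightarrow> f x = 0"
  shows "integral UNIV f = integral S f"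
proof -
  have "f = (\<lambda>x. if x \<in> S then f x else 0)" using assms by auto
  then show ?thesis using Henstock_Kurzweil_Integration.integral_restrict_UNIV[of S f] by simp
qed

lemma kern_eq_0: "(\<And>n t. \<bar>t\<bar> > \<epsilon> \<Longrightarrow> H n t = 0) \<Longrightarrow> x \<notin> square 0 \<epsilon> \<Longrightarrow> kern H a x = 0"
  by (auto simp: kern_def square_def not_le) (metis (full_types) exhaust_2)

lemma kern_cont:
  assumes "derivatives H"
  shows "continuous_on UNIV (kern H a)"
proof -
  have "continuous_on UNIV (H n)" for n
    using assms unfolding derivatives_def by (intro continuous_at_imp_continuous_on) (auto intro: DERIV_isCont)
  then have "continuous_on UNIV (\<lambda>x::real^2. H n (x $ i))" for n i
    by (rule continuous_on_compose2) (auto intro!: continuous_intros)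
  then show ?thesis unfolding kern_def by (intro continuous_on_mult) auto
qed

lemma mollifier_exists:
  assumes "\<epsilon> > 0"
  obtains H where "mollifier \<epsilon> H"
proof -
  \<comment> \<open>The Leibniz sequence of the product of \<open>flat 0 (1 + t)\<close> and
    \<open>flat 0 (1 - t)\<close>, a bump supported in [-1, 1]; the factors 1 reproduce the shape of
    \<open>derivatives_affine\<close>.\<close>
  define G where "G n t = (\<Sum>j\<le>n. real (n choose j) * (1 * (1 ^ j * flat j (1 + 1 * t)) * (1 * ((-1) ^ (n - j) * flat (n - j) (1 + (-1) * t)))))" for n t
  have G: "derivatives G"
    unfolding G_def by (intro derivatives_mult derivatives_affine derivatives_flat)
  have G0: "G n t = 0" if "\<bar>t\<bar> > 1" for n t
    using that by (auto simp: G_def flat_def intro!: sum.neutral)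
  have Gpos: "G 0 t \<ge> 0" for t by (simp add: G_def flat_def)
  have G00: "G 0 0 > 0" by (simp add: G_def flat_def)
  define H where "H c n t = c * ((1/\<epsilon>) ^ n * G n (0 + (1/\<epsilon>) * t))" for c :: real and n t
  have H: "derivatives (H c)" for c unfolding H_def by (intro derivatives_affine G)
  have H0: "H c n t = 0" if "\<bar>t\<bar> > \<epsilon>" for c n t
    using that assms by (auto simp: H_def abs_mult intro!: G0)
  define I where "I = integral UNIV (kern (H 1) (\<lambda>_. 0))"
  have I: "I = integral (square 0 \<epsilon>) (kern (H 1) (\<lambda>_. 0))"
    unfolding I_def by (rule integral_eq_UNIV) (rule kern_eq_0[OF H0])
  have nonneg: "kern (H 1) (\<lambda>_. 0) x \<ge> 0" for x by (simp add: kern_def H_def Gpos)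
  have int: "kern (H 1) (\<lambda>_. 0) integrable_on square 0 \<epsilon>"
    unfolding square_eq_cbox by (rule integrable_continuous[OF continuous_on_subset[OF kern_cont[OF H] subset_UNIV]])
  have "I \<noteq> 0"
  proof
    assume "I = 0"
    then have hi: "((kern (H 1) (\<lambda>_. 0)) has_integral 0) (cbox (0 - vec \<epsilon>) (0 + vec \<epsilon>))"
      using I integrable_integral[OF int] unfolding square_eq_cbox by metis
    have ne: "(0 :: real^2) \<in> box (0 - vec \<epsilon>) (0 + vec \<epsilon>)" using assms by (simp add: mem_box_cart)
    have "kern (H 1) (\<lambda>_. 0) 0 = 0"
      using has_integral_0_cbox_imp_0[OF continuous_on_subset[OF kern_cont[OF H] subset_UNIV] nonneg hi] ne
        box_subset_cbox by blast
    then show False using G00 by (simp add: kern_def H_def)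
  qed
  moreover have "I \<ge> 0" unfolding I
    by (rule Henstock_Kurzweil_Integration.integral_nonneg[OF int nonneg])
  ultimately have Ipos: "I > 0" by simp
  \<comment> \<open>A square root, since the planar kernel contains the one-dimensional bump
    twice.\<close>
  define c where "c = 1 / sqrt I"
  have "kern (H c) (\<lambda>_. 0) = (\<lambda>x. (1 / I) * kern (H 1) (\<lambda>_. 0) x)"
    using Ipos by (auto simp: kern_def H_def c_def field_simps)
  then have "integral UNIV (kern (H c) (\<lambda>_. 0)) = 1"
    using Ipos by (simp add: I_def)
  then have "mollifier \<epsilon> (H c)"
    unfolding mollifier_def using H H0 Gpos Ipos by (auto simp: H_def c_def)
  then show ?thesis by (rule that)
qed

section \<open>Regularity of weak solutions\<close>

text \<open>The common support radius 1 allows every convolution near a point to be computed over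
  one fixed compact square, where integrals with a parameter may be continued and
  differentiated.\<close>

definition smoothing_kernel :: "(real^2 \<Rightarrow> real) \<Rightarrow> bool" where
  "smoothing_kernel K \<longleftrightarrow> continuous_on UNIV K \<and> (\<forall>z. z \<notin> square 0 1 \<longrightarrow> K z = 0)"

definition conv :: "(real^2 \<Rightarrow> real) \<Rightarrow> (real^2 \<Rightarrow> real) \<Rightarrow> real^2 \<Rightarrow> real" where
  "conv K w x = integral UNIV (\<lambda>y. K (x - y) * w y)"

lemma mem_square_diff: "x - y \<in> square 0 r \<longleftrightarrow> y \<in> square x r"
  by (simp add: square_def abs_minus_commute)

lemma cont_compose_UNIV: "continuous_on UNIV K \<Longrightarrow> continuous_on S f \<Longrightarrow> continuous_on S (\<lambda>y. K (f y))"
  by (rule continuous_on_compose2) auto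

lemma integrable_square:
  fixes f :: "real^2 \<Rightarrow> real"
  shows "continuous_on UNIV f \<Longrightarrow> f integrable_on square x r"
  unfolding square_eq_cbox by (rule integrable_continuous) (rule continuous_on_subset, auto)

lemma kern_has_partial:
  assumes "derivatives H"
  shows "has_partial i (kern H a) (kern H (a(i := Suc (a i))))"
proof -
  have H: "(H n has_real_derivative H (Suc n) t) (at t)" for n t
    using assms unfolding derivatives_def by auto
  have "has_partial i (\<lambda>x. H n (x $ j)) (\<lambda>x. H (Suc n) (x $ j) * (if j = i then 1 else 0))" for n j
    by (rule has_partial_chain[OF has_partial_nth]) (rule H)
  from has_partial_mult[OF this[of "a 1" 1] this[of "a 2" 2]] show ?thesis
    unfolding kern_def by (rule has_partial_cong) (use exhaust_2[of i] in auto)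
qed

lemma mollifier_smoothing_kernel: "mollifier \<epsilon> H \<Longrightarrow> \<epsilon> \<le> 1 \<Longrightarrow> smoothing_kernel (kern H a)"
  unfolding smoothing_kernel_def using kern_eq_0[of 1 H] by (auto simp: mollifier_def kern_cont)

lemma conv_eq:
  assumes "smoothing_kernel K" "x \<in> square x0 1"
  shows "conv K w x = integral (square x0 2) (\<lambda>y. K (x - y) * w y)"
  unfolding conv_def
proof (rule integral_eq_UNIV)
  fix y assume "y \<notin> square x0 2"
  then have "y \<notin> square x 1" using square_trans[OF assms(2), of y 1 2] by auto
  then show "K (x - y) * w y = 0" using assms(1) by (simp add: smoothing_kernel_def mem_square_diff)
qed

lemma conv_continuous:
  assumes K: "smoothing_kernel K" and w: "continuous_on UNIV w"
  shows "continuous_on UNIV (conv K w)"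
proof (rule continuous_at_imp_continuous_on, rule)
  fix x0
  have cK: "continuous_on UNIV K" using K by (simp add: smoothing_kernel_def)
  have "continuous_on (square x0 1) (\<lambda>x. integral (square x0 2) (\<lambda>y. K (x - y) * w y))"
    unfolding square_eq_cbox[of _ 2]
    by (rule integral_continuous_on_param)
      (auto simp: split_beta intro!: continuous_intros cont_compose_UNIV[OF cK] cont_compose_UNIV[OF w])
  then have "continuous_on (square x0 1) (conv K w)"
    by (rule continuous_on_eq) (simp add: conv_eq[OF K])
  moreover have "x0 \<in> interior (square x0 1)"
    unfolding square_eq_cbox by (simp add: mem_box_cart)
  ultimately show "isCont (conv K w) x0" by (rule continuous_on_interior)
qed

lemma has_partial_from_within:
  assumes "\<And>x. ((\<lambda>t. f (x + t *\<^sub>R axis i 1)) has_real_derivative g x) (at 0 within {-1..1})"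
  shows "has_partial i f g"
  unfolding has_partial_def using assms at_within_interior[of "0::real" "{-1..1}"] by simp

lemma has_real_derivative_transform:
  fixes f :: "real \<Rightarrow> real"
  shows "x \<in> S \<Longrightarrow> (\<And>t. t \<in> S \<Longrightarrow> g t = f t) \<Longrightarrow> (f has_real_derivative D) (at x within S) \<Longrightarrow>
    (g has_real_derivative D) (at x within S)"
  unfolding has_field_derivative_def by (rule has_derivative_transform)

lemma conv_has_partial:
  assumes K: "smoothing_kernel K" and K': "smoothing_kernel K'" and w: "continuous_on UNIV w" and p: "has_partial i K K'"
  shows "has_partial i (conv K w) (conv K' w)"
proof (rule has_partial_from_within)
  fix x
  have cK: "continuous_on UNIV K" "continuous_on UNIV K'" using K K' by (simp_all add: smoothing_kernel_def)
  have D: "((\<lambda>t. K (x + t *\<^sub>R axis i 1 - y) * w y) has_real_derivative K' (x + t *\<^sub>R axis i 1 - y) * w y) (at t within {-1..1})" for t y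
  proof -
    have "((\<lambda>t. K ((x - y) + t *\<^sub>R axis i 1)) has_real_derivative K' ((x - y) + t *\<^sub>R axis i 1)) (at t within {-1..1})"
      using has_partialD[OF p] by (rule has_field_derivative_at_within)
    then have "((\<lambda>t. K (x + t *\<^sub>R axis i 1 - y)) has_real_derivative K' (x + t *\<^sub>R axis i 1 - y)) (at t within {-1..1})"
      by (simp add: algebra_simps)
    then show ?thesis by (rule DERIV_cmult_right)
  qed
  have "((\<lambda>t. integral (square x 2) (\<lambda>y. K (x + t *\<^sub>R axis i 1 - y) * w y)) has_real_derivative
      integral (square x 2) (\<lambda>y. K' (x + 0 *\<^sub>R axis i 1 - y) * w y)) (at 0 within {-1..1})"
    unfolding square_eq_cbox
    by (rule leibniz_rule_field_derivative[OF D])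
      (auto simp: split_beta intro!: integrable_continuous continuous_intros cont_compose_UNIV[OF cK(1)] cont_compose_UNIV[OF cK(2)] cont_compose_UNIV[OF w])
  then have "((\<lambda>t. conv K w (x + t *\<^sub>R axis i 1)) has_real_derivative
      integral (square x 2) (\<lambda>y. K' (x + 0 *\<^sub>R axis i 1 - y) * w y)) (at 0 within {-1..1})"
    by (rule has_real_derivative_transform[rotated 2]) (auto intro!: conv_eq[OF K] square_add_axis)
  then show "((\<lambda>t. conv K w (x + t *\<^sub>R axis i 1)) has_real_derivative conv K' w x) (at 0 within {-1..1})"
    using conv_eq[OF K' center_in_square[of 1 x]] by simp
qed

text \<open>Translation invariance makes the integral of \<open>G\<close> shifted along the axis
  constant in the shift; differentiating under the integral sign at shift 0 yields the integral of
  \<open>G'\<close>.\<close>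

lemma integral_partial_eq_0:
  assumes G: "continuous_on UNIV G" and G': "continuous_on UNIV G'" and p: "has_partial i G G'"
    and 0: "\<And>y. y \<notin> square c r \<Longrightarrow> G y = 0" "\<And>y. y \<notin> square c r \<Longrightarrow> G' y = 0"
  shows "integral UNIV G' = 0"
proof -
  \<comment> \<open>One unit of margin keeps the support inside the box for all shifts of size at
    most 1.\<close>
  let ?a = "c - vec (r + 1)" and ?b = "c + vec (r + 1)"
  have const: "integral (cbox ?a ?b) (\<lambda>y. G (y + t *\<^sub>R axis i 1)) = integral UNIV G" if "t \<in> {-1..1}" for t
  proof -
    let ?e = "t *\<^sub>R axis i (1::real)"
    have "integral (cbox (?a + ?e - ?e) (?b + ?e - ?e)) (\<lambda>y. G (y + ?e)) = integral (cbox (?a + ?e) (?b + ?e)) G"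
      by (rule integral_shift_cbox)
    also have "\<dots> = integral UNIV G"
    proof (rule integral_eq_UNIV[symmetric])
      fix y assume "y \<notin> cbox (?a + ?e) (?b + ?e)"
      then have "y - ?e \<notin> square c (r + 1)" unfolding square_eq_cbox by (auto simp: mem_box_cart algebra_simps)
      moreover have "y - ?e \<in> square y 1"
        using square_add_axis[of "-t" 1 y i] that by (simp add: abs_le_iff)
      ultimately have "y \<notin> square c r" using square_trans[of y c r "y - ?e" 1 "r + 1"] by auto
      then show "G y = 0" by (rule 0)
    qed
    finally show ?thesis by simp
  qed
  have D: "((\<lambda>t. integral (cbox ?a ?b) (\<lambda>y. G (y + t *\<^sub>R axis i 1))) has_real_derivative
      integral (cbox ?a ?b) (\<lambda>y. G' (y + 0 *\<^sub>R axis i 1))) (at 0 within {-1..1})"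
    by (rule leibniz_rule_field_derivative)
      (auto simp: split_beta intro!: integrable_continuous continuous_intros cont_compose_UNIV[OF G] cont_compose_UNIV[OF G']
        has_field_derivative_at_within[OF has_partialD[OF p]])
  have "((\<lambda>t. integral UNIV G) has_real_derivative integral (cbox ?a ?b) (\<lambda>y. G' (y + 0 *\<^sub>R axis i 1))) (at 0 within {-1..1})"
    by (rule has_real_derivative_transform[OF _ _ D]) (use const in auto)
  then have "((\<lambda>t. integral UNIV G) has_real_derivative integral (cbox ?a ?b) G') (at 0)"
    using at_within_interior[of "0::real" "{-1..1}"] by simp
  then have "integral (cbox ?a ?b) G' = 0" using DERIV_const DERIV_unique by blast
  moreover have "integral UNIV G' = integral (cbox ?a ?b) G'"
    by (rule integral_eq_UNIV, rule 0(2)) (use square_mono[of r "r + 1" c] in \<open>auto simp: square_eq_cbox\<close>)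
  ultimately show ?thesis by simp
qed

text \<open>The product K(x - y) w(y) has compact support in y, so its derivative integrates to
  zero; the reflection of the kernel absorbs the minus sign of partial integration.\<close>

lemma conv_by_parts:
  assumes K: "smoothing_kernel K" and K': "smoothing_kernel K'" and p: "has_partial i K K'"
    and w: "continuous_on UNIV w" and w': "continuous_on UNIV w'" and pw: "has_partial i w w'"
  shows "conv K' w x = conv K w' x"
proof -
  have cK: "continuous_on UNIV K" "continuous_on UNIV K'" using K K' by (simp_all add: smoothing_kernel_def)
  have z: "K (x - y) = 0" "K' (x - y) = 0" if "y \<notin> square x 1" for y
    using that K K' by (simp_all add: smoothing_kernel_def mem_square_diff)
  have pK: "has_partial i (\<lambda>y. K (x - y)) (\<lambda>y. - K' (x - y))"
    unfolding has_partial_def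
  proof
    fix y
    have "((\<lambda>t. K ((x - y) + t *\<^sub>R axis i 1)) has_real_derivative K' (x - y)) (at (- 0))"
      using has_partialD[OF p, of "x - y" 0] by simp
    then have "((\<lambda>t. K ((x - y) + (- t) *\<^sub>R axis i 1)) has_real_derivative K' (x - y) * (-1)) (at 0)"
      by (rule DERIV_chain2) (auto intro!: derivative_eq_intros)
    then show "((\<lambda>t. K (x - (y + t *\<^sub>R axis i 1))) has_real_derivative - K' (x - y)) (at 0)"
      by (simp add: algebra_simps)
  qed
  have cc: "continuous_on UNIV (\<lambda>y. K (x - y))" "continuous_on UNIV (\<lambda>y. K' (x - y))"
    by (intro continuous_intros cont_compose_UNIV[OF cK(1)] cont_compose_UNIV[OF cK(2)])+
  have "integral UNIV (\<lambda>y. - K' (x - y) * w y + K (x - y) * w' y) = 0"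
    by (rule integral_partial_eq_0[OF _ _ has_partial_mult[OF pK pw], of x 1])
      (use z in \<open>auto intro!: continuous_intros cc w w'\<close>)
  moreover have "integral UNIV (\<lambda>y. - K' (x - y) * w y + K (x - y) * w' y)
      = integral (square x 1) (\<lambda>y. K (x - y) * w' y - K' (x - y) * w y)"
    by (subst integral_eq_UNIV[of "square x 1"]) (auto simp: z algebra_simps intro!: integral_cong)
  moreover have "\<dots> = integral (square x 1) (\<lambda>y. K (x - y) * w' y) - integral (square x 1) (\<lambda>y. K' (x - y) * w y)"
    by (intro Henstock_Kurzweil_Integration.integral_diff integrable_square continuous_intros cc w w')
  moreover have "conv K' w x = integral (square x 1) (\<lambda>y. K' (x - y) * w y)"
    unfolding conv_def by (rule integral_eq_UNIV) (simp add: z)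
  moreover have "conv K w' x = integral (square x 1) (\<lambda>y. K (x - y) * w' y)"
    unfolding conv_def by (rule integral_eq_UNIV) (simp add: z)
  ultimately show ?thesis by simp
qed

text \<open>Averaging with a nonnegative kernel of mass 1. Two choices of \<open>c\<close> matter:
  \<open>c = w x\<close> gives convergence of mollifications, \<open>c = 0\<close> carries sup
  bounds over to them.\<close>

lemma conv_mollifier_near:
  assumes H: "mollifier \<epsilon> H" and e: "\<epsilon> > 0" and w: "continuous_on UNIV w"
    and c: "\<And>y. y \<in> square x \<epsilon> \<Longrightarrow> \<bar>w y - c\<bar> \<le> e"
  shows "\<bar>conv (kern H (\<lambda>_. 0)) w x - c\<bar> \<le> e"
proof -
  define K where "K = kern H (\<lambda>_. 0)"
  have cK: "continuous_on UNIV K" unfolding K_def using H by (simp add: kern_cont mollifier_def)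
  have K0: "K z \<ge> 0" for z using H by (simp add: K_def mollifier_def kern_def)
  have z: "K z = 0" if "z \<notin> square 0 \<epsilon>" for z
    unfolding K_def by (rule kern_eq_0[OF _ that]) (use H in \<open>auto simp: mollifier_def\<close>)
  have z': "K (x - y) = 0" if "y \<notin> square x \<epsilon>" for y using z[of "x - y"] that by (simp add: mem_square_diff)
  have cc: "continuous_on UNIV (\<lambda>y. K (x - y))"
    by (intro continuous_intros cont_compose_UNIV[OF cK])
  have "integral (square x \<epsilon>) (\<lambda>y. K (x - y)) = integral (cbox (- vec \<epsilon> - (- x)) (vec \<epsilon> - (- x))) (\<lambda>y. K (- (y + - x)))"
    by (simp add: square_eq_cbox algebra_simps)
  also have "\<dots> = integral (cbox (- vec \<epsilon>) (vec \<epsilon>)) (\<lambda>y. K (- y))" by (rule integral_shift_cbox)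
  also have "\<dots> = integral (cbox (- vec \<epsilon>) (vec \<epsilon>)) K"
    using integral_reflect[of "vec \<epsilon>" "- vec \<epsilon>" K] by simp
  also have "\<dots> = integral UNIV K"
    by (rule integral_eq_UNIV[symmetric]) (use z in \<open>auto simp: square_eq_cbox\<close>)
  also have "\<dots> = 1" using H by (simp add: mollifier_def K_def)
  finally have one: "integral (square x \<epsilon>) (\<lambda>y. K (x - y)) = 1" .
  have "conv K w x = integral (square x \<epsilon>) (\<lambda>y. K (x - y) * w y)"
    unfolding conv_def by (rule integral_eq_UNIV) (simp add: z')
  moreover have "c = integral (square x \<epsilon>) (\<lambda>y. K (x - y) * c)"
    using one by simp
  ultimately have "conv K w x - c = integral (square x \<epsilon>) (\<lambda>y. K (x - y) * w y) - integral (square x \<epsilon>) (\<lambda>y. K (x - y) * c)"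
    by simp
  also have "\<dots> = integral (square x \<epsilon>) (\<lambda>y. K (x - y) * (w y - c))"
    by (subst Henstock_Kurzweil_Integration.integral_diff[symmetric])
      (auto simp: algebra_simps intro!: integrable_square continuous_intros cc w)
  also have "norm \<dots> \<le> integral (square x \<epsilon>) (\<lambda>y. K (x - y) * e)"
    by (rule integral_norm_bound_integral)
      (auto simp: abs_mult K0 intro!: integrable_square continuous_intros cc w mult_left_mono c)
  also have "\<dots> = e" using one by simp
  finally show ?thesis by (simp add: K_def)
qed

lemma conv_mollifier_uniform:
  assumes w: "continuous_on UNIV w" and e: "e > 0"
  obtains d where "d > 0" "d \<le> 1" "\<And>\<epsilon> H x. mollifier \<epsilon> H \<Longrightarrow> 0 < \<epsilon> \<Longrightarrow> \<epsilon> < d \<Longrightarrow> x \<in> square x0 R \<Longrightarrow>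
      \<bar>conv (kern H (\<lambda>_. 0)) w x - w x\<bar> \<le> e"
proof -
  have "uniformly_continuous_on (square x0 (R + 1)) w"
    by (rule compact_uniformly_continuous[OF _ compact_square]) (rule continuous_on_subset[OF w], auto)
  then obtain d where d: "d > 0" "\<And>x y. x \<in> square x0 (R + 1) \<Longrightarrow> y \<in> square x0 (R + 1) \<Longrightarrow> dist y x < d \<Longrightarrow> dist (w y) (w x) < e"
    using e unfolding uniformly_continuous_on_def by metis
  show ?thesis
  proof (rule that[of "min (d / 2) 1"])
    fix \<epsilon> H x assume *: "mollifier \<epsilon> H" "0 < \<epsilon>" "\<epsilon> < min (d / 2) 1" "x \<in> square x0 R"
    show "\<bar>conv (kern H (\<lambda>_. 0)) w x - w x\<bar> \<le> e"
    proof (rule conv_mollifier_near[OF *(1,2) w])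
      fix y assume y: "y \<in> square x \<epsilon>"
      have "y \<in> square x0 (R + 1)" "x \<in> square x0 (R + 1)"
        using square_trans[OF *(4) y, of "R + 1"] * square_mono[of R "R + 1" x0] by auto
      moreover have "dist y x < d" using norm_le_square[OF y] * by (simp add: dist_norm)
      ultimately show "\<bar>w y - w x\<bar> \<le> e" using d(2)[of x y] by (simp add: dist_real_def)
    qed
  qed (use d in auto)
qed

text \<open>Turns identities between mollified functions into pointwise ones, by letting the
  mollification radius tend to 0.\<close>

lemma conv_mollifier_inject:
  assumes f: "continuous_on UNIV f" and g: "continuous_on UNIV g"
    and eq: "\<And>\<epsilon> H x. 0 < \<epsilon> \<Longrightarrow> \<epsilon> \<le> 1 \<Longrightarrow> mollifier \<epsilon> H \<Longrightarrow> conv (kern H (\<lambda>_. 0)) f x = conv (kern H (\<lambda>_. 0)) g x"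
  shows "f = g"
proof
  fix x
  have "\<bar>f x - g x\<bar> \<le> e" if "e > 0" for e
  proof -
    have half: "e / 2 > 0" using that by simp
    obtain d where d: "d > 0" "d \<le> 1" "\<And>\<epsilon> H y. mollifier \<epsilon> H \<Longrightarrow> 0 < \<epsilon> \<Longrightarrow> \<epsilon> < d \<Longrightarrow> y \<in> square x 0 \<Longrightarrow>
      \<bar>conv (kern H (\<lambda>_. 0)) f y - f y\<bar> \<le> e / 2" by (rule conv_mollifier_uniform[OF f half, of x 0]) blast
    obtain d' where d': "d' > 0" "d' \<le> 1" "\<And>\<epsilon> H y. mollifier \<epsilon> H \<Longrightarrow> 0 < \<epsilon> \<Longrightarrow> \<epsilon> < d' \<Longrightarrow> y \<in> square x 0 \<Longrightarrow>
      \<bar>conv (kern H (\<lambda>_. 0)) g y - g y\<bar> \<le> e / 2" by (rule conv_mollifier_uniform[OF g half, of x 0]) blast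
    define \<epsilon> where "\<epsilon> = min d d' / 2"
    have eps: "0 < \<epsilon>" "\<epsilon> < d" "\<epsilon> < d'" "\<epsilon> \<le> 1" using d d' by (auto simp: \<epsilon>_def)
    obtain H where H: "mollifier \<epsilon> H" using mollifier_exists eps by blast
    show ?thesis using d(3)[OF H eps(1,2) center_in_square[of 0 x]] d'(3)[OF H eps(1,3) center_in_square[of 0 x]]
        eq[OF eps(1,4) H, of x] by arith
  qed
  then have "\<bar>f x - g x\<bar> \<le> 0" by (rule field_le_epsilon[of _ 0, simplified])
  then show "f x = g x" by simp
qed

text \<open>Testing against translated mollifiers alone: every mollification of \<open>w\<close> has
  as classical Laplacian the same mollification of \<open>f\<close>, which is all that regularity
  theory uses here.\<close>

definition weak_laplacian :: "(real^2 \<Rightarrow> real) \<Rightarrow> (real^2 \<Rightarrow> real) \<Rightarrow> bool" where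
  "weak_laplacian w f \<longleftrightarrow> continuous_on UNIV w \<and> continuous_on UNIV f \<and>
     (\<forall>\<epsilon> H x. 0 < \<epsilon> \<and> \<epsilon> \<le> 1 \<and> mollifier \<epsilon> H \<longrightarrow>
        (\<Sum>i\<in>UNIV. conv (kern H ((\<lambda>_. 0)(i := 2))) w x) = conv (kern H (\<lambda>_. 0)) f x)"

text \<open>Differentiate the mollified equation in \<open>x\<close>; partial integration moves the
  derivative from the kernel to \<open>w\<close> and to \<open>f\<close>.\<close>

lemma weak_laplacian_partial:
  assumes w: "weak_laplacian w f" and g: "has_partial i w g" "continuous_on UNIV g"
    and f': "has_partial i f f'" "continuous_on UNIV f'"
  shows "weak_laplacian g f'"
  unfolding weak_laplacian_def
proof (intro conjI allI impI)
  fix \<epsilon> :: real and H x assume H: "0 < \<epsilon> \<and> \<epsilon> \<le> 1 \<and> mollifier \<epsilon> H"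
  have cw: "continuous_on UNIV w" "continuous_on UNIV f" using w by (simp_all add: weak_laplacian_def)
  have k: "smoothing_kernel (kern H a)" for a using mollifier_smoothing_kernel H by blast
  have dH: "derivatives H" using H by (simp add: mollifier_def)
  let ?d = "\<lambda>a. a(i := Suc (a i)) :: 2 \<Rightarrow> nat"
  have parts: "conv (kern H (?d a)) w x = conv (kern H a) g x" for a x
    by (rule conv_by_parts[OF k k kern_has_partial[OF dH] cw(1) g(2) g(1)])
  have parts': "conv (kern H (?d a)) f x = conv (kern H a) f' x" for a x
    by (rule conv_by_parts[OF k k kern_has_partial[OF dH] cw(2) f'(2) f'(1)])
  have P: "has_partial i (conv (kern H a) v) (conv (kern H (?d a)) v)" if "continuous_on UNIV v" for a v
    by (rule conv_has_partial[OF k k that kern_has_partial[OF dH]])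
  have p: "has_partial i (\<lambda>x. \<Sum>l\<in>UNIV. conv (kern H ((\<lambda>_. 0)(l := 2))) w x) (\<lambda>x. \<Sum>l\<in>UNIV. conv (kern H (?d ((\<lambda>_. 0)(l := 2)))) w x)"
    by (intro has_partial_sum P cw)
  have e: "(\<lambda>x. \<Sum>l\<in>UNIV. conv (kern H ((\<lambda>_. 0)(l := 2))) w x) = conv (kern H (\<lambda>_. 0)) f"
    using w H by (intro ext) (simp add: weak_laplacian_def)
  have "(\<lambda>x. \<Sum>l\<in>UNIV. conv (kern H (?d ((\<lambda>_. 0)(l := 2)))) w x) = conv (kern H (?d (\<lambda>_. 0))) f"
    by (rule has_partial_unique[OF p[unfolded e] P[OF cw(2)]])
  from fun_cong[OF this, of x] show "(\<Sum>l\<in>UNIV. conv (kern H ((\<lambda>_. 0)(l := 2))) g x) = conv (kern H (\<lambda>_. 0)) f' x"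
    using parts'[of "\<lambda>_. 0" x] by (simp only: parts)
qed (use g f' in auto)

lemma DERIV_uniform_limit:
  fixes f :: "nat \<Rightarrow> real \<Rightarrow> real"
  assumes D: "\<And>n t. t \<in> {-1..1} \<Longrightarrow> (f n has_real_derivative f' n t) (at t)"
    and lim: "\<And>t. t \<in> {-1..1} \<Longrightarrow> (\<lambda>n. f n t) \<longlonglongrightarrow> F t"
    and unif: "uniform_limit {-1..1} f' g sequentially"
  shows "(F has_real_derivative g 0) (at 0)"
proof -
  have "\<exists>G. \<forall>t\<in>{-1..1}. (\<lambda>n. f n t) \<longlonglongrightarrow> G t \<and> (G has_derivative (\<lambda>h. h * g t)) (at t within {-1..1})"
  proof (rule has_derivative_sequence[where f' = "\<lambda>n t h. h * f' n t"])
    show "(f n has_derivative (\<lambda>h. h * f' n t)) (at t within {-1..1})" if "t \<in> {-1..1}" for n t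
      using D[OF that, of n] by (simp add: has_field_derivative_def mult_commute_abs has_derivative_at_withinI)
    show "\<forall>\<^sub>F n in sequentially. \<forall>t\<in>{-1..1}. \<forall>h. norm (h * f' n t - h * g t) \<le> e * norm h" if "e > 0" for e
      using uniform_limitD[OF unif that]
    proof eventually_elim
      case (elim n)
      show ?case
      proof safe
        fix t h :: real assume t: "t \<in> {-1..1}"
        have "norm (h * f' n t - h * g t) = \<bar>h\<bar> * dist (f' n t) (g t)"
          by (simp add: dist_real_def abs_mult[symmetric] right_diff_distrib)
        also have "\<dots> \<le> \<bar>h\<bar> * e" using elim t by (intro mult_left_mono) force+
        finally show "norm (h * f' n t - h * g t) \<le> e * norm h" by (simp add: mult.commute)
      qed
    qed
    show "(\<lambda>n. f n 0) \<longlonglongrightarrow> F 0" using lim by simp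
  qed auto
  then obtain G where G: "\<And>t. t \<in> {-1..1} \<Longrightarrow> (\<lambda>n. f n t) \<longlonglongrightarrow> G t"
      "\<And>t. t \<in> {-1..1} \<Longrightarrow> (G has_derivative (\<lambda>h. h * g t)) (at t within {-1..1})" by blast
  have eq: "G t = F t" if "t \<in> {-1..1}" for t using LIMSEQ_unique[OF G(1)[OF that] lim[OF that]] .
  have "(F has_derivative (\<lambda>h. h * g 0)) (at 0 within {-1..1})"
    by (rule has_derivative_transform[OF _ _ G(2)]) (use eq in auto)
  then show ?thesis using at_within_interior[of "0::real" "{-1..1}"]
    by (simp add: has_field_derivative_def mult_commute_abs)
qed

text \<open>The gradient bound applied to the difference of two mollifications involves only their
  values and Laplacians, which converge locally uniformly; hence the first partials are locally
  uniformly Cauchy. The estimate for the limit is obtained on slightly smaller squares, leaving room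
  for the mollification radius, and then \<open>d'\<close> increases to \<open>d\<close>.\<close>

lemma weak_laplacian_regularity:
  assumes wf: "weak_laplacian w f"
  obtains g where "has_partial i w g" "continuous_on UNIV g"
    "\<And>x d M N. d > 0 \<Longrightarrow> (\<And>y. y \<in> square x d \<Longrightarrow> \<bar>w y\<bar> \<le> M) \<Longrightarrow> (\<And>y. y \<in> square x d \<Longrightarrow> \<bar>f y\<bar> \<le> N) \<Longrightarrow>
       \<bar>g x\<bar> \<le> 2 / d * M + d / 2 * N"
proof -
  have cw: "continuous_on UNIV w" and cf: "continuous_on UNIV f" using wf by (simp_all add: weak_laplacian_def)
  define ep where "ep n = 1 / real (Suc (Suc n))" for n
  have ep: "0 < ep n" "ep n \<le> 1" for n by (auto simp: ep_def)
  have "\<exists>H. mollifier (ep n) H" for n using mollifier_exists[OF ep(1), of n] by blast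
  then obtain H where H: "\<And>n. mollifier (ep n) (H n)" by metis
  have dH: "derivatives (H n)" for n using H by (auto simp: mollifier_def)
  have k: "smoothing_kernel (kern (H n) a)" for n a using mollifier_smoothing_kernel H ep by blast
  define W where "W n = conv (kern (H n) (\<lambda>_. 0)) w" for n
  define F where "F n = conv (kern (H n) (\<lambda>_. 0)) f" for n
  define W1 where "W1 n i = conv (kern (H n) ((\<lambda>_. 0)(i := 1))) w" for n i
  define W2 where "W2 n i = conv (kern (H n) ((\<lambda>_. 0)(i := 2))) w" for n i
  have W1: "has_partial i (W n) (W1 n i)" for n i
    unfolding W_def W1_def using conv_has_partial[OF k k cw kern_has_partial[OF dH, of i n "\<lambda>_. 0"]] by simp
  have W2: "has_partial i (W1 n i) (W2 n i)" for n i
    unfolding W1_def W2_def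
    using conv_has_partial[OF k k cw kern_has_partial[OF dH, of i n "(\<lambda>_. 0)(i := 1)"]] by (simp add: numeral_2_eq_2)
  have sumW2: "(\<Sum>i\<in>UNIV. W2 n i x) = F n x" for n x
    using wf H[of n] ep[of n] unfolding weak_laplacian_def W2_def F_def by blast
  have cW: "continuous_on UNIV (W n)" "continuous_on UNIV (W1 n i)" for n i
    unfolding W_def W1_def by (intro conv_continuous k cw)+
  have "ep \<longlonglongrightarrow> 0"
    using LIMSEQ_Suc[OF LIMSEQ_inverse_real_of_nat] by (simp add: ep_def[abs_def] inverse_eq_divide)
  then have "\<forall>\<^sub>F n in sequentially. ep n < d" if "d > 0" for d
    using order_tendstoD(2) that by blast
  then have ep_ev: "\<exists>N. \<forall>n\<ge>N. ep n < d" if "d > 0" for d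
    using that by (simp add: eventually_sequentially)
  have unifW: "\<exists>N. \<forall>n\<ge>N. \<forall>x\<in>square x0 R. \<bar>conv (kern (H n) (\<lambda>_. 0)) v x - v x\<bar> \<le> e"
    if v: "continuous_on UNIV v" and e: "e > 0" for v x0 R e
  proof -
    obtain d where d: "d > 0" "d \<le> 1" "\<And>\<epsilon> H x. mollifier \<epsilon> H \<Longrightarrow> 0 < \<epsilon> \<Longrightarrow> \<epsilon> < d \<Longrightarrow> x \<in> square x0 R \<Longrightarrow>
      \<bar>conv (kern H (\<lambda>_. 0)) v x - v x\<bar> \<le> e"
      by (rule conv_mollifier_uniform[OF v e]) blast
    obtain N where "\<forall>n\<ge>N. ep n < d" using ep_ev[OF d(1)] by blast
    then show ?thesis using d(3)[OF H ep(1)] by blast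
  qed
  have limW: "(\<lambda>n. W n x) \<longlonglongrightarrow> w x" for x
  proof (rule LIMSEQ_I)
    fix e :: real assume "e > 0"
    then obtain N where "\<forall>n\<ge>N. \<forall>y\<in>square x 0. \<bar>conv (kern (H n) (\<lambda>_. 0)) w y - w y\<bar> \<le> e / 2"
      using unifW[OF cw, of "e / 2" x 0] by auto
    then have "\<bar>W n x - w x\<bar> \<le> e / 2" if "n \<ge> N" for n
      using center_in_square[of 0 x] that by (simp add: W_def)
    then have "norm (W n x - w x) < e" if "n \<ge> N" for n
      using \<open>e > 0\<close> that by (smt (verit, ccfv_SIG) field_sum_of_halves real_norm_def)
    then show "\<exists>no. \<forall>n\<ge>no. norm (W n x - w x) < e" by blast
  qed
  have diff: "\<bar>W1 n i x - W1 m i x\<bar> \<le> 2 * M + 1/2 * N"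
    if "\<And>y. y \<in> square x 1 \<Longrightarrow> \<bar>W n y - W m y\<bar> \<le> M" "\<And>y. y \<in> square x 1 \<Longrightarrow> \<bar>F n y - F m y\<bar> \<le> N" for n m i x M N
    using gradient_bound[of "\<lambda>x. W n x - W m x" "\<lambda>i x. W1 n i x - W1 m i x" "\<lambda>i x. W2 n i x - W2 m i x" 1 x M N i]
    by (auto intro!: continuous_intros cW has_partial_diff W1 W2 that simp: sum_subtractf sumW2)
  have cauchy: "uniformly_Cauchy_on (square x0 R) (\<lambda>n. W1 n i)" for x0 R
    unfolding uniformly_Cauchy_on_def
  proof (intro allI impI)
    fix e :: real assume e: "e > 0"
    obtain N1 where N1: "\<forall>n\<ge>N1. \<forall>x\<in>square x0 (R + 1). \<bar>W n x - w x\<bar> \<le> e / 16"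
      using unifW[OF cw, of "e / 16" x0 "R + 1"] e unfolding W_def by auto
    obtain N2 where N2: "\<forall>n\<ge>N2. \<forall>x\<in>square x0 (R + 1). \<bar>F n x - f x\<bar> \<le> e / 16"
      using unifW[OF cf, of "e / 16" x0 "R + 1"] e unfolding F_def by auto
    show "\<exists>M. \<forall>x\<in>square x0 R. \<forall>m\<ge>M. \<forall>n\<ge>M. dist (W1 m i x) (W1 n i x) < e"
    proof (intro exI[of _ "max N1 N2"] ballI allI impI)
      fix x m n assume x: "x \<in> square x0 R" and mn: "m \<ge> max N1 N2" "n \<ge> max N1 N2"
      have sub: "y \<in> square x0 (R + 1)" if "y \<in> square x 1" for y using square_trans[OF x that] by simp
      have "\<bar>W m y - W n y\<bar> \<le> e / 8" if "y \<in> square x 1" for y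
      proof -
        have "\<bar>W m y - w y\<bar> \<le> e / 16" "\<bar>W n y - w y\<bar> \<le> e / 16" using N1 sub[OF that] mn by auto
        then show ?thesis by arith
      qed
      moreover have "\<bar>F m y - F n y\<bar> \<le> e / 8" if "y \<in> square x 1" for y
      proof -
        have "\<bar>F m y - f y\<bar> \<le> e / 16" "\<bar>F n y - f y\<bar> \<le> e / 16" using N2 sub[OF that] mn by auto
        then show ?thesis by arith
      qed
      ultimately have "\<bar>W1 m i x - W1 n i x\<bar> \<le> 2 * (e / 8) + 1/2 * (e / 8)" by (rule diff)
      then show "dist (W1 m i x) (W1 n i x) < e" using e by (simp add: dist_real_def)
    qed
  qed
  define g where "g x = lim (\<lambda>n. W1 n i x)" for x
  have unif: "uniform_limit (square x0 R) (\<lambda>n. W1 n i) g sequentially" for x0 R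
  proof -
    have "uniformly_convergent_on (square x0 R) (\<lambda>n. W1 n i)" by (rule Cauchy_uniformly_convergent[OF cauchy])
    then show ?thesis unfolding uniformly_convergent_uniform_limit_iff g_def .
  qed
  have limg: "(\<lambda>n. W1 n i x) \<longlonglongrightarrow> g x" for x
    by (rule tendsto_uniform_limitI[OF unif[of x 0]]) (simp add: center_in_square)
  have cg: "continuous_on UNIV g"
  proof (rule continuous_at_imp_continuous_on, rule)
    fix x0
    have "continuous_on (square x0 1) g"
      by (rule uniform_limit_theorem[OF _ unif]) (auto intro!: always_eventually continuous_on_subset[OF cW(2)])
    moreover have "x0 \<in> interior (square x0 1)"
      unfolding square_eq_cbox by (simp add: mem_box_cart)
    ultimately show "isCont g x0" by (rule continuous_on_interior)
  qed
  have pg: "has_partial i w g"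
    unfolding has_partial_def
  proof
    fix x
    have "uniform_limit {-1..1} (\<lambda>n t. W1 n i (x + t *\<^sub>R axis i 1)) (\<lambda>t. g (x + t *\<^sub>R axis i 1)) sequentially"
      by (rule uniform_limit_compose'[OF unif[of x 1]]) (auto intro!: square_add_axis)
    from DERIV_uniform_limit[of "\<lambda>n t. W n (x + t *\<^sub>R axis i 1)", OF has_partialD[OF W1] limW this]
    show "((\<lambda>t. w (x + t *\<^sub>R axis i 1)) has_real_derivative g x) (at 0)" by simp
  qed
  have est: "\<bar>g x\<bar> \<le> 2 / d * M + d / 2 * N"
    if d: "d > 0" and M: "\<And>y. y \<in> square x d \<Longrightarrow> \<bar>w y\<bar> \<le> M" and N: "\<And>y. y \<in> square x d \<Longrightarrow> \<bar>f y\<bar> \<le> N" for x d M N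
  proof -
    have "\<bar>g x\<bar> \<le> 2 / d' * M + d' / 2 * N" if d': "0 < d'" "d' < d" for d'
    proof -
      obtain n0 where n0: "\<And>n. n \<ge> n0 \<Longrightarrow> ep n < d - d'" using ep_ev[of "d - d'"] d' by auto
      have "\<bar>W1 n i x\<bar> \<le> 2 / d' * M + d' / 2 * N" if n: "n \<ge> n0" for n
      proof -
        have in_d: "z \<in> square x d" if "y \<in> square x d'" "z \<in> square y (ep n)" for y z
          using square_trans[OF that, of d] n0[OF n] by simp
        have "\<bar>W n y\<bar> \<le> M" if "y \<in> square x d'" for y
          using conv_mollifier_near[OF H[of n] ep(1) cw, of y 0 M] M in_d[OF that] unfolding W_def by simp
        moreover have "\<bar>F n y\<bar> \<le> N" if "y \<in> square x d'" for y
          using conv_mollifier_near[OF H[of n] ep(1) cf, of y 0 N] N in_d[OF that] unfolding F_def by simp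
        ultimately show ?thesis
          by (intro gradient_bound[OF cW(1) W1 W2 d'(1)]) (auto simp: sumW2)
      qed
      then show ?thesis
        by (intro LIMSEQ_le_const2[OF tendsto_rabs[OF limg]]) auto
    qed
    then have "\<forall>\<^sub>F d' in at_left d. \<bar>g x\<bar> \<le> 2 / d' * M + d' / 2 * N"
      using eventually_at_left_real[OF d] by (auto elim: eventually_mono)
    moreover have "((\<lambda>d'. 2 / d' * M + d' / 2 * N) \<longlongrightarrow> 2 / d * M + d / 2 * N) (at_left d)"
      using d by (auto intro!: tendsto_eq_intros)
    ultimately show ?thesis by (intro tendsto_lowerbound) auto
  qed
  show ?thesis by (rule that[OF pg cg est])
qed

section \<open>Derivative bounds for solutions\<close>

lemma power_le_fact_exp:
  fixes x :: real
  assumes "x \<ge> 0"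
  shows "x ^ n \<le> fact n * exp x"
proof -
  have s: "(\<lambda>k. x ^ k /\<^sub>R fact k) sums exp x" by (rule exp_converges)
  have "x ^ n /\<^sub>R fact n \<le> exp x"
    using sum_le_suminf[OF sums_summable[OF s], of "{n}"] assms sums_unique[OF s] by simp
  then show ?thesis by (simp add: field_simps)
qed

text \<open>\<open>dq i n\<close> is the n-th pure derivative of \<open>q\<close> along axis
  \<open>i\<close>. Pure derivatives suffice to bound \<open>u\<close> on axis-parallel lines,
  because differentiating the equation along one axis keeps the Laplacian on the left.\<close>

locale schroedinger_solution =
  fixes u q :: "real^2 \<Rightarrow> real" and dq :: "2 \<Rightarrow> nat \<Rightarrow> real^2 \<Rightarrow> real"
  assumes weak: "weak_laplacian u (\<lambda>x. q x * u x)"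
    and dq_0: "dq i 0 = q" and dq_cont: "continuous_on UNIV (dq i n)"
    and dq_partial: "has_partial i (dq i n) (dq i (Suc n))"
begin

primrec du :: "2 \<Rightarrow> nat \<Rightarrow> real^2 \<Rightarrow> real" where
  "du i 0 = u"
| "du i (Suc n) = (\<lambda>x. deriv (\<lambda>t. du i n (x + t *\<^sub>R axis i 1)) 0)"

declare du.simps(2) [simp del]

definition rhs :: "2 \<Rightarrow> nat \<Rightarrow> real^2 \<Rightarrow> real" where
  "rhs i n x = (\<Sum>j\<le>n. real (n choose j) * (dq i j x * du i (n - j) x))"

lemma du_step:
  assumes "weak_laplacian (du i n) (rhs i n)"
  shows "has_partial i (du i n) (du i (Suc n))" (is ?a)
    and "continuous_on UNIV (du i (Suc n))" (is ?b)
    and "d > 0 \<Longrightarrow> (\<And>y. y \<in> square x d \<Longrightarrow> \<bar>du i n y\<bar> \<le> M) \<Longrightarrow> (\<And>y. y \<in> square x d \<Longrightarrow> \<bar>rhs i n y\<bar> \<le> N) \<Longrightarrow>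
       \<bar>du i (Suc n) x\<bar> \<le> 2 / d * M + d / 2 * N"
proof -
  obtain g where g: "has_partial i (du i n) g" "continuous_on UNIV g"
    "\<And>x d M N. d > 0 \<Longrightarrow> (\<And>y. y \<in> square x d \<Longrightarrow> \<bar>du i n y\<bar> \<le> M) \<Longrightarrow> (\<And>y. y \<in> square x d \<Longrightarrow> \<bar>rhs i n y\<bar> \<le> N) \<Longrightarrow>
       \<bar>g x\<bar> \<le> 2 / d * M + d / 2 * N"
    by (rule weak_laplacian_regularity[OF assms, of i]) blast
  have "du i (Suc n) = g"
    using g(1) by (auto simp: has_partial_def du.simps(2) intro!: DERIV_imp_deriv)
  then show ?a ?b and "d > 0 \<Longrightarrow> (\<And>y. y \<in> square x d \<Longrightarrow> \<bar>du i n y\<bar> \<le> M) \<Longrightarrow> (\<And>y. y \<in> square x d \<Longrightarrow> \<bar>rhs i n y\<bar> \<le> N) \<Longrightarrow>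
       \<bar>du i (Suc n) x\<bar> \<le> 2 / d * M + d / 2 * N"
    using g by blast+
qed

text \<open>Bootstrap: \<open>rhs i n\<close> contains derivatives of \<open>u\<close> of order at
  most \<open>n\<close>, so the weak equation at order \<open>n\<close> produces the derivative of
  order \<open>n + 1\<close>, and differentiating that equation gives the next one. All lower orders
  enter the Leibniz sum, hence the strong induction.\<close>

lemma weak_du: "weak_laplacian (du i n) (rhs i n)"
proof (induction n rule: less_induct)
  case (less n)
  show ?case
  proof (cases n)
    case 0
    have "rhs i 0 = (\<lambda>x. q x * u x)" by (auto simp: rhs_def dq_0)
    then show ?thesis using weak 0 by simp
  next
    case (Suc k)
    have w: "weak_laplacian (du i j) (rhs i j)" if "j \<le> k" for j using less Suc that by simp
    have p: "has_partial i (du i j) (du i (Suc j))" if "j \<le> k" for j using du_step(1)[OF w[OF that]] .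
    have c: "continuous_on UNIV (du i j)" if "j \<le> Suc k" for j
      using that weak du_step(2)[OF w] by (cases j) (auto simp: weak_laplacian_def)
    have "has_partial i (rhs i k) (\<lambda>x. \<Sum>j\<le>k. real (k choose j) * (dq i (Suc j) x * du i (k - j) x + dq i j x * du i (Suc (k - j)) x))"
      unfolding rhs_def by (intro has_partial_sum has_partial_cmult has_partial_mult dq_partial p) auto
    then have "has_partial i (rhs i k) (rhs i (Suc k))"
      by (rule has_partial_cong) (simp_all only: rhs_def leibniz_sum[of k "\<lambda>j. dq i j x" "\<lambda>j. du i j x" for x])
    moreover have "continuous_on UNIV (rhs i (Suc k))"
      unfolding rhs_def by (intro continuous_intros dq_cont c) auto
    ultimately show ?thesis unfolding Suc
      using weak_laplacian_partial[OF w[OF order_refl] p[OF order_refl] c[OF order_refl]] by blast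
  qed
qed

lemmas du_partial = du_step(1)[OF weak_du]
  and du_bound_step = du_step(3)[OF weak_du]

lemma du_cont: "continuous_on UNIV (du i n)"
  using weak_du by (auto simp: weak_laplacian_def)

lemma u_cont: "continuous_on UNIV u"
  using du_cont[of _ 0] by simp

lemma gradient_estimate:
  assumes "d > 0" "\<And>y. y \<in> square x d \<Longrightarrow> \<bar>u y\<bar> \<le> M" "\<And>y. y \<in> square x d \<Longrightarrow> \<bar>q y\<bar> \<le> \<Lambda>"
  shows "\<bar>du i 1 x\<bar> \<le> (2 / d + d / 2 * \<Lambda>) * M"
proof -
  have "\<bar>rhs i 0 y\<bar> \<le> \<Lambda> * M" if "y \<in> square x d" for y
  proof -
    have "\<bar>q y\<bar> * \<bar>u y\<bar> \<le> \<Lambda> * M"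
      using assms(2,3)[OF that] by (intro mult_mono) auto
    then show ?thesis by (simp add: rhs_def dq_0 abs_mult)
  qed
  then have "\<bar>du i (Suc 0) x\<bar> \<le> 2 / d * M + d / 2 * (\<Lambda> * M)"
    by (intro du_bound_step[OF assms(1)]) (use assms(2) in auto)
  then show ?thesis by (simp add: algebra_simps)
qed

lemma second_partials:
  obtains u2 where "\<And>i j. has_partial j (du i 1) (u2 i j)" "\<And>i j. continuous_on UNIV (u2 i j)"
    "\<And>i j. u2 i j = u2 j i" "\<And>x. (\<Sum>i\<in>UNIV. u2 i i x) = q x * u x"
proof -
  have "\<exists>g. has_partial j (du i 1) g \<and> continuous_on UNIV g" for i j
    by (rule weak_laplacian_regularity[OF weak_du[of i 1], of j]) blast
  then have ex: "\<exists>g. has_partial j (du i 1) g \<and> continuous_on UNIV g" for i j .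
  define u2 where "u2 i j = (SOME g. has_partial j (du i 1) g \<and> continuous_on UNIV g)" for i j
  have u2: "has_partial j (du i 1) (u2 i j)" "continuous_on UNIV (u2 i j)" for i j
    using someI_ex[OF ex[of j i]] unfolding u2_def by blast+
  have parts: "conv (kern H (\<lambda>_. 0)) (u2 i j) = conv (kern H (((\<lambda>_. 0)(j := 1))(i := Suc (((\<lambda>_. 0)(j := 1)) i)))) u"
    if H: "mollifier \<epsilon> H" "\<epsilon> \<le> 1" for \<epsilon> H i j
  proof
    fix x
    have k: "smoothing_kernel (kern H a)" for a using mollifier_smoothing_kernel H by blast
    have dH: "derivatives H" using H by (simp add: mollifier_def)
    have "conv (kern H ((\<lambda>_. 0)(j := 1))) (du i 1) x = conv (kern H (\<lambda>_. 0)) (u2 i j) x"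
      using conv_by_parts[OF k k kern_has_partial[OF dH] du_cont u2(2,1), of "\<lambda>_. 0" j i x] by simp
    moreover have "conv (kern H (((\<lambda>_. 0)(j := 1))(i := Suc (((\<lambda>_. 0)(j := 1)) i)))) u x = conv (kern H ((\<lambda>_. 0)(j := 1))) (du i 1) x"
      using conv_by_parts[OF k k kern_has_partial[OF dH] du_cont du_cont du_partial, of "(\<lambda>_. 0)(j := 1)" i 0 x] by simp
    ultimately show "conv (kern H (\<lambda>_. 0)) (u2 i j) x = conv (kern H (((\<lambda>_. 0)(j := 1))(i := Suc (((\<lambda>_. 0)(j := 1)) i)))) u x" by simp
  qed
  have "u2 i j = u2 j i" for i j
  proof (cases "i = j")
    case False
    then have "((\<lambda>_. 0)(j := 1))(i := Suc (((\<lambda>_. 0)(j := 1)) i)) = ((\<lambda>_. 0)(i := 1))(j := Suc (((\<lambda>_. 0::nat)(i := 1)) j))"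
      by (auto simp: fun_upd_def)
    then show ?thesis using parts[of _ _ i j] parts[of _ _ j i]
      by (intro conv_mollifier_inject u2) metis
  qed simp
  moreover have "(\<lambda>x. \<Sum>i\<in>UNIV. u2 i i x) = (\<lambda>x. q x * u x)"
  proof (rule conv_mollifier_inject)
    fix \<epsilon> :: real and H x assume H: "0 < \<epsilon>" "\<epsilon> \<le> 1" "mollifier \<epsilon> H"
    let ?K = "kern H (\<lambda>_. 0)"
    have k: "smoothing_kernel ?K" using mollifier_smoothing_kernel H by blast
    have cK: "continuous_on UNIV (\<lambda>y. ?K (x - y))"
      by (rule cont_compose_UNIV) (use k in \<open>auto simp: smoothing_kernel_def intro!: continuous_intros\<close>)
    have "conv ?K (\<lambda>x. \<Sum>i\<in>UNIV. u2 i i x) x = (\<Sum>i\<in>UNIV. conv ?K (u2 i i) x)"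
      unfolding conv_eq[OF k center_in_square[of 1 x], simplified] sum_distrib_left
      by (intro Henstock_Kurzweil_Integration.integral_sum integrable_square continuous_intros cK u2) auto
    also have "\<dots> = (\<Sum>i\<in>UNIV. conv (kern H ((\<lambda>_. 0)(i := 2))) u x)"
      by (intro sum.cong refl) (simp add: parts[OF H(3,2)] numeral_2_eq_2)
    also have "\<dots> = conv ?K (\<lambda>x. q x * u x) x" using weak H unfolding weak_laplacian_def by blast
    finally show "conv ?K (\<lambda>x. \<Sum>i\<in>UNIV. u2 i i x) x = conv ?K (\<lambda>x. q x * u x) x" .
  next
    show "continuous_on UNIV (\<lambda>x. q x * u x)" using weak by (simp add: weak_laplacian_def)
  qed (intro continuous_intros u2)
  ultimately show ?thesis using that[of u2] u2 by metis
qed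

text \<open>The gradient bound is iterated \<open>n\<close> times on squares that shrink by \<delta>
  each time. A step costs 2/\<delta> through \<open>u\<close> and \<delta> \<Lambda> through the
  right side; for \<delta> at most \<Lambda>^(-1/2) the total is at most 3/\<delta>, which is the
  origin of \<open>A \<ge> 3\<close>.\<close>

lemma du_bound:
  assumes R: "R > 0" and A: "A \<ge> 3" "A \<ge> B" "B \<ge> 0" and L: "\<Lambda> \<ge> 0"
    and dq: "\<And>j y. y \<in> square p R \<Longrightarrow> \<bar>dq i j y\<bar> \<le> \<Lambda> * fact j * (B / R) ^ j"
    and M: "\<And>y. y \<in> square p R \<Longrightarrow> \<bar>u y\<bar> \<le> M" and x: "x \<in> square p (R / 2)"
  shows "\<bar>du i n x\<bar> \<le> M * exp (R * sqrt \<Lambda>) * fact n * (6 * A / R) ^ n"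
proof (cases "n = 0")
  case True
  have M0: "M \<ge> 0" using M[OF center_in_square] R by force
  have "\<bar>u x\<bar> \<le> M * 1" using M x square_mono[of "R / 2" R p] R by auto
  also have "\<dots> \<le> M * exp (R * sqrt \<Lambda>)" using M0 R L by (intro mult_left_mono) auto
  finally show ?thesis using True by simp
next
  case False
  define \<sigma> where "\<sigma> = R * sqrt \<Lambda>"
  have s0: "\<sigma> \<ge> 0" using R L by (simp add: \<sigma>_def)
  \<comment> \<open>The summand \<open>n\<close> keeps \<open>n\<close> steps within distance
    \<open>R / 2\<close>; the summand \<sigma> keeps \<delta> below the scale
    \<Lambda>^(-1/2).\<close>
  define \<delta> where "\<delta> = R / (2 * (n + \<sigma>))"
  have ns: "n + \<sigma> > 0" using False s0 by (simp add: add_pos_nonneg)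
  have d: "\<delta> > 0" using R ns by (simp add: \<delta>_def)
  have nd: "n * \<delta> \<le> R / 2" using R ns s0 by (simp add: \<delta>_def field_simps)
  have M0: "M \<ge> 0" using M[OF center_in_square] R by force
  have dL: "\<delta> * \<Lambda> \<le> 1 / \<delta>"
  proof -
    have "\<sigma>\<^sup>2 \<le> (n + \<sigma>)\<^sup>2" using s0 by (intro power_mono) auto
    then have "R\<^sup>2 * \<Lambda> \<le> (n + \<sigma>)\<^sup>2" using L by (simp add: \<sigma>_def power_mult_distrib)
    moreover have "(R / (2 * s))\<^sup>2 * \<Lambda> = (R\<^sup>2 * \<Lambda>) / (4 * s\<^sup>2)" for s
      by (simp add: power_divide power_mult_distrib)
    then have "\<delta>\<^sup>2 * \<Lambda> = (R\<^sup>2 * \<Lambda>) / (4 * (n + \<sigma>)\<^sup>2)" unfolding \<delta>_def .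
    ultimately have "\<delta>\<^sup>2 * \<Lambda> \<le> (n + \<sigma>)\<^sup>2 / (4 * (n + \<sigma>)\<^sup>2)"
      by (simp add: divide_right_mono)
    also have "\<dots> \<le> 1" using ns by simp
    finally have "\<delta>\<^sup>2 * \<Lambda> \<le> 1" .
    then show ?thesis using d by (simp add: field_simps power2_eq_square)
  qed
  have main: "\<forall>y\<in>square p (R - k * \<delta>). \<bar>du i k y\<bar> \<le> M * (A / \<delta>) ^ k" if "k \<le> n" for k
    using that
  proof (induction k rule: less_induct)
    case (less k')
    show ?case
    proof (cases k')
      case 0
      then show ?thesis using M by simp
    next
      case (Suc k)
      have IH: "\<bar>du i l y\<bar> \<le> M * (A / \<delta>) ^ l" if "l \<le> k" "y \<in> square p (R - k * \<delta>)" for l y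
      proof -
        have "R - k * \<delta> \<le> R - l * \<delta>" using that d by simp
        then have "y \<in> square p (R - l * \<delta>)" using that(2) square_mono by blast
        moreover have "l < k'" "l \<le> n" using that(1) less.prems Suc by auto
        ultimately show ?thesis using less.IH by blast
      qed
      have rhs: "\<bar>rhs i k y\<bar> \<le> 2 * \<Lambda> * M * (A / \<delta>) ^ k" if y: "y \<in> square p (R - k * \<delta>)" for y
      proof -
        have yR: "y \<in> square p R" using y square_mono[of "R - k * \<delta>" R p] d by auto
        \<comment> \<open>The Leibniz terms decay geometrically: the binomial times
          \<open>fact j\<close> is at most \<open>n ^ j\<close>, and
          \<open>n * \<delta> \<le> R / 2\<close> with \<open>B \<le> A\<close> makes
          \<open>n * B / R\<close> at most half of \<open>A / \<delta>\<close>.\<close>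
        have "\<bar>real (k choose j) * (dq i j y * du i (k - j) y)\<bar> \<le> \<Lambda> * M * (A / \<delta>) ^ k * (1/2) ^ j" if j: "j \<le> k" for j
        proof -
          have "real (k choose j) * fact j \<le> real n ^ j"
          proof -
            have "(k choose j) * fact j \<le> k ^ j" by (rule binomial_fact_pow)
            also have "\<dots> \<le> n ^ j" using less Suc by (intro power_mono) auto
            finally have "real ((k choose j) * fact j) \<le> real (n ^ j)" by (simp only: of_nat_le_iff)
            then show ?thesis by simp
          qed
          have "\<bar>real (k choose j) * (dq i j y * du i (k - j) y)\<bar> = real (k choose j) * (\<bar>dq i j y\<bar> * \<bar>du i (k - j) y\<bar>)"
            by (simp add: abs_mult)
          also have "\<dots> \<le> real (k choose j) * ((\<Lambda> * fact j * (B / R) ^ j) * (M * (A / \<delta>) ^ (k - j)))"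
            using dq[OF yR, of j] IH[of "k - j", OF _ y] by (intro mult_left_mono mult_mono) auto
          also have "\<dots> = (real (k choose j) * fact j) * (B / R) ^ j * (\<Lambda> * M * (A / \<delta>) ^ (k - j))"
            by (simp add: algebra_simps)
          also have "\<dots> \<le> real n ^ j * (B / R) ^ j * (\<Lambda> * M * (A / \<delta>) ^ (k - j))"
            using \<open>real (k choose j) * fact j \<le> real n ^ j\<close> A R L M0 d by (intro mult_right_mono) auto
          also have "\<dots> = (n * B / R) ^ j * (\<Lambda> * M * (A / \<delta>) ^ (k - j))"
            by (simp add: power_mult_distrib[symmetric])
          also have "\<dots> \<le> ((A / \<delta>) * (1/2)) ^ j * (\<Lambda> * M * (A / \<delta>) ^ (k - j))"
          proof (intro mult_right_mono power_mono)
            have "n * \<delta> * B \<le> R / 2 * A" using nd A R d by (intro mult_mono) auto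
            then show "n * B / R \<le> (A / \<delta>) * (1/2)" using R d by (simp add: field_simps)
          qed (use A R L M0 d in auto)
          also have "\<dots> = \<Lambda> * M * ((A / \<delta>) ^ j * (A / \<delta>) ^ (k - j)) * (1/2) ^ j"
            by (subst power_mult_distrib) (simp only: ac_simps)
          also have "(A / \<delta>) ^ j * (A / \<delta>) ^ (k - j) = (A / \<delta>) ^ k"
            using j by (simp add: power_add[symmetric])
          finally show ?thesis .
        qed
        then have "\<bar>rhs i k y\<bar> \<le> (\<Sum>j\<le>k. \<Lambda> * M * (A / \<delta>) ^ k * (1/2) ^ j)"
          unfolding rhs_def by (intro order_trans[OF sum_abs] sum_mono) auto
        also have "\<dots> = \<Lambda> * M * (A / \<delta>) ^ k * (\<Sum>j\<le>k. (1/2) ^ j)" by (simp add: sum_distrib_left)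
        also have "\<dots> \<le> \<Lambda> * M * (A / \<delta>) ^ k * 2"
        proof (intro mult_left_mono)
          have "(\<Sum>j\<le>k. (1/2::real) ^ j) = 2 - (1/2) ^ k" by (induction k) (auto simp: field_simps)
          then show "(\<Sum>j\<le>k. (1/2) ^ j) \<le> (2::real)" by simp
        qed (use L M0 A d in auto)
        finally show ?thesis by (simp add: algebra_simps)
      qed
      show ?thesis
      proof
        fix y assume y: "y \<in> square p (R - k' * \<delta>)"
        have sub: "z \<in> square p (R - k * \<delta>)" if "z \<in> square y \<delta>" for z
          using square_trans[OF y that] Suc by (simp add: algebra_simps)
        have "\<bar>du i (Suc k) y\<bar> \<le> 2 / \<delta> * (M * (A / \<delta>) ^ k) + \<delta> / 2 * (2 * \<Lambda> * M * (A / \<delta>) ^ k)"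
          by (rule du_bound_step[OF d]) (use IH rhs sub in auto)
        also have "\<dots> = (M * (A / \<delta>) ^ k) * (2 / \<delta> + \<delta> * \<Lambda>)" by (simp add: algebra_simps)
        also have "\<dots> \<le> (M * (A / \<delta>) ^ k) * (A / \<delta>)"
        proof (intro mult_left_mono)
          have "2 / \<delta> + \<delta> * \<Lambda> \<le> 3 / \<delta>" using dL by (simp add: field_simps)
          also have "\<dots> \<le> A / \<delta>" using A d by (simp add: divide_right_mono)
          finally show "2 / \<delta> + \<delta> * \<Lambda> \<le> A / \<delta>" .
        qed (use M0 A d in auto)
        finally show "\<bar>du i k' y\<bar> \<le> M * (A / \<delta>) ^ k'" unfolding Suc power_Suc by (simp only: ac_simps)
      qed
    qed
  qed
  have "\<bar>du i n x\<bar> \<le> M * (A / \<delta>) ^ n"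
    using main[of n] x square_mono[of "R / 2" "R - n * \<delta>" p] nd by auto
  also have "A / \<delta> = (2 * A / R) * (n + \<sigma>)" using R ns by (simp add: \<delta>_def)
  also have "M * ((2 * A / R) * (n + \<sigma>)) ^ n = M * ((2 * A / R) ^ n * (n + \<sigma>) ^ n)" by (simp only: power_mult_distrib)
  \<comment> \<open>One term of the exponential series bounds (n + \<sigma>)^n by n! e^n e^\<sigma>:
    the price of the frequency is the single factor e^\<sigma>, and 6 is 2 times the bound 3 for
    e.\<close>
  also have "\<dots> \<le> M * ((2 * A / R) ^ n * (fact n * (3 ^ n * exp \<sigma>)))"
  proof (intro mult_left_mono)
    have "(n + \<sigma>) ^ n \<le> fact n * exp (n + \<sigma>)" using ns by (intro power_le_fact_exp) simp
    also have "exp (n + \<sigma>) = exp 1 ^ n * exp \<sigma>" by (simp add: exp_add exp_of_nat_mult[symmetric])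
    also have "exp 1 ^ n * exp \<sigma> \<le> 3 ^ n * exp \<sigma>" by (intro mult_right_mono power_mono exp_le) auto
    finally show "(n + \<sigma>) ^ n \<le> fact n * (3 ^ n * exp \<sigma>)" by (simp add: mult_left_mono)
  qed (use M0 A R in auto)
  also have "\<dots> = M * exp \<sigma> * fact n * ((2 * A / R) ^ n * 3 ^ n)" by (simp add: algebra_simps)
  also have "(2 * A / R) ^ n * 3 ^ n = (6 * A / R) ^ n" by (simp add: power_mult_distrib[symmetric])
  finally show ?thesis by (simp add: \<sigma>_def)
qed

end

section \<open>Zeros in small squares\<close>

text \<open>An eigenfunction of the Laplacian for the eigenvalue -2 k^2. With k l = 1 it is positive
  on the closed square of radius l and serves as a supersolution; with k l = pi/2 it is the
  Dirichlet ground state of that square.\<close>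

definition cosprod :: "real \<Rightarrow> real^2 \<Rightarrow> real^2 \<Rightarrow> real" where
  "cosprod k x y = cos (k * (y $ 1 - x $ 1)) * cos (k * (y $ 2 - x $ 2))"

lemma cosprod_partials:
  obtains c1 where "\<And>i. has_partial i (cosprod k x) (c1 i)" "\<And>i. has_partial i (c1 i) (\<lambda>y. - (k\<^sup>2) * cosprod k x y)"
proof (rule that)
  let ?c1 = "\<lambda>i y. - k * (if i = 1 then sin (k * (y $ 1 - x $ 1)) * cos (k * (y $ 2 - x $ 2))
       else cos (k * (y $ 1 - x $ 1)) * sin (k * (y $ 2 - x $ 2)))"
  show "has_partial i (cosprod k x) (?c1 i)" for i
    using exhaust_2[of i] unfolding has_partial_def cosprod_def
    by (auto simp: axis_def intro!: derivative_eq_intros)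
  show "has_partial i (?c1 i) (\<lambda>y. - (k\<^sup>2) * cosprod k x y)" for i
    using exhaust_2[of i] unfolding has_partial_def cosprod_def
    by (auto simp: axis_def power2_eq_square intro!: derivative_eq_intros)
qed

lemma cosprod_cont: "continuous_on S (cosprod k x)"
  unfolding cosprod_def by (intro continuous_intros)

lemma square_interior:
  assumes y: "y \<in> square x l" and nb: "\<And>i. \<bar>y $ i - x $ i\<bar> \<noteq> l"
  obtains r where "r > 0" "square y r \<subseteq> square x l"
proof
  let ?m = "max \<bar>y $ 1 - x $ 1\<bar> \<bar>y $ 2 - x $ 2\<bar>"
  have lt: "\<bar>y $ i - x $ i\<bar> < l" for i using y nb[of i] by (auto simp: square_def less_le)
  show "l - ?m > 0" using lt[of 1] lt[of 2] by auto
  show "square y (l - ?m) \<subseteq> square x l"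
  proof
    fix z assume z: "z \<in> square y (l - ?m)"
    have "y \<in> square x ?m" unfolding square_def using exhaust_2 by (auto simp: forall_2)
    then show "z \<in> square x l" using square_trans[OF _ z] by simp
  qed
qed

text \<open>The coefficient \<open>q\<close> may be negative, but on a square of side comparable to \<open>1 / sqrt \<Lambda>\<close> the cosine
  product is a positive strict supersolution, and comparison with it restores the maximum principle.\<close>

lemma positive_in_small_square:
  fixes v q :: "real^2 \<Rightarrow> real"
  assumes cv: "continuous_on UNIV v" and v1: "\<And>i. has_partial i v (v1 i)" and v2: "\<And>i. has_partial i (v1 i) (v2 i)"
    and eq: "\<And>y. (\<Sum>i\<in>UNIV. v2 i y) = q y * v y"
    and q: "\<And>y. y \<in> square x l \<Longrightarrow> \<bar>q y\<bar> \<le> \<Lambda>" and l: "l > 0" "l * sqrt \<Lambda> \<le> 1"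
    and bd: "\<And>y i. y \<in> square x l \<Longrightarrow> \<bar>y $ i - x $ i\<bar> = l \<Longrightarrow> v y > 0" and y: "y \<in> square x l"
  shows "v y > 0"
proof -
  have L0: "\<Lambda> \<ge> 0" using q[OF center_in_square] l by force
  have "(l * sqrt \<Lambda>)\<^sup>2 \<le> 1" using l L0 by (simp add: power_le_one)
  then have L: "\<Lambda> \<le> (1 / l)\<^sup>2" using l L0 by (simp add: power_mult_distrib field_simps)
  define k where "k = 1 / l"
  have k: "k > 0" "\<Lambda> \<le> k\<^sup>2" using l L by (auto simp: k_def)
  define f where "f = cosprod k x"
  obtain f1 where f1: "\<And>i. has_partial i f (f1 i)" "\<And>i. has_partial i (f1 i) (\<lambda>y. - (k\<^sup>2) * f y)"
    unfolding f_def by (rule cosprod_partials[of k x]) blast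
  have f0: "f y > 0" if "y \<in> square x l" for y
  proof -
    have "\<bar>k * (y $ i - x $ i)\<bar> \<le> 1" for i using that l by (auto simp: square_def k_def abs_mult field_simps)
    then have "\<bar>k * (y $ i - x $ i)\<bar> < pi / 2" for i
      by (rule le_less_trans) (use pi_gt3 in simp)
    moreover have "cos t > 0" if "\<bar>t\<bar> < pi / 2" for t using that by (intro cos_gt_zero_pi) auto
    ultimately have "cos (k * (y $ i - x $ i)) > 0" for i by blast
    then show ?thesis unfolding f_def cosprod_def by simp
  qed
  \<comment> \<open>A positive subsolution, because \<open>q \<le> k\<^sup>2\<close>. Comparing
    \<open>v\<close> with a small multiple of \<open>g\<close> instead of with 0 is what gives
    strict positivity inside.\<close>
  define g where "g y = exp (k * y $ 1)" for y :: "real^2"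
  define g1 where "g1 i y = (if i = 1 then k * g y else 0)" for i :: 2 and y
  define g2 where "g2 i y = (if i = 1 then k\<^sup>2 * g y else 0)" for i :: 2 and y
  have g1: "has_partial i g (g1 i)" and g2: "has_partial i (g1 i) (g2 i)" for i
    unfolding has_partial_def g_def g1_def g2_def using exhaust_2[of i]
    by (auto simp: axis_def power2_eq_square intro!: derivative_eq_intros)
  have cg: "continuous_on S g" for S unfolding g_def by (intro continuous_intros)
  have gpos: "g y > 0" for y by (simp add: g_def)
  define D where "D = square x l"
  define S where "S = D \<inter> (\<Union>i. {y. \<bar>y $ i - x $ i\<bar> = l})"
  have "closed {y :: real^2. \<bar>y $ i - x $ i\<bar> = l}" for i
    by (intro closed_Collect_eq continuous_intros)
  then have "closed (\<Union>i::2. {y :: real^2. \<bar>y $ i - x $ i\<bar> = l})"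
    by (intro closed_UN) auto
  then have cS: "compact S" unfolding S_def D_def by (intro compact_Int_closed compact_square)
  have "x + l *\<^sub>R axis 1 1 \<in> S" using l by (auto simp: S_def D_def square_def axis_def)
  then have ne: "S \<noteq> {}" by blast
  have ct: "continuous_on S (\<lambda>y. v y / g y)"
    by (intro continuous_on_divide continuous_on_subset[OF cv] cg) (auto simp: g_def)
  obtain z where z: "z \<in> S" "\<And>y. y \<in> S \<Longrightarrow> v z / g z \<le> v y / g y"
    using continuous_attains_inf[OF cS ne ct] by blast
  define \<eta> where "\<eta> = v z / g z"
  have eta: "\<eta> > 0" using z bd gpos unfolding \<eta>_def S_def D_def by (auto intro!: divide_pos_pos)
  define w where "w y = v y - \<eta> * g y" for y
  have wS: "w y \<ge> 0" if "y \<in> S" for y using z(2)[OF that] gpos[of y] by (simp add: w_def \<eta>_def[symmetric] field_simps)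
  have cD: "compact D" "x \<in> D" using l by (auto simp: D_def compact_square center_in_square)
  have cw: "continuous_on UNIV w" unfolding w_def by (intro continuous_intros cv cg)
  have "continuous_on D (\<lambda>y. w y / f y)"
    by (intro continuous_on_divide continuous_on_subset[OF cw]) (auto simp: D_def cosprod_cont f_def dest: f0[unfolded f_def])
  then obtain y0 where y0: "y0 \<in> D" "\<And>y. y \<in> D \<Longrightarrow> w y0 / f y0 \<le> w y / f y"
    using continuous_attains_inf[OF cD(1)] cD(2) by blast
  have "w y0 \<ge> 0"
  proof (rule ccontr)
    assume neg: "\<not> w y0 \<ge> 0"
    then have "y0 \<notin> S" using wS by blast
    then obtain r where r: "r > 0" "square y0 r \<subseteq> D"
      using square_interior[of y0 x l] y0(1) unfolding S_def D_def by blast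
    \<comment> \<open>If the minimum \<open>c\<close> of \<open>w / f\<close> were negative,
      \<open>w - c * f\<close> would have an interior minimum there, and the supersolution
      \<open>f\<close> makes its Laplacian negative.\<close>
    define c where "c = w y0 / f y0"
    have f00: "f y0 > 0" using f0 y0 by (simp add: D_def)
    have c: "c < 0" "w y0 = c * f y0" using neg f00 by (auto simp: c_def divide_less_0_iff)
    define h2 where "h2 i y = (v2 i y - \<eta> * g2 i y) - c * (- (k\<^sup>2) * f y)" for i y
    have "h2 i y0 \<ge> 0" for i
    proof (rule second_partial_nonneg_at_min[OF _ _ r(1)])
      show "has_partial i (\<lambda>y. w y - c * f y) (\<lambda>y. (v1 i y - \<eta> * g1 i y) - c * f1 i y)"
        unfolding w_def by (intro has_partial_diff has_partial_cmult v1 g1 f1)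
      show "has_partial i (\<lambda>y. (v1 i y - \<eta> * g1 i y) - c * f1 i y) (h2 i)"
        unfolding h2_def by (intro has_partial_diff has_partial_cmult v2 g2 f1)
      fix y assume "y \<in> square y0 r"
      then have "y \<in> D" using r by auto
      then have "c \<le> w y / f y" "f y > 0" using y0(2) f0 by (auto simp: c_def D_def)
      then have "c * f y \<le> w y" by (simp add: field_simps)
      then show "w y0 - c * f y0 \<le> w y - c * f y" using c by simp
    qed
    then have "0 \<le> (\<Sum>i\<in>UNIV. h2 i y0)" by (intro sum_nonneg) auto
    also have "\<dots> = q y0 * v y0 - \<eta> * (k\<^sup>2 * g y0) + 2 * k\<^sup>2 * (c * f y0)"
      unfolding eq[symmetric] by (simp add: h2_def sum_2 g2_def algebra_simps)
    also have "v y0 = c * f y0 + \<eta> * g y0" using c by (simp add: w_def)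
    also have "q y0 * (c * f y0 + \<eta> * g y0) - \<eta> * (k\<^sup>2 * g y0) + 2 * k\<^sup>2 * (c * f y0)
       = (c * f y0) * (q y0 + 2 * k\<^sup>2) + (\<eta> * g y0) * (q y0 - k\<^sup>2)" by (simp add: algebra_simps)
    also have "\<dots> < 0"
    proof (rule add_neg_nonpos)
      have "\<bar>q y0\<bar> \<le> k\<^sup>2" using q[of y0] y0 k by (simp add: D_def)
      moreover have "k\<^sup>2 > 0" using k by simp
      ultimately have "q y0 + 2 * k\<^sup>2 > 0" "q y0 - k\<^sup>2 \<le> 0" by linarith+
      then show "(c * f y0) * (q y0 + 2 * k\<^sup>2) < 0" "(\<eta> * g y0) * (q y0 - k\<^sup>2) \<le> 0"
        using c f00 eta gpos[of y0] by (auto intro!: mult_neg_pos mult_nonneg_nonpos)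
    qed
    finally show False by simp
  qed
  then have "w y / f y \<ge> 0" using y0(2)[of y] y f0[of y0] y0(1)
    by (smt (verit) D_def divide_nonneg_pos)
  then have "w y \<ge> 0" using f0[OF y] by (simp add: zero_le_divide_iff)
  then show ?thesis using mult_pos_pos[OF eta gpos[of y]] by (simp add: w_def)
qed

text \<open>Sturm comparison with the Dirichlet ground state of the square, whose eigenvalue pi^2 /
  (2 l^2) is below \<kappa>. If \<open>v\<close> were positive, the ground state would touch a
  multiple of \<open>v\<close> from below at an interior point, where the Laplacian of the
  difference has the wrong sign. The 9 leaves room for the crude bound pi < 4.\<close>

lemma zero_in_allowed_square:
  fixes v q :: "real^2 \<Rightarrow> real"
  assumes cv: "continuous_on UNIV v" and v1: "\<And>i. has_partial i v (v1 i)" and v2: "\<And>i. has_partial i (v1 i) (v2 i)"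
    and eq: "\<And>y. (\<Sum>i\<in>UNIV. v2 i y) = q y * v y"
    and q: "\<And>y. y \<in> square x l \<Longrightarrow> q y \<le> - \<kappa>" and l: "l > 0" "\<kappa> * l\<^sup>2 \<ge> 9"
  shows "\<exists>y\<in>square x l. v y \<le> 0"
proof (rule ccontr)
  assume "\<not> (\<exists>y\<in>square x l. v y \<le> 0)"
  then have pos: "v y > 0" if "y \<in> square x l" for y using that by force
  define k where "k = pi / (2 * l)"
  have kl: "k * l = pi / 2" "k > 0" using l by (auto simp: k_def)
  have k2: "2 * k\<^sup>2 < \<kappa>"
  proof -
    have "pi * pi < 4 * 4" using pi_less_4 pi_gt_zero by (intro mult_strict_mono) auto
    then have "2 * k\<^sup>2 * l\<^sup>2 < 9" using l by (simp add: k_def power2_eq_square field_simps)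
    then have "2 * k\<^sup>2 * l\<^sup>2 < \<kappa> * l\<^sup>2" using l by linarith
    then show ?thesis using l by (simp add: mult_less_cancel_right)
  qed
  define f where "f = cosprod k x"
  obtain f1 where f1: "\<And>i. has_partial i f (f1 i)" "\<And>i. has_partial i (f1 i) (\<lambda>y. - (k\<^sup>2) * f y)"
    unfolding f_def by (rule cosprod_partials[of k x]) blast
  define D where "D = square x l"
  have cD: "compact D" "x \<in> D" using l by (auto simp: D_def compact_square center_in_square)
  have "continuous_on D (\<lambda>y. f y / v y)"
    by (intro continuous_on_divide continuous_on_subset[OF cv]) (auto simp: D_def f_def cosprod_cont dest: pos)
  then obtain y0 where y0: "y0 \<in> D" "\<And>y. y \<in> D \<Longrightarrow> f y / v y \<le> f y0 / v y0"
    using continuous_attains_sup[OF cD(1)] cD(2) by blast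
  define c where "c = f y0 / v y0"
  have "f x = 1" by (simp add: f_def cosprod_def)
  then have "c > 0" using y0(2)[OF cD(2)] pos[of x] cD(2) unfolding c_def D_def by (smt (verit) zero_less_divide_1_iff)
  have v0: "v y0 > 0" using pos y0 by (simp add: D_def)
  have "f y0 = c * v y0" using v0 by (simp add: c_def)
  with \<open>c > 0\<close> v0 have f0: "f y0 > 0" "f y0 = c * v y0" by auto
  have "\<bar>y0 $ i - x $ i\<bar> \<noteq> l" for i
  proof
    assume "\<bar>y0 $ i - x $ i\<bar> = l"
    then have "k * (y0 $ i - x $ i) = pi / 2 \<or> k * (y0 $ i - x $ i) = - (pi / 2)"
      using kl(1) by (smt (verit) mult_minus_right)
    then have "cos (k * (y0 $ i - x $ i)) = 0" by (metis cos_minus cos_pi_half)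
    then have "f y0 = 0" unfolding f_def cosprod_def using exhaust_2[of i] by auto
    then show False using f0(1) by linarith
  qed
  then obtain r where r: "r > 0" "square y0 r \<subseteq> D"
    using square_interior[of y0 x l] y0(1) unfolding D_def by blast
  define h2 where "h2 i y = c * v2 i y - (- (k\<^sup>2) * f y)" for i y
  have "h2 i y0 \<ge> 0" for i
  proof (rule second_partial_nonneg_at_min[OF _ _ r(1)])
    show "has_partial i (\<lambda>y. c * v y - f y) (\<lambda>y. c * v1 i y - f1 i y)"
      by (intro has_partial_diff has_partial_cmult v1 f1)
    show "has_partial i (\<lambda>y. c * v1 i y - f1 i y) (h2 i)"
      unfolding h2_def by (intro has_partial_diff has_partial_cmult v2 f1)
    fix y assume "y \<in> square y0 r"
    then have "y \<in> D" using r by auto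
    then have "f y / v y \<le> c" "v y > 0" using y0(2) pos by (auto simp: c_def D_def)
    then have "f y \<le> c * v y" by (simp add: field_simps)
    then show "c * v y0 - f y0 \<le> c * v y - f y" using f0 by simp
  qed
  then have "0 \<le> (\<Sum>i\<in>UNIV. h2 i y0)" by (intro sum_nonneg) auto
  also have "\<dots> = c * (q y0 * v y0) + 2 * k\<^sup>2 * f y0"
    unfolding eq[symmetric] by (simp add: h2_def sum_2 algebra_simps)
  also have "\<dots> = f y0 * (q y0 + 2 * k\<^sup>2)" using f0 by (simp add: algebra_simps)
  also have "\<dots> < 0" using f0(1) q[of y0] k2 y0(1) by (intro mult_pos_neg) (auto simp: D_def)
  finally show False by simp
qed

lemma connected_square_boundary:
  assumes "l > 0"
  shows "connected {y \<in> square x l. \<exists>i. \<bar>y $ i - x $ i\<bar> = l}"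
proof -
  let ?a = "x - vec l" and ?b = "x + vec l"
  have "{y \<in> square x l. \<exists>i. \<bar>y $ i - x $ i\<bar> = l} = frontier (cbox ?a ?b)"
  proof (intro set_eqI)
    fix y
    have "(\<bar>y $ i - x $ i\<bar> \<le> l \<and> \<not> (?a $ i < y $ i \<and> y $ i < ?b $ i)) \<longleftrightarrow> \<bar>y $ i - x $ i\<bar> = l" for i
      using assms by auto
    then show "y \<in> {y \<in> square x l. \<exists>i. \<bar>y $ i - x $ i\<bar> = l} \<longleftrightarrow> y \<in> frontier (cbox ?a ?b)"
      unfolding frontier_cbox by (auto simp: square_def mem_box_cart)
         (metis abs_le_iff add.commute diff_le_eq minus_diff_eq)+
  qed
  moreover have ne: "interior (cbox ?a ?b) \<noteq> {}"
  proof -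
    have "x \<in> box ?a ?b" using assms by (simp add: mem_box_cart)
    then show ?thesis by auto
  qed
  moreover have "connected (rel_frontier (cbox ?a ?b))"
    by (rule connected_sphere_gen[OF convex_box(1) bounded_cbox]) (simp add: aff_dim_nonempty_interior[OF ne])
  ultimately show ?thesis by (simp add: rel_frontier_nonempty_interior)
qed

context schroedinger_solution
begin

text \<open>Without a boundary zero \<open>u\<close> has one sign on the connected boundary, and the
  maximum principle for \<open>u\<close> or \<open>- u\<close> excludes the zero \<open>p\<close>.
  So the nodal set near \<open>p\<close> cannot be confined to a small region, and this yields its
  lower length bounds.\<close>

lemma zero_on_square_boundary:
  assumes q: "\<And>y. y \<in> square x l \<Longrightarrow> \<bar>q y\<bar> \<le> \<Lambda>" and l: "l > 0" "l * sqrt \<Lambda> \<le> 1"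
    and p: "p \<in> square x l" "u p = 0"
  shows "\<exists>y\<in>square x l. \<exists>i. \<bar>y $ i - x $ i\<bar> = l \<and> u y = 0"
proof (rule ccontr)
  assume no: "\<not> ?thesis"
  obtain u2 where u2: "\<And>i j. has_partial j (du i 1) (u2 i j)" "\<And>x. (\<Sum>i\<in>UNIV. u2 i i x) = q x * u x"
    using second_partials by metis
  have u1: "has_partial i u (du i 1)" for i using du_partial[of i 0] by simp
  let ?S = "{y \<in> square x l. \<exists>i. \<bar>y $ i - x $ i\<bar> = l}"
  have conn: "connected (u ` ?S)"
    by (rule connected_continuous_image[OF continuous_on_subset[OF u_cont subset_UNIV] connected_square_boundary[OF l(1)]])
  have "0 \<notin> u ` ?S" using no by auto
  then have "(\<forall>y\<in>?S. u y > 0) \<or> (\<forall>y\<in>?S. u y < 0)"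
    using connected_contains_Icc[OF conn] by (smt (verit) atLeastAtMost_iff imageI subset_iff)
  then show False
  proof
    assume "\<forall>y\<in>?S. u y > 0"
    then have "u p > 0"
      by (intro positive_in_small_square[OF u_cont u1 u2(1,2) q l _ p(1)]) auto
    then show False using p by simp
  next
    assume neg: "\<forall>y\<in>?S. u y < 0"
    have "- u p > 0"
      by (rule positive_in_small_square[of "\<lambda>x. - u x" "\<lambda>i x. - du i 1 x" "\<lambda>i x. - u2 i i x" q, OF _ _ _ _ q l _ p(1)])
        (use neg u1 u2 in \<open>auto intro!: continuous_intros u_cont has_partial_minus simp: sum_negf\<close>)
    then show False using p by simp
  qed
qed

lemma zero_exists_in_square:
  assumes q: "\<And>y. y \<in> square x l \<Longrightarrow> q y \<le> - \<kappa>" and l: "l > 0" "\<kappa> * l\<^sup>2 \<ge> 9"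
  shows "\<exists>y\<in>square x l. u y = 0"
proof -
  obtain u2 where u2: "\<And>i j. has_partial j (du i 1) (u2 i j)" "\<And>x. (\<Sum>i\<in>UNIV. u2 i i x) = q x * u x"
    using second_partials by metis
  have u1: "has_partial i u (du i 1)" for i using du_partial[of i 0] by simp
  obtain y where y: "y \<in> square x l" "u y \<le> 0"
    using zero_in_allowed_square[OF u_cont u1 u2(1,2) q l] by auto
  have "\<exists>z\<in>square x l. - u z \<le> 0"
    by (rule zero_in_allowed_square[of "\<lambda>x. - u x" "\<lambda>i x. - du i 1 x" "\<lambda>i x. - u2 i i x" q, OF _ _ _ _ q l])
      (use u1 u2 in \<open>auto intro!: continuous_intros u_cont has_partial_minus simp: sum_negf\<close>)
  then obtain z where z: "z \<in> square x l" "- u z \<le> 0" by blast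
  have conn: "connected (u ` square x l)"
    by (rule connected_continuous_image[OF continuous_on_subset[OF u_cont subset_UNIV] convex_connected[OF convex_square]])
  have "0 \<in> u ` square x l"
    using connected_contains_Icc[OF conn, of "u y" "u z"] y z by auto
  then show ?thesis by auto
qed

end

section \<open>Smallness and zeros of functions on an interval\<close>

text \<open>The largest zero is split off and the induction hypothesis is used up to the second
  largest, \<open>m0\<close>; the Rolle point beyond \<open>m0\<close> is then certainly new. This
  is why \<open>b\<close> varies in the induction.\<close>

lemma rolle_finite:
  fixes a :: real
  assumes F: "derivatives F"
  shows "finite Z \<Longrightarrow> card Z = Suc n \<Longrightarrow> Z \<subseteq> {a..b} \<Longrightarrow> (\<And>z. z \<in> Z \<Longrightarrow> F k z = 0) \<Longrightarrow>
    \<exists>Z'. finite Z' \<and> card Z' = n \<and> Z' \<subseteq> {a..b} \<and> (\<forall>z\<in>Z'. F (Suc k) z = 0)"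
proof (induction n arbitrary: Z b)
  case 0
  show ?case by (rule exI[of _ "{}"]) auto
next
  case (Suc n)
  define m where "m = Max Z"
  define Z0 where "Z0 = Z - {m}"
  have m: "m \<in> Z" unfolding m_def using Suc.prems by (intro Max_in) auto
  have Z0: "finite Z0" "card Z0 = Suc n" using Suc.prems m by (auto simp: Z0_def)
  define m0 where "m0 = Max Z0"
  have m0: "m0 \<in> Z0" unfolding m0_def using Z0 by (intro Max_in) auto
  have lt: "m0 < m" using m0 Suc.prems(1) unfolding Z0_def m_def by (simp add: less_le)
  have "Z0 \<subseteq> {a..m0}"
  proof
    fix z assume "z \<in> Z0"
    then have "z \<le> m0" "z \<in> Z" using Z0(1) unfolding m0_def by (auto simp: Z0_def)
    then show "z \<in> {a..m0}" using Suc.prems(3) by auto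
  qed
  then obtain Z' where Z': "finite Z'" "card Z' = n" "Z' \<subseteq> {a..m0}" "\<forall>z\<in>Z'. F (Suc k) z = 0"
    using Suc.IH[OF Z0, of m0] Suc.prems(4) unfolding Z0_def by blast
  have D: "(F k has_real_derivative F (Suc k) t) (at t)" for t using F unfolding derivatives_def by blast
  obtain x where x: "m0 < x" "x < m" "F (Suc k) x = 0"
  proof -
    obtain z where z: "m0 < z" "z < m" "F k m - F k m0 = (m - m0) * F (Suc k) z"
      using MVT2[OF lt, of "F k" "F (Suc k)"] D by blast
    moreover have "F k m = 0" "F k m0 = 0" using Suc.prems(4) m m0 unfolding Z0_def by auto
    ultimately show ?thesis using that by auto
  qed
  have "a \<le> m0" "m \<le> b" using m m0 Suc.prems(3) unfolding Z0_def by auto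
  moreover have "x \<notin> Z'" using x Z' by auto
  ultimately show ?case using Z' x by (intro exI[of _ "insert x Z'"]) auto
qed

lemma rolle_iterated:
  fixes a :: real
  assumes F: "derivatives F"
  shows "finite Z \<Longrightarrow> card Z = Suc n \<Longrightarrow> Z \<subseteq> {a..b} \<Longrightarrow> (\<And>z. z \<in> Z \<Longrightarrow> F k z = 0) \<Longrightarrow>
    \<exists>x\<in>{a..b}. F (k + n) x = 0"
proof (induction n arbitrary: Z k)
  case 0
  then obtain z where "Z = {z}" by (auto simp: card_Suc_eq)
  then show ?case using 0 by auto
next
  case (Suc n)
  obtain Z' where "finite Z'" "card Z' = Suc n" "Z' \<subseteq> {a..b}" "\<forall>z\<in>Z'. F (Suc k) z = 0"
    using rolle_finite[OF F Suc.prems] by blast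
  then show ?case using Suc.IH[of Z' "Suc k"] by auto
qed

lemma higher_pderiv_const:
  fixes p :: "real poly"
  assumes "degree p \<le> n"
  shows "poly ((pderiv ^^ n) p) x = fact n * coeff p n"
proof -
  have "(pderiv ^^ n) p = [:fact n * coeff p n:]"
  proof (rule poly_eqI)
    fix i
    show "coeff ((pderiv ^^ n) p) i = coeff [:fact n * coeff p n:] i"
      using assms by (cases i) (auto simp: coeff_higher_pderiv pochhammer_fact coeff_eq_0)
  qed
  then show ?thesis by simp
qed

lemma derivatives_poly: "derivatives (\<lambda>n. poly ((pderiv ^^ n) p))"
  unfolding derivatives_def by (auto intro!: poly_DERIV)

lemma derivatives_diff: "derivatives F \<Longrightarrow> derivatives G \<Longrightarrow> derivatives (\<lambda>n t. F n t - G n t)"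
  unfolding derivatives_def by (auto intro!: DERIV_diff)

definition lagrange_basis :: "(nat \<Rightarrow> real) \<Rightarrow> nat \<Rightarrow> nat \<Rightarrow> real poly" where
  "lagrange_basis t n j = smult (1 / (\<Prod>i\<in>{..<n} - {j}. t j - t i)) (\<Prod>i\<in>{..<n} - {j}. [:- t i, 1:])"

definition lagrange :: "(nat \<Rightarrow> real) \<Rightarrow> nat \<Rightarrow> (nat \<Rightarrow> real) \<Rightarrow> real poly" where
  "lagrange t n y = (\<Sum>j<n. smult (y j) (lagrange_basis t n j))"

lemma poly_lagrange_basis:
  "poly (lagrange_basis t n j) s = (\<Prod>i\<in>{..<n} - {j}. s - t i) / (\<Prod>i\<in>{..<n} - {j}. t j - t i)"
  by (simp add: lagrange_basis_def poly_prod)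

lemma poly_lagrange:
  assumes inj: "inj_on t {..<n}" and k: "k < n"
  shows "poly (lagrange t n y) (t k) = y k"
proof -
  have "poly (lagrange_basis t n j) (t k) = (if j = k then 1 else 0)" if "j < n" for j
  proof (cases "j = k")
    case True
    have "(\<Prod>i\<in>{..<n} - {k}. t k - t i) \<noteq> 0" using inj k by (auto simp: inj_on_def)
    then show ?thesis using True by (simp add: poly_lagrange_basis)
  next
    case False
    have "(\<Prod>i\<in>{..<n} - {j}. t k - t i) = 0" using False k by (intro prod_zero) auto
    then show ?thesis using False by (simp add: poly_lagrange_basis)
  qed
  then have "poly (lagrange t n y) (t k) = (\<Sum>j<n. y j * (if j = k then 1 else 0))"
    by (simp add: lagrange_def poly_sum)
  then show ?thesis using k by (simp add: if_distrib[of "(*) _"] sum.delta cong: if_cong)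
qed

lemma degree_prod_linear: "finite A \<Longrightarrow> degree (\<Prod>i\<in>A. [:- t i, 1 :: real:]) = card A"
  by (subst degree_prod_eq_sum_degree) auto

lemma lead_coeff_prod_linear: "finite A \<Longrightarrow> coeff (\<Prod>i\<in>A. [:- t i, 1 :: real:]) (card A) = 1"
  using lead_coeff_prod[of "\<lambda>i. [:- t i, 1 :: real:]" A] degree_prod_linear[of A t] by simp

lemma degree_lagrange: "degree (lagrange t n y) \<le> n - 1"
  unfolding lagrange_def lagrange_basis_def
  by (intro degree_sum_le order_trans[OF degree_smult_le]) (auto simp: degree_prod_linear)

text \<open>The classical remainder: subtracting the interpolant and a suitable multiple of the
  nodal polynomial leaves \<open>n + 1\<close> zeros, so the n-th derivative vanishes
  somewhere.\<close>

lemma lagrange_error: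
  assumes G: "derivatives G" and t: "\<And>i. i < n \<Longrightarrow> t i \<in> {a..b}" "inj_on t {..<n}" and s: "s \<in> {a..b}"
  shows "\<exists>x\<in>{a..b}. G 0 s - poly (lagrange t n (\<lambda>i. G 0 (t i))) s = G n x / fact n * (\<Prod>i<n. s - t i)"
proof (cases "s \<in> t ` {..<n}")
  case True
  then obtain k where k: "k < n" "s = t k" by auto
  have "(\<Prod>i<n. s - t i) = 0" using k by (intro prod_zero) auto
  then show ?thesis using k poly_lagrange[OF t(2) k(1)] s by auto
next
  case False
  define P where "P = lagrange t n (\<lambda>i. G 0 (t i))"
  define W where "W = (\<Prod>i<n. [:- t i, 1:])"
  have W: "poly W x = (\<Prod>i<n. x - t i)" for x by (simp add: W_def poly_prod)
  have W0: "poly W s \<noteq> 0" using False unfolding W by auto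
  \<comment> \<open>Chosen so that \<open>s\<close> becomes one more zero of
    \<open>G 0 - Q\<close>.\<close>
  define c where "c = (G 0 s - poly P s) / poly W s"
  define Q where "Q = P + smult c W"
  have dW: "degree W = n" "coeff W n = 1"
    using degree_prod_linear[of "{..<n}" t] lead_coeff_prod_linear[of "{..<n}" t] by (auto simp: W_def)
  have dP: "degree P \<le> n - 1" unfolding P_def by (rule degree_lagrange)
  \<comment> \<open>For \<open>n = 0\<close> the bound \<open>n - 1\<close> on the degree is 0 and
    says too little; there the interpolant is the empty sum.\<close>
  have cP: "coeff P n = 0"
  proof (cases n)
    case 0 then show ?thesis by (simp add: P_def lagrange_def)
  next
    case (Suc m) then show ?thesis using dP by (intro coeff_eq_0) auto
  qed
  have dQ: "degree Q \<le> n" unfolding Q_def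
    by (intro degree_add_le order_trans[OF degree_smult_le]) (use dP dW in auto)
  have cQ: "coeff Q n = c" using cP dW by (simp add: Q_def)
  define H where "H k x = G k x - poly ((pderiv ^^ k) Q) x" for k x
  have H: "derivatives H" unfolding H_def by (intro derivatives_diff G derivatives_poly)
  have "\<exists>x\<in>{a..b}. H (0 + n) x = 0"
  proof (rule rolle_iterated[OF H, of "insert s (t ` {..<n})"])
    show "card (insert s (t ` {..<n})) = Suc n" using False card_image[OF t(2)] by simp
    show "insert s (t ` {..<n}) \<subseteq> {a..b}" using s t by auto
    fix z assume "z \<in> insert s (t ` {..<n})"
    then show "H 0 z = 0"
    proof
      assume "z = s" then show ?thesis using W0 by (simp add: H_def Q_def c_def)
    next
      assume "z \<in> t ` {..<n}"
      then obtain k where k: "k < n" "z = t k" by auto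
      have "poly W z = 0" unfolding W using k by (intro prod_zero) auto
      then show ?thesis using k poly_lagrange[OF t(2) k(1)] by (simp add: H_def Q_def P_def)
    qed
  qed simp
  then obtain x where x: "x \<in> {a..b}" "G n x = fact n * c"
    using higher_pderiv_const[OF dQ] cQ by (auto simp: H_def)
  have "G 0 s - poly P s = G n x / fact n * (\<Prod>i<n. s - t i)"
    using x W0 W by (simp add: c_def)
  then show ?thesis using x(1) unfolding P_def by blast
qed

lemma spaced_inj:
  fixes t :: "nat \<Rightarrow> real"
  assumes gap: "\<And>i. Suc i < n \<Longrightarrow> t i + \<kappa> \<le> t (Suc i)" and "i + d < n"
  shows "t i + d * \<kappa> \<le> t (i + d)"
  using assms(2)
proof (induction d)
  case (Suc d)
  then have "t i + d * \<kappa> \<le> t (i + d)" by simp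
  moreover have "t (i + d) + \<kappa> \<le> t (i + Suc d)" using gap[of "i + d"] Suc.prems by simp
  ultimately show ?case by (simp add: algebra_simps)
qed simp

text \<open>The i-th neighbour on either side is at distance at least i \<kappa>; the two sides
  contribute the two factorials.\<close>

lemma spaced_prod:
  fixes t :: "nat \<Rightarrow> real"
  assumes gap: "\<And>i. Suc i < n \<Longrightarrow> t i + \<kappa> \<le> t (Suc i)" and k: "\<kappa> > 0" and j: "j < n"
  shows "\<kappa> ^ (n - 1) * (fact j * fact (n - 1 - j)) \<le> (\<Prod>i\<in>{..<n} - {j}. \<bar>t j - t i\<bar>)"
proof -
  have split: "{..<n} - {j} = {..<j} \<union> {j<..<n}" using j by auto
  have l: "real (j - i) * \<kappa> \<le> \<bar>t j - t i\<bar>" if "i < j" for i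
    using spaced_inj[of n t \<kappa> i "j - i", OF gap] that j by (simp add: of_nat_diff)
  have r: "real (i - j) * \<kappa> \<le> \<bar>t j - t i\<bar>" if "j < i" "i < n" for i
    using spaced_inj[of n t \<kappa> j "i - j", OF gap] that j by (simp add: of_nat_diff)
  have "\<kappa> ^ (n - 1) * (fact j * fact (n - 1 - j)) = (fact j * \<kappa> ^ j) * (fact (n - 1 - j) * \<kappa> ^ (n - 1 - j))"
  proof -
    have "n - 1 = j + (n - 1 - j)" using j by simp
    then have "\<kappa> ^ (n - 1) = \<kappa> ^ j * \<kappa> ^ (n - 1 - j)" by (metis power_add)
    then show ?thesis by simp
  qed
  also have "fact j * \<kappa> ^ j = (\<Prod>i<j. real (j - i) * \<kappa>)"
    by (simp add: prod.distrib fact_prod_rev atLeast0LessThan)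
  also have "fact (n - 1 - j) * \<kappa> ^ (n - 1 - j) = (\<Prod>i\<in>{j<..<n}. real (i - j) * \<kappa>)"
  proof -
    have "(\<Prod>i\<in>{j<..<n}. real (i - j)) = (\<Prod>i\<in>{1..n - 1 - j}. real i)"
      by (rule prod.reindex_bij_witness[of _ "\<lambda>i. i + j" "\<lambda>i. i - j"]) auto
    moreover have "card {j<..<n} = n - 1 - j" by auto
    ultimately show ?thesis by (simp add: prod.distrib fact_prod)
  qed
  also have "(\<Prod>i<j. real (j - i) * \<kappa>) * (\<Prod>i\<in>{j<..<n}. real (i - j) * \<kappa>)
      \<le> (\<Prod>i<j. \<bar>t j - t i\<bar>) * (\<Prod>i\<in>{j<..<n}. \<bar>t j - t i\<bar>)"
    using l r k by (intro mult_mono prod_mono prod_nonneg) auto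
  also have "\<dots> = (\<Prod>i\<in>{..<n} - {j}. \<bar>t j - t i\<bar>)"
    unfolding split by (rule prod.union_disjoint[symmetric]) auto
  finally show ?thesis .
qed

text \<open>Bounding denominators by \<open>spaced_prod\<close>, the sum over the basis becomes a
  binomial sum, which gives a power of 2; the spacing e/n produces n^n / n!, at most 3^n. Hence 6
  per node.\<close>

lemma lagrange_bound:
  fixes t :: "nat \<Rightarrow> real"
  assumes n: "n \<ge> 1" and gap: "\<And>i. Suc i < n \<Longrightarrow> t i + e / n \<le> t (Suc i)" and e: "e > 0"
    and t: "\<And>i. i < n \<Longrightarrow> t i \<in> {a..b}" and s: "s \<in> {a..b}" and y: "\<And>i. i < n \<Longrightarrow> \<bar>y i\<bar> \<le> S"
    and ab: "e \<le> b - a"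
  shows "\<bar>poly (lagrange t n y) s\<bar> \<le> S * (6 * (b - a) / e) ^ n"
proof -
  let ?l = "b - a"
  have S0: "S \<ge> 0" using y[of 0] n by force
  have k: "e / n > 0" using e n by simp
  have "\<bar>poly (lagrange t n y) s\<bar> \<le> (\<Sum>j<n. \<bar>y j * poly (lagrange_basis t n j) s\<bar>)"
    unfolding lagrange_def poly_sum poly_smult by (rule sum_abs)
  also have "\<dots> \<le> (\<Sum>j<n. S * (?l ^ (n - 1) / ((e / n) ^ (n - 1) * (fact j * fact (n - 1 - j)))))"
  proof (intro sum_mono)
    fix j assume "j \<in> {..<n}"
    then have j: "j < n" by simp
    have "(\<Prod>i\<in>{..<n} - {j}. \<bar>s - t i\<bar>) \<le> (\<Prod>i\<in>{..<n} - {j}. ?l)"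
      using s t by (intro prod_mono) (force simp: abs_le_iff)
    also have "\<dots> = ?l ^ (n - 1)" using j by simp
    finally have "\<bar>poly (lagrange_basis t n j) s\<bar> \<le> ?l ^ (n - 1) / ((e / n) ^ (n - 1) * (fact j * fact (n - 1 - j)))"
      unfolding poly_lagrange_basis abs_divide abs_prod
      using spaced_prod[where t = t and \<kappa> = "e / n", OF gap k j] k e ab by (intro frac_le) auto
    then show "\<bar>y j * poly (lagrange_basis t n j) s\<bar> \<le> S * (?l ^ (n - 1) / ((e / n) ^ (n - 1) * (fact j * fact (n - 1 - j))))"
      unfolding abs_mult using y[OF j] S0 by (intro mult_mono) auto
  qed
  also have "\<dots> = S * (?l / (e / n)) ^ (n - 1) * (\<Sum>j<n. 1 / (fact j * fact (n - 1 - j)))"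
    unfolding sum_distrib_left by (intro sum.cong refl) (simp add: power_divide power_mult_distrib)
  also have "(\<Sum>j<n. 1 / (fact j * fact (n - 1 - j))) = (2::real) ^ (n - 1) / fact (n - 1)"
  proof -
    have "(\<Sum>j<n. 1 / (fact j * fact (n - 1 - j))) = (\<Sum>j\<le>n - 1. real (n - 1 choose j) / fact (n - 1))"
      using n by (intro sum.cong) (auto simp: binomial_fact)
    also have "\<dots> = real (\<Sum>j\<le>n - 1. n - 1 choose j) / fact (n - 1)" by (simp add: sum_divide_distrib)
    also have "\<dots> = 2 ^ (n - 1) / fact (n - 1)" by (simp only: choose_row_sum) simp
    finally show ?thesis .
  qed
  also have "S * (?l / (e / n)) ^ (n - 1) * (2 ^ (n - 1) / fact (n - 1)) = S * (2 * ?l / e) ^ (n - 1) * (real n ^ (n - 1) / fact (n - 1))"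
  proof -
    have "S * (l / (e / n)) ^ k * (2 ^ k / f) = S * (2 * l / e) ^ k * (real n ^ k / f)" for l k f
      by (simp add: power_divide power_mult_distrib)
    then show ?thesis by blast
  qed
  also have "real n ^ (n - 1) / fact (n - 1) = real n ^ n / fact n"
  proof -
    obtain m where m: "n = Suc m" using n by (cases n) auto
    have "real n ^ n = real n * real n ^ m" "(fact n :: real) = real n * fact m"
      unfolding m by (rule power_Suc, rule fact_Suc)
    moreover have "real n * real n ^ m / (real n * fact m) = real n ^ m / fact m"
      by (rule mult_divide_mult_cancel_left) (use n in simp)
    ultimately show ?thesis by (simp only: m diff_Suc_1)
  qed
  also have "S * (2 * ?l / e) ^ (n - 1) * (real n ^ n / fact n) \<le> S * (2 * ?l / e) ^ n * 3 ^ n"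
  proof (intro mult_mono)
    have "real n ^ n / fact n \<le> exp n" using power_le_fact_exp[of "real n" n] by (simp add: field_simps)
    also have "exp (real n) = exp 1 ^ n" by (simp add: exp_of_nat_mult[symmetric])
    also have "\<dots> \<le> 3 ^ n" by (intro power_mono exp_le) auto
    finally show "real n ^ n / fact n \<le> 3 ^ n" .
    have "1 \<le> 2 * ?l / e" using ab e by (simp add: field_simps)
    then show "(2 * ?l / e) ^ (n - 1) \<le> (2 * ?l / e) ^ n" by (intro power_increasing) auto
  qed (use S0 e ab in auto)
  also have "\<dots> = S * (6 * ?l / e) ^ n" by (simp add: power_mult_distrib[symmetric] mult.assoc)
  finally show ?thesis .
qed

text \<open>Greedy choice: take the leftmost point and discard what lies within \<kappa> of it,
  which costs measure at most \<kappa>.\<close>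

lemma spaced_points:
  fixes E :: "real set" and m :: nat and \<kappa> :: real
  assumes "compact E" "measure lborel E > m * \<kappa>" "\<kappa> > 0"
  shows "\<exists>t. (\<forall>i\<le>m. t i \<in> E) \<and> (\<forall>i<m. t i + \<kappa> \<le> t (Suc i))"
  using assms(1,2)
proof (induction m arbitrary: E)
  case 0
  then have "E \<noteq> {}" by auto
  then show ?case by auto
next
  case (Suc m)
  have "0 \<le> real (Suc m) * \<kappa>" using assms(3) by simp
  then have "measure lborel E > 0" using Suc.prems(2) by linarith
  then have ne: "E \<noteq> {}" by auto
  define t0 where "t0 = Inf E"
  have t0: "t0 \<in> E" unfolding t0_def using Suc.prems(1) ne
    by (intro closed_contains_Inf compact_imp_closed compact_imp_bounded bounded_imp_bdd_below) auto
  have le: "t0 \<le> z" if "z \<in> E" for z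
    unfolding t0_def using that Suc.prems(1) by (intro cInf_lower bounded_imp_bdd_below compact_imp_bounded)
  define E' where "E' = E \<inter> {t0 + \<kappa>..}"
  have cE': "compact E'" unfolding E'_def using Suc.prems(1) by (intro compact_Int_closed) auto
  have "measure lborel E \<le> measure lborel ({t0..t0 + \<kappa>} \<union> E')"
    using le cE' Suc.prems(1)
    by (intro measure_mono_fmeasurable fmeasurable_compact compact_Un) (auto simp: E'_def compact_imp_closed)
  also have "\<dots> \<le> measure lborel {t0..t0 + \<kappa>} + measure lborel E'"
    using cE' by (intro measure_Un_le) (auto simp: borel_compact)
  also have "measure lborel {t0..t0 + \<kappa>} = \<kappa>" using assms(3) by simp
  finally have "measure lborel E' > m * \<kappa>" using Suc.prems(2) by (simp add: algebra_simps)
  then obtain t where t: "\<forall>i\<le>m. t i \<in> E'" "\<forall>i<m. t i + \<kappa> \<le> t (Suc i)" using Suc.IH[OF cE'] by blast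
  define t' where "t' i = (case i of 0 \<Rightarrow> t0 | Suc i \<Rightarrow> t i)" for i
  have "t' i \<in> E" if "i \<le> Suc m" for i using that t t0 by (cases i) (auto simp: t'_def E'_def)
  moreover have "t' i + \<kappa> \<le> t' (Suc i)" if "i < Suc m" for i
    using that t by (cases i) (auto simp: t'_def E'_def)
  ultimately show ?case by blast
qed

text \<open>A Remez type inequality: a set of measure \<open>e\<close> contains \<open>n\<close>
  nodes with spacing e/n, since (n - 1) e/n < e. The interpolant is controlled by the values on
  \<open>E\<close>, the remainder by the n-th derivative. The order \<open>n\<close> remains free,
  to be balanced against the size of \<sigma> later.\<close>

lemma small_set_propagation:
  assumes G: "derivatives G" and E: "compact E" "E \<subseteq> {a..b}" "measure lborel E \<ge> e" "e > 0" and n: "n \<ge> 1"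
    and S: "\<And>t. t \<in> E \<Longrightarrow> \<bar>G 0 t\<bar> \<le> S"
    and D: "\<And>t. t \<in> {a..b} \<Longrightarrow> \<bar>G n t\<bar> \<le> D * fact n * \<theta> ^ n" and s: "s \<in> {a..b}"
  shows "\<bar>G 0 s\<bar> \<le> S * (6 * (b - a) / e) ^ n + D * (\<theta> * (b - a)) ^ n"
proof -
  have "measure lborel E \<le> measure lborel {a..b}"
    using E by (intro measure_mono_fmeasurable) (auto simp: borel_compact intro!: fmeasurable_compact)
  then have ab: "e \<le> b - a" using E s by simp
  have "real (n - 1) * (e / n) < e" using n E(4) by (simp add: field_simps of_nat_diff)
  then obtain t where t: "\<forall>i\<le>n - 1. t i \<in> E" "\<forall>i<n - 1. t i + e / n \<le> t (Suc i)"
    using spaced_points[OF E(1), of "n - 1" "e / n"] E n by auto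
  have tE: "t i \<in> E" if "i < n" for i using t that by auto
  have gap: "t i + e / n \<le> t (Suc i)" if "Suc i < n" for i using t that by auto
  have lt: "t i < t j" if "i < j" "j < n" for i j
  proof -
    have "t i + real (j - i) * (e / n) \<le> t (i + (j - i))"
      by (rule spaced_inj[where t = t and \<kappa> = "e / n", OF gap]) (use that in auto)
    moreover have "real (j - i) * (e / n) > 0" using that E(4) by simp
    ultimately show ?thesis using that by simp
  qed
  have inj: "inj_on t {..<n}"
    by (rule inj_onI) (metis lessThan_iff less_irrefl linorder_neqE_nat lt)
  obtain x where x: "x \<in> {a..b}" "G 0 s - poly (lagrange t n (\<lambda>i. G 0 (t i))) s = G n x / fact n * (\<Prod>i<n. s - t i)"
    using lagrange_error[OF G _ inj s] tE E(2) by blast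
  have "\<bar>poly (lagrange t n (\<lambda>i. G 0 (t i))) s\<bar> \<le> S * (6 * (b - a) / e) ^ n"
    by (rule lagrange_bound[where t = t and e = e, OF n gap E(4) _ s _ ab]) (use tE E(2) S in blast)+
  moreover have "\<bar>G n x / fact n * (\<Prod>i<n. s - t i)\<bar> \<le> D * \<theta> ^ n * (b - a) ^ n"
  proof -
    have A: "\<bar>G n x / fact n\<bar> \<le> D * \<theta> ^ n" using D[OF x(1)] by (simp add: abs_divide divide_le_eq algebra_simps)
    note A
    moreover have "\<bar>\<Prod>i<n. s - t i\<bar> \<le> (b - a) ^ n"
    proof -
      have "(\<Prod>i<n. \<bar>s - t i\<bar>) \<le> (\<Prod>i<n. b - a)"
        using s tE E(2) by (intro prod_mono) (force simp: abs_le_iff)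
      then show ?thesis by (simp add: abs_prod)
    qed
    moreover have "0 \<le> D * \<theta> ^ n" using A by (rule order_trans[OF abs_ge_zero])
    ultimately show ?thesis unfolding abs_mult by (intro mult_mono) auto
  qed
  moreover have "G 0 s = poly (lagrange t n (\<lambda>i. G 0 (t i))) s + G n x / fact n * (\<Prod>i<n. s - t i)"
    using x(2) by (simp add: diff_eq_eq add.commute)
  then have "\<bar>G 0 s\<bar> \<le> \<bar>poly (lagrange t n (\<lambda>i. G 0 (t i))) s\<bar> + \<bar>G n x / fact n * (\<Prod>i<n. s - t i)\<bar>"
    by (metis abs_triangle_ineq)
  ultimately have "\<bar>G 0 s\<bar> \<le> S * (6 * (b - a) / e) ^ n + D * \<theta> ^ n * (b - a) ^ n" by linarith
  then show ?thesis by (simp only: power_mult_distrib mult.assoc)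
qed

text \<open>With the zeros as nodes the interpolant vanishes and only the remainder is left.\<close>

lemma many_zeros_small:
  assumes G: "derivatives G" and Z: "finite Z" "Z \<subseteq> {a..b}" "card Z = n" "\<And>t. t \<in> Z \<Longrightarrow> G 0 t = 0"
    and D: "\<And>t. t \<in> {a..b} \<Longrightarrow> \<bar>G n t\<bar> \<le> D * fact n * \<theta> ^ n" and s: "s \<in> {a..b}"
  shows "\<bar>G 0 s\<bar> \<le> D * (\<theta> * (b - a)) ^ n"
proof -
  obtain t where t: "bij_betw t {0..<n} Z" using ex_bij_betw_nat_finite[OF Z(1)] Z(3) by blast
  have inj: "inj_on t {..<n}" and tZ: "\<And>i. i < n \<Longrightarrow> t i \<in> Z"
    using t by (auto simp: bij_betw_def atLeast0LessThan)
  obtain x where x: "x \<in> {a..b}" "G 0 s - poly (lagrange t n (\<lambda>i. G 0 (t i))) s = G n x / fact n * (\<Prod>i<n. s - t i)"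
    using lagrange_error[OF G _ inj s] tZ Z(2) by blast
  have "lagrange t n (\<lambda>i. G 0 (t i)) = 0" unfolding lagrange_def using tZ Z(4) by (intro sum.neutral) auto
  then have eq: "G 0 s = G n x / fact n * (\<Prod>i<n. s - t i)" using x(2) by simp
  have A: "\<bar>G n x / fact n\<bar> \<le> D * \<theta> ^ n" using D[OF x(1)] by (simp add: abs_divide divide_le_eq algebra_simps)
  note A
  moreover have "\<bar>\<Prod>i<n. s - t i\<bar> \<le> (b - a) ^ n"
  proof -
    have "(\<Prod>i<n. \<bar>s - t i\<bar>) \<le> (\<Prod>i<n. b - a)"
      using s tZ Z(2) by (intro prod_mono) (force simp: abs_le_iff)
    then show ?thesis by (simp add: abs_prod)
  qed
  moreover have "0 \<le> D * \<theta> ^ n" using A by (rule order_trans[OF abs_ge_zero])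
  ultimately have "\<bar>G n x / fact n\<bar> * \<bar>\<Prod>i<n. s - t i\<bar> \<le> D * \<theta> ^ n * (b - a) ^ n"
    by (intro mult_mono) auto
  then show ?thesis unfolding eq by (simp add: abs_mult power_mult_distrib)
qed

section \<open>Eigenfunctions as bounded solutions\<close>

lemma partial_lipschitz:
  assumes p: "has_partial i f g" and b: "\<And>s. \<bar>s\<bar> \<le> \<bar>t\<bar> \<Longrightarrow> \<bar>g (x + s *\<^sub>R axis i 1)\<bar> \<le> B"
  shows "\<bar>f (x + t *\<^sub>R axis i 1) - f x\<bar> \<le> B * \<bar>t\<bar>"
proof -
  have "norm (f (x + t *\<^sub>R axis i 1) - f (x + 0 *\<^sub>R axis i 1)) \<le> B * norm (t - 0)"
    by (rule field_differentiable_bound[of "{-\<bar>t\<bar>..\<bar>t\<bar>}" "\<lambda>t. f (x + t *\<^sub>R axis i 1)" "\<lambda>t. g (x + t *\<^sub>R axis i 1)"])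
      (auto intro!: has_field_derivative_at_within has_partialD[OF p] b)
  then show ?thesis by simp
qed

lemma vec2_decompose: "z = y + (z $ 1 - y $ 1) *\<^sub>R axis 1 1 + (z $ 2 - y $ 2) *\<^sub>R axis 2 (1::real)"
  for y z :: "real^2"
  by (simp add: vec_eq_iff forall_2 axis_def)

lemma lipschitz_on_square:
  assumes p: "\<And>i. has_partial i f (g i)" and b: "\<And>i y. y \<in> square x r \<Longrightarrow> \<bar>g i y\<bar> \<le> B" and z: "z \<in> square x r"
  shows "\<bar>f z - f x\<bar> \<le> 2 * r * B"
proof -
  have z12: "\<bar>z $ 1 - x $ 1\<bar> \<le> r" "\<bar>z $ 2 - x $ 2\<bar> \<le> r" using z by (auto simp: square_def)
  have r0: "r \<ge> 0" using z12(1) by linarith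
  have B0: "B \<ge> 0" using b[OF center_in_square[OF r0], of 1] by linarith
  let ?w = "x + (z $ 1 - x $ 1) *\<^sub>R axis 1 1"
  have "\<bar>f ?w - f x\<bar> \<le> B * \<bar>z $ 1 - x $ 1\<bar>"
    by (rule partial_lipschitz[OF p b]) (use z12 in \<open>auto intro!: square_add_axis\<close>)
  also have "\<dots> \<le> B * r" using z12 B0 by (intro mult_left_mono)
  finally have 1: "\<bar>f ?w - f x\<bar> \<le> B * r" .
  have "\<bar>f (?w + (z $ 2 - x $ 2) *\<^sub>R axis 2 1) - f ?w\<bar> \<le> B * \<bar>z $ 2 - x $ 2\<bar>"
    by (rule partial_lipschitz[OF p b]) (use z12 in \<open>auto simp: square_def forall_2 axis_def\<close>)
  also have "\<dots> \<le> B * r" using z12 B0 by (intro mult_left_mono)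
  finally have "\<bar>f z - f ?w\<bar> \<le> B * r" unfolding vec2_decompose[of z x, symmetric] .
  with 1 show ?thesis by (simp add: algebra_simps)
qed

lemma content_square: "r \<ge> 0 \<Longrightarrow> measure lborel (square x r) = (2 * r)\<^sup>2"
  unfolding square_eq_cbox
  by (subst content_cbox_cart) (auto simp: box_ne_empty prod_constant power2_eq_square interval_eq_empty_cart UNIV_2)

context schroedinger_solution
begin

text \<open>Maximise \<open>d y * \<bar>u y\<bar>\<close>, where \<open>d\<close> is the distance to
  the boundary. At the maximiser \<open>y0\<close> the values nearby are at most twice as large, so
  the gradient bound keeps \<open>\<bar>u\<bar>\<close> above half its value on a square of radius
  d0/68, which bounds the integral from below.\<close>

lemma sup_le_L2:
  assumes r: "\<rho> > 0" and q: "\<And>y. y \<in> square x \<rho> \<Longrightarrow> \<bar>q y\<bar> \<le> \<Lambda>" and L: "\<rho>\<^sup>2 * \<Lambda> \<le> 1"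
  shows "\<rho>\<^sup>2 * (u x)\<^sup>2 \<le> 4624 * integral (square x \<rho>) (\<lambda>y. (u y)\<^sup>2)"
proof (cases "u x = 0")
  case True
  then show ?thesis
    by (auto intro!: Henstock_Kurzweil_Integration.integral_nonneg integrable_square continuous_intros u_cont)
next
  case False
  define d where "d y = \<rho> - max \<bar>y $ 1 - x $ 1\<bar> \<bar>y $ 2 - x $ 2\<bar>" for y :: "real^2"
  have dsq: "d y \<ge> s \<longleftrightarrow> y \<in> square x (\<rho> - s)" for y s
    by (auto simp: d_def square_def forall_2)
  obtain y0 where y0: "y0 \<in> square x \<rho>" "\<And>y. y \<in> square x \<rho> \<Longrightarrow> d y * \<bar>u y\<bar> \<le> d y0 * \<bar>u y0\<bar>"
  proof -
    have "continuous_on (square x \<rho>) (\<lambda>y. d y * \<bar>u y\<bar>)"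
      unfolding d_def by (intro continuous_intros continuous_on_subset[OF u_cont]) auto
    moreover have "square x \<rho> \<noteq> {}" using center_in_square[of \<rho> x] r by auto
    ultimately show ?thesis using continuous_attains_sup[OF compact_square] that by blast
  qed
  define d0 where "d0 = d y0"
  define u0 where "u0 = \<bar>u y0\<bar>"
  have "d x = \<rho>" by (simp add: d_def)
  then have main: "\<rho> * \<bar>u x\<bar> \<le> d0 * u0" using y0(2)[of x] r by (simp add: d0_def u0_def center_in_square)
  then have "d0 * u0 > 0" using r False by (smt (verit) mult_pos_pos zero_less_abs_iff)
  moreover have "u0 \<ge> 0" by (simp add: u0_def)
  ultimately have d0: "d0 > 0" and u0: "u0 > 0" by (auto simp: zero_less_mult_iff)
  have y0s: "y0 \<in> square x (\<rho> - d0)" using dsq[of d0 y0] by (simp add: d0_def)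
  have d0r: "d0 \<le> \<rho>" by (simp add: d0_def d_def)
  have L0: "\<Lambda> \<ge> 0" using q[OF center_in_square[of \<rho> x]] r by simp
  have dL: "d0 * \<Lambda> \<le> 1 / d0"
  proof -
    have "d0 * d0 * \<Lambda> \<le> \<rho>\<^sup>2 * \<Lambda>" using d0 d0r L0 by (intro mult_right_mono) (auto simp: power2_eq_square intro!: mult_mono)
    then show ?thesis using L d0 by (simp add: field_simps)
  qed
  have u2: "\<bar>u z\<bar> \<le> 2 * u0" if "z \<in> square y0 (d0 / 2)" for z
  proof -
    have z: "z \<in> square x (\<rho> - d0 / 2)" using square_trans[OF y0s that] by simp
    then have "z \<in> square x \<rho>" using square_mono[of "\<rho> - d0 / 2" \<rho> x] d0 by auto
    then have "d z * \<bar>u z\<bar> \<le> d0 * u0" using y0(2) by (simp add: d0_def u0_def)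
    moreover have "d0 / 2 * \<bar>u z\<bar> \<le> d z * \<bar>u z\<bar>" using dsq[of "d0 / 2" z] z by (intro mult_right_mono) auto
    ultimately have "d0 * \<bar>u z\<bar> \<le> d0 * (2 * u0)" by simp
    then show ?thesis using d0 by simp
  qed
  have grad: "\<bar>du i 1 z\<bar> \<le> 17 * u0 / d0" if z: "z \<in> square y0 (d0 / 4)" for i z
  proof -
    have "\<bar>du i 1 z\<bar> \<le> (2 / (d0 / 4) + (d0 / 4) / 2 * \<Lambda>) * (2 * u0)"
    proof (rule gradient_estimate)
      fix y assume y: "y \<in> square z (d0 / 4)"
      have y2: "y \<in> square y0 (d0 / 2)" using square_trans[OF z y] by simp
      then show "\<bar>u y\<bar> \<le> 2 * u0" by (rule u2)
      have "y \<in> square x \<rho>" using square_trans[OF y0s y2] d0 by simp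
      then show "\<bar>q y\<bar> \<le> \<Lambda>" by (rule q)
    qed (use d0 in simp)
    also have "\<dots> = (16 / d0 + (d0 * \<Lambda>) / 4) * u0" using d0 by (simp add: field_simps)
    also have "\<dots> \<le> (16 / d0 + 1 / d0) * u0" using dL u0 d0 L0 
      by (intro mult_right_mono add_left_mono) (auto intro: order_trans[rotated] simp: field_simps)
    finally show ?thesis by (simp add: field_simps)
  qed
  \<comment> \<open>The gradient is at most 17 u0/d0, so over radius d0/68 the value changes by at
    most u0/2; 4624 is 68 squared.\<close>
  let ?r = "d0 / 68"
  have low: "\<bar>u z\<bar> \<ge> u0 / 2" if "z \<in> square y0 ?r" for z
  proof -
    have "\<bar>u z - u y0\<bar> \<le> 2 * ?r * (17 * u0 / d0)"
    proof (rule lipschitz_on_square[OF _ _ that])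
      show "has_partial i u (du i 1)" for i using du_partial[of i 0] by simp
      show "\<bar>du i 1 y\<bar> \<le> 17 * u0 / d0" if "y \<in> square y0 ?r" for i y
        using grad that square_mono[of ?r "d0 / 4" y0] d0 by auto
    qed
    also have "\<dots> = u0 / 2" using d0 by simp
    finally show ?thesis unfolding u0_def by linarith
  qed
  have sub: "square y0 ?r \<subseteq> square x \<rho>" using square_trans[OF y0s, of _ ?r \<rho>] d0 by auto
  have "(\<rho> * \<bar>u x\<bar>)\<^sup>2 \<le> (d0 * u0)\<^sup>2" using main r by (intro power_mono) auto
  then have "\<rho>\<^sup>2 * (u x)\<^sup>2 \<le> 4624 * ((2 * ?r)\<^sup>2 * (u0 / 2)\<^sup>2)"
    by (simp add: power_mult_distrib power_divide)
  also have "(2 * ?r)\<^sup>2 * (u0 / 2)\<^sup>2 = integral (square y0 ?r) (\<lambda>y. (u0 / 2)\<^sup>2)"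
    using content_square[of ?r y0] d0 by (simp add: square_eq_cbox)
  also have "\<dots> \<le> integral (square y0 ?r) (\<lambda>y. (u y)\<^sup>2)"
  proof (intro integral_le integrable_square continuous_intros u_cont)
    fix y assume "y \<in> square y0 ?r"
    then have "(u0 / 2)\<^sup>2 \<le> \<bar>u y\<bar>\<^sup>2" using low u0 by (intro power_mono) auto
    then show "(u0 / 2)\<^sup>2 \<le> (u y)\<^sup>2" by simp
  qed
  also have "\<dots> \<le> integral (square x \<rho>) (\<lambda>y. (u y)\<^sup>2)"
    by (intro integral_subset_le sub integrable_square continuous_intros u_cont) auto
  finally show ?thesis by simp
qed

end

lemma poly_growth_vs_exp:
  fixes C \<delta> :: real
  assumes "\<delta> > 0"
  shows "\<forall>\<^sub>F L in at_top. C * (4 + 2 * L) ^ k < (\<delta> * exp L)\<^sup>2"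
proof -
  have "((\<lambda>L::real. (4 + 2 * L) ^ k / exp (4 + 2 * L)) \<longlongrightarrow> 0) at_top"
    by (rule filterlim_compose[OF tendsto_power_div_exp_0])
      (auto intro!: filterlim_tendsto_add_at_top filterlim_tendsto_pos_mult_at_top filterlim_ident)
  then have "((\<lambda>L::real. C * ((4 + 2 * L) ^ k / exp (4 + 2 * L))) \<longlongrightarrow> C * 0) at_top"
    by (intro tendsto_intros)
  then have "\<forall>\<^sub>F L in at_top. C * ((4 + 2 * L) ^ k / exp (4 + 2 * L)) < \<delta>\<^sup>2 / exp 4"
    by (rule order_tendstoD) (use assms in simp)
  then show ?thesis
  proof eventually_elim
    case (elim L)
    have "exp (4 + 2 * L) = exp 4 * (exp L)\<^sup>2" by (simp add: exp_add exp_double)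
    then show ?case using elim by (simp add: field_simps power_mult_distrib)
  qed
qed

text \<open>A Phragmen-Lindelof argument: the sum of the four exponentials \<open>exp (\<plusminus> y\<^sub>i)\<close> is a supersolution
  where \<open>q \<ge> 1\<close> and outgrows the polynomially bounded \<open>v\<close>.\<close>

lemma comparison_at_infinity:
  fixes v q :: "real^2 \<Rightarrow> real"
  assumes cv: "continuous_on UNIV v" and v1: "\<And>i. has_partial i v (v1 i)" and v2: "\<And>i. has_partial i (v1 i) (v2 i)"
    and eq: "\<And>y. (\<Sum>i\<in>UNIV. v2 i y) = q y * v y"
    and q: "\<And>y. y \<notin> square 0 L0 \<Longrightarrow> q y \<ge> 1"
    and growth: "\<And>y. (v y)\<^sup>2 \<le> C * (4 + norm y) ^ k" and C: "C \<ge> 0"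
    and M: "\<And>y. y \<in> square 0 L0 \<Longrightarrow> v y \<le> M" "M \<ge> 0"
  shows "v x \<le> M"
proof -
  define g where "g y = exp (y $ 1) + exp (- (y $ 1)) + (exp (y $ 2) + exp (- (y $ 2)))" for y :: "real^2"
  define g1 where "g1 i y = exp (y $ i) - exp (- (y $ i))" for i and y :: "real^2"
  define g2 where "g2 i y = exp (y $ i) + exp (- (y $ i))" for i and y :: "real^2"
  have g1: "has_partial i g (g1 i)" and g2: "has_partial i (g1 i) (g2 i)" for i
    unfolding has_partial_def g_def g1_def g2_def using exhaust_2[of i]
    by (auto simp: axis_def intro!: derivative_eq_intros)
  have cg: "continuous_on S g" for S unfolding g_def by (intro continuous_intros)
  have gpos: "g y > 0" for y unfolding g_def by (intro add_pos_pos) auto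
  have gexp: "exp \<bar>y $ i\<bar> \<le> g y" for i y
    using exhaust_2[of i] exp_gt_zero[of "y $ 1"] exp_gt_zero[of "- y $ 1"] exp_gt_zero[of "y $ 2"] exp_gt_zero[of "- y $ 2"]
    by (auto simp: g_def abs_if)
  have claim: "v x \<le> M + \<delta> * g x" if d: "\<delta> > 0" for \<delta>
  proof -
    \<comment> \<open>\<open>L\<close> is so large that on the boundary of the square the growth
      bound keeps \<open>v\<close> below \<open>\<delta> * g\<close>.\<close>
    obtain L where L: "L \<ge> L0 + 1" "L \<ge> norm x" "L \<ge> 1" "C * (4 + 2 * L) ^ k < (\<delta> * exp L)\<^sup>2"
    proof -
      have "\<forall>\<^sub>F L in at_top. L \<ge> L0 + 1 \<and> L \<ge> norm x \<and> L \<ge> 1 \<and> C * (4 + 2 * L) ^ k < (\<delta> * exp L)\<^sup>2"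
        by (intro eventually_conj eventually_ge_at_top poly_growth_vs_exp d)
      then show ?thesis using that eventually_happens'[OF trivial_limit_at_top_linorder] by blast
    qed
    define w where "w y = - v y + M + \<delta> * g y" for y
    have cw: "continuous_on S w" for S unfolding w_def by (intro continuous_intros cg continuous_on_subset[OF cv subset_UNIV])
    have xL: "x \<in> square 0 L" using L norm_in_square[of x 0 L] by simp
    obtain y0 where y0: "y0 \<in> square 0 L" "\<And>y. y \<in> square 0 L \<Longrightarrow> w y0 \<le> w y"
      using continuous_attains_inf[OF compact_square _ cw, of 0 L] xL by blast
    have "w y0 \<ge> 0"
    proof (rule ccontr)
      assume neg: "\<not> w y0 \<ge> 0"
      then have vbig: "v y0 > M + \<delta> * g y0" by (simp add: w_def)
      have "\<bar>y0 $ i - 0 $ i\<bar> \<noteq> L" for i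
      proof
        assume "\<bar>y0 $ i - 0 $ i\<bar> = L"
        then have e: "exp L \<le> g y0" using gexp[of y0 i] by simp
        have "(v y0)\<^sup>2 \<le> C * (4 + norm y0) ^ k" by (rule growth)
        also have "\<dots> \<le> C * (4 + 2 * L) ^ k"
          using norm_le_square[OF y0(1)] C by (intro mult_left_mono power_mono) auto
        also have "\<dots> < (\<delta> * exp L)\<^sup>2" by (rule L)
        finally have "v y0 < \<delta> * exp L" by (rule power2_less_imp_less) (use d in simp)
        also have "\<dots> \<le> \<delta> * g y0" using e d by simp
        finally show False using vbig M by simp
      qed
      then obtain r where r: "r > 0" "square y0 r \<subseteq> square 0 L" using square_interior[OF y0(1)] by metis
      have "y0 \<notin> square 0 L0" using vbig M(1)[of y0] mult_pos_pos[OF d gpos[of y0]] by auto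
      then have q1: "q y0 \<ge> 1" by (rule q)
      define h2 where "h2 i y = - v2 i y + 0 + \<delta> * g2 i y" for i y
      have "h2 i y0 \<ge> 0" for i
      proof (rule second_partial_nonneg_at_min[OF _ _ r(1)])
        show "has_partial i w (\<lambda>y. - v1 i y + 0 + \<delta> * g1 i y)"
          unfolding w_def by (intro has_partial_add has_partial_minus has_partial_const has_partial_cmult v1 g1)
        show "has_partial i (\<lambda>y. - v1 i y + 0 + \<delta> * g1 i y) (h2 i)"
          unfolding h2_def by (intro has_partial_add has_partial_minus has_partial_const has_partial_cmult v2 g2)
      qed (use r y0 in auto)
      then have "0 \<le> (\<Sum>i\<in>UNIV. h2 i y0)" by (intro sum_nonneg) auto
      also have "\<dots> = - (q y0 * v y0) + \<delta> * g y0"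
        unfolding eq[symmetric] by (simp add: h2_def sum_2 g2_def g_def algebra_simps)
      also have "\<dots> < 0"
      proof -
        have "v y0 > 0" using vbig M mult_pos_pos[OF d gpos[of y0]] by simp
        then have "1 * v y0 \<le> q y0 * v y0" using q1 by (intro mult_right_mono) auto
        then show ?thesis using vbig M by simp
      qed
      finally show False by simp
    qed
    then have "w x \<ge> 0" using y0(2)[OF xL] by simp
    then show ?thesis by (simp add: w_def)
  qed
  show ?thesis
  proof (rule field_le_epsilon)
    fix e :: real assume "e > 0"
    then show "v x \<le> M + e" using claim[of "e / g x"] gpos[of x] by simp
  qed
qed

context schroedinger_solution
begin

text \<open>The bounded L2 mass gives polynomial growth of \<open>u\<close>, through
  \<open>sup_le_L2\<close> on squares of radius \<rho> = \<Lambda>^(-1/2); comparison at infinity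
  then confines the supremum to a compact square. At a maximum of \<open>\<bar>u\<bar>\<close> the
  equation forces \<open>q \<le> 0\<close>.\<close>

lemma max_attained:
  assumes I: "\<And>x r. integral (square x r) (\<lambda>y. (u y)\<^sup>2) \<le> I"
    and q1: "\<And>y. y \<notin> square 0 L0 \<Longrightarrow> q y \<ge> 1" and L0: "L0 \<ge> 0"
    and qg: "\<And>y. \<bar>q y\<bar> \<le> c * (1 + norm y) ^ k" and c: "c \<ge> 1" and ne: "\<exists>x. u x \<noteq> 0"
  obtains z where "\<And>x. \<bar>u x\<bar> \<le> \<bar>u z\<bar>" "q z \<le> 0" "u z \<noteq> 0"
proof -
  obtain u2 where u2: "\<And>i j. has_partial j (du i 1) (u2 i j)" "\<And>x. (\<Sum>i\<in>UNIV. u2 i i x) = q x * u x"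
    using second_partials by metis
  have u1: "has_partial i u (du i 1)" for i using du_partial[of i 0] by simp
  have I0: "I \<ge> 0" using I[of 0 0] by (rule order_trans[rotated])
    (auto intro!: Henstock_Kurzweil_Integration.integral_nonneg integrable_square continuous_intros u_cont)
  have growth: "(u x)\<^sup>2 \<le> (4624 * I * c) * (4 + norm x) ^ k" for x
  proof -
    define \<Lambda> where "\<Lambda> = c * (4 + norm x) ^ k"
    have pow1: "1 \<le> (4 + norm x) ^ k" by (rule one_le_power) simp
    have L1: "\<Lambda> \<ge> 1" unfolding \<Lambda>_def using mult_mono[OF c pow1] c by simp
    define \<rho> where "\<rho> = 1 / sqrt \<Lambda>"
    have r: "\<rho> > 0" "\<rho> \<le> 1" "\<rho>\<^sup>2 * \<Lambda> \<le> 1" "\<rho>\<^sup>2 = 1 / \<Lambda>" using L1 by (auto simp: \<rho>_def power_divide)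
    have "\<bar>q y\<bar> \<le> \<Lambda>" if "y \<in> square x \<rho>" for y
    proof -
      have "norm y \<le> norm x + norm (y - x)" by (metis add.commute diff_add_cancel norm_triangle_ineq)
      also have "\<dots> \<le> norm x + 2" using norm_le_square[OF that] r by simp
      finally have "c * (1 + norm y) ^ k \<le> \<Lambda>" unfolding \<Lambda>_def using c by (intro mult_left_mono power_mono) auto
      then show ?thesis using qg[of y] by simp
    qed
    from sup_le_L2[where x = x, OF r(1) this r(3)] have "\<rho>\<^sup>2 * (u x)\<^sup>2 \<le> 4624 * I" using I[of x \<rho>] by simp
    then show ?thesis using L1 unfolding r(4) by (simp add: \<Lambda>_def field_simps)
  qed
  obtain z where z: "z \<in> square 0 L0" "\<And>y. y \<in> square 0 L0 \<Longrightarrow> \<bar>u y\<bar> \<le> \<bar>u z\<bar>"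
    using continuous_attains_sup[OF compact_square, of 0 L0 "\<lambda>y. \<bar>u y\<bar>"] center_in_square[OF L0, of 0]
      continuous_on_subset[OF u_cont subset_UNIV] by (metis continuous_on_rabs empty_iff)
  have C0: "4624 * I * c \<ge> 0" using I0 c by simp
  have "u x \<le> \<bar>u z\<bar>" for x
    by (rule comparison_at_infinity[OF u_cont u1 u2(1,2) q1 growth C0]) (use z in \<open>auto intro: order_trans[OF abs_ge_self]\<close>)
  moreover have "- u x \<le> \<bar>u z\<bar>" for x
    by (rule comparison_at_infinity[of "\<lambda>x. - u x" "\<lambda>i x. - du i 1 x" "\<lambda>i x. - u2 i i x" q, OF _ _ _ _ q1 _ C0])
      (use z u1 u2 growth in \<open>auto intro!: continuous_intros u_cont has_partial_minus intro: order_trans[OF abs_ge_minus_self] simp: sum_negf\<close>)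
  ultimately have max: "\<bar>u x\<bar> \<le> \<bar>u z\<bar>" for x by (simp add: abs_le_iff)
  have uz: "u z \<noteq> 0" using ne max by (metis abs_le_zero_iff abs_zero)
  \<comment> \<open>The sign that turns the maximum of \<open>\<bar>u\<bar>\<close> at
    \<open>z\<close> into a minimum of \<open>s * u\<close>.\<close>
  define s where "s = - sgn (u z)"
  have s: "s * u z = - \<bar>u z\<bar>" "\<bar>s\<bar> \<le> 1" by (auto simp: s_def sgn_if)
  have "s * u2 i i z \<ge> 0" for i
  proof (rule second_partial_nonneg_at_min[of i "\<lambda>y. s * u y" _ "\<lambda>y. s * u2 i i y" 1])
    show "s * u z \<le> s * u y" for y
    proof -
      have "\<bar>s * u y\<bar> \<le> 1 * \<bar>u z\<bar>" unfolding abs_mult using s max by (intro mult_mono) auto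
      then show ?thesis using s(1) by (simp add: abs_le_iff)
    qed
  qed (use has_partial_cmult[OF u1] has_partial_cmult[OF u2(1)] in auto)
  then have "0 \<le> (\<Sum>i\<in>UNIV. s * u2 i i z)" by (intro sum_nonneg) auto
  also have "\<dots> = q z * (s * u z)" unfolding sum_distrib_left[symmetric] u2(2) by simp
  also have "\<dots> = - (q z * \<bar>u z\<bar>)" unfolding s(1) by simp
  finally have "q z \<le> 0" using uz by (simp add: mult_le_0_iff)
  then show ?thesis using that max uz by blast
qed

end

section \<open>Mollifiers as test functions, and eigenpairs as weak solutions\<close>

lemma partial_eq:
  assumes "f differentiable (at x)" "((\<lambda>t. f (x + t *\<^sub>R axis i 1)) has_real_derivative g) (at 0)"
  shows "partial i f x = g"
proof -
  have "(f has_derivative frechet_derivative f (at x)) (at (x + 0 *\<^sub>R axis i 1))"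
    using assms(1) by (simp add: frechet_derivative_works)
  moreover have "((\<lambda>t. x + t *\<^sub>R axis i 1) has_derivative (\<lambda>t. t *\<^sub>R axis i 1)) (at (0::real))"
    by (auto intro!: derivative_eq_intros)
  ultimately have "((\<lambda>t. f (x + t *\<^sub>R axis i 1)) has_derivative (\<lambda>t. frechet_derivative f (at x) (t *\<^sub>R axis i 1))) (at 0)"
    by (rule has_derivative_compose[rotated])
  moreover have "linear (frechet_derivative f (at x))" using assms(1) by (rule linear_frechet_derivative)
  ultimately have "((\<lambda>t. f (x + t *\<^sub>R axis i 1)) has_real_derivative partial i f x) (at 0)"
    unfolding has_field_derivative_def partial_def by (simp add: linear_scale mult_commute_abs)
  then show ?thesis using assms(2) DERIV_unique by blast
qed

lemma kern_differentiable:
  assumes "derivatives H"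
  shows "(\<lambda>y. c * kern H a (x - y)) differentiable (at y)"
proof -
  have H: "(H n has_real_derivative H (Suc n) t) (at t)" for n t
    using assms unfolding derivatives_def by auto
  have "(\<lambda>y. H n ((x - y) $ i)) differentiable (at y)" for n i
  proof -
    have d: "((\<lambda>y. (x - y) $ i) has_derivative (\<lambda>h. - h $ i)) (at y)"
      by (auto intro!: derivative_eq_intros bounded_linear.has_derivative[OF bounded_linear_vec_nth])
    have "((\<lambda>y. H n ((x - y) $ i)) has_derivative (\<lambda>h. H (Suc n) ((x - y) $ i) * (- h $ i))) (at y)"
      by (rule has_derivative_compose[OF d H[of n "(x - y) $ i", unfolded has_field_derivative_def]])
    then show ?thesis by (rule differentiableI)
  qed
  then show ?thesis unfolding kern_def by (intro differentiable_mult differentiable_const)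
qed

lemma kern_reflect_partial:
  assumes H: "derivatives H"
  shows "has_partial i (\<lambda>y. c * kern H a (x - y)) (\<lambda>y. (- c) * kern H (a(i := Suc (a i))) (x - y))"
  unfolding has_partial_def
proof
  fix y
  have "((\<lambda>t. kern H a ((x - y) + t *\<^sub>R axis i 1)) has_real_derivative kern H (a(i := Suc (a i))) (x - y)) (at (- 0))"
    using has_partialD[OF kern_has_partial[OF H, of i a], of "x - y" 0] by simp
  then have "((\<lambda>t. kern H a ((x - y) + (- t) *\<^sub>R axis i 1)) has_real_derivative kern H (a(i := Suc (a i))) (x - y) * (-1)) (at 0)"
    by (rule DERIV_chain2) (auto intro!: derivative_eq_intros)
  then have "((\<lambda>t. kern H a (x - (y + t *\<^sub>R axis i 1))) has_real_derivative - kern H (a(i := Suc (a i))) (x - y)) (at 0)"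
    by (simp add: algebra_simps)
  from DERIV_cmult[OF this, of c] show "((\<lambda>t. c * kern H a (x - (y + t *\<^sub>R axis i 1))) has_real_derivative (- c) * kern H (a(i := Suc (a i))) (x - y)) (at 0)"
    by simp
qed

text \<open>All iterated partials stay multiples of the family \<open>kern\<close>, which proves
  smoothness in the recursive sense of \<open>smooth\<close>.\<close>

lemma kern_iterated_partial:
  assumes H: "derivatives H"
  shows "\<exists>c a. foldr partial is (\<lambda>y. kern H b (x - y)) = (\<lambda>y. c * kern H a (x - y))"
proof (induction "is")
  case Nil
  show ?case by (intro exI[of _ 1] exI[of _ b]) simp
next
  case (Cons i "is")
  then obtain c a where *: "foldr partial is (\<lambda>y. kern H b (x - y)) = (\<lambda>y. c * kern H a (x - y))" by blast
  have "partial i (\<lambda>y. c * kern H a (x - y)) y = (- c) * kern H (a(i := Suc (a i))) (x - y)" for y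
    by (rule partial_eq[OF kern_differentiable[OF H]]) (use kern_reflect_partial[OF H] in \<open>auto simp: has_partial_def\<close>)
  then have "foldr partial (i # is) (\<lambda>y. kern H b (x - y)) = (\<lambda>y. (- c) * kern H (a(i := Suc (a i))) (x - y))"
    unfolding foldr.simps comp_apply * by (intro ext)
  then show ?case by blast
qed

lemma kern_test_function:
  assumes H: "mollifier \<epsilon> H" and e: "\<epsilon> \<le> 1"
  shows "test_function (\<lambda>y. kern H (\<lambda>_. 0) (x - y))"
  unfolding test_function_def smooth_def
proof (intro conjI allI)
  have dH: "derivatives H" using H by (simp add: mollifier_def)
  fix "is" :: "2 list" and y
  show "foldr partial is (\<lambda>y. kern H (\<lambda>_. 0) (x - y)) differentiable at y"
    using kern_iterated_partial[OF dH, of "is" "\<lambda>_. 0" x] kern_differentiable[OF dH] by auto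
next
  have k: "smoothing_kernel (kern H (\<lambda>_. 0))" using mollifier_smoothing_kernel[OF H e] .
  have "y \<in> square x 1" if "kern H (\<lambda>_. 0) (x - y) \<noteq> 0" for y
    using that k mem_square_diff[of x y 1] unfolding smoothing_kernel_def by blast
  then have "closure {y. kern H (\<lambda>_. 0) (x - y) \<noteq> 0} \<subseteq> square x 1"
    by (intro closure_minimal compact_imp_closed[OF compact_square]) blast
  then show "compact (closure {y. kern H (\<lambda>_. 0) (x - y) \<noteq> 0})"
    by (meson bounded_subset compact_eq_bounded_closed compact_square closed_closure)
qed

lemma kern_laplacian:
  assumes H: "derivatives H"
  shows "laplacian (\<lambda>y. kern H (\<lambda>_. 0) (x - y)) y = (\<Sum>i\<in>UNIV. kern H ((\<lambda>_. 0)(i := 2)) (x - y))"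
  unfolding laplacian_def
proof (intro sum.cong refl)
  fix i :: 2
  have P: "partial i (\<lambda>y. c * kern H a (x - y)) = (\<lambda>y. (- c) * kern H (a(i := Suc (a i))) (x - y))" for c a
    by (intro ext partial_eq[OF kern_differentiable[OF H]]) (use kern_reflect_partial[OF H] in \<open>auto simp: has_partial_def\<close>)
  have "partial i (\<lambda>y. kern H (\<lambda>_. 0) (x - y)) = (\<lambda>y. (- 1) * kern H ((\<lambda>_. 0)(i := 1)) (x - y))"
    using P[of 1 "\<lambda>_. 0"] by simp
  then show "partial i (partial i (\<lambda>y. kern H (\<lambda>_. 0) (x - y))) y = kern H ((\<lambda>_. 0)(i := 2)) (x - y)"
    using P[of "- 1" "(\<lambda>_. 0)(i := 1)"] by (simp add: numeral_2_eq_2)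
qed

lemma integral_compact_support:
  fixes f :: "real^2 \<Rightarrow> real"
  assumes f: "continuous_on UNIV f" and z: "\<And>y. y \<notin> square x 1 \<Longrightarrow> f y = 0"
  shows "(LINT y|lebesgue. f y) = integral UNIV f"
proof -
  have "integrable lborel (\<lambda>y. indicator (square x 1) y *\<^sub>R f y)"
    by (rule borel_integrable_compact[OF compact_square]) (rule continuous_on_subset[OF f subset_UNIV])
  moreover have "(\<lambda>y. indicator (square x 1) y *\<^sub>R f y) = f" using z by (auto simp: fun_eq_iff indicator_def)
  ultimately have "integrable lborel f" by simp
  then have "integrable lebesgue f" using integrable_completion by blast
  then show "(LINT y|lebesgue. f y) = integral UNIV f" by (rule integral_lebesgue[symmetric])
qed

text \<open>The translated mollifier is an admissible test function. All integrands are continuous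
  with compact support, so the Lebesgue integrals of the operator agree with the gauge integrals in
  \<open>conv\<close>, and the tested identity splits into the two sides of the mollified
  equation.\<close>

lemma eigenpair_weak_laplacian:
  assumes e: "eigenpair V u lam" and V: "continuous_on UNIV V"
  shows "weak_laplacian u (\<lambda>x. (V x - lam) * u x)"
  unfolding weak_laplacian_def
proof (intro conjI allI impI)
  show cu: "continuous_on UNIV u" using e by (simp add: eigenpair_def)
  show c: "continuous_on UNIV (\<lambda>x. (V x - lam) * u x)" by (intro continuous_intros V cu)
  fix \<epsilon> H x assume H: "0 < \<epsilon> \<and> \<epsilon> \<le> 1 \<and> mollifier \<epsilon> H"
  then have dH: "derivatives H" by (simp add: mollifier_def)
  have k: "smoothing_kernel (kern H a)" for a using mollifier_smoothing_kernel H by blast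
  define p where "p y = kern H (\<lambda>_. 0) (x - y)" for y
  define l where "l i y = kern H ((\<lambda>_. 0)(i := 2)) (x - y)" for i y
  have ck: "continuous_on UNIV (\<lambda>y. kern H a (x - y))" for a
    by (rule cont_compose_UNIV[OF kern_cont[OF dH]]) (intro continuous_on_diff continuous_on_const continuous_on_id)
  have cp: "continuous_on UNIV p" and cl: "continuous_on UNIV (l i)" for i
    unfolding p_def l_def by (rule ck)+
  have z: "p y = 0" "l i y = 0" if "y \<notin> square x 1" for y i
    using that k by (auto simp: p_def l_def smoothing_kernel_def mem_square_diff)
  have lap: "laplacian p y = (\<Sum>i\<in>UNIV. l i y)" for y
    unfolding p_def l_def by (rule kern_laplacian[OF dH])
  have "test_function p" unfolding p_def using kern_test_function H by blast
  then have "(LINT y|lebesgue. u y * (- laplacian p y + V y * p y)) = (LINT y|lebesgue. (lam * u y) * p y)"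
    using e by (auto simp: eigenpair_def schroedinger_op_def)
  moreover have "(LINT y|lebesgue. u y * (- (\<Sum>i\<in>UNIV. l i y) + V y * p y)) = integral UNIV (\<lambda>y. u y * (- (\<Sum>i\<in>UNIV. l i y) + V y * p y))"
    by (rule integral_compact_support[where x = x], intro continuous_intros cu cl cp V) (simp add: z)
  moreover have "(LINT y|lebesgue. (lam * u y) * p y) = integral UNIV (\<lambda>y. (lam * u y) * p y)"
    by (rule integral_compact_support[where x = x], intro continuous_intros cu cl cp V) (simp add: z)
  ultimately have "integral UNIV (\<lambda>y. u y * (- (\<Sum>i\<in>UNIV. l i y) + V y * p y)) = integral UNIV (\<lambda>y. (lam * u y) * p y)"
    unfolding lap by simp
  moreover have "integral UNIV (\<lambda>y. u y * (- (\<Sum>i\<in>UNIV. l i y) + V y * p y)) = integral (square x 1) (\<lambda>y. u y * (- (\<Sum>i\<in>UNIV. l i y) + V y * p y))"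
    by (rule integral_eq_UNIV) (simp add: z)
  moreover have "integral UNIV (\<lambda>y. (lam * u y) * p y) = integral (square x 1) (\<lambda>y. (lam * u y) * p y)"
    by (rule integral_eq_UNIV) (simp add: z)
  ultimately have "0 = integral (square x 1) (\<lambda>y. (lam * u y) * p y) - integral (square x 1) (\<lambda>y. u y * (- (\<Sum>i\<in>UNIV. l i y) + V y * p y))"
    by simp
  also have "\<dots> = integral (square x 1) (\<lambda>y. (lam * u y) * p y - u y * (- (\<Sum>i\<in>UNIV. l i y) + V y * p y))"
    by (intro Henstock_Kurzweil_Integration.integral_diff[symmetric] integrable_square continuous_intros cu cp cl V)
  also have "\<dots> = integral (square x 1) (\<lambda>y. (\<Sum>i\<in>UNIV. l i y * u y) - p y * ((V y - lam) * u y))"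
    by (intro integral_cong) (simp add: sum_distrib_left algebra_simps)
  also have "\<dots> = integral (square x 1) (\<lambda>y. \<Sum>i\<in>UNIV. l i y * u y) - integral (square x 1) (\<lambda>y. p y * ((V y - lam) * u y))"
    by (intro Henstock_Kurzweil_Integration.integral_diff integrable_square continuous_intros cu cp cl V)
  also have "integral (square x 1) (\<lambda>y. \<Sum>i\<in>UNIV. l i y * u y) = (\<Sum>i\<in>UNIV. integral (square x 1) (\<lambda>y. l i y * u y))"
    by (intro Henstock_Kurzweil_Integration.integral_sum integrable_square continuous_intros cu cl) auto
  also have "\<dots> = (\<Sum>i\<in>UNIV. conv (kern H ((\<lambda>_. 0)(i := 2))) u x)"
    unfolding conv_def l_def[symmetric] by (intro sum.cong refl integral_eq_UNIV[symmetric]) (simp add: z)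
  also have "integral (square x 1) (\<lambda>y. p y * ((V y - lam) * u y)) = conv (kern H (\<lambda>_. 0)) (\<lambda>x. (V x - lam) * u x) x"
    unfolding conv_def p_def[symmetric] by (intro integral_eq_UNIV[symmetric]) (simp add: z)
  finally show "(\<Sum>i\<in>UNIV. conv (kern H ((\<lambda>_. 0)(i := 2))) u x) = conv (kern H (\<lambda>_. 0)) (\<lambda>x. (V x - lam) * u x) x"
    by linarith
qed

lemma eigenpair_L2_bound:
  assumes e: "eigenpair V u lam"
  obtains I where "\<And>x r. integral (square x r) (\<lambda>y. (u y)\<^sup>2) \<le> I"
proof (rule that[of "integral UNIV (\<lambda>y. (u y)\<^sup>2)"])
  fix x r
  have cu: "continuous_on UNIV u" using e by (simp add: eigenpair_def)
  have "integrable lebesgue (\<lambda>y. (u y)\<^sup>2)" using e by (simp add: eigenpair_def schroedinger_op_def L2_def)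
  then have "(\<lambda>y. (u y)\<^sup>2) integrable_on UNIV" by (rule integrable_on_lebesgue)
  then show "integral (square x r) (\<lambda>y. (u y)\<^sup>2) \<le> integral UNIV (\<lambda>y. (u y)\<^sup>2)"
    by (intro integral_subset_le integrable_square continuous_intros cu) auto
qed

section \<open>Covering the nodal set of a solution\<close>

lemma twelve_le_exp: "12 \<le> exp (4::real)"
  using exp_lower_Taylor_quadratic[of "4::real"] by simp

lemma two_le_exp: "2 \<le> exp (1::real)"
  using exp_ge_add_one_self[of "1::real"] by simp

lemma three_tenths_le_exp: "3 / 10 \<le> exp (- 1::real)"
  using exp_le by (simp add: exp_minus field_simps)

context schroedinger_solution
begin

text \<open>Says that \<open>q\<close> is analytic around \<open>p\<close> with amplitude \<Lambda>
  and radius R/A along both axes. The single constant \<open>A\<close> plays the roles of both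
  \<open>A\<close> and \<open>B\<close> in \<open>du_bound\<close>.\<close>

definition regular :: "real \<Rightarrow> real \<Rightarrow> real \<Rightarrow> real^2 \<Rightarrow> bool" where
  "regular A \<Lambda> R p \<longleftrightarrow> R > 0 \<and> \<Lambda> \<ge> 0 \<and> A \<ge> 3 \<and>
     (\<forall>i j. \<forall>y\<in>square p R. \<bar>dq i j y\<bar> \<le> \<Lambda> * fact j * (A / R) ^ j)"

lemma derivatives_line: "derivatives (\<lambda>n t. du i n (y + t *\<^sub>R axis i 1))"
  unfolding derivatives_def by (intro allI has_partialD du_partial)

lemma u_line_cont: "continuous_on S (\<lambda>t. u (y + t *\<^sub>R axis i 1))"
  by (intro cont_compose_UNIV[OF u_cont] continuous_intros)

lemma line_bound:
  assumes reg: "regular A \<Lambda> R p" and M: "\<And>y. \<bar>u y\<bar> \<le> M" and x: "x \<in> square p (R / 2)"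
  shows "\<bar>du i n x\<bar> \<le> M * exp (R * sqrt \<Lambda>) * fact n * (6 * A / R) ^ n"
  by (rule du_bound[where B = A and p = p]) (use reg M x in \<open>auto simp: regular_def\<close>)

text \<open>The reason for r = R/(80 A): on a line segment of length at most 4 r each interpolation
  node gains a factor 24/80 = 3/10, which is below 1/e.\<close>

lemma theta_small:
  assumes reg: "regular A \<Lambda> R p" and l: "0 \<le> l" "l \<le> 4 * (R / (80 * A))"
  shows "0 \<le> 6 * A / R * l" "6 * A / R * l \<le> exp (- 1)"
proof -
  have RA: "R > 0" "A > 0" using reg by (auto simp: regular_def)
  show "0 \<le> 6 * A / R * l" using RA l by simp
  have "6 * A / R * l \<le> 6 * A / R * (4 * (R / (80 * A)))" using RA l by (intro mult_left_mono) auto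
  also have "\<dots> = 3 / 10" using RA by (simp add: field_simps)
  finally show "6 * A / R * l \<le> exp (- 1)" using three_tenths_le_exp by linarith
qed

text \<open>Interpolation at \<open>n\<close> nodes in the inner half of the segment: the data term
  loses at most e^(4n), the remainder is at most e^(\<sigma> - n). With n near S \<sigma>/8 both are
  small enough; the 3 absorbs the factor e^\<sigma>, the rounding of \<open>n\<close> and the sum of
  two terms. For S up to 24 the bound is no better than \<open>M\<close>.\<close>

lemma line_propagation:
  assumes reg: "regular A \<Lambda> R p" and M: "\<And>y. \<bar>u y\<bar> \<le> M" and s1: "R * sqrt \<Lambda> \<ge> 1"
    and r: "r = R / (80 * A)"
    and line: "\<And>t. \<bar>t\<bar> \<le> 2 * r \<Longrightarrow> y + t *\<^sub>R axis i 1 \<in> square p (R / 2)"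
    and small: "\<And>t. \<bar>t\<bar> \<le> r \<Longrightarrow> \<bar>u (y + t *\<^sub>R axis i 1)\<bar> \<le> M * exp (- S * (R * sqrt \<Lambda>))"
    and t: "\<bar>t\<bar> \<le> 2 * r"
  shows "\<bar>u (y + t *\<^sub>R axis i 1)\<bar> \<le> M * exp (- (S / 8 - 3) * (R * sqrt \<Lambda>))"
proof -
  define \<sigma> where "\<sigma> = R * sqrt \<Lambda>"
  have M0: "M \<ge> 0" using M[of 0] by linarith
  have RA: "R > 0" "A \<ge> 3" using reg by (auto simp: regular_def)
  then have r0: "r > 0" unfolding r by simp
  show ?thesis
  proof (cases "S \<le> 24")
    case True
    have "0 \<le> - (S / 8 - 3) * \<sigma>" using True s1 by (simp add: \<sigma>_def mult_nonpos_nonneg)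
    then have "M * 1 \<le> M * exp (- (S / 8 - 3) * \<sigma>)" using M0 by (intro mult_left_mono) (simp_all only: one_le_exp_iff)
    then show ?thesis using M[of "y + t *\<^sub>R axis i 1"] by (simp add: \<sigma>_def)
  next
    case False
    \<comment> \<open>The data term carries 12^n, since the segment is twice as long as the set
      where \<open>u\<close> is small. With this \<open>n\<close> it uses up at most half of the
      exponent S \<sigma>.\<close>
    define n where "n = nat \<lfloor>S * \<sigma> / 8\<rfloor>"
    have S\<sigma>: "S * \<sigma> \<ge> 24" using mult_mono[of 24 S 1 \<sigma>] False s1 by (simp add: \<sigma>_def)
    have n: "real n \<le> S * \<sigma> / 8" "real n > S * \<sigma> / 8 - 1" "n \<ge> 1"
      unfolding n_def using S\<sigma> by linarith+
    have 1: "\<bar>du i 0 (y + t *\<^sub>R axis i 1)\<bar> \<le> M * exp (- S * \<sigma>) * (6 * (2 * r - (- (2 * r))) / (2 * r)) ^ n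
        + (M * exp \<sigma>) * (6 * A / R * (2 * r - (- (2 * r)))) ^ n"
    proof (rule small_set_propagation[OF derivatives_line, of "{- r..r}" "- (2 * r)" "2 * r" "2 * r" n i y])
      show "\<bar>du i n (y + t *\<^sub>R axis i 1)\<bar> \<le> M * exp \<sigma> * fact n * (6 * A / R) ^ n" if "t \<in> {- (2 * r)..2 * r}" for t
        unfolding \<sigma>_def by (rule line_bound[OF reg M line]) (use that in auto)
    qed (use r0 n t small in \<open>auto simp: \<sigma>_def abs_le_iff\<close>)
    have "(6 * (2 * r - (- (2 * r))) / (2 * r)) ^ n = 12 ^ n" using r0 by simp
    also have "\<dots> \<le> exp 4 ^ n" by (intro power_mono twelve_le_exp) simp
    also have "\<dots> = exp (4 * n)" by (simp add: exp_of_nat_mult[symmetric] mult.commute)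
    also have "\<dots> \<le> exp (S * \<sigma> / 2)" using n by simp
    finally have "M * exp (- S * \<sigma>) * (6 * (2 * r - (- (2 * r))) / (2 * r)) ^ n \<le> M * exp (- S * \<sigma>) * exp (S * \<sigma> / 2)"
      using M0 by (intro mult_left_mono) auto
    also have "\<dots> = M * exp (- S * \<sigma> / 2)" by (simp add: exp_add[symmetric])
    also have "\<dots> \<le> M * exp (\<sigma> + 1 - S * \<sigma> / 8)"
      using M0 s1 S\<sigma> by (intro mult_left_mono) (auto simp: \<sigma>_def)
    finally have 2: "M * exp (- S * \<sigma>) * (6 * (2 * r - (- (2 * r))) / (2 * r)) ^ n \<le> M * exp (\<sigma> + 1 - S * \<sigma> / 8)" .
    have "(6 * A / R * (2 * r - (- (2 * r)))) ^ n \<le> exp (- 1) ^ n"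
      using theta_small[OF reg, of "4 * r"] r0 by (intro power_mono) (auto simp: r)
    also have "\<dots> = exp (- real n)" by (simp add: exp_of_nat_mult[symmetric])
    finally have "(M * exp \<sigma>) * (6 * A / R * (2 * r - (- (2 * r)))) ^ n \<le> (M * exp \<sigma>) * exp (- real n)"
      using M0 by (intro mult_left_mono) auto
    also have "\<dots> = M * exp (\<sigma> - n)" by (simp add: exp_diff exp_minus field_simps)
    also have "\<dots> \<le> M * exp (\<sigma> + 1 - S * \<sigma> / 8)" using M0 n by (intro mult_left_mono) auto
    finally have "\<bar>u (y + t *\<^sub>R axis i 1)\<bar> \<le> M * (2 * exp (\<sigma> + 1 - S * \<sigma> / 8))" using 1 2 by simp
    also have "\<dots> \<le> M * exp (- (S / 8 - 3) * \<sigma>)"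
    proof (intro mult_left_mono M0)
      have "2 * exp (\<sigma> + 1 - S * \<sigma> / 8) \<le> exp 1 * exp (\<sigma> + 1 - S * \<sigma> / 8)"
        using two_le_exp by (intro mult_right_mono) auto
      also have "\<dots> = exp (\<sigma> + 2 - S * \<sigma> / 8)" by (simp add: exp_add[symmetric])
      also have "\<dots> \<le> exp (- (S / 8 - 3) * \<sigma>)" using s1 by (simp add: \<sigma>_def algebra_simps)
      finally show "2 * exp (\<sigma> + 1 - S * \<sigma> / 8) \<le> exp (- (S / 8 - 3) * \<sigma>)" .
    qed
    finally show ?thesis by (simp add: \<sigma>_def)
  qed
qed

text \<open>First along horizontal, then along vertical lines; the two exponents compose to S/64 -
  27/8.\<close>

lemma square_propagation:
  assumes reg: "regular A \<Lambda> R p" and M: "\<And>y. \<bar>u y\<bar> \<le> M" and s1: "R * sqrt \<Lambda> \<ge> 1"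
    and r: "r = R / (80 * A)"
    and small: "\<And>y. y \<in> square p r \<Longrightarrow> \<bar>u y\<bar> \<le> M * exp (- S * (R * sqrt \<Lambda>))"
    and z: "z \<in> square p (2 * r)"
  shows "\<bar>u z\<bar> \<le> M * exp (- (S / 64 - 4) * (R * sqrt \<Lambda>))"
proof -
  have M0: "M \<ge> 0" using M[of 0] by linarith
  have RA: "R > 0" "A \<ge> 3" using reg by (auto simp: regular_def)
  then have r0: "r > 0" unfolding r by simp
  have rR: "2 * r \<le> R / 2" using RA unfolding r by (simp add: field_simps)
  have step1: "\<bar>u y\<bar> \<le> M * exp (- (S / 8 - 3) * (R * sqrt \<Lambda>))" if y: "\<bar>y $ 1 - p $ 1\<bar> \<le> 2 * r" "\<bar>y $ 2 - p $ 2\<bar> \<le> r" for y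
  proof -
    let ?y = "p + (y $ 2 - p $ 2) *\<^sub>R axis 2 (1::real)"
    have "y = ?y + (y $ 1 - p $ 1) *\<^sub>R axis 1 1" by (simp add: vec_eq_iff forall_2 axis_def)
    moreover have "\<bar>u (?y + (y $ 1 - p $ 1) *\<^sub>R axis 1 1)\<bar> \<le> M * exp (- (S / 8 - 3) * (R * sqrt \<Lambda>))"
      by (rule line_propagation[OF reg M s1 r _ small y(1)])
        (use y rR r0 in \<open>auto simp: square_def forall_2 axis_def\<close>)
    ultimately show ?thesis by simp
  qed
  let ?z = "p + (z $ 1 - p $ 1) *\<^sub>R axis 1 (1::real)"
  have zz: "\<bar>z $ 1 - p $ 1\<bar> \<le> 2 * r" "\<bar>z $ 2 - p $ 2\<bar> \<le> 2 * r" using z by (auto simp: square_def)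
  have "z = ?z + (z $ 2 - p $ 2) *\<^sub>R axis 2 1" by (simp add: vec_eq_iff forall_2 axis_def)
  moreover have "\<bar>u (?z + (z $ 2 - p $ 2) *\<^sub>R axis 2 1)\<bar> \<le> M * exp (- ((S / 8 - 3) / 8 - 3) * (R * sqrt \<Lambda>))"
    by (rule line_propagation[OF reg M s1 r _ step1 zz(2)])
      (use zz rR r0 in \<open>auto simp: square_def forall_2 axis_def\<close>)
  moreover have "M * exp (- ((S / 8 - 3) / 8 - 3) * (R * sqrt \<Lambda>)) \<le> M * exp (- (S / 64 - 4) * (R * sqrt \<Lambda>))"
    using M0 s1 by (intro mult_left_mono) (simp_all only: exp_le_cancel_iff, intro mult_right_mono, auto simp: field_simps)
  ultimately show ?thesis by simp
qed

text \<open>Each zero contributes a factor at most 1/e to the remainder, which starts from M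
  e^\<sigma>; a lower bound for \<open>\<bar>u\<bar>\<close> at one point therefore limits the
  number of zeros.\<close>

lemma line_zero_count:
  assumes reg: "regular A \<Lambda> R p" and M: "\<And>y. \<bar>u y\<bar> \<le> M" "M > 0" and r: "r = R / (80 * A)"
    and line: "\<And>t. t \<in> {a..b} \<Longrightarrow> y + t *\<^sub>R axis i 1 \<in> square p (R / 2)" and ab: "a \<le> b" "b - a \<le> 4 * r"
    and t0: "t0 \<in> {a..b}" "\<bar>u (y + t0 *\<^sub>R axis i 1)\<bar> \<ge> M * exp (- S * (R * sqrt \<Lambda>))"
    and Z: "finite Z" "Z \<subseteq> {a..b}" "\<And>t. t \<in> Z \<Longrightarrow> u (y + t *\<^sub>R axis i 1) = 0"
  shows "real (card Z) \<le> (1 + S) * (R * sqrt \<Lambda>)"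
proof -
  define \<sigma> where "\<sigma> = R * sqrt \<Lambda>"
  let ?n = "card Z"
  have "\<bar>du i 0 (y + t0 *\<^sub>R axis i 1)\<bar> \<le> (M * exp \<sigma>) * (6 * A / R * (b - a)) ^ ?n"
    by (rule many_zeros_small[OF derivatives_line Z(1,2) refl _ _ t0(1)])
      (use line_bound[OF reg M(1) line] Z(3) in \<open>auto simp: \<sigma>_def\<close>)
  also have "\<dots> \<le> (M * exp \<sigma>) * exp (- 1) ^ ?n"
    using theta_small[OF reg, of "b - a"] ab M(2) by (intro mult_left_mono power_mono) (auto simp: r)
  also have "\<dots> = M * exp (\<sigma> - ?n)" by (simp add: exp_of_nat_mult[symmetric] exp_diff exp_minus field_simps)
  finally have "M * exp (- S * \<sigma>) \<le> M * exp (\<sigma> - ?n)" using t0(2) by (simp add: \<sigma>_def)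
  then have "- S * \<sigma> \<le> \<sigma> - ?n" using M(2) by simp
  then show ?thesis by (simp add: \<sigma>_def algebra_simps)
qed

text \<open>Propagation read backwards: if the sublevel set had measure e, interpolating from it
  would make \<open>u\<close> too small at \<open>t0\<close>. A smaller threshold, by s (3 + S0) in
  the exponent, forces the measure down by the factor e^(-s).\<close>

lemma line_sublevel_measure:
  assumes reg: "regular A \<Lambda> R p" and M: "\<And>y. \<bar>u y\<bar> \<le> M" "M > 0" and s1: "R * sqrt \<Lambda> \<ge> 1" and r: "r = R / (80 * A)"
    and line: "\<And>t. t \<in> {a..b} \<Longrightarrow> y + t *\<^sub>R axis i 1 \<in> square p (R / 2)" and ab: "a < b" "b - a \<le> 4 * r"
    and t0: "t0 \<in> {a..b}" "\<bar>u (y + t0 *\<^sub>R axis i 1)\<bar> \<ge> M * exp (- S0 * (R * sqrt \<Lambda>))" and S0: "S0 \<ge> 0"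
    and E: "E = {t \<in> {a..b}. \<bar>u (y + t *\<^sub>R axis i 1)\<bar> \<le> M * exp (- (S0 + s * (3 + S0)) * (R * sqrt \<Lambda>))}" and s: "s \<ge> 0"
  shows "compact E" "measure lborel E \<le> 12 * (b - a) * exp (- s)"
proof -
  define \<sigma> where "\<sigma> = R * sqrt \<Lambda>"
  have s1': "\<sigma> \<ge> 1" using s1 by (simp add: \<sigma>_def)
  have "closed {t. \<bar>u (y + t *\<^sub>R axis i 1)\<bar> \<le> M * exp (- (S0 + s * (3 + S0)) * (R * sqrt \<Lambda>))}"
    by (intro closed_Collect_le continuous_intros u_line_cont)
  moreover have "E = {a..b} \<inter> {t. \<bar>u (y + t *\<^sub>R axis i 1)\<bar> \<le> M * exp (- (S0 + s * (3 + S0)) * (R * sqrt \<Lambda>))}"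
    unfolding E by auto
  ultimately show cE: "compact E" by (simp add: compact_Int_closed)
  define e where "e = measure lborel E"
  show "measure lborel E \<le> 12 * (b - a) * exp (- s)"
  proof (cases "e = 0")
    case True
    then show ?thesis using ab by (simp add: e_def)
  next
    case False
    then have e: "e > 0" by (simp add: e_def zero_less_measure_iff)
    \<comment> \<open>Just large enough for the remainder M e^(\<sigma> - n) to be at most half of
      the lower bound at \<open>t0\<close>. The resulting bound (3 + S0) \<sigma> for
      \<open>n\<close> fixes the step between successive thresholds.\<close>
    define n where "n = nat \<lceil>(1 + S0) * \<sigma> + 1\<rceil>"
    have "(1 + S0) * \<sigma> \<ge> 0" using S0 s1' by simp
    then have n: "real n \<ge> (1 + S0) * \<sigma> + 1" "real n \<le> (1 + S0) * \<sigma> + 2" "n \<ge> 1"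
      unfolding n_def by linarith+
    have nu: "real n \<le> (3 + S0) * \<sigma>" using n(2) s1' by (simp add: algebra_simps)
    have "\<bar>du i 0 (y + t0 *\<^sub>R axis i 1)\<bar> \<le> M * exp (- (S0 + s * (3 + S0)) * \<sigma>) * (6 * (b - a) / e) ^ n
       + (M * exp \<sigma>) * (6 * A / R * (b - a)) ^ n"
    proof (rule small_set_propagation[OF derivatives_line cE _ _ e n(3)])
      show "\<bar>du i n (y + t *\<^sub>R axis i 1)\<bar> \<le> M * exp \<sigma> * fact n * (6 * A / R) ^ n" if "t \<in> {a..b}" for t
        unfolding \<sigma>_def by (rule line_bound[OF reg M(1) line[OF that]])
    qed (use t0 in \<open>auto simp: E e_def \<sigma>_def\<close>)
    moreover have "(M * exp \<sigma>) * (6 * A / R * (b - a)) ^ n \<le> 1/2 * (M * exp (- S0 * \<sigma>))"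
    proof -
      have "(M * exp \<sigma>) * (6 * A / R * (b - a)) ^ n \<le> (M * exp \<sigma>) * exp (- 1) ^ n"
        using theta_small[OF reg, of "b - a"] ab M(2) by (intro mult_left_mono power_mono) (auto simp: r)
      also have "\<dots> = M * exp (\<sigma> - n)" by (simp add: exp_of_nat_mult[symmetric] exp_diff exp_minus field_simps)
      also have "\<dots> \<le> M * exp (- S0 * \<sigma> - 1)" using M(2) n(1) by (intro mult_left_mono) (auto simp: algebra_simps)
      also have "\<dots> = M * exp (- S0 * \<sigma>) / exp 1" by (simp add: exp_diff)
      also have "\<dots> \<le> M * exp (- S0 * \<sigma>) / 2" using M(2) two_le_exp by (intro divide_left_mono) auto
      finally show ?thesis by simp
    qed
    ultimately have "M * exp (- S0 * \<sigma>) \<le> M * exp (- (S0 + s * (3 + S0)) * \<sigma>) * (6 * (b - a) / e) ^ n + 1/2 * (M * exp (- S0 * \<sigma>))"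
      using t0(2) unfolding \<sigma>_def[symmetric] by (simp only: du.simps(1))
    then have "M * exp (- S0 * \<sigma>) \<le> 2 * (M * exp (- (S0 + s * (3 + S0)) * \<sigma>) * (6 * (b - a) / e) ^ n)" by linarith
    also have "\<dots> = M * exp (- S0 * \<sigma>) * (2 * exp (- (s * (3 + S0) * \<sigma>)) * (6 * (b - a) / e) ^ n)"
      by (simp add: exp_add[symmetric] algebra_simps)
    finally have "1 \<le> 2 * exp (- (s * (3 + S0) * \<sigma>)) * (6 * (b - a) / e) ^ n"
      using M(2) by (simp add: mult_le_cancel_left1)
    moreover have "1 \<le> 2 * exp (- Y) * P \<Longrightarrow> exp Y \<le> 2 * P" for Y P :: real by (simp add: exp_minus field_simps)
    ultimately have "exp (s * (3 + S0) * \<sigma>) \<le> 2 * (6 * (b - a) / e) ^ n" by blast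
    also have "\<dots> \<le> 2 ^ n * (6 * (b - a) / e) ^ n"
      using n(3) e ab power_increasing[of 1 n "2::real"] by (intro mult_right_mono) auto
    also have "\<dots> = (12 * (b - a) / e) ^ n" by (simp add: power_mult_distrib[symmetric])
    finally have "exp (s * (3 + S0) * \<sigma>) \<le> (12 * (b - a) / e) ^ n" .
    moreover have "exp s ^ n \<le> exp (s * (3 + S0) * \<sigma>)"
      using mult_left_mono[OF nu s] by (simp add: exp_of_nat_mult[symmetric] algebra_simps)
    ultimately have "exp s ^ n \<le> (12 * (b - a) / e) ^ n" by linarith
    then have "exp s \<le> 12 * (b - a) / e"
      using n(3) e ab by (subst (asm) power_mono_iff) auto
    then show ?thesis using e unfolding e_def[symmetric] by (simp add: exp_minus field_simps)
  qed
qed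

text \<open>For each t in [s, 2s] the boundary of the concentric square of radius t carries a zero,
  one coordinate of which differs from that of \<open>c\<close> by exactly t. Hence [s, 2s] is
  covered by four translated or reflected copies of the two projections.\<close>

lemma zero_projections:
  assumes q: "\<And>y. y \<in> square c (2 * s) \<Longrightarrow> \<bar>q y\<bar> \<le> \<Lambda>" and s: "s > 0" "2 * s * sqrt \<Lambda> \<le> 1"
    and z: "z \<in> square c s" "u z = 0"
  shows "s / 2 \<le> (\<Sum>i\<in>UNIV. measure lborel ((\<lambda>y. y $ i) ` {y \<in> square c (2 * s). u y = 0}))"
proof -
  let ?Z = "{y \<in> square c (2 * s). u y = 0}"
  have L0: "\<Lambda> \<ge> 0" using q[OF center_in_square[of "2 * s" c]] s by simp
  have "?Z = square c (2 * s) \<inter> {y. u y = 0}" by auto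
  then have cZ: "compact ?Z"
    by (simp add: compact_Int_closed compact_square closed_Collect_eq[OF u_cont continuous_on_const])
  define P where "P i = (\<lambda>y. y $ i) ` ?Z" for i
  have cP: "compact (P i)" for i
    unfolding P_def by (intro compact_continuous_image cZ continuous_intros)
  define Q where "Q i = (\<lambda>t. t - c $ i) ` P i" for i
  define Q' where "Q' i = (\<lambda>t. c $ i - t) ` P i" for i
  have cQ: "compact (Q i)" "compact (Q' i)" for i
    unfolding Q_def Q'_def by (intro compact_continuous_image cP continuous_intros)+
  have mQ: "measure lborel (Q i) = measure lborel (P i)" "measure lborel (Q' i) = measure lborel (P i)" for i
  proof -
    have "Q i = (+) (- c $ i) ` P i" by (auto simp: Q_def)
    then have "measure lebesgue (Q i) = measure lebesgue (P i)" using measure_translation by metis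
    moreover have *: "measure lebesgue S = measure lborel S" if "compact S" for S :: "real set"
      using that by (simp add: measure_completion borel_compact)
    ultimately show "measure lborel (Q i) = measure lborel (P i)" using cP cQ by simp
    have "Q' i = (\<lambda>x. (- 1) *\<^sub>R x + c $ i) ` P i" by (auto simp: Q'_def)
    then have "measure lebesgue (Q' i) = measure lebesgue (P i)"
      using measure_lebesgue_affine[of "-1" "c $ i" "P i"] by (simp add: algebra_simps)
    with * have "measure lborel (Q' i) = measure lborel (P i)" using cP cQ by simp
    then show "measure lborel (Q' i) = measure lborel (P i)" by simp
  qed
  have "{s..2 * s} \<subseteq> (Q 1 \<union> Q' 1) \<union> (Q 2 \<union> Q' 2)"
  proof
    fix t assume t: "t \<in> {s..2 * s}"
    have "\<exists>y\<in>square c t. \<exists>i. \<bar>y $ i - c $ i\<bar> = t \<and> u y = 0"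
    proof (rule zero_on_square_boundary)
      show "\<bar>q y\<bar> \<le> \<Lambda>" if "y \<in> square c t" for y using q that t square_mono[of t "2 * s" c] by auto
      have "t * sqrt \<Lambda> \<le> 2 * s * sqrt \<Lambda>" using t L0 by (intro mult_right_mono) auto
      then show "t * sqrt \<Lambda> \<le> 1" using s by simp
      show "z \<in> square c t" using z t square_mono[of s t c] by auto
    qed (use s t z in auto)
    then obtain y i where y: "y \<in> square c t" "\<bar>y $ i - c $ i\<bar> = t" "u y = 0" by blast
    then have "y $ i \<in> P i" unfolding P_def using t square_mono[of t "2 * s" c] by auto
    then have "t \<in> Q i \<union> Q' i" using y(2) unfolding Q_def Q'_def by (cases "y $ i \<ge> c $ i") force+
    then show "t \<in> (Q 1 \<union> Q' 1) \<union> (Q 2 \<union> Q' 2)" using exhaust_2[of i] by auto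
  qed
  then have "measure lborel {s..2 * s} \<le> measure lborel ((Q 1 \<union> Q' 1) \<union> (Q 2 \<union> Q' 2))"
    by (intro measure_mono_fmeasurable fmeasurable_compact compact_Un cQ) auto
  also have "\<dots> \<le> measure lborel (Q 1 \<union> Q' 1) + measure lborel (Q 2 \<union> Q' 2)"
    by (intro measure_Un_le) (auto intro!: sets.Un borel_compact cQ simp: cQ borel_compact)
  also have "\<dots> \<le> (measure lborel (Q 1) + measure lborel (Q' 1)) + (measure lborel (Q 2) + measure lborel (Q' 2))"
    by (intro add_mono measure_Un_le) (auto simp: cQ borel_compact)
  finally have "s \<le> 2 * measure lborel (P 1) + 2 * measure lborel (P 2)" using s unfolding mQ by simp
  then show ?thesis unfolding P_def sum_2 by simp
qed

end

lemma card_int_near: "finite {k::int. \<bar>a - of_int k\<bar> \<le> (1::real)}" "card {k::int. \<bar>a - of_int k\<bar> \<le> (1::real)} \<le> 3"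
proof -
  have sub: "{k::int. \<bar>a - of_int k\<bar> \<le> (1::real)} \<subseteq> {\<lceil>a\<rceil> - 1..\<lceil>a\<rceil> + 1}"
    by (auto simp: abs_le_iff) linarith+
  show "finite {k::int. \<bar>a - of_int k\<bar> \<le> (1::real)}" by (rule finite_subset[OF sub]) simp
  have "card {k::int. \<bar>a - of_int k\<bar> \<le> (1::real)} \<le> card {\<lceil>a\<rceil> - 1..\<lceil>a\<rceil> + 1}"
    by (rule card_mono[OF _ sub]) simp
  also have "\<dots> = 3" by simp
  finally show "card {k::int. \<bar>a - of_int k\<bar> \<le> (1::real)} \<le> 3" .
qed

text \<open>Centres of the grid through \<open>p\<close> whose closed squares of radius
  \<open>s\<close> tile the plane; the index gives the column and the row.\<close>

definition cell :: "real^2 \<Rightarrow> real \<Rightarrow> int \<times> int \<Rightarrow> real^2" where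
  "cell p s c = (\<chi> i. p $ i + 2 * s * of_int (if i = 1 then fst c else snd c))"

lemma card_cells_near:
  assumes s: "s > 0"
  shows "finite {c. z \<in> square (cell p s c) (2 * s)}" "card {c. z \<in> square (cell p s c) (2 * s)} \<le> 9"
proof -
  define a where "a i = (z $ i - p $ i) / (2 * s)" for i
  define B where "B i = {k::int. \<bar>a i - of_int k\<bar> \<le> (1::real)}" for i
  have eq: "\<bar>z $ i - (p $ i + 2 * s * of_int k)\<bar> \<le> 2 * s \<longleftrightarrow> k \<in> B i" for i k
  proof -
    have "z $ i - (p $ i + 2 * s * of_int k) = (2 * s) * (a i - of_int k)" using s by (simp add: a_def field_simps)
    then have "\<bar>z $ i - (p $ i + 2 * s * of_int k)\<bar> = (2 * s) * \<bar>a i - of_int k\<bar>" using s by (simp add: abs_mult)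
    then show ?thesis using s by (simp add: B_def)
  qed
  have sub: "{c. z \<in> square (cell p s c) (2 * s)} \<subseteq> B 1 \<times> B 2"
    using eq by (auto simp: square_def cell_def forall_2)
  have fin: "finite (B i)" "card (B i) \<le> 3" for i unfolding B_def by (rule card_int_near)+
  show "finite {c. z \<in> square (cell p s c) (2 * s)}" using finite_subset[OF sub] fin by blast
  have "card {c. z \<in> square (cell p s c) (2 * s)} \<le> card (B 1 \<times> B 2)" by (rule card_mono[OF _ sub]) (simp add: fin)
  also have "\<dots> \<le> 3 * 3" unfolding card_cartesian_product by (intro mult_mono fin) auto
  finally show "card {c. z \<in> square (cell p s c) (2 * s)} \<le> 9" by simp
qed

lemma cells_cover:
  assumes s: "s > 0" and z: "z \<in> square p r"
  obtains k l where "z \<in> square (cell p s (k, l)) s" "\<bar>k\<bar> \<le> \<lceil>r / (2 * s)\<rceil> + 1" "\<bar>l\<bar> \<le> \<lceil>r / (2 * s)\<rceil> + 1"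
proof -
  define k where "k i = round ((z $ i - p $ i) / (2 * s))" for i
  have near: "\<bar>z $ i - (p $ i + 2 * s * of_int (k i))\<bar> \<le> s" for i
  proof -
    have "\<bar>of_int (k i) - (z $ i - p $ i) / (2 * s)\<bar> \<le> 1 / 2" unfolding k_def by (rule of_int_round_abs_le)
    then have "(2 * s) * \<bar>(z $ i - p $ i) / (2 * s) - of_int (k i)\<bar> \<le> (2 * s) * (1 / 2)"
      using s by (intro mult_left_mono) (simp_all add: abs_minus_commute)
    also have "(2 * s) * \<bar>(z $ i - p $ i) / (2 * s) - of_int (k i)\<bar> = \<bar>(2 * s) * ((z $ i - p $ i) / (2 * s) - of_int (k i))\<bar>"
      using s by (simp add: abs_mult)
    also have "(2 * s) * ((z $ i - p $ i) / (2 * s) - of_int (k i)) = z $ i - (p $ i + 2 * s * of_int (k i))"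
      using s by (simp add: field_simps)
    finally show ?thesis by simp
  qed
  have bound: "\<bar>k i\<bar> \<le> \<lceil>r / (2 * s)\<rceil> + 1" for i
  proof -
    have zi: "\<bar>z $ i - p $ i\<bar> \<le> r" using z by (simp add: square_def)
    have "\<bar>of_int (k i)\<bar> \<le> \<bar>(z $ i - p $ i) / (2 * s)\<bar> + 1/2"
      using of_int_round_abs_le[of "(z $ i - p $ i) / (2 * s)"] unfolding k_def by linarith
    also have "\<bar>(z $ i - p $ i) / (2 * s)\<bar> \<le> r / (2 * s)" using zi s by (simp add: abs_divide divide_right_mono)
    finally have "real_of_int \<bar>k i\<bar> \<le> r / (2 * s) + 1/2" by simp
    then show ?thesis by linarith
  qed
  show ?thesis
    by (rule that[of "k 1" "k 2"]) (use near bound exhaust_2 in \<open>auto simp: square_def cell_def forall_2\<close>)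
qed

context schroedinger_solution
begin

text \<open>The squares overlap boundedly, so the sum is at most a multiple of the integral over lines of the
  number of zeros on the line. That number is at most of order \<open>(S + 1) \<sigma>\<close> unless \<open>u\<close> is below \<open>M e\<^sup>-\<^sup>S\<^sup>\<sigma>\<close> on
  the whole line, and the measure of such exceptional lines decays exponentially along a linearly growing sequence of
  exponents \<open>S\<close>.\<close>

lemma projections_sum:
  assumes reg: "regular A \<Lambda> R p" and M: "\<And>y. \<bar>u y\<bar> \<le> M" "M > 0" and s1: "R * sqrt \<Lambda> \<ge> 1" and r: "r = R / (80 * A)"
    and S0: "S0 \<ge> 0" and x: "x \<in> square p r" "\<bar>u x\<bar> \<ge> M * exp (- S0 * (R * sqrt \<Lambda>))"
    and s: "s > 0" and J: "finite J" "\<And>c. c \<in> J \<Longrightarrow> square (cell p s c) (2 * s) \<subseteq> square p (2 * r)"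
  shows "(\<Sum>c\<in>J. measure lborel ((\<lambda>y. y $ j) ` {y \<in> square (cell p s c) (2 * s). u y = 0})) \<le> 900 * (3 + S0) * (R * sqrt \<Lambda>) * r"
proof -
  obtain i where ij: "i \<noteq> j" using ex_other_2 by metis
  define \<sigma> where "\<sigma> = R * sqrt \<Lambda>"
  have RA: "R > 0" "A \<ge> 3" using reg by (auto simp: regular_def)
  then have r0: "r > 0" unfolding r by simp
  have rR: "2 * r \<le> R / 2" using RA unfolding r by (simp add: field_simps)
  define K where "K c = (\<lambda>y. y $ j) ` {y \<in> square (cell p s c) (2 * s). u y = 0}" for c
  have cK: "compact (K c)" for c
  proof -
    have "{y \<in> square (cell p s c) (2 * s). u y = 0} = square (cell p s c) (2 * s) \<inter> {y. u y = 0}" by auto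
    then have "compact {y \<in> square (cell p s c) (2 * s). u y = 0}"
      by (simp add: compact_Int_closed compact_square closed_Collect_eq[OF u_cont continuous_on_const])
    then show ?thesis unfolding K_def by (intro compact_continuous_image continuous_intros)
  qed
  define pt where "pt a b = (\<chi> k. if k = i then a else b)" for a b :: real
  have ij2: "k = i \<or> k = j" for k using UNIV_2_pair[OF ij] by auto
  have pt_i: "pt 0 b + a *\<^sub>R axis i 1 = pt a b" for a b
    by (auto simp: vec_eq_iff pt_def axis_def)
  have pt_j: "pt a 0 + b *\<^sub>R axis j 1 = pt a b" for a b
    unfolding vec_eq_iff
  proof
    fix k show "(pt a 0 + b *\<^sub>R axis j 1) $ k = pt a b $ k" using ij2[of k] ij by (elim disjE) (simp_all add: pt_def axis_def)
  qed
  have pt_eq: "y = pt (y $ i) (y $ j)" for y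
    unfolding vec_eq_iff
  proof
    fix k show "y $ k = pt (y $ i) (y $ j) $ k" using ij2[of k] ij by (elim disjE) (simp_all add: pt_def)
  qed
  have all2: "(\<forall>k. P k) \<longleftrightarrow> P i \<and> P j" for P using ij2 by metis
  have pt_sq: "pt a b \<in> square p t \<longleftrightarrow> \<bar>a - p $ i\<bar> \<le> t \<and> \<bar>b - p $ j\<bar> \<le> t" for a b t
    unfolding square_def mem_Collect_eq all2 using ij by (simp add: pt_def)
  have sq2: "pt a b \<in> square p (R / 2)" if "a \<in> {p $ i - 2 * r..p $ i + 2 * r}" "b \<in> {p $ j - 2 * r..p $ j + 2 * r}" for a b
  proof -
    have "\<bar>a - p $ i\<bar> \<le> 2 * r" "\<bar>b - p $ j\<bar> \<le> 2 * r" using that by (simp_all add: abs_le_iff algebra_simps)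
    then show ?thesis unfolding pt_sq using rR by (auto intro: order_trans)
  qed
  let ?Ii = "{p $ i - 2 * r..p $ i + 2 * r}" and ?Ij = "{p $ j - 2 * r..p $ j + 2 * r}"
  have xI: "x $ i \<in> ?Ii" "x $ j \<in> ?Ij" using x(1) r0 by (auto simp: square_def abs_le_iff) (smt (verit))+
  \<comment> \<open>The slice through the good point \<open>x\<close>, transverse to the lines of
    constant j-coordinate. If \<open>t\<close> is outside \<open>E m\<close>, the point of the slice
    with j-coordinate \<open>t\<close> shows that \<open>u\<close> is not everywhere below the m-th
    threshold on the line at \<open>t\<close>, as the zero count requires.\<close>
  define E where "E m = {t \<in> ?Ij. \<bar>u (pt (x $ i) 0 + t *\<^sub>R axis j 1)\<bar> \<le> M * exp (- (S0 + real m * (3 + S0)) * (R * sqrt \<Lambda>))}" for m :: nat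
  have E: "compact (E m)" "measure lborel (E m) \<le> 48 * r * (1/2) ^ m" for m
  proof -
    have a: "pt (x $ i) 0 + t *\<^sub>R axis j 1 \<in> square p (R / 2)" if "t \<in> ?Ij" for t
      unfolding pt_j by (rule sq2[OF xI(1) that])
    have b: "p $ j - 2 * r < p $ j + 2 * r" "p $ j + 2 * r - (p $ j - 2 * r) \<le> 4 * r" using r0 by auto
    have c: "\<bar>u (pt (x $ i) 0 + (x $ j) *\<^sub>R axis j 1)\<bar> \<ge> M * exp (- S0 * (R * sqrt \<Lambda>))"
      unfolding pt_j pt_eq[symmetric] by (rule x(2))
    note L = line_sublevel_measure[OF reg M s1 r a b xI(2) c S0 E_def[of m], simplified]
    show "compact (E m)" by (rule L(1))
    have "measure lborel (E m) \<le> 12 * (4 * r) * exp (- real m)" using L(2) by simp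
    also have "exp (- real m) = exp (- 1) ^ m" by (simp add: exp_of_nat_mult[symmetric])
    also have "12 * (4 * r) * exp (- 1) ^ m \<le> 12 * (4 * r) * (1/2) ^ m"
      using r0 two_le_exp by (intro mult_left_mono power_mono) (auto simp: exp_minus field_simps)
    finally show "measure lborel (E m) \<le> 48 * r * (1/2) ^ m" by simp
  qed
  define \<kappa> where "\<kappa> = 9 * (3 + S0) * \<sigma>"
  have k0: "\<kappa> > 0" using S0 s1 by (simp add: \<kappa>_def \<sigma>_def)
  define Jt where "Jt t = {c \<in> J. t \<in> K c}" for t
  have KI: "K c \<subseteq> ?Ij" if cJ: "c \<in> J" for c
  proof
    fix a assume "a \<in> K c"
    then obtain y where "y \<in> square p (2 * r)" "a = y $ j" using J(2)[OF cJ] unfolding K_def by blast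
    then have "\<bar>a - p $ j\<bar> \<le> 2 * r" by (simp add: square_def)
    then show "a \<in> ?Ij" by (simp add: abs_le_iff algebra_simps)
  qed
  \<comment> \<open>Each cell whose projection contains \<open>t\<close> supplies a zero on the line
    at \<open>t\<close>, and one zero lies in at most nine of the doubled cells.\<close>
  have count: "real (card (Jt t)) \<le> \<kappa> * (real m + 1)" if t: "t \<in> ?Ij" "t \<notin> E m" for t m
  proof -
    have "\<forall>c\<in>Jt t. \<exists>y. y \<in> square (cell p s c) (2 * s) \<and> u y = 0 \<and> y $ j = t"
      unfolding Jt_def K_def by auto
    then obtain Y where Y: "\<And>c. c \<in> Jt t \<Longrightarrow> Y c \<in> square (cell p s c) (2 * s) \<and> u (Y c) = 0 \<and> Y c $ j = t"
      by metis
    define Zs where "Zs = (\<lambda>c. Y c $ i) ` Jt t"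
    have fJ: "finite (Jt t)" using J(1) by (simp add: Jt_def)
    have Yp: "Y c = pt (Y c $ i) t" if "c \<in> Jt t" for c using pt_eq[of "Y c"] Y[OF that] by simp
    have "real (card Zs) \<le> (1 + (S0 + real m * (3 + S0))) * (R * sqrt \<Lambda>)"
    proof (rule line_zero_count[OF reg M r])
      show "pt 0 t + a *\<^sub>R axis i 1 \<in> square p (R / 2)" if "a \<in> ?Ii" for a
        unfolding pt_i by (rule sq2[OF that t(1)])
      show "p $ i - 2 * r \<le> p $ i + 2 * r" "p $ i + 2 * r - (p $ i - 2 * r) \<le> 4 * r" using r0 by auto
      show "x $ i \<in> ?Ii" by (rule xI)
      show "\<bar>u (pt 0 t + x $ i *\<^sub>R axis i 1)\<bar> \<ge> M * exp (- (S0 + real m * (3 + S0)) * (R * sqrt \<Lambda>))"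
        using t unfolding E_def pt_i pt_j by auto
      show "finite Zs" unfolding Zs_def using fJ by simp
      show "Zs \<subseteq> ?Ii"
      proof
        fix a assume "a \<in> Zs"
        then obtain c where c: "c \<in> Jt t" "a = Y c $ i" by (auto simp: Zs_def)
        then have "Y c \<in> square p (2 * r)" using Y[OF c(1)] J(2)[of c] by (auto simp: Jt_def)
        then show "a \<in> ?Ii" using c by (auto simp: square_def abs_le_iff) (smt (verit))+
      qed
      show "u (pt 0 t + a *\<^sub>R axis i 1) = 0" if "a \<in> Zs" for a
        using that Y Yp unfolding Zs_def pt_i by fastforce
    qed
    also have "\<dots> \<le> ((3 + S0) * (real m + 1)) * \<sigma>"
      unfolding \<sigma>_def using s1 by (intro mult_right_mono) (auto simp: algebra_simps)
    finally have cZ: "real (card Zs) \<le> ((3 + S0) * (real m + 1)) * \<sigma>" .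
    have fZ: "finite Zs" unfolding Zs_def using fJ by simp
    have "Jt t \<subseteq> (\<Union>a\<in>Zs. {c. pt a t \<in> square (cell p s c) (2 * s)})"
      using Y Yp unfolding Zs_def by fastforce
    then have "card (Jt t) \<le> card (\<Union>a\<in>Zs. {c. pt a t \<in> square (cell p s c) (2 * s)})"
      by (intro card_mono finite_UN_I fZ card_cells_near s)
    also have "\<dots> \<le> (\<Sum>a\<in>Zs. card {c. pt a t \<in> square (cell p s c) (2 * s)})" by (rule card_UN_le[OF fZ])
    also have "\<dots> \<le> (\<Sum>a\<in>Zs. 9)" by (intro sum_mono card_cells_near s)
    finally have "card (Jt t) \<le> 9 * card Zs" by simp
    then have "real (card (Jt t)) \<le> 9 * real (card Zs)" by linarith
    also have "\<dots> \<le> 9 * (((3 + S0) * (real m + 1)) * \<sigma>)" using cZ by simp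
    finally show ?thesis by (simp add: \<kappa>_def algebra_simps)
  qed
  have level: "\<exists>m. real (card (Jt t)) \<le> \<kappa> * (real m + 1) \<and> (\<forall>m'<m. t \<in> E m')" if t: "t \<in> ?Ij" for t
  proof (cases "\<exists>m. t \<notin> E m")
    case True
    define m where "m = (LEAST m. t \<notin> E m)"
    have "t \<notin> E m" unfolding m_def using True by (rule LeastI_ex)
    moreover have "\<forall>m'<m. t \<in> E m'" unfolding m_def using not_less_Least by blast
    ultimately show ?thesis using count[OF t] by blast
  next
    case False
    \<comment> \<open>If \<open>t\<close> lies in every \<open>E m\<close>, the series of indicators
      diverges; any \<open>m\<close> that dominates the finite count will do.\<close>
    obtain m :: nat where "real (card (Jt t)) / \<kappa> \<le> real m" using real_arch_simple by blast
    then have "real (card (Jt t)) \<le> \<kappa> * (real m + 1)" using k0 by (simp add: field_simps)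
    then show ?thesis using False by blast
  qed
  have point: "(\<Sum>c\<in>J. indicator (K c) t) \<le> ennreal \<kappa> * (indicator ?Ij t + (\<Sum>m. indicator (E m) t))" for t
  proof (cases "t \<in> ?Ij")
    case False
    then have "indicator (K c) t = (0::ennreal)" if "c \<in> J" for c using KI[OF that] by (auto simp: indicator_def)
    then show ?thesis by simp
  next
    case True
    obtain m where m: "real (card (Jt t)) \<le> \<kappa> * (real m + 1)" "\<forall>m'<m. t \<in> E m'" using level[OF True] by blast
    have "(\<Sum>c\<in>J. indicator (K c) t) = (\<Sum>c\<in>J. if t \<in> K c then 1 else (0::ennreal))"
      by (intro sum.cong) (auto simp: indicator_def)
    also have "\<dots> = (\<Sum>c\<in>Jt t. 1)" unfolding Jt_def using J(1) by (simp add: sum.If_cases Int_def)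
    also have "\<dots> = ennreal (real (card (Jt t)))" by (simp add: ennreal_of_nat_eq_real_of_nat)
    also have "\<dots> \<le> ennreal (\<kappa> * (1 + real m))" using m(1) by (intro ennreal_leI) (simp add: add.commute)
    also have "\<dots> = ennreal \<kappa> * (1 + ennreal (real m))" using k0 by (simp add: ennreal_mult)
    \<comment> \<open>\<open>t\<close> lies in the first \<open>m\<close> exceptional sets, so
      \<open>m\<close> is bounded by the sum of their indicators; integration turns it into the sum
      of their measures.\<close>
    also have "ennreal (real m) = (\<Sum>m'<m. indicator (E m') t)"
      using m(2) by (simp add: ennreal_of_nat_eq_real_of_nat)
    also have "\<dots> \<le> (\<Sum>m. indicator (E m) t)" by (rule sum_le_suminf) auto
    finally show ?thesis using True by (simp add: mult_left_mono add_left_mono)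
  qed
  have mE: "E m \<in> sets lborel" for m using E(1) by (simp add: borel_compact)
  have mK: "K c \<in> sets lborel" for c using cK by (simp add: borel_compact)
  have fin: "emeasure lborel S = ennreal (measure lborel S)" if "compact S" for S :: "real set"
    using fmeasurable_compact[OF that] by (intro emeasure_eq_ennreal_measure) (auto simp: fmeasurable_def)
  have "ennreal (\<Sum>c\<in>J. measure lborel (K c)) = (\<Sum>c\<in>J. emeasure lborel (K c))"
    by (subst sum_ennreal[symmetric]) (auto simp: fin[OF cK])
  also have "\<dots> = (\<integral>\<^sup>+t. (\<Sum>c\<in>J. indicator (K c) t) \<partial>lborel)"
    using mK by (simp add: nn_integral_sum)
  also have "\<dots> \<le> (\<integral>\<^sup>+t. ennreal \<kappa> * (indicator ?Ij t + (\<Sum>m. indicator (E m) t)) \<partial>lborel)"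
    by (intro nn_integral_mono point)
  also have "\<dots> = ennreal \<kappa> * (emeasure lborel ?Ij + (\<Sum>m. emeasure lborel (E m)))"
    using mE by (simp add: nn_integral_cmult nn_integral_add nn_integral_suminf)
  also have "\<dots> \<le> ennreal \<kappa> * (ennreal (4 * r) + (\<Sum>m. ennreal (48 * r * (1/2) ^ m)))"
  proof (intro mult_left_mono add_mono suminf_le)
    show "emeasure lborel ?Ij \<le> ennreal (4 * r)" using r0 by simp
    show "emeasure lborel (E m) \<le> ennreal (48 * r * (1/2) ^ m)" for m
      using E(2)[of m] unfolding fin[OF E(1)] by (rule ennreal_leI)
  qed auto
  also have "(\<Sum>m. ennreal (48 * r * (1/2) ^ m)) = ennreal (96 * r)"
  proof -
    have "(\<lambda>m. 48 * r * (1/2) ^ m) sums (48 * r * (1 / (1 - 1/2)))" by (intro sums_mult geometric_sums) simp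
    then have "(\<lambda>m. ennreal (48 * r * (1/2) ^ m)) sums ennreal (96 * r)" using r0 by (subst sums_ennreal) auto
    then show ?thesis by (rule sums_unique[symmetric])
  qed
  \<comment> \<open>The whole range contributes 4 r, the exceptional sets 48 r times 2; with the
    overlap 9 inside \<kappa> the constant is 900.\<close>
  also have "ennreal \<kappa> * (ennreal (4 * r) + ennreal (96 * r)) = ennreal (\<kappa> * (100 * r))"
  proof -
    have "ennreal (4 * r) + ennreal (96 * r) = ennreal (100 * r)"
      using r0 by (subst ennreal_plus[symmetric]) auto
    then show ?thesis using k0 r0 by (simp only: ennreal_mult[of \<kappa> "100 * r"])
  qed
  finally have "(\<Sum>c\<in>J. measure lborel (K c)) \<le> \<kappa> * (100 * r)"
    using k0 r0 by (subst (asm) ennreal_le_iff) auto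
  then show ?thesis unfolding K_def \<kappa>_def \<sigma>_def by (simp add: algebra_simps)
qed

text \<open>Every cell of the grid that meets the nodal set contributes at least s/2 to the sum of
  projections, which \<open>projections_sum\<close> bounds. The bound on the total size of the cover
  is independent of \<open>s\<close>, so \<open>s\<close> may later tend to 0.\<close>

lemma nodal_cover:
  assumes reg: "regular A \<Lambda> R p" and M: "\<And>y. \<bar>u y\<bar> \<le> M" "M > 0" and s1: "R * sqrt \<Lambda> \<ge> 1" and r: "r = R / (80 * A)"
    and S0: "S0 \<ge> 0" and x: "x \<in> square p r" "\<bar>u x\<bar> \<ge> M * exp (- S0 * (R * sqrt \<Lambda>))"
    and s: "s > 0" "3 * s \<le> r" "2 * s * sqrt \<Lambda> \<le> 1"
  shows "\<exists>J. finite J \<and> {z \<in> square p r. u z = 0} \<subseteq> (\<Union>c\<in>J. square c s) \<and>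
     real (card J) * s \<le> 3600 * (3 + S0) * (R * sqrt \<Lambda>) * r"
proof -
  have RA: "R > 0" "A \<ge> 3" using reg by (auto simp: regular_def)
  have rR: "2 * r \<le> R" using RA unfolding r by (simp add: field_simps)
  define N where "N = \<lceil>r / (2 * s)\<rceil> + 1"
  define J where "J = {c \<in> {-N..N} \<times> {-N..N}. \<exists>z\<in>square p r. z \<in> square (cell p s c) s \<and> u z = 0}"
  have fJ: "finite J" unfolding J_def by simp
  have sub: "square (cell p s c) (2 * s) \<subseteq> square p (2 * r)" if cJ: "c \<in> J" for c
  proof
    fix y assume y: "y \<in> square (cell p s c) (2 * s)"
    obtain z where z: "z \<in> square p r" "z \<in> square (cell p s c) s" using cJ unfolding J_def by blast
    have "cell p s c \<in> square p (r + s)" using square_trans[OF z(1)] z(2) square_commute by blast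
    then show "y \<in> square p (2 * r)" using square_trans[OF _ y] s by simp
  qed
  have q: "\<bar>q y\<bar> \<le> \<Lambda>" if "c \<in> J" "y \<in> square (cell p s c) (2 * s)" for c y
  proof -
    have "y \<in> square p R" using sub[OF that(1)] that(2) square_mono[OF rR] by blast
    then have "\<bar>dq 1 0 y\<bar> \<le> \<Lambda> * fact 0 * (A / R) ^ 0" using reg unfolding regular_def by blast
    then show ?thesis by (simp add: dq_0)
  qed
  have cover: "{z \<in> square p r. u z = 0} \<subseteq> (\<Union>c\<in>cell p s ` J. square c s)"
  proof
    fix z assume z: "z \<in> {z \<in> square p r. u z = 0}"
    obtain k l where kl: "z \<in> square (cell p s (k, l)) s" "\<bar>k\<bar> \<le> N" "\<bar>l\<bar> \<le> N"
      using cells_cover[OF s(1), of z p r] z unfolding N_def by blast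
    then have "(k, l) \<in> J" using z unfolding J_def by auto
    then show "z \<in> (\<Union>c\<in>cell p s ` J. square c s)" using kl by blast
  qed
  have "real (card J) * (s / 2) = (\<Sum>c\<in>J. s / 2)" by simp
  also have "\<dots> \<le> (\<Sum>c\<in>J. \<Sum>i\<in>UNIV. measure lborel ((\<lambda>y. y $ i) ` {y \<in> square (cell p s c) (2 * s). u y = 0}))"
  proof (intro sum_mono)
    fix c assume c: "c \<in> J"
    then obtain z where z: "z \<in> square (cell p s c) s" "u z = 0" unfolding J_def by blast
    show "s / 2 \<le> (\<Sum>i\<in>UNIV. measure lborel ((\<lambda>y. y $ i) ` {y \<in> square (cell p s c) (2 * s). u y = 0}))"
      by (rule zero_projections[OF q[OF c] s(1,3) z])
  qed
  also have "\<dots> = (\<Sum>i\<in>UNIV. \<Sum>c\<in>J. measure lborel ((\<lambda>y. y $ i) ` {y \<in> square (cell p s c) (2 * s). u y = 0}))"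
    by (rule sum.swap)
  also have "\<dots> \<le> (\<Sum>i\<in>(UNIV :: 2 set). 900 * (3 + S0) * (R * sqrt \<Lambda>) * r)"
    by (intro sum_mono projections_sum[OF reg M s1 r S0 x s(1) fJ sub])
  also have "\<dots> = 1800 * (3 + S0) * (R * sqrt \<Lambda>) * r" by (simp add: sum_2)
  finally have "real (card J) * s \<le> 3600 * (3 + S0) * (R * sqrt \<Lambda>) * r" by (simp add: algebra_simps)
  moreover have "real (card (cell p s ` J)) * s \<le> real (card J) * s"
    using s fJ by (intro mult_right_mono) (auto intro: card_image_le)
  ultimately show ?thesis using cover fJ by (intro exI[of _ "cell p s ` J"]) auto
qed

end

section \<open>An identity of Rellich\<close>

text \<open>A continuously differentiable truncation; the divergence argument differentiates the
  cutoff only once.\<close>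

definition pos_sq :: "real \<Rightarrow> real" where "pos_sq t = (max 0 t)\<^sup>2"

lemma pos_sq_deriv: "(pos_sq has_real_derivative 2 * max 0 t) (at t)"
proof -
  consider "t > 0" | "t < 0" | "t = 0" by linarith
  then show ?thesis
  proof cases
    case 1
    have d: "((\<lambda>t. t\<^sup>2) has_real_derivative 2 * max 0 t) (at t)" using 1 by (auto intro!: derivative_eq_intros)
    have e: "eventually (\<lambda>s. s\<^sup>2 = pos_sq s) (nhds t)"
      using 1 eventually_nhds_in_open[of "{0<..}" t] by (auto simp: pos_sq_def elim: eventually_mono)
    show ?thesis by (rule DERIV_cong_ev[OF refl e refl, THEN iffD1, OF d])
  next
    case 2
    have d: "((\<lambda>t. 0) has_real_derivative 2 * max 0 t) (at t)" using 2 by simp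
    have e: "eventually (\<lambda>s. 0 = pos_sq s) (nhds t)"
      using 2 eventually_nhds_in_open[of "{..<0}" t] by (auto simp: pos_sq_def elim: eventually_mono)
    show ?thesis by (rule DERIV_cong_ev[OF refl e refl, THEN iffD1, OF d])
  next
    case 3
    have "((\<lambda>h. pos_sq h / h) \<longlongrightarrow> 0) (at 0)"
    proof (rule Lim_null_comparison)
      show "\<forall>\<^sub>F h in at 0. norm (pos_sq h / h) \<le> \<bar>h\<bar>"
        by (intro always_eventually) (auto simp: pos_sq_def max_def power2_eq_square)
      show "((\<lambda>h::real. \<bar>h\<bar>) \<longlongrightarrow> 0) (at 0)" by (auto intro!: tendsto_eq_intros)
    qed
    then show ?thesis using 3 by (simp add: has_field_derivative_iff pos_sq_def)
  qed
qed

text \<open>Equal to 1 up to 1 and to 0 from 2 on, with a continuous derivative.\<close>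

definition cutoff :: "real \<Rightarrow> real" where "cutoff s = pos_sq (1 - pos_sq (s - 1))"

definition cutoff' :: "real \<Rightarrow> real" where "cutoff' s = 2 * max 0 (1 - pos_sq (s - 1)) * (- (2 * max 0 (s - 1)))"

lemma cutoff_deriv: "(cutoff has_real_derivative cutoff' s) (at s)"
proof -
  have "((\<lambda>s. s - 1) has_real_derivative 1) (at s)" by (auto intro!: derivative_eq_intros)
  from DERIV_chain2[OF pos_sq_deriv this] have "((\<lambda>s. 1 - pos_sq (s - 1)) has_real_derivative - (2 * max 0 (s - 1))) (at s)"
    by (auto intro!: derivative_eq_intros)
  from DERIV_chain2[OF pos_sq_deriv this] show ?thesis unfolding cutoff_def[abs_def] cutoff'_def by simp
qed

lemma cutoff_cont: "continuous_on UNIV cutoff" "continuous_on UNIV cutoff'"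
  unfolding cutoff_def cutoff'_def pos_sq_def by (intro continuous_intros)+

lemma cutoff_nonneg: "cutoff s \<ge> 0" by (simp add: cutoff_def pos_sq_def)

lemma cutoff_eq_1: "s \<le> 1 \<Longrightarrow> cutoff s = 1" by (simp add: cutoff_def pos_sq_def max_def)

lemma cutoff'_eq_0: "s \<le> 1 \<Longrightarrow> cutoff' s = 0" by (simp add: cutoff'_def max_def)

lemma cutoff_eq_0:
  assumes "s \<ge> 2"
  shows "cutoff s = 0" "cutoff' s = 0"
proof -
  have "1 \<le> pos_sq (s - 1)" using assms by (simp add: pos_sq_def one_le_power)
  then show "cutoff s = 0" "cutoff' s = 0" by (simp_all add: cutoff_def cutoff'_def pos_sq_def[of "1 - _"] max_def)
qed

lemma cutoff'_bound: "\<bar>cutoff' s\<bar> \<le> 4"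
proof (cases "s \<le> 1 \<or> s \<ge> 2")
  case True
  then show ?thesis using cutoff'_eq_0 cutoff_eq_0 by fastforce
next
  case False
  have "\<bar>2 * max 0 (1 - pos_sq (s - 1))\<bar> \<le> 2" using zero_le_power2[of "max 0 (s - 1)"] by (simp add: pos_sq_def)
  moreover have "\<bar>- (2 * max 0 (s - 1))\<bar> \<le> 2" using False by simp
  ultimately have "\<bar>cutoff' s\<bar> \<le> 2 * 2" unfolding cutoff'_def abs_mult[of "2 * max 0 (1 - pos_sq (s - 1))"] by (intro mult_mono) auto
  then show ?thesis by simp
qed

context schroedinger_solution
begin

text \<open>Rellich's identity: with \<open>E = (x \<cdot> \<nabla>u)\<nabla>u - (|\<nabla>u|\<^sup>2/2) x - (q u\<^sup>2/2) x\<close> one has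
  \<open>div E = - (q + x \<cdot> \<nabla>q / 2) u\<^sup>2\<close> in the plane. It replaces a Carleman estimate for
  propagating smallness across the disc where \<open>q\<close> is not uniformly analytic.\<close>

lemma rellich_bound:
  assumes \<alpha>: "\<alpha> > 0" and \<mu>: "\<mu> > 0"
    and pos: "\<And>x. norm x \<le> 2 * \<alpha> \<Longrightarrow> - q x - 1/2 * (\<Sum>i\<in>UNIV. x $ i * dq i 1 x) \<ge> \<mu>"
    and G: "\<And>x i. \<alpha> \<le> norm x \<Longrightarrow> norm x \<le> 2 * \<alpha> \<Longrightarrow> \<bar>du i 1 x\<bar> \<le> G"
    and m: "\<And>x. \<alpha> \<le> norm x \<Longrightarrow> norm x \<le> 2 * \<alpha> \<Longrightarrow> \<bar>u x\<bar> \<le> m"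
    and L: "\<And>x. \<alpha> \<le> norm x \<Longrightarrow> norm x \<le> 2 * \<alpha> \<Longrightarrow> \<bar>q x\<bar> \<le> \<Lambda>"
  shows "\<mu> * integral (square 0 (\<alpha> / 2)) (\<lambda>x. (u x)\<^sup>2) \<le> 2560 * \<alpha>\<^sup>2 * (G\<^sup>2 + \<Lambda> * m\<^sup>2)"
proof -
  obtain u2 where u2: "\<And>i j. has_partial j (du i 1) (u2 i j)" "\<And>i j. continuous_on UNIV (u2 i j)"
    "\<And>i j. u2 i j = u2 j i" "\<And>x. (\<Sum>i\<in>UNIV. u2 i i x) = q x * u x"
    by (rule second_partials) blast
  have u1: "has_partial i u (du i 1)" for i using du_partial[of i 0] by simp
  have q1: "has_partial i q (dq i 1)" for i using dq_partial[of i 0] by (simp add: dq_0)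
  have cq: "continuous_on UNIV q" using dq_cont[of 1 0] by (simp add: dq_0)
  let ?a = "\<lambda>x. du 1 1 x" and ?b = "\<lambda>x. du 2 1 x"
  define X where "X x = x $ 1 * ?a x + x $ 2 * ?b x" for x
  define D where "D x = ?a x * ?a x + ?b x * ?b x" for x
  define w where "w x = x $ 1 * x $ 1 + x $ 2 * x $ 2" for x :: "real^2"
  \<comment> \<open>The squared norm \<open>w\<close> keeps the cutoff differentiable at the origin;
    the transition takes place for norms between \<alpha> and 2 \<alpha>.\<close>
  define ch where "ch x = cutoff ((1 / \<alpha>\<^sup>2) * w x)" for x
  define ch' where "ch' x = cutoff' ((1 / \<alpha>\<^sup>2) * w x)" for x
  define E where "E i x = X x * du i 1 x - 1/2 * (D x * x $ i) - 1/2 * ((q x * (u x * u x)) * x $ i)" for i x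
  define X1 where "X1 i x = ((if 1 = i then 1 else 0) * ?a x + x $ 1 * u2 1 i x) + ((if 2 = i then 1 else 0) * ?b x + x $ 2 * u2 2 i x)" for i x
  define D1 where "D1 i x = (u2 1 i x * ?a x + ?a x * u2 1 i x) + (u2 2 i x * ?b x + ?b x * u2 2 i x)" for i x
  \<comment> \<open>The trivially true conditionals are the shape in which
    \<open>has_partial_nth\<close> delivers the derivative of a coordinate.\<close>
  define E1 where "E1 i x = (X1 i x * du i 1 x + X x * u2 i i x) - 1/2 * (D1 i x * x $ i + D x * (if i = i then 1 else 0))
     - 1/2 * ((dq i 1 x * (u x * u x) + q x * (du i 1 x * u x + u x * du i 1 x)) * x $ i + (q x * (u x * u x)) * (if i = i then 1 else 0))" for i x
  have pX: "has_partial i X (X1 i)" for i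
    unfolding X_def X1_def by (intro has_partial_add has_partial_mult has_partial_nth u2)
  have pD: "has_partial i D (D1 i)" for i
    unfolding D_def D1_def by (intro has_partial_add has_partial_mult u2)
  have pE: "has_partial i (E i) (E1 i)" for i
    unfolding E_def E1_def by (intro has_partial_diff has_partial_mult has_partial_cmult has_partial_nth u2 u1 q1 pX pD)
  have pw: "has_partial i w (\<lambda>x. 2 * x $ i)" for i
    by (rule has_partial_cong[OF has_partial_add[OF has_partial_mult[OF has_partial_nth has_partial_nth] has_partial_mult[OF has_partial_nth has_partial_nth], of i 1 1 2 2]])
      (use exhaust_2[of i] in \<open>auto simp: w_def\<close>)
  have pch: "has_partial i ch (\<lambda>x. ch' x * ((1 / \<alpha>\<^sup>2) * (2 * x $ i)))" for i
    unfolding ch_def ch'_def by (rule has_partial_chain[OF has_partial_cmult[OF pw] cutoff_deriv])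
  define F where "F i x = (ch' x * ((1 / \<alpha>\<^sup>2) * (2 * x $ i))) * E i x + ch x * E1 i x" for i x
  have pF: "has_partial i (\<lambda>x. ch x * E i x) (F i)" for i
    unfolding F_def by (rule has_partial_mult[OF pch pE])
  have cw: "continuous_on UNIV w" unfolding w_def by (intro continuous_intros)
  have cch: "continuous_on UNIV ch" "continuous_on UNIV ch'"
    unfolding ch_def ch'_def by (intro cont_compose_UNIV[OF cutoff_cont(1)] cont_compose_UNIV[OF cutoff_cont(2)] continuous_intros cw)+
  have cX: "continuous_on UNIV X" "continuous_on UNIV D" "continuous_on UNIV (X1 i)" "continuous_on UNIV (D1 i)" for i
    unfolding X_def D_def X1_def D1_def by (intro continuous_intros du_cont u2)+
  have cE: "continuous_on UNIV (E i)" "continuous_on UNIV (E1 i)" for i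
    unfolding E_def E1_def by (intro continuous_intros du_cont u2 cX u_cont cq dq_cont)+
  have cF: "continuous_on UNIV (F i)" for i
    unfolding F_def by (intro continuous_intros cch cE)
  have wn: "w x = (norm x)\<^sup>2" for x
    by (simp add: w_def norm_vec_def L2_set_def sum_2 power2_eq_square)
  have far: "ch x = 0" "ch' x = 0" if "norm x \<ge> 2 * \<alpha>" for x
  proof -
    have "(2 * \<alpha>)\<^sup>2 \<le> w x" unfolding wn using that \<alpha> by (intro power_mono) auto
    then have "(1 / \<alpha>\<^sup>2) * (2 * \<alpha>)\<^sup>2 \<le> (1 / \<alpha>\<^sup>2) * w x" by (intro mult_left_mono) auto
    moreover have "(1 / \<alpha>\<^sup>2) * (2 * \<alpha>)\<^sup>2 = 4" using \<alpha> by (simp add: power_mult_distrib)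
    ultimately have "2 \<le> (1 / \<alpha>\<^sup>2) * w x" by linarith
    then show "ch x = 0" "ch' x = 0" unfolding ch_def ch'_def by (simp_all only: cutoff_eq_0)
  qed
  have near: "ch x = 1" "ch' x = 0" if "norm x \<le> \<alpha>" for x
  proof -
    have "w x \<le> \<alpha>\<^sup>2" unfolding wn using that by (intro power_mono) auto
    then have "(1 / \<alpha>\<^sup>2) * w x \<le> 1" using \<alpha> by (simp add: field_simps)
    then show "ch x = 1" "ch' x = 0" unfolding ch_def ch'_def by (simp_all only: cutoff_eq_1 cutoff'_eq_0)
  qed
  have out: "norm x \<ge> 2 * \<alpha>" if "x \<notin> square 0 (2 * \<alpha>)" for x
    using that norm_in_square[of x 0 "2 * \<alpha>"] by force
  \<comment> \<open>In dimension two the terms with the squared gradient cancel, and the second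
    derivatives outside the Laplacian cancel by symmetry.\<close>
  have divE: "(\<Sum>i\<in>UNIV. E1 i x) = - (q x + 1/2 * (\<Sum>i\<in>UNIV. x $ i * dq i 1 x)) * (u x)\<^sup>2" for x
  proof -
    have l: "u2 1 1 x + u2 2 2 x = q x * u x" using u2(4)[of x] by (simp add: sum_2)
    have "(\<Sum>i\<in>UNIV. E1 i x) = X x * (u2 1 1 x + u2 2 2 x) - (q x * (u x * u x)) - u x * q x * X x
        - 1/2 * (x $ 1 * dq 1 1 x + x $ 2 * dq 2 1 x) * (u x * u x)"
      unfolding sum_2 E1_def X1_def D1_def X_def D_def u2(3)[of 2 1] by (simp add: algebra_simps)
    also have "\<dots> = - (q x + 1/2 * (x $ 1 * dq 1 1 x + x $ 2 * dq 2 1 x)) * (u x)\<^sup>2"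
      unfolding l by (simp add: algebra_simps power2_eq_square)
    finally show ?thesis by (simp add: sum_2)
  qed
  let ?S = "square 0 (2 * \<alpha>)"
  have F0: "integral ?S (F i) = 0" for i
  proof -
    have z: "ch y * E i y = 0" "F i y = 0" if "y \<notin> ?S" for y
      using far[OF out[OF that]] by (simp_all add: F_def)
    have "integral UNIV (F i) = 0"
      by (rule integral_partial_eq_0[OF _ cF pF z]) (intro continuous_intros cch cE)
    then show ?thesis using integral_eq_UNIV[of ?S "F i"] z by simp
  qed
  \<comment> \<open>Bounds the term in which the cutoff is differentiated: its derivative is at most
    4, the inner derivative brings 2/\<alpha>^2, and the field paired with x is at most \<alpha>^2
    (20 G^2 + 2 \<Lambda> m^2). With the area 16 \<alpha>^2 the final 2560 is 16 * 8 * 20.\<close>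
  define B where "B = 8 * (20 * G\<^sup>2 + 2 * \<Lambda> * m\<^sup>2)"
  have bnd: "\<mu> * (ch x * (u x)\<^sup>2) \<le> (\<Sum>i\<in>UNIV. F i x) + B" for x
  proof -
    define g where "g = (\<Sum>i\<in>UNIV. (ch' x * ((1 / \<alpha>\<^sup>2) * (2 * x $ i))) * E i x)"
    have split: "(\<Sum>i\<in>UNIV. F i x) = g + ch x * (\<Sum>i\<in>UNIV. E1 i x)"
      by (simp add: F_def g_def sum.distrib sum_distrib_left)
    have main: "\<mu> * (ch x * (u x)\<^sup>2) \<le> ch x * (\<Sum>i\<in>UNIV. E1 i x)"
    proof (cases "norm x \<le> 2 * \<alpha>")
      case True
      have "\<mu> * (ch x * (u x)\<^sup>2) \<le> (- q x - 1/2 * (\<Sum>i\<in>UNIV. x $ i * dq i 1 x)) * (ch x * (u x)\<^sup>2)"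
        using pos[OF True] cutoff_nonneg by (intro mult_right_mono) (auto simp: ch_def)
      also have "\<dots> = ch x * (\<Sum>i\<in>UNIV. E1 i x)" unfolding divE by (simp add: algebra_simps)
      finally show ?thesis .
    qed (use far in simp)
    have "\<bar>g\<bar> \<le> B"
    proof (cases "\<alpha> \<le> norm x \<and> norm x \<le> 2 * \<alpha>")
      case False
      then have "ch' x = 0" using near far by force
      moreover have "B \<ge> 0"
      proof -
        let ?y = "\<alpha> *\<^sub>R axis 1 1 :: real^2"
        have "norm ?y = \<alpha>" using \<alpha> by (simp add: norm_axis_1)
        then have "\<Lambda> \<ge> 0" using L[of ?y] \<alpha> by force
        then show ?thesis by (simp add: B_def)
      qed
      ultimately show ?thesis by (simp add: g_def)
    next
      case True
      have L0: "\<Lambda> \<ge> 0" and G0: "G \<ge> 0" and m0: "m \<ge> 0"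
        using L[of x] G[of x 1] m[of x] True by force+
      have xi: "\<bar>x $ i\<bar> \<le> 2 * \<alpha>" for i using component_le_norm_cart[of x i] True by linarith
      have ui: "\<bar>du i 1 x\<bar> \<le> G" for i using G True by blast
      have uu: "(u x)\<^sup>2 \<le> m\<^sup>2" using m[of x] True by (simp add: abs_le_square_iff[symmetric] m0)
      have wx: "0 \<le> w x" "w x \<le> 4 * \<alpha>\<^sup>2" unfolding wn using True power_mono[of "norm x" "2 * \<alpha>" 2] by (auto simp: power_mult_distrib)
      have gX: "g = ch' x * (2 / \<alpha>\<^sup>2) * ((X x)\<^sup>2 - 1/2 * (D x * w x) - 1/2 * (q x * (u x)\<^sup>2 * w x))"
        by (simp add: g_def sum_2 E_def X_def w_def algebra_simps power2_eq_square)
      have "\<bar>X x\<bar> \<le> \<bar>x $ 1\<bar> * \<bar>?a x\<bar> + \<bar>x $ 2\<bar> * \<bar>?b x\<bar>" unfolding X_def abs_mult[symmetric] by (rule abs_triangle_ineq)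
      also have "\<dots> \<le> 2 * \<alpha> * G + 2 * \<alpha> * G" using \<alpha> by (intro add_mono mult_mono xi ui) auto
      finally have "(X x)\<^sup>2 \<le> (4 * \<alpha> * G)\<^sup>2" using \<alpha> G0 by (simp add: abs_le_square_iff[symmetric] ac_simps)
      then have t1: "(X x)\<^sup>2 \<le> 16 * \<alpha>\<^sup>2 * G\<^sup>2" by (simp add: power_mult_distrib)
      have aa: "(du i 1 x)\<^sup>2 \<le> G\<^sup>2" for i using ui[of i] G0 by (simp add: abs_le_square_iff[symmetric])
      have D0: "0 \<le> D x" "D x \<le> 2 * G\<^sup>2" using aa[of 1] aa[of 2] by (auto simp: D_def power2_eq_square)
      have t2: "D x * w x \<le> 2 * G\<^sup>2 * (4 * \<alpha>\<^sup>2)" "0 \<le> D x * w x"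
        using D0 wx by (intro mult_mono mult_nonneg_nonneg; simp)+
      have t3: "\<bar>q x * (u x)\<^sup>2 * w x\<bar> \<le> \<Lambda> * m\<^sup>2 * (4 * \<alpha>\<^sup>2)"
        unfolding abs_mult using L[of x] True uu wx L0 by (intro mult_mono) auto
      have arith: "\<bar>P - 1/2 * d - 1/2 * Q\<bar> \<le> a1 + a2 / 2 + a3 / 2"
        if "0 \<le> P" "P \<le> a1" "d \<le> a2" "0 \<le> d" "\<bar>Q\<bar> \<le> a3" for P d Q a1 a2 a3 :: real
        using that by arith
      have "\<bar>(X x)\<^sup>2 - 1/2 * (D x * w x) - 1/2 * (q x * (u x)\<^sup>2 * w x)\<bar>
          \<le> 16 * \<alpha>\<^sup>2 * G\<^sup>2 + 2 * G\<^sup>2 * (4 * \<alpha>\<^sup>2) / 2 + \<Lambda> * m\<^sup>2 * (4 * \<alpha>\<^sup>2) / 2"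
        by (rule arith[OF zero_le_power2 t1 t2 t3])
      also have "\<dots> = 16 * \<alpha>\<^sup>2 * G\<^sup>2 + 4 * G\<^sup>2 * \<alpha>\<^sup>2 + 2 * \<Lambda> * m\<^sup>2 * \<alpha>\<^sup>2" by simp
      finally have "\<bar>(X x)\<^sup>2 - 1/2 * (D x * w x) - 1/2 * (q x * (u x)\<^sup>2 * w x)\<bar>
          \<le> 16 * \<alpha>\<^sup>2 * G\<^sup>2 + 4 * G\<^sup>2 * \<alpha>\<^sup>2 + 2 * \<Lambda> * m\<^sup>2 * \<alpha>\<^sup>2" .
      then have "\<bar>g\<bar> \<le> 4 * (2 / \<alpha>\<^sup>2) * (16 * \<alpha>\<^sup>2 * G\<^sup>2 + 4 * G\<^sup>2 * \<alpha>\<^sup>2 + 2 * \<Lambda> * m\<^sup>2 * \<alpha>\<^sup>2)"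
        unfolding gX abs_mult using cutoff'_bound by (intro mult_mono) (auto simp: ch'_def)
      also have "\<dots> = B" using \<alpha> by (simp add: B_def field_simps)
      finally show ?thesis .
    qed
    then show ?thesis using main unfolding split by linarith
  qed
  have cont: "continuous_on UNIV (\<lambda>x. ch x * (u x)\<^sup>2)" by (intro continuous_intros cch u_cont)
  have sub: "square 0 (\<alpha> / 2) \<subseteq> ?S" using \<alpha> by (intro square_mono) simp
  have "integral (square 0 (\<alpha> / 2)) (\<lambda>x. (u x)\<^sup>2) = integral (square 0 (\<alpha> / 2)) (\<lambda>x. ch x * (u x)\<^sup>2)"
  proof (intro integral_cong)
    fix x assume "x \<in> square 0 (\<alpha> / 2)"
    then have "norm x \<le> \<alpha>" using norm_le_square[of x 0 "\<alpha> / 2"] by simp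
    then show "(u x)\<^sup>2 = ch x * (u x)\<^sup>2" using near by simp
  qed
  also have "\<dots> \<le> integral ?S (\<lambda>x. ch x * (u x)\<^sup>2)"
    by (intro integral_subset_le sub integrable_square cont) (auto simp: ch_def cutoff_nonneg)
  finally have "\<mu> * integral (square 0 (\<alpha> / 2)) (\<lambda>x. (u x)\<^sup>2) \<le> \<mu> * integral ?S (\<lambda>x. ch x * (u x)\<^sup>2)"
    using \<mu> by simp
  also have "\<dots> = integral ?S (\<lambda>x. \<mu> * (ch x * (u x)\<^sup>2))" by simp
  also have "\<dots> \<le> integral ?S (\<lambda>x. (\<Sum>i\<in>UNIV. F i x) + B)"
    by (intro integral_le integrable_square continuous_intros cont cF bnd)
  also have "\<dots> = (\<Sum>i\<in>UNIV. integral ?S (F i)) + integral ?S (\<lambda>x. B)"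
    by (subst Henstock_Kurzweil_Integration.integral_add)
      (auto intro!: integrable_square continuous_intros cF Henstock_Kurzweil_Integration.integral_sum)
  also have "\<dots> = (4 * \<alpha>)\<^sup>2 * B"
    using F0 content_square[of "2 * \<alpha>" 0] \<alpha> by (simp add: square_eq_cbox)
  also have "\<dots> = 128 * \<alpha>\<^sup>2 * (20 * G\<^sup>2 + 2 * \<Lambda> * m\<^sup>2)" by (simp add: B_def power_mult_distrib)
  also have "\<dots> \<le> 128 * \<alpha>\<^sup>2 * (20 * (G\<^sup>2 + \<Lambda> * m\<^sup>2))"
  proof (intro mult_left_mono)
    let ?y = "\<alpha> *\<^sub>R axis 1 1 :: real^2"
    have "norm ?y = \<alpha>" using \<alpha> by (simp add: norm_axis_1)
    then have "\<Lambda> \<ge> 0" using L[of ?y] \<alpha> by force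
    then have "0 \<le> \<Lambda> * m\<^sup>2" by simp
    then show "20 * G\<^sup>2 + 2 * \<Lambda> * m\<^sup>2 \<le> 20 * (G\<^sup>2 + \<Lambda> * m\<^sup>2)" by (simp only: mult.assoc distrib_left)
  qed auto
  finally show ?thesis by (simp add: algebra_simps)
qed

end

section \<open>Chains of squares and Hausdorff measure\<close>

lemma polar_form:
  fixes x :: "real^2"
  obtains t where "0 \<le> t" "t < 2 * pi" "x $ 1 = norm x * cos t" "x $ 2 = norm x * sin t"
proof (cases "x = 0")
  case True
  then show ?thesis using that[of 0] by simp
next
  case False
  have n2: "(norm x)\<^sup>2 = (x $ 1)\<^sup>2 + (x $ 2)\<^sup>2"
    by (simp add: norm_vec_def L2_set_def sum_2)
  have "(x $ 1 / norm x)\<^sup>2 + (x $ 2 / norm x)\<^sup>2 = ((x $ 1)\<^sup>2 + (x $ 2)\<^sup>2) / (norm x)\<^sup>2"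
    by (simp only: power_divide add_divide_distrib)
  also have "\<dots> = 1" unfolding n2[symmetric] using False by simp
  finally obtain t where "0 \<le> t" "t < 2 * pi" "x $ 1 / norm x = cos t" "x $ 2 / norm x = sin t"
    by (rule sincos_total_2pi)
  then show ?thesis using that[of t] False by (simp add: field_simps)
qed

text \<open>Linear interpolation in polar coordinates: the norm stays between those of the end
  points, and a step moves each coordinate by at most b (1 + 2 pi)/K. The number of steps depends
  only on the ratio of \<open>b\<close> to \<open>r\<close>.\<close>

lemma annulus_chain:
  fixes p p' :: "real^2"
  assumes p: "a \<le> norm p" "norm p \<le> b" and p': "a \<le> norm p'" "norm p' \<le> b"
    and K: "K \<ge> 1" "b * (1 + 2 * pi) \<le> real K * r"
  obtains x where "x 0 = p" "x K = p'" "\<And>k. k \<le> K \<Longrightarrow> a \<le> norm (x k) \<and> norm (x k) \<le> b"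
    "\<And>k. k < K \<Longrightarrow> x (Suc k) \<in> square (x k) r"
proof -
  have b0: "b \<ge> 0" using p norm_ge_zero[of p] by linarith
  obtain t where t: "0 \<le> t" "t < 2 * pi" "p $ 1 = norm p * cos t" "p $ 2 = norm p * sin t" by (rule polar_form)
  obtain t' where t': "0 \<le> t'" "t' < 2 * pi" "p' $ 1 = norm p' * cos t'" "p' $ 2 = norm p' * sin t'" by (rule polar_form)
  define \<rho> where "\<rho> k = norm p + real k / K * (norm p' - norm p)" for k
  define \<theta> where "\<theta> k = t + real k / K * (t' - t)" for k
  define x :: "nat \<Rightarrow> real^2" where "x k = (\<chi> i. if i = 1 then \<rho> k * cos (\<theta> k) else \<rho> k * sin (\<theta> k))" for k
  have rho: "a \<le> \<rho> k" "\<rho> k \<le> b" "0 \<le> \<rho> k" if "k \<le> K" for k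
  proof -
    have c: "0 \<le> real k / K" "real k / K \<le> 1" using that K by auto
    have "n + z * (n' - n) = (1 - z) * n + z * n'" for n n' z :: real by (simp add: algebra_simps)
    then have e: "\<rho> k = (1 - real k / K) * norm p + real k / K * norm p'" unfolding \<rho>_def .
    have "(1 - real k / K) * a + real k / K * a \<le> \<rho> k" unfolding e
      using c p p' by (intro add_mono mult_left_mono) auto
    then show "a \<le> \<rho> k" by (simp add: algebra_simps)
    have "\<rho> k \<le> (1 - real k / K) * b + real k / K * b" unfolding e
      using c p p' by (intro add_mono mult_left_mono) auto
    then show "\<rho> k \<le> b" by (simp add: algebra_simps)
    show "0 \<le> \<rho> k" unfolding e using c by simp
  qed
  have nx: "norm (x k) = \<rho> k" if "k \<le> K" for k
  proof -
    have "(norm (x k))\<^sup>2 = (\<rho> k)\<^sup>2 * (cos (\<theta> k))\<^sup>2 + (\<rho> k)\<^sup>2 * (sin (\<theta> k))\<^sup>2"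
      by (simp add: norm_vec_def L2_set_def sum_2 x_def power_mult_distrib)
    also have "\<dots> = (\<rho> k)\<^sup>2 * ((cos (\<theta> k))\<^sup>2 + (sin (\<theta> k))\<^sup>2)" by (simp only: distrib_left)
    also have "\<dots> = (\<rho> k)\<^sup>2" by (simp only: sin_cos_squared_add2 mult_1_right)
    finally have "(norm (x k))\<^sup>2 = (\<rho> k)\<^sup>2" .
    then show ?thesis using rho(3)[OF that] by (simp add: power2_eq_iff_nonneg)
  qed
  have step: "\<bar>\<rho> (Suc k) * f (\<theta> (Suc k)) - \<rho> k * f (\<theta> k)\<bar> \<le> r"
    if k: "k < K" and f1: "\<And>y. \<bar>f y\<bar> \<le> 1" and fl: "\<And>y z. \<bar>f y - f z\<bar> \<le> \<bar>y - z\<bar>" for k and f :: "real \<Rightarrow> real"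
  proof -
    have dr: "\<rho> (Suc k) - \<rho> k = (norm p' - norm p) / K" "\<theta> (Suc k) - \<theta> k = (t' - t) / K"
    proof -
      have "(n + real (Suc k) / K * d) - (n + real k / K * d) = d / K" for n d :: real
        by (simp add: add_divide_distrib distrib_right)
      then show "\<rho> (Suc k) - \<rho> k = (norm p' - norm p) / K" "\<theta> (Suc k) - \<theta> k = (t' - t) / K"
        unfolding \<rho>_def \<theta>_def by blast+
    qed
    have "\<rho> (Suc k) * f (\<theta> (Suc k)) - \<rho> k * f (\<theta> k) = (\<rho> (Suc k) - \<rho> k) * f (\<theta> (Suc k)) + \<rho> k * (f (\<theta> (Suc k)) - f (\<theta> k))"
      by (simp add: algebra_simps)
    also have "\<bar>\<dots>\<bar> \<le> \<bar>\<rho> (Suc k) - \<rho> k\<bar> * \<bar>f (\<theta> (Suc k))\<bar> + \<bar>\<rho> k\<bar> * \<bar>f (\<theta> (Suc k)) - f (\<theta> k)\<bar>"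
      unfolding abs_mult[symmetric] by (rule abs_triangle_ineq)
    also have "\<dots> \<le> (b / K) * 1 + b * (2 * pi / K)"
    proof (intro add_mono mult_mono)
      have "\<bar>norm p' - norm p\<bar> \<le> b" using p p' norm_ge_zero[of p] norm_ge_zero[of p'] by linarith
      then show "\<bar>\<rho> (Suc k) - \<rho> k\<bar> \<le> b / K" unfolding dr by (simp add: divide_right_mono)
      have "\<bar>t' - t\<bar> \<le> 2 * pi" using t t' by linarith
      then have "\<bar>\<theta> (Suc k) - \<theta> k\<bar> \<le> 2 * pi / K" unfolding dr by (simp add: divide_right_mono)
      then show "\<bar>f (\<theta> (Suc k)) - f (\<theta> k)\<bar> \<le> 2 * pi / K" using fl order_trans by blast
      show "\<bar>\<rho> k\<bar> \<le> b" using rho(2,3)[of k] k by simp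
    qed (use f1 b0 in auto)
    also have "\<dots> = b * (1 + 2 * pi) / K" by (simp add: add_divide_distrib algebra_simps)
    also have "\<dots> \<le> r" using K by (simp add: divide_le_eq mult.commute)
    finally show ?thesis .
  qed
  show ?thesis
  proof (rule that[of x])
    show "x 0 = p" by (simp add: vec_eq_iff forall_2 x_def \<rho>_def \<theta>_def t)
    show "x K = p'" using K by (simp add: vec_eq_iff forall_2 x_def \<rho>_def \<theta>_def t')
    show "a \<le> norm (x k) \<and> norm (x k) \<le> b" if "k \<le> K" for k using nx[OF that] rho[OF that] by simp
    show "x (Suc k) \<in> square (x k) r" if "k < K" for k
    proof -
      have c: "\<bar>cos y - cos z\<bar> \<le> \<bar>y - z\<bar>" for y z :: real
      proof -
        have "norm (cos y - cos z) \<le> 1 * norm (y - z)"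
          by (rule field_differentiable_bound[of UNIV cos "\<lambda>x. - sin x"]) (auto intro: DERIV_cos)
        then show ?thesis by simp
      qed
      have s: "\<bar>sin y - sin z\<bar> \<le> \<bar>y - z\<bar>" for y z :: real
      proof -
        have "norm (sin y - sin z) \<le> 1 * norm (y - z)"
          by (rule field_differentiable_bound[of UNIV sin cos]) (auto intro: DERIV_sin)
        then show ?thesis by simp
      qed
      show ?thesis
        using step[OF that abs_cos_le_one c] step[OF that abs_sin_le_one s]
        by (simp add: square_def forall_2 x_def)
    qed
  qed
qed

section \<open>Hausdorff measure through coverings by squares and through projections\<close>

lemma diameter_square: "s \<ge> 0 \<Longrightarrow> diameter (square c s) \<le> 4 * s" and bounded_square: "bounded (square c s)"
proof -
  show "bounded (square c s)" by (rule compact_imp_bounded[OF compact_square])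
  show "diameter (square c s) \<le> 4 * s" if "s \<ge> 0"
  proof (rule diameter_le)
    fix y z assume yz: "y \<in> square c s" "z \<in> square c s"
    have "norm (y - z) \<le> norm (y - c) + norm (z - c)" by (metis dist_norm dist_triangle2)
    then show "norm (y - z) \<le> 4 * s" using norm_le_square[OF yz(1)] norm_le_square[OF yz(2)] by linarith
  qed (use that in simp)
qed

lemma hausdorff1_content_squares:
  fixes A :: "(real^2) set"
  assumes C: "finite C" "A \<subseteq> (\<Union>c\<in>C. square c s)" and s: "s > 0" "4 * s \<le> \<delta>"
  shows "hausdorff1_content \<delta> A \<le> ennreal (4 * s * real (card C))"
proof -
  obtain h where h: "bij_betw h {0..<card C} C" using ex_bij_betw_nat_finite[OF C(1)] by blast
  define E where "E i = (if i < card C then square (h i) s else {})" for i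
  have cover: "A \<subseteq> (\<Union>i. E i)"
  proof
    fix z assume "z \<in> A"
    then obtain c where c: "c \<in> C" "z \<in> square c s" using C(2) by blast
    then obtain i where "i < card C" "h i = c" using h unfolding bij_betw_def by force
    then have "z \<in> E i" using c by (simp add: E_def)
    then show "z \<in> (\<Union>i. E i)" by blast
  qed
  have bd: "bounded (E i) \<and> diameter (E i) \<le> \<delta>" for i
    using s bounded_square diameter_square[of s "h i"] by (auto simp: E_def)
  have "hausdorff1_content \<delta> A \<le> (\<Sum>i. ennreal (diameter (E i)))"
    unfolding hausdorff1_content_def by (rule INF_lower) (use cover bd in auto)
  also have "\<dots> = (\<Sum>i<card C. ennreal (diameter (E i)))"
    by (rule suminf_finite) (auto simp: E_def)
  also have "\<dots> \<le> (\<Sum>i<card C. ennreal (4 * s))"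
    by (intro sum_mono ennreal_leI) (use s diameter_square[of s] in \<open>auto simp: E_def\<close>)
  also have "\<dots> = ennreal (4 * s * real (card C))"
    using s by (simp add: ennreal_of_nat_eq_real_of_nat ennreal_mult[symmetric] mult.commute)
  finally show ?thesis .
qed

text \<open>A covering set of diameter at most \<delta> meets at most one of the separated pieces,
  so the pieces do not compete for covering sets. Within one piece the projection is covered by
  intervals of twice the diameter; summing over two axes gives the factor 4.\<close>

lemma hausdorff1_lower:
  fixes A :: "(real^2) set"
  assumes J: "finite J" and A: "\<And>c. c \<in> J \<Longrightarrow> compact (B c) \<and> B c \<subseteq> A"
    and sep: "\<And>c c' x y. c \<in> J \<Longrightarrow> c' \<in> J \<Longrightarrow> c \<noteq> c' \<Longrightarrow> x \<in> B c \<Longrightarrow> y \<in> B c' \<Longrightarrow> dist x y > \<delta>" and d: "\<delta> > 0"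
  shows "ennreal (1/4 * (\<Sum>c\<in>J. \<Sum>i\<in>UNIV. measure lborel ((\<lambda>y. y $ i) ` B c))) \<le> hausdorff1 A"
proof -
  define P where "P i c = (\<lambda>y. y $ i) ` B c" for i c
  have cP: "compact (P i c)" if "c \<in> J" for i c
    unfolding P_def using A[OF that] by (intro compact_continuous_image continuous_intros) auto
  have fin: "emeasure lborel S = ennreal (measure lborel S)" if "compact S" for S :: "real set"
    using fmeasurable_compact[OF that] by (intro emeasure_eq_ennreal_measure) (auto simp: fmeasurable_def)
  have main: "ennreal (\<Sum>c\<in>J. measure lborel (P i c)) \<le> 2 * (\<Sum>n. ennreal (diameter (E n)))"
    if E: "A \<subseteq> (\<Union>n. E n)" "\<And>n. bounded (E n) \<and> diameter (E n) \<le> \<delta>" for E :: "nat \<Rightarrow> (real^2) set" and i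
  proof -
    define W where "W c n = (if E n \<inter> B c = {} then 0 else ennreal (2 * diameter (E n)))" for c n
    have one: "emeasure lborel (P i c) \<le> (\<Sum>n. W c n)" if c: "c \<in> J" for c
    proof -
      define e where "e n = (SOME y. y \<in> E n \<inter> B c)" for n
      have e: "e n \<in> E n" if "E n \<inter> B c \<noteq> {}" for n
        using someI_ex[of "\<lambda>y. y \<in> E n \<inter> B c"] that unfolding e_def by blast
      \<comment> \<open>An interval of radius \<open>diameter (E n)\<close> around a projected point
        of the covering set contains its whole projection.\<close>
      define I where "I n = (if E n \<inter> B c = {} then {} else {e n $ i - diameter (E n)..e n $ i + diameter (E n)})" for n
      have sub: "P i c \<subseteq> (\<Union>n. I n)"
      proof
        fix t assume "t \<in> P i c"
        then obtain y where y: "y \<in> B c" "t = y $ i" unfolding P_def by blast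
        then obtain n where n: "y \<in> E n" using A[OF c] E(1) by blast
        then have ne: "E n \<inter> B c \<noteq> {}" using y by blast
        have "dist y (e n) \<le> diameter (E n)" using E(2) n e[OF ne] by (intro diameter_bounded_bound) auto
        then have "\<bar>y $ i - e n $ i\<bar> \<le> diameter (E n)"
          using component_le_norm_cart[of "y - e n" i] by (simp add: dist_norm)
        then have "t \<in> I n" using y ne by (auto simp: I_def abs_le_iff)
        then show "t \<in> (\<Union>n. I n)" by blast
      qed
      have mI: "I n \<in> sets lborel" for n by (simp add: I_def)
      have "emeasure lborel (P i c) \<le> emeasure lborel (\<Union>n. I n)"
        using sub mI by (intro emeasure_mono) auto
      also have "\<dots> \<le> (\<Sum>n. emeasure lborel (I n))" using mI by (intro emeasure_subadditive_countably) auto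
      also have "\<dots> \<le> (\<Sum>n. W c n)"
      proof (intro suminf_le)
        fix n
        have "0 \<le> diameter (E n)" using E(2)[of n] diameter_ge_0 by blast
        then show "emeasure lborel (I n) \<le> W c n" by (simp add: I_def W_def)
      qed auto
      finally show ?thesis .
    qed
    have "ennreal (\<Sum>c\<in>J. measure lborel (P i c)) = (\<Sum>c\<in>J. emeasure lborel (P i c))"
      by (subst sum_ennreal[symmetric]) (auto simp: fin[OF cP])
    also have "\<dots> \<le> (\<Sum>c\<in>J. \<Sum>n. W c n)" by (intro sum_mono one)
    also have "\<dots> = (\<Sum>n. \<Sum>c\<in>J. W c n)" by (rule suminf_sum[symmetric]) simp
    also have "\<dots> \<le> (\<Sum>n. 2 * ennreal (diameter (E n)))"
    proof (intro suminf_le)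
      fix n
      show "(\<Sum>c\<in>J. W c n) \<le> 2 * ennreal (diameter (E n))"
      proof (cases "\<exists>c\<in>J. E n \<inter> B c \<noteq> {}")
        case False
        then have "(\<Sum>c\<in>J. W c n) = 0" by (intro sum.neutral) (auto simp: W_def)
        then show ?thesis by simp
      next
        case True
        then obtain c where c: "c \<in> J" "E n \<inter> B c \<noteq> {}" by blast
        have "W c' n = 0" if "c' \<in> J - {c}" for c'
        proof -
          have "E n \<inter> B c' = {}"
          proof (rule ccontr)
            assume "E n \<inter> B c' \<noteq> {}"
            then obtain x y where xy: "x \<in> E n" "x \<in> B c" "y \<in> E n" "y \<in> B c'" using c by blast
            then have "dist x y > \<delta>" using sep c(1) that by blast
            moreover have "dist x y \<le> diameter (E n)" using E(2) xy by (intro diameter_bounded_bound) auto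
            ultimately show False using E(2)[of n] by linarith
          qed
          then show ?thesis by (simp add: W_def)
        qed
        then have "(\<Sum>c\<in>J. W c n) = W c n" using J c(1) by (simp add: sum.remove)
        also have "\<dots> = 2 * ennreal (diameter (E n))"
          using c(2) E(2)[of n] diameter_ge_0[of "E n"] by (simp add: W_def ennreal_mult)
        finally show ?thesis by simp
      qed
    qed auto
    also have "\<dots> = 2 * (\<Sum>n. ennreal (diameter (E n)))" by (rule ennreal_suminf_cmult)
    finally show ?thesis .
  qed
  have "ennreal (1/4 * (\<Sum>c\<in>J. \<Sum>i\<in>UNIV. measure lborel (P i c))) \<le> hausdorff1_content \<delta> A"
    unfolding hausdorff1_content_def
  proof (rule INF_greatest)
    fix E assume "E \<in> {E :: nat \<Rightarrow> (real^2) set. A \<subseteq> (\<Union>i. E i) \<and> (\<forall>i. bounded (E i) \<and> diameter (E i) \<le> \<delta>)}"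
    then have E: "A \<subseteq> (\<Union>n. E n)" "\<And>n. bounded (E n) \<and> diameter (E n) \<le> \<delta>" by auto
    let ?D = "\<Sum>n. ennreal (diameter (E n))"
    have "ennreal (\<Sum>c\<in>J. \<Sum>i\<in>UNIV. measure lborel (P i c))
        = ennreal (\<Sum>c\<in>J. measure lborel (P 1 c)) + ennreal (\<Sum>c\<in>J. measure lborel (P 2 c))"
      by (simp add: sum_2 sum.distrib ennreal_plus[symmetric] sum_nonneg del: ennreal_plus)
    also have "\<dots> \<le> 2 * ?D + 2 * ?D" by (intro add_mono main E)
    also have "\<dots> = 4 * ?D" by (simp add: mult_2[symmetric] mult.assoc[symmetric] distrib_right[symmetric])
    finally have le: "ennreal (\<Sum>c\<in>J. \<Sum>i\<in>UNIV. measure lborel (P i c)) \<le> 4 * ?D" .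
    have "ennreal (1/4 * (\<Sum>c\<in>J. \<Sum>i\<in>UNIV. measure lborel (P i c))) = ennreal (1/4) * ennreal (\<Sum>c\<in>J. \<Sum>i\<in>UNIV. measure lborel (P i c))"
      by (rule ennreal_mult) (auto intro!: sum_nonneg)
    also have "\<dots> \<le> ennreal (1/4) * (4 * ?D)" by (intro mult_left_mono le) simp
    also have "\<dots> = (ennreal (1/4) * ennreal 4) * ?D" by (simp add: mult.assoc)
    also have "ennreal (1/4) * ennreal 4 = 1" by (subst ennreal_mult[symmetric]) auto
    finally show "ennreal (1/4 * (\<Sum>c\<in>J. \<Sum>i\<in>UNIV. measure lborel (P i c))) \<le> ?D" by simp
  qed
  also have "\<dots> \<le> hausdorff1 A" unfolding hausdorff1_def using d by (intro SUP_upper) simp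
  finally show ?thesis unfolding P_def .
qed

context schroedinger_solution
begin

text \<open>The map sending S to 64 (S + 4) inverts the loss S/64 - 4 of one step, so the hypothesis
  asks for the exponent that still leaves \<open>S\<close> after \<open>K\<close> steps. It is meant
  for a contradiction: extreme smallness on one square spreads over the annulus.\<close>

lemma chain_propagation:
  assumes reg: "\<And>p. a \<le> norm p \<Longrightarrow> norm p \<le> b \<Longrightarrow> regular A \<Lambda> R p" and M: "\<And>y. \<bar>u y\<bar> \<le> M"
    and s1: "R * sqrt \<Lambda> \<ge> 1" and r: "r = R / (80 * A)" and r0: "r > 0"
    and K: "K \<ge> 1" "b * (1 + 2 * pi) \<le> real K * r"
    and p: "a \<le> norm p" "norm p \<le> b" and p': "a \<le> norm p'" "norm p' \<le> b"
    and small: "\<And>y. y \<in> square p r \<Longrightarrow> \<bar>u y\<bar> \<le> M * exp (- (((\<lambda>S. 64 * (S + 4)) ^^ K) S) * (R * sqrt \<Lambda>))"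
  shows "\<bar>u p'\<bar> \<le> M * exp (- S * (R * sqrt \<Lambda>))"
proof -
  obtain x where x: "x 0 = p" "x K = p'" "\<And>k. k \<le> K \<Longrightarrow> a \<le> norm (x k) \<and> norm (x k) \<le> b"
    "\<And>k. k < K \<Longrightarrow> x (Suc k) \<in> square (x k) r" by (rule annulus_chain[OF p p' K]) blast
  define g where "g = (\<lambda>S::real. 64 * (S + 4))"
  have "\<forall>y\<in>square (x k) r. \<bar>u y\<bar> \<le> M * exp (- ((g ^^ (K - k)) S) * (R * sqrt \<Lambda>))" if "k \<le> K" for k
    using that
  proof (induction k)
    case 0
    then show ?case using small x(1) by (simp add: g_def)
  next
    case (Suc k)
    have e: "(g ^^ (K - k)) S = g ((g ^^ (K - Suc k)) S)" using Suc.prems by (simp add: Suc_diff_Suc[symmetric])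
    show ?case
    proof
      fix y assume y: "y \<in> square (x (Suc k)) r"
      have "y \<in> square (x k) (2 * r)" using square_trans[OF x(4) y] Suc.prems by simp
      then have "\<bar>u y\<bar> \<le> M * exp (- ((g ^^ (K - k)) S / 64 - 4) * (R * sqrt \<Lambda>))"
        by (intro square_propagation[OF reg M s1 r]) (use Suc x(3)[of k] in auto)
      then show "\<bar>u y\<bar> \<le> M * exp (- ((g ^^ (K - Suc k)) S) * (R * sqrt \<Lambda>))"
      proof -
        have "g z / 64 - 4 = z" for z by (simp add: g_def field_simps)
        then show ?thesis using \<open>\<bar>u y\<bar> \<le> M * exp (- ((g ^^ (K - k)) S / 64 - 4) * (R * sqrt \<Lambda>))\<close> unfolding e by simp
      qed
    qed
  qed
  from this[of K] show ?thesis using center_in_square[of r p'] r0 x(2) by auto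
qed

end

section \<open>Eigenfunctions of a growing potential\<close>

lemma powr_scale_le:
  fixes m :: real
  assumes m: "m \<ge> 1" and k: "0 \<le> k" "k \<le> 1" and T: "T > 0" and z: "0 \<le> z" "z \<le> k * T"
  shows "z powr m \<le> k * T powr m"
proof -
  have "z powr m \<le> (k * T) powr m" using z m by (intro powr_mono2) auto
  also have "\<dots> = k powr m * T powr m" using k T by (simp add: powr_mult)
  also have "\<dots> \<le> k * T powr m"
  proof (intro mult_right_mono)
    have "k powr m \<le> k powr 1" by (rule powr_mono') (use k m in auto)
    then show "k powr m \<le> k" using k by simp
  qed simp
  finally show ?thesis .
qed

lemma square_le_exp: "\<sigma> \<ge> 0 \<Longrightarrow> \<sigma>\<^sup>2 \<le> 2 * exp (\<sigma>::real)"
  using exp_lower_Taylor_quadratic[of \<sigma>] by simp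

text \<open>Eigenvalues are written \<open>\<lambda> = T powr m\<close>, so that the classically allowed region has diameter comparable to \<open>T\<close>.
  In \<open>analytic_potential\<close> the potential is uniformly analytic at scale \<open>T\<close> outside the disc of radius \<open>a T\<close>;
  \<open>a = 0\<close> is the polynomial case.\<close>

locale growing_potential =
  fixes V :: "real^2 \<Rightarrow> real" and dV :: "2 \<Rightarrow> nat \<Rightarrow> real^2 \<Rightarrow> real" and m c1 c2 :: real
  assumes m: "m \<ge> 1" and c1: "0 < c1" "c1 \<le> 1" and c2: "c2 \<ge> 1"
    and dV_0: "dV i 0 = V" and dV_cont: "continuous_on UNIV (dV i n)" and dV_partial: "has_partial i (dV i n) (dV i (Suc n))"
    and V_lower: "c1 * (1 + norm x) powr m \<le> V x" and V_upper: "V x \<le> c2 * (1 + norm x) powr m"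
    and V_grad: "\<bar>dV i 1 x\<bar> \<le> c2 * (1 + norm x) powr (m - 1)"
begin

lemma V_cont: "continuous_on UNIV V"
  using dV_cont[of 1 0] by (simp add: dV_0)

lemma V_nonneg: "V x \<ge> 0"
proof -
  have "0 \<le> c1 * (1 + norm x) powr m" using c1 by simp
  then show ?thesis using V_lower[of x] by linarith
qed

definition "dq lam i n = (if n = 0 then (\<lambda>x. V x - lam) else dV i n)"

lemma eigenpair_solution:
  assumes "eigenpair V u lam"
  shows "schroedinger_solution u (\<lambda>x. V x - lam) (dq lam)"
proof
  show "weak_laplacian u (\<lambda>x. (V x - lam) * u x)" by (rule eigenpair_weak_laplacian[OF assms V_cont])
  fix i n
  show "dq lam i 0 = (\<lambda>x. V x - lam)" by (simp add: dq_def)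
  show "continuous_on UNIV (dq lam i n)"
    unfolding dq_def using V_cont dV_cont by (auto intro!: continuous_intros)
  show "has_partial i (dq lam i n) (dq lam i (Suc n))"
  proof (cases "n = 0")
    case True
    have "has_partial i V (dV i 1)" using dV_partial[of i 0] by (simp add: dV_0)
    from has_partial_diff[OF this has_partial_const[of i lam]] show ?thesis using True by (simp add: dq_def)
  next
    case False
    then show ?thesis using dV_partial[of i n] by (simp add: dq_def)
  qed
qed

lemma V_le_imp_norm:
  assumes "V x \<le> T powr m" "T > 0"
  shows "norm x \<le> 1 / c1 * T"
proof -
  have "c1 * (1 + norm x) powr m \<le> T powr m" using V_lower[of x] assms by linarith
  then have "(1 + norm x) powr m \<le> 1 / c1 * T powr m" using c1 by (simp add: field_simps)
  also have "\<dots> \<le> (1 / c1) powr m * T powr m"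
  proof (intro mult_right_mono)
    have "(1 / c1) powr 1 \<le> (1 / c1) powr m" using c1 m by (intro powr_mono) auto
    then show "1 / c1 \<le> (1 / c1) powr m" using c1 by simp
  qed simp
  also have "\<dots> = (1 / c1 * T) powr m" by (rule powr_mult[symmetric])
  finally have le: "(1 + norm x) powr m \<le> (1 / c1 * T) powr m" .
  have "1 + norm x \<le> 1 / c1 * T"
  proof (rule ccontr)
    assume "\<not> 1 + norm x \<le> 1 / c1 * T"
    then have "(1 / c1 * T) powr m < (1 + norm x) powr m" using m c1 assms by (intro powr_less_mono2) auto
    then show False using le by simp
  qed
  then show ?thesis by simp
qed

lemma eigenfunction_max:
  assumes e: "eigenpair V u lam" and lam: "lam \<ge> 0"
  obtains z where "\<And>x. \<bar>u x\<bar> \<le> \<bar>u z\<bar>" "V z \<le> lam" "u z \<noteq> 0"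
proof -
  interpret schroedinger_solution u "\<lambda>x. V x - lam" "dq lam" by (rule eigenpair_solution[OF e])
  obtain I where I: "\<And>x r. integral (square x r) (\<lambda>y. (u y)\<^sup>2) \<le> I" by (rule eigenpair_L2_bound[OF e]) blast
  define k where "k = nat \<lceil>m\<rceil>"
  have pk: "(1 + norm y) powr m \<le> (1 + norm y) ^ k" for y :: "real^2"
  proof -
    have "(1 + norm y) powr m \<le> (1 + norm y) powr real k" using m by (intro powr_mono) (auto simp: k_def)
    then show ?thesis by (simp add: powr_realpow add_pos_nonneg)
  qed
  have "\<exists>z. (\<forall>x. \<bar>u x\<bar> \<le> \<bar>u z\<bar>) \<and> V z - lam \<le> 0 \<and> u z \<noteq> 0"
  proof (rule max_attained[OF I, of "(lam + 1) / c1" "c2 + lam" k])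
    fix y :: "real^2" assume "y \<notin> square 0 ((lam + 1) / c1)"
    then have n: "norm y \<ge> (lam + 1) / c1" using norm_in_square[of y 0 "(lam + 1) / c1"] by force
    have "lam + 1 \<le> c1 * norm y" using n c1 by (simp add: field_simps)
    also have "\<dots> \<le> c1 * (1 + norm y) powr 1" using c1 by (intro mult_left_mono) auto
    also have "\<dots> \<le> c1 * (1 + norm y) powr m" using c1 m by (intro mult_left_mono powr_mono) auto
    also have "\<dots> \<le> V y" by (rule V_lower)
    finally show "1 \<le> V y - lam" by simp
  next
    fix y :: "real^2"
    have "1 \<le> (1 + norm y) ^ k" by (rule one_le_power) simp
    then have "lam * 1 \<le> lam * (1 + norm y) ^ k" using lam by (intro mult_left_mono) auto
    moreover have "V y \<le> c2 * (1 + norm y) ^ k"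
      using V_upper[of y] mult_left_mono[OF pk[of y], of c2] c2 by linarith
    moreover have "\<bar>V y - lam\<bar> \<le> V y + lam" using V_nonneg[of y] lam by (simp add: abs_le_iff)
    ultimately show "\<bar>V y - lam\<bar> \<le> (c2 + lam) * (1 + norm y) ^ k" by (simp add: algebra_simps)
  next
    show "\<exists>x. u x \<noteq> 0" using e by (simp add: eigenpair_def)
  qed (use c1 c2 lam in auto)
  then show ?thesis using that by auto
qed

end

text \<open>Derivative bounds are asked up to norm (1/c1 + 1) T because squares around points of the
  allowed region, of norm at most T/c1, have to fit in. The bound on \<open>a\<close> puts norm 2 a
  T below a quarter of the radius \<alpha> = T/(12 c2) used with Rellich's identity in
  \<open>doubling\<close>.\<close>

locale analytic_potential = growing_potential +
  fixes a C3 B T1 :: real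
  assumes a: "a \<ge> 0" "a \<le> 1 / (96 * c2)" and C3: "C3 \<ge> 0" and B: "B \<ge> 0" and T1: "T1 \<ge> 1"
    and dV_bound: "T \<ge> T1 \<Longrightarrow> a * T \<le> norm x \<Longrightarrow> norm x \<le> (1 / c1 + 1) * T \<Longrightarrow>
        \<bar>dV i j x\<bar> \<le> C3 * T powr m * fact j * (B / T) ^ j"
begin

text \<open>Squares of radius \<eta> T around points of norm at least 2 a T must avoid the disc of
  radius a T; since a square of that radius reaches at most 2 \<eta> T, this requires 2 \<eta> at
  most a when a is positive.\<close>

definition "\<eta> = (if a > 0 then min a 1 / 2 else 1 / 2)"
definition "A = max 3 (B * \<eta>)"
definition "rr = \<eta> / (80 * A)"
definition "\<Lambda> T = (C3 + 1) * T powr m"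
definition "\<sigma> T = \<eta> * T * sqrt (\<Lambda> T)"

lemma eta: "\<eta> > 0" "2 * \<eta> \<le> 1" "a > 0 \<Longrightarrow> 2 * \<eta> \<le> a"
  by (auto simp: \<eta>_def)

lemma A: "A \<ge> 3" by (simp add: A_def)

lemma rr: "rr > 0" using eta A by (simp add: rr_def)

lemma Lambda_ge: "T powr m \<le> \<Lambda> T"
  using mult_nonneg_nonneg[OF C3, of "T powr m"] by (simp add: \<Lambda>_def distrib_right)

lemma Lambda_ge_T: "T \<ge> 1 \<Longrightarrow> T \<le> \<Lambda> T"
  using Lambda_ge[of T] m powr_mono[of 1 m T] by simp

lemma sigma_ge_1: "T \<ge> 1 \<Longrightarrow> T \<ge> 1 / \<eta> \<Longrightarrow> \<sigma> T \<ge> 1"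
proof -
  assume T: "T \<ge> 1" "T \<ge> 1 / \<eta>"
  have "1 \<le> \<eta> * T" using T eta by (simp add: field_simps)
  moreover have "1 \<le> sqrt (\<Lambda> T)" using Lambda_ge_T[OF T(1)] T by simp
  ultimately have "1 * 1 \<le> (\<eta> * T) * sqrt (\<Lambda> T)" by (intro mult_mono) auto
  then show ?thesis by (simp add: \<sigma>_def)
qed

lemma regular_point:
  assumes e: "eigenpair V u (T powr m)" and T: "T \<ge> T1" and p: "2 * a * T \<le> norm p" "norm p \<le> 1 / c1 * T"
  shows "schroedinger_solution.regular (dq (T powr m)) A (\<Lambda> T) (\<eta> * T) p"
proof -
  interpret schroedinger_solution u "\<lambda>x. V x - T powr m" "dq (T powr m)" by (rule eigenpair_solution[OF e])
  have T0: "T > 0" using T T1 by simp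
  show ?thesis unfolding regular_def
  proof (intro conjI allI ballI)
    show "\<eta> * T > 0" using eta T0 by simp
    show "0 \<le> \<Lambda> T" using C3 by (simp add: \<Lambda>_def)
    show "3 \<le> A" by (rule A)
    fix i j y assume y: "y \<in> square p (\<eta> * T)"
    have d: "norm (y - p) \<le> 2 * (\<eta> * T)" by (rule norm_le_square[OF y])
    have tri: "norm y \<le> norm p + norm (y - p)" "norm p \<le> norm y + norm (y - p)"
      using norm_triangle_ineq[of p "y - p"] norm_triangle_ineq4[of y "y - p"] by simp_all
    have e1: "2 * (\<eta> * T) \<le> T" using eta T0 by (simp add: field_simps)
    have hi: "norm y \<le> (1 / c1 + 1) * T" using tri(1) d e1 p(2) by (simp add: algebra_simps)
    have lo: "a * T \<le> norm y"
    proof (cases "a > 0")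
      case True
      have "2 * \<eta> * T \<le> a * T" using eta(3)[OF True] T0 by (intro mult_right_mono) auto
      then show ?thesis using tri(2) d p(1) by (simp add: algebra_simps)
    next
      case False
      then show ?thesis using a T0 by simp
    qed
    have b: "\<bar>dV i j y\<bar> \<le> C3 * T powr m * fact j * (B / T) ^ j" by (rule dV_bound[OF T lo hi])
    show "\<bar>dq (T powr m) i j y\<bar> \<le> \<Lambda> T * fact j * (A / (\<eta> * T)) ^ j"
    proof (cases "j = 0")
      case True
      then have "\<bar>V y\<bar> \<le> C3 * T powr m" using b by (simp add: dV_0)
      then have "\<bar>V y - T powr m\<bar> \<le> C3 * T powr m + T powr m" by (simp add: abs_le_iff) (smt (verit) powr_ge_zero)
      then show ?thesis using True by (simp add: dq_def \<Lambda>_def algebra_simps)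
    next
      case False
      note b
      also have "C3 * T powr m * fact j * (B / T) ^ j \<le> \<Lambda> T * fact j * (A / (\<eta> * T)) ^ j"
      proof (intro mult_mono power_mono)
        show "C3 * T powr m \<le> \<Lambda> T" by (simp add: \<Lambda>_def algebra_simps)
        have "B * \<eta> \<le> A" by (simp add: A_def)
        then show "B / T \<le> A / (\<eta> * T)" using eta T0 by (simp add: field_simps)
      qed (use B C3 T0 in \<open>auto simp: \<Lambda>_def\<close>)
      finally show ?thesis using False by (simp add: dq_def)
    qed
  qed
qed

text \<open>The lower bound on \<open>T\<close> absorbs the 1: 1 + norm x is at most T/(12 c2) + 3
  T/(12 c2) = T/(3 c2). So \<open>V\<close> is below a third of \<lambda> on this disc, which leaves
  room for x . grad V in Rellich's identity.\<close>

lemma V_hole: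
  assumes T: "T \<ge> 12 * c2" and x: "norm x \<le> 3 * (T / (12 * c2))"
  shows "(1 + norm x) powr m \<le> 1 / (3 * c2) * T powr m" "\<bar>V x - T powr m\<bar> \<le> T powr m"
proof -
  have T0: "T > 0" using T c2 by linarith
  have "1 \<le> T / (12 * c2)" using T c2 by (simp add: field_simps)
  then have "1 + norm x \<le> 1 / (3 * c2) * T" using x by (simp add: field_simps)
  then show *: "(1 + norm x) powr m \<le> 1 / (3 * c2) * T powr m"
    using c2 T0 by (intro powr_scale_le m) (auto simp: field_simps)
  have "V x \<le> c2 * (1 / (3 * c2) * T powr m)"
    using V_upper[of x] mult_left_mono[OF *, of c2] c2 by linarith
  also have "\<dots> \<le> T powr m" using c2 by simp
  finally show "\<bar>V x - T powr m\<bar> \<le> T powr m" using V_nonneg[of x] by (simp add: abs_le_iff)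
qed

text \<open>By contradiction: smallness on one square makes \<open>u\<close> at most m' = M exp(-Ss
  \<sigma>) on the whole annulus. The maximum point \<open>z\<close> is not in the annulus, since
  there \<open>\<bar>u\<bar>\<close> is below \<open>M\<close>. If it lies in the central disc,
  Rellich's identity bounds the L2 mass of the disc by the data on a ring inside the annulus, and
  \<open>sup_le_L2\<close> turns this into M^2 at most C6 \<sigma>^2 m'^2, which the size of
  \<open>Ss\<close> excludes.\<close>

lemma doubling:
  obtains S0 T0 where "S0 \<ge> 0" "T0 \<ge> 1" "T0 \<ge> T1" "\<And>T. T \<ge> T0 \<Longrightarrow> \<sigma> T \<ge> 1"
    "\<And>T u. T \<ge> T0 \<Longrightarrow> eigenpair V u (T powr m) \<Longrightarrow> \<exists>M>0. (\<forall>y. \<bar>u y\<bar> \<le> M) \<and>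
       (\<forall>p. 2 * a * T \<le> norm p \<and> norm p \<le> 1 / c1 * T \<longrightarrow> (\<exists>x\<in>square p (rr * T). \<bar>u x\<bar> \<ge> M * exp (- S0 * \<sigma> T)))"
proof -
  \<comment> \<open>The ring between \<alpha>0 T and 2 \<alpha>0 T lies outside norm 2 a T, and the
    disc of radius 3 \<alpha>0 T lies where \<open>V_hole\<close> applies.\<close>
  define \<alpha>0 where "\<alpha>0 = 1 / (12 * c2)"
  have a0: "\<alpha>0 > 0" "\<alpha>0 \<le> 1 / 12" "2 * a \<le> \<alpha>0 / 4"
    using c2 a by (auto simp: \<alpha>0_def field_simps)
  \<comment> \<open>4624 comes from \<open>sup_le_L2\<close>; 55680 is 3 * 2560 * (25/4 + 1), from
    Rellich's bound with the gradient estimate on the ring.\<close>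
  define C6 where "C6 = 4624 * 55680 * (C3 + 1) * (\<alpha>0 / \<eta>)\<^sup>2"
  have C60: "C6 \<ge> 0" using C3 by (simp add: C6_def)
  \<comment> \<open>Then (2 Ss - 1) \<sigma> is at least 2 C6 + 1, and its exponential exceeds 2
    C6.\<close>
  define Ss where "Ss = C6 + 1"
  \<comment> \<open>Outer radius and step length are both proportional to \<open>T\<close>, so the
    length of the chain does not depend on \<open>T\<close>.\<close>
  define K where "K = nat \<lceil>1 / c1 * (1 + 2 * pi) / rr\<rceil> + 1"
  have K: "K \<ge> 1" "1 / c1 * (1 + 2 * pi) \<le> real K * rr"
  proof -
    have "1 / c1 * (1 + 2 * pi) / rr \<le> real K" unfolding K_def by linarith
    then show "1 / c1 * (1 + 2 * pi) \<le> real K * rr" by (simp only: pos_divide_le_eq[OF rr])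
  qed (simp add: K_def)
  define S0 where "S0 = ((\<lambda>S. 64 * (S + 4)) ^^ K) Ss"
  have S00: "S0 \<ge> 0"
  proof -
    have "((\<lambda>S. 64 * (S + 4)) ^^ k) Ss \<ge> 0" for k by (induction k) (use C60 in \<open>auto simp: Ss_def\<close>)
    then show ?thesis by (simp add: S0_def)
  qed
  \<comment> \<open>The last entry makes 8 d at most \<alpha> for d = \<Lambda>^(-1/2), so that
    squares of radius \<open>d\<close> do not leave the regions in question.\<close>
  define T0 where "T0 = Max {1, T1, 1 / \<eta>, 12 * c2, (8 / \<alpha>0)\<^sup>2}"
  have T0: "T0 \<ge> 1" "T0 \<ge> T1" "T0 \<ge> 1 / \<eta>" "T0 \<ge> 12 * c2" "T0 \<ge> (8 / \<alpha>0)\<^sup>2" by (auto simp: T0_def)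
  have main: "\<exists>M>0. (\<forall>y. \<bar>u y\<bar> \<le> M) \<and>
       (\<forall>p. 2 * a * T \<le> norm p \<and> norm p \<le> 1 / c1 * T \<longrightarrow> (\<exists>x\<in>square p (rr * T). \<bar>u x\<bar> \<ge> M * exp (- S0 * \<sigma> T)))"
    if T: "T \<ge> T0" and e: "eigenpair V u (T powr m)" for T u
  proof -
    interpret schroedinger_solution u "\<lambda>x. V x - T powr m" "dq (T powr m)" by (rule eigenpair_solution[OF e])
    obtain z where z: "\<And>x. \<bar>u x\<bar> \<le> \<bar>u z\<bar>" "V z \<le> T powr m" "u z \<noteq> 0" by (rule eigenfunction_max[OF e]) auto
    define M where "M = \<bar>u z\<bar>"
    have M: "M > 0" "\<And>y. \<bar>u y\<bar> \<le> M" using z by (auto simp: M_def)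
    have TT: "T \<ge> 1" "T > 0" "T \<ge> T1" "T \<ge> 12 * c2" using T T0 by auto
    have sg: "\<sigma> T \<ge> 1" using sigma_ge_1 T T0 by simp
    have sg': "\<eta> * T * sqrt (\<Lambda> T) \<ge> 1" using sg by (simp add: \<sigma>_def)
    show ?thesis
    proof (intro exI[of _ M] conjI allI impI, goal_cases)
      case (3 p)
      show ?case
      proof (rule ccontr)
        assume "\<not> ?case"
        then have small: "\<bar>u x\<bar> \<le> M * exp (- S0 * (\<eta> * T * sqrt (\<Lambda> T)))" if "x \<in> square p (rr * T)" for x
          using that by (force simp: \<sigma>_def)
        define m' where "m' = M * exp (- Ss * \<sigma> T)"
        have m': "m' \<ge> 0" using M by (simp add: m'_def)
        have far: "\<bar>u x\<bar> \<le> m'" if "2 * a * T \<le> norm x" "norm x \<le> 1 / c1 * T" for x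
          unfolding m'_def \<sigma>_def
        proof (rule chain_propagation[where R = "\<eta> * T" and \<Lambda> = "\<Lambda> T" and A = A and r = "rr * T" and K = K and a = "2 * a * T" and b = "1 / c1 * T" and p = p])
          show "regular A (\<Lambda> T) (\<eta> * T) p" if "2 * a * T \<le> norm p" "norm p \<le> 1 / c1 * T" for p
            by (rule regular_point[OF e TT(3) that])
          show "rr * T > 0" using rr TT by simp
          show "1 / c1 * T * (1 + 2 * pi) \<le> real K * (rr * T)"
            using mult_right_mono[OF K(2), of T] TT by (simp add: algebra_simps)
        qed (use M sg' rr TT K 3 that small in \<open>auto simp: rr_def S0_def\<close>)
        have zT: "norm z \<le> 1 / c1 * T" by (rule V_le_imp_norm[OF z(2) TT(2)])
        have Ss1: "Ss \<ge> 1" using C60 by (simp add: Ss_def)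
        show False
        proof (cases "2 * a * T \<le> norm z")
          case True
          have "M \<le> m'" using far[OF True zT] by (simp add: M_def)
          then have "1 \<le> exp (- Ss * \<sigma> T)" using M by (simp add: m'_def)
          then have "0 \<le> - Ss * \<sigma> T" by (simp only: one_le_exp_iff)
          moreover have "Ss * \<sigma> T > 0" using Ss1 sg by (intro mult_pos_pos) auto
          ultimately show False by simp
        next
          case False
          define \<alpha> where "\<alpha> = \<alpha>0 * T"
          have al: "\<alpha> > 0" using a0 TT by (simp add: \<alpha>_def)
          have alT: "2 * a * T \<le> \<alpha> / 4" using mult_right_mono[OF a0(3), of T] TT by (simp add: \<alpha>_def)
          have "3 * \<alpha> \<le> 1 * T" unfolding \<alpha>_def mult.assoc[symmetric] using a0 TT by (intro mult_right_mono) auto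
          also have "\<dots> \<le> 1 / c1 * T" using c1 TT by (intro mult_right_mono) auto
          finally have al3: "3 * \<alpha> \<le> 1 / c1 * T" .
          have L0: "\<Lambda> T \<ge> 1" using Lambda_ge_T[OF TT(1)] TT by linarith
          define d where "d = 1 / sqrt (\<Lambda> T)"
          have d0: "d > 0" "d\<^sup>2 * \<Lambda> T = 1" "sqrt (\<Lambda> T) = 1 / d" using L0 by (auto simp: d_def power_divide)
          have dal: "8 * d \<le> \<alpha>"
          proof -
            have "(8 / \<alpha>0)\<^sup>2 \<le> \<Lambda> T" using T T0 Lambda_ge_T[OF TT(1)] by linarith
            then have "8 / \<alpha>0 \<le> sqrt (\<Lambda> T)" by (rule real_le_rsqrt)
            then have "8 * d \<le> \<alpha>0 * 1" using d0(1) a0 unfolding d0(3) by (simp add: field_simps)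
            also have "\<dots> \<le> \<alpha>" unfolding \<alpha>_def using a0 TT by (intro mult_left_mono) auto
            finally show ?thesis .
          qed
          have hole: "(1 + norm x) powr m \<le> 1 / (3 * c2) * T powr m" "\<bar>V x - T powr m\<bar> \<le> \<Lambda> T" if "norm x \<le> 3 * \<alpha>" for x
          proof -
            have nx: "norm x \<le> 3 * (T / (12 * c2))" using that by (simp add: \<alpha>_def \<alpha>0_def)
            show "(1 + norm x) powr m \<le> 1 / (3 * c2) * T powr m" by (rule V_hole(1)[OF TT(4) nx])
            show "\<bar>V x - T powr m\<bar> \<le> \<Lambda> T" using V_hole(2)[OF TT(4) nx] Lambda_ge[of T] by linarith
          qed
          have near: "norm y \<le> norm x + 2 * s" "norm x \<le> norm y + 2 * s" if "y \<in> square x s" for x y s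
            using norm_le_square[OF that] norm_triangle_ineq[of x "y - x"] norm_triangle_ineq4[of y "y - x"] by simp_all
          \<comment> \<open>With d = \<Lambda>^(-1/2) the factor 2/d + d \<Lambda>/2 of the gradient
            estimate equals 5/2 sqrt \<Lambda>.\<close>
          define G where "G = 5 / 2 * sqrt (\<Lambda> T) * m'"
          have grad: "\<bar>du i 1 x\<bar> \<le> G" if x: "\<alpha> \<le> norm x" "norm x \<le> 2 * \<alpha>" for i x
          proof -
            have "\<bar>du i 1 x\<bar> \<le> (2 / d + d / 2 * \<Lambda> T) * m'"
            proof (rule gradient_estimate[OF d0(1)])
              fix y assume y: "y \<in> square x d"
              have "norm y \<le> 3 * \<alpha>" "norm y \<ge> \<alpha> / 4" using near[OF y] x dal d0 by linarith+
              then show "\<bar>u y\<bar> \<le> m'" "\<bar>V y - T powr m\<bar> \<le> \<Lambda> T" using far[of y] alT al3 hole(2) by auto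
            qed
            also have "2 / d + d / 2 * \<Lambda> T = 5 / 2 * sqrt (\<Lambda> T)"
              using d0 unfolding d0(3) by (simp add: field_simps power2_eq_square)
            finally show ?thesis by (simp add: G_def)
          qed
          \<comment> \<open>\<open>V\<close> and each of the two products of a coordinate with its
            partial of \<open>V\<close> are at most \<lambda>/3, and 1 - 1/3 - 1/3 remains.\<close>
          have pos: "T powr m / 3 \<le> - (V x - T powr m) - 1/2 * (\<Sum>i\<in>UNIV. x $ i * dq (T powr m) i 1 x)" if x: "norm x \<le> 2 * \<alpha>" for x
          proof -
            define W where "W = (1 + norm x) powr m"
            have W: "c2 * W \<le> T powr m / 3"
              using mult_left_mono[OF hole(1)[of x], of c2] x al c2 by (simp add: W_def)
            have t: "\<bar>x $ i * dq (T powr m) i 1 x\<bar> \<le> c2 * W" for i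
            proof -
              have "\<bar>x $ i * dq (T powr m) i 1 x\<bar> \<le> (1 + norm x) * (c2 * (1 + norm x) powr (m - 1))"
                unfolding abs_mult dq_def using component_le_norm_cart[of x i] V_grad[of i x] by (intro mult_mono) auto
              also have "\<dots> = c2 * W" unfolding W_def using powr_add[of "1 + norm x" 1 "m - 1"] by (simp add: add_pos_nonneg)
              finally show ?thesis .
            qed
            have "V x \<le> T powr m / 3" using V_upper[of x] W by (simp add: W_def)
            moreover have "L / 3 \<le> - (v - L) - 1/2 * (y + w)" if "v \<le> L / 3" "y \<le> L / 3" "w \<le> L / 3" for L v y w :: real
              using that by (simp add: field_simps)
            moreover have "x $ 1 * dq (T powr m) 1 1 x \<le> T powr m / 3" "x $ 2 * dq (T powr m) 2 1 x \<le> T powr m / 3"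
              using t[of 1] t[of 2] W by linarith+
            ultimately show ?thesis unfolding sum_2 by blast
          qed
          define J where "J = integral (square 0 (\<alpha> / 2)) (\<lambda>x. (u x)\<^sup>2)"
          have "(T powr m / 3) * J \<le> 2560 * \<alpha>\<^sup>2 * (G\<^sup>2 + \<Lambda> T * m'\<^sup>2)"
            unfolding J_def
          proof (rule rellich_bound[OF al _ pos grad])
            show "\<bar>u x\<bar> \<le> m'" if "\<alpha> \<le> norm x" "norm x \<le> 2 * \<alpha>" for x
              using far[of x] that alT al3 al by auto
            show "\<bar>V x - T powr m\<bar> \<le> \<Lambda> T" if "\<alpha> \<le> norm x" "norm x \<le> 2 * \<alpha>" for x
              using hole(2)[of x] that al by auto
          qed (use TT in auto)
          also have "G\<^sup>2 = 25 / 4 * \<Lambda> T * m'\<^sup>2" using L0 by (simp add: G_def power_mult_distrib power_divide)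
          also have "2560 * \<alpha>\<^sup>2 * (25 / 4 * \<Lambda> T * m'\<^sup>2 + \<Lambda> T * m'\<^sup>2) = (T powr m / 3) * (55680 * (C3 + 1) * \<alpha>\<^sup>2 * m'\<^sup>2)"
            by (simp add: \<Lambda>_def algebra_simps)
          finally have J: "J \<le> 55680 * (C3 + 1) * \<alpha>\<^sup>2 * m'\<^sup>2"
            using TT by (subst (asm) mult_le_cancel_left_pos) auto
          have zin: "z \<in> square 0 (\<alpha> / 4)" using norm_in_square[of z 0 "\<alpha> / 4"] False alT by simp
          have "d\<^sup>2 * (u z)\<^sup>2 \<le> 4624 * integral (square z d) (\<lambda>y. (u y)\<^sup>2)"
          proof (rule sup_le_L2[OF d0(1)])
            show "\<bar>V y - T powr m\<bar> \<le> \<Lambda> T" if "y \<in> square z d" for y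
              using hole(2)[of y] near[OF that] False alT dal al by linarith
          qed (use d0 in simp)
          also have "\<dots> \<le> 4624 * J"
          proof (unfold J_def, intro mult_left_mono integral_subset_le integrable_square continuous_intros u_cont)
            show "square z d \<subseteq> square 0 (\<alpha> / 2)" using square_trans[OF zin, of _ d "\<alpha> / 2"] dal al by auto
          qed auto
          finally have "d\<^sup>2 * M\<^sup>2 \<le> 4624 * (55680 * (C3 + 1) * \<alpha>\<^sup>2 * m'\<^sup>2)" using J by (simp add: M_def)
          then have "\<Lambda> T * (d\<^sup>2 * M\<^sup>2) \<le> \<Lambda> T * (4624 * (55680 * (C3 + 1) * \<alpha>\<^sup>2 * m'\<^sup>2))"
            using L0 by (intro mult_left_mono) auto
          also have "\<Lambda> T * (d\<^sup>2 * M\<^sup>2) = M\<^sup>2" using d0(2) by (simp add: mult.assoc[symmetric] mult.commute)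
          also have "\<Lambda> T * (4624 * (55680 * (C3 + 1) * \<alpha>\<^sup>2 * m'\<^sup>2)) = C6 * (\<sigma> T)\<^sup>2 * m'\<^sup>2"
            using L0 eta by (simp add: C6_def \<sigma>_def \<alpha>_def power_mult_distrib power_divide field_simps)
          \<comment> \<open>The polynomial factor \<sigma>^2 is traded for one power of e^\<sigma>,
            which costs 1 in the exponent 2 Ss.\<close>
          also have "\<dots> \<le> C6 * (2 * exp (\<sigma> T)) * m'\<^sup>2"
            using C60 sg by (intro mult_right_mono mult_left_mono square_le_exp) auto
          also have "\<dots> = M\<^sup>2 * (2 * C6 * exp (- (2 * Ss - 1) * \<sigma> T))"
          proof -
            have "exp (\<sigma> T) * (exp (- Ss * \<sigma> T))\<^sup>2 = exp (- (2 * Ss - 1) * \<sigma> T)"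
              by (simp add: exp_double[symmetric] exp_add[symmetric] algebra_simps)
            then show ?thesis by (simp add: m'_def power_mult_distrib mult.assoc[symmetric] mult.commute[of _ "M\<^sup>2"])
          qed
          finally have "1 \<le> 2 * C6 * exp (- (2 * Ss - 1) * \<sigma> T)" using M by (simp add: mult_le_cancel_left1)
          moreover have "1 \<le> 2 * C6 * exp (- Y) \<Longrightarrow> exp Y \<le> 2 * C6" for Y :: real by (simp add: exp_minus field_simps)
          ultimately have "exp ((2 * Ss - 1) * \<sigma> T) \<le> 2 * C6" by (metis minus_mult_left)
          moreover have "2 * C6 + 1 \<le> (2 * Ss - 1) * \<sigma> T"
            using mult_mono[of "2 * C6 + 1" "2 * Ss - 1" 1 "\<sigma> T"] sg C60 by (simp add: Ss_def)
          moreover have "1 + (2 * Ss - 1) * \<sigma> T \<le> exp ((2 * Ss - 1) * \<sigma> T)" by (rule exp_ge_add_one_self)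
          ultimately show False by linarith
        qed
      qed
    qed (use M in auto)
  qed
  show ?thesis
    by (rule that[OF S00 T0(1,2) _ main]) (use sigma_ge_1 T0 in auto)
qed

end

section \<open>Upper bound for the length\<close>

context analytic_potential
begin

text \<open>A number of regular squares independent of \<open>T\<close> covers the annulus, and each
  contributes at most a multiple of \<sigma> times its side, for covers of arbitrarily small mesh.
  The product has order T^2 sqrt \<lambda>.\<close>

lemma nodal_upper:
  obtains C T0 where "C \<ge> 0" "T0 \<ge> 1" "\<And>T u. T \<ge> T0 \<Longrightarrow> eigenpair V u (T powr m) \<Longrightarrow>
    hausdorff1 ({x. u x = 0} \<inter> {x. 2 * a * T \<le> norm x \<and> norm x \<le> 1 / c1 * T}) \<le> ennreal (C * (T\<^sup>2 * sqrt (T powr m)))"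
proof -
  obtain S0 T0 where S0: "S0 \<ge> 0" and T0: "T0 \<ge> 1" "T0 \<ge> T1" "\<And>T. T \<ge> T0 \<Longrightarrow> \<sigma> T \<ge> 1"
    and db: "\<And>T u. T \<ge> T0 \<Longrightarrow> eigenpair V u (T powr m) \<Longrightarrow> \<exists>M>0. (\<forall>y. \<bar>u y\<bar> \<le> M) \<and>
       (\<forall>p. 2 * a * T \<le> norm p \<and> norm p \<le> 1 / c1 * T \<longrightarrow> (\<exists>x\<in>square p (rr * T). \<bar>u x\<bar> \<ge> M * exp (- S0 * \<sigma> T)))"
    by (rule doubling) blast
  \<comment> \<open>Region and grid spacing both scale with \<open>T\<close>, so the index set does
    not depend on it.\<close>
  define N where "N = \<lceil>(1 / c1) / rr\<rceil> + 1"
  define C0 where "C0 = {-N..N} \<times> {-N..N}"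
  define n0 where "n0 = real (card C0)"
  define C where "C = 14400 * n0 * (3 + S0) * \<eta> * rr * sqrt (C3 + 1)"
  show ?thesis
  proof (rule that[of C T0])
    show "C \<ge> 0" using S0 eta rr C3 by (simp add: C_def n0_def)
    show "T0 \<ge> 1" by (rule T0)
    fix T u assume T: "T \<ge> T0" and e: "eigenpair V u (T powr m)"
    interpret schroedinger_solution u "\<lambda>x. V x - T powr m" "dq (T powr m)" by (rule eigenpair_solution[OF e])
    obtain M where M: "M > 0" "\<And>y. \<bar>u y\<bar> \<le> M" and dM: "\<And>p. 2 * a * T \<le> norm p \<Longrightarrow> norm p \<le> 1 / c1 * T \<Longrightarrow>
        \<exists>x\<in>square p (rr * T). \<bar>u x\<bar> \<ge> M * exp (- S0 * \<sigma> T)" using db[OF T e] by blast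
    have TT: "T > 0" "T \<ge> T1" using T T0 by auto
    define Reg where "Reg = {x :: real^2. 2 * a * T \<le> norm x \<and> norm x \<le> 1 / c1 * T}"
    define s0 where "s0 = rr * T / 2"
    have s0: "s0 > 0" using rr TT by (simp add: s0_def)
    define C1 where "C1 = {c \<in> C0. square (cell 0 s0 c) s0 \<inter> Reg \<noteq> {}}"
    \<comment> \<open>The centre of a cell may leave the annulus, where regularity is not known; a
      point of the annulus in the cell replaces it, and the doubled radius \<open>rr * T\<close>
      still covers the cell.\<close>
    define pp where "pp c = (SOME p. p \<in> square (cell 0 s0 c) s0 \<inter> Reg)" for c
    have pp: "pp c \<in> square (cell 0 s0 c) s0 \<inter> Reg" if "c \<in> C1" for c
      unfolding pp_def using that someI_ex[of "\<lambda>p. p \<in> square (cell 0 s0 c) s0 \<inter> Reg"] by (auto simp: C1_def)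
    have fC: "finite C0" "finite C1" by (auto simp: C0_def C1_def)
    have cover: "Reg \<subseteq> (\<Union>c\<in>C1. square (pp c) (rr * T))"
    proof
      fix x assume x: "x \<in> Reg"
      then have "x \<in> square 0 (1 / c1 * T)" using norm_in_square[of x 0] by (simp add: Reg_def)
      then obtain k l where kl: "x \<in> square (cell 0 s0 (k, l)) s0" "\<bar>k\<bar> \<le> \<lceil>1 / c1 * T / (2 * s0)\<rceil> + 1" "\<bar>l\<bar> \<le> \<lceil>1 / c1 * T / (2 * s0)\<rceil> + 1"
        by (rule cells_cover[OF s0]) blast
      have "1 / c1 * T / (2 * s0) = (1 / c1) / rr" using TT by (simp add: s0_def)
      then have "(k, l) \<in> C0" using kl by (auto simp: C0_def N_def abs_le_iff)
      then have c: "(k, l) \<in> C1" using kl(1) x by (auto simp: C1_def)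
      have "cell 0 s0 (k, l) \<in> square (pp (k, l)) s0" using pp[OF c] square_commute by blast
      then have "x \<in> square (pp (k, l)) (rr * T)" using square_trans[OF _ kl(1)] by (simp add: s0_def)
      then show "x \<in> (\<Union>c\<in>C1. square (pp c) (rr * T))" using c by blast
    qed
    define X where "X = 3600 * (3 + S0) * (\<eta> * T * sqrt (\<Lambda> T)) * (rr * T)"
    have X0: "X \<ge> 0" using S0 eta rr TT C3 by (simp add: X_def \<Lambda>_def)
    have X: "4 * (n0 * X) = C * (T\<^sup>2 * sqrt (T powr m))"
      unfolding X_def C_def \<Lambda>_def by (simp add: real_sqrt_mult power2_eq_square)
    have "hausdorff1 ({x. u x = 0} \<inter> Reg) \<le> ennreal (4 * (n0 * X))"
      unfolding hausdorff1_def
    proof (rule SUP_least)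
      fix \<delta> :: real assume "\<delta> \<in> {0<..}"
      then have d: "\<delta> > 0" by simp
      have L0: "\<Lambda> T > 0" using Lambda_ge_T[of T] T T0 by linarith
      \<comment> \<open>The first bound makes the covering squares admissible at scale \<delta>; the
        other two are the conditions of \<open>nodal_cover\<close>.\<close>
      define s where "s = Min {\<delta> / 4, rr * T / 3, 1 / (2 * sqrt (\<Lambda> T))}"
      have s: "s > 0" "s \<le> \<delta> / 4" "s \<le> rr * T / 3" "s \<le> 1 / (2 * sqrt (\<Lambda> T))"
        unfolding s_def using d rr TT L0 by auto
      have "\<exists>J. finite J \<and> {z \<in> square (pp c) (rr * T). u z = 0} \<subseteq> (\<Union>c\<in>J. square c s) \<and> real (card J) * s \<le> X"
        if c: "c \<in> C1" for c
      proof -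
        have p: "2 * a * T \<le> norm (pp c)" "norm (pp c) \<le> 1 / c1 * T" using pp[OF c] by (auto simp: Reg_def)
        obtain x where x: "x \<in> square (pp c) (rr * T)" "\<bar>u x\<bar> \<ge> M * exp (- S0 * (\<eta> * T * sqrt (\<Lambda> T)))"
          using dM[OF p] by (auto simp: \<sigma>_def)
        show ?thesis unfolding X_def
        proof (rule nodal_cover[OF regular_point[OF e TT(2) p] M(2,1) _ _ S0 x s(1)])
          show "1 \<le> \<eta> * T * sqrt (\<Lambda> T)" using T0(3)[OF T] by (simp add: \<sigma>_def)
          show "rr * T = \<eta> * T / (80 * A)" by (simp add: rr_def)
          show "3 * s \<le> rr * T" using s by simp
          show "2 * s * sqrt (\<Lambda> T) \<le> 1" using s(4) L0 by (simp add: field_simps)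
        qed
      qed
      then have ex: "\<forall>c\<in>C1. \<exists>J. finite J \<and> {z \<in> square (pp c) (rr * T). u z = 0} \<subseteq> (\<Union>c\<in>J. square c s) \<and> real (card J) * s \<le> X"
        by blast
      obtain J where "\<forall>c\<in>C1. finite (J c) \<and> {z \<in> square (pp c) (rr * T). u z = 0} \<subseteq> (\<Union>c\<in>J c. square c s) \<and> real (card (J c)) * s \<le> X"
        using bchoice[OF ex] by (elim exE)
      then have J: "\<And>c. c \<in> C1 \<Longrightarrow> finite (J c)" "\<And>c. c \<in> C1 \<Longrightarrow> {z \<in> square (pp c) (rr * T). u z = 0} \<subseteq> (\<Union>c\<in>J c. square c s)"
        "\<And>c. c \<in> C1 \<Longrightarrow> real (card (J c)) * s \<le> X" by blast+
      define JJ where "JJ = (\<Union>c\<in>C1. J c)"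
      have "hausdorff1_content \<delta> ({x. u x = 0} \<inter> Reg) \<le> ennreal (4 * s * real (card JJ))"
      proof (rule hausdorff1_content_squares)
        show "finite JJ" unfolding JJ_def using fC J(1) by blast
        show "{x. u x = 0} \<inter> Reg \<subseteq> (\<Union>c\<in>JJ. square c s)"
        proof
          fix x assume x: "x \<in> {x. u x = 0} \<inter> Reg"
          then obtain c where c: "c \<in> C1" "x \<in> square (pp c) (rr * T)" using cover by blast
          then have "x \<in> (\<Union>c\<in>J c. square c s)" using J(2)[OF c(1)] x by blast
          then show "x \<in> (\<Union>c\<in>JJ. square c s)" using c(1) unfolding JJ_def by blast
        qed
      qed (use s in auto)
      also have "\<dots> \<le> ennreal (4 * (n0 * X))"
      proof (rule ennreal_leI)
        have "card JJ \<le> (\<Sum>c\<in>C1. card (J c))" unfolding JJ_def by (rule card_UN_le[OF fC(2)])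
        then have "real (card JJ) \<le> (\<Sum>c\<in>C1. real (card (J c)))" by (metis of_nat_le_iff of_nat_sum)
        then have "real (card JJ) * s \<le> (\<Sum>c\<in>C1. real (card (J c))) * s" using s by (intro mult_right_mono) auto
        also have "\<dots> \<le> (\<Sum>c\<in>C1. X)" unfolding sum_distrib_right by (intro sum_mono J)
        also have "\<dots> = real (card C1) * X" by simp
        also have "\<dots> \<le> n0 * X" unfolding n0_def using fC X0
          by (intro mult_right_mono) (auto simp: C1_def intro!: card_mono)
        finally show "4 * s * real (card JJ) \<le> 4 * (n0 * X)" by (simp add: mult.commute)
      qed
      finally show "hausdorff1_content \<delta> ({x. u x = 0} \<inter> Reg) \<le> ennreal (4 * (n0 * X))" .
    qed
    then show "hausdorff1 ({x. u x = 0} \<inter> {x. 2 * a * T \<le> norm x \<and> norm x \<le> 1 / c1 * T}) \<le> ennreal (C * (T\<^sup>2 * sqrt (T powr m)))"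
      unfolding X Reg_def .
  qed
qed

end

section \<open>Lower bound for the length\<close>

context growing_potential
begin

lemma ex_level_point:
  assumes "c2 \<le> h"
  obtains x where "V x = h"
proof -
  have conn: "connected (V ` UNIV)"
    by (rule connected_continuous_image[OF V_cont connected_UNIV])
  have h0: "h \<ge> 0" using assms c2 by linarith
  have "V 0 \<le> h" using V_upper[of 0] assms by simp
  moreover have "h \<le> V ((h / c1) *\<^sub>R axis 1 1)"
  proof -
    let ?y = "(h / c1) *\<^sub>R axis 1 1 :: real^2"
    have n: "norm ?y = h / c1" using c1 h0 by (simp add: norm_axis_1)
    have "h = c1 * (h / c1)" using c1 by simp
    also have "\<dots> \<le> c1 * (1 + norm ?y) powr 1" unfolding n using c1 h0 by (intro mult_left_mono) auto
    also have "\<dots> \<le> c1 * (1 + norm ?y) powr m" using c1 m by (intro mult_left_mono powr_mono) auto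
    finally show ?thesis using V_lower[of ?y] by linarith
  qed
  ultimately have "h \<in> V ` UNIV" using connected_contains_Icc[OF conn, of "V 0" "V ((h / c1) *\<^sub>R axis 1 1)"] by auto
  then show ?thesis using that by auto
qed

text \<open>Purely local: around a point where \<open>V\<close> is midway between \<epsilon>
  \<lambda> and \<lambda>, a whole square of radius proportional to \<open>T\<close> stays inside
  the shell with \<open>q \<le> - \<delta> \<lambda>\<close>. It holds about T^2 \<lambda> separated
  squares of radius of order \<lambda>^(-1/2), and each contains a zero together with nodal length
  of order \<lambda>^(-1/2).\<close>

lemma nodal_lower:
  assumes \<epsilon>: "0 \<le> \<epsilon>" "\<epsilon> < 1"
  obtains C T0 where "C > 0" "T0 \<ge> 1" "\<And>T u. T \<ge> T0 \<Longrightarrow> eigenpair V u (T powr m) \<Longrightarrow>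
    ennreal (C * (T\<^sup>2 * sqrt (T powr m))) \<le> hausdorff1 ({x. u x = 0} \<inter> {x. \<epsilon> * T powr m \<le> V x \<and> V x < T powr m})"
proof -
  \<comment> \<open>A quarter of the gap: (1 + \<epsilon>)/2 + \<delta> equals 1 - \<delta>, and (1
    + \<epsilon>)/2 - \<delta> is still at least \<epsilon>.\<close>
  define \<delta> where "\<delta> = (1 - \<epsilon>) / 4"
  have de: "\<delta> > 0" "\<delta> \<le> 1 / 4" using \<epsilon> by (auto simp: \<delta>_def)
  define b where "b = 1 / c1"
  have b: "b \<ge> 1" using c1 by (simp add: b_def)
  define D where "D = c2 * (b + 2) powr (m - 1)"
  have D: "D \<ge> 1" unfolding D_def
    using mult_mono[of 1 c2 1 "(b + 2) powr (m - 1)"] c2 b m ge_one_powr_ge_zero[of "b + 2" "m - 1"] by simp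
  \<comment> \<open>Chosen so that the gradient bound lets \<open>V\<close> vary by at most \<delta>
    \<lambda> over the square of radius t T.\<close>
  define t where "t = \<delta> / (2 * D)"
  have t: "t > 0" "t \<le> 1 / 8" "2 * t * D = \<delta>"
    using de D by (auto simp: t_def field_simps)
  \<comment> \<open>In units of \<lambda>^(-1/2), 3 / sqrt \<delta> is the radius in which a zero is
    certain and 1 is the radius of the square around it that carries the projections.\<close>
  define c6 where "c6 = 3 / sqrt \<delta> + 1"
  have c6: "c6 > 0" using de by (simp add: c6_def add_nonneg_pos)
  define C where "C = t\<^sup>2 / (1024 * c6\<^sup>2)"
  define T0 where "T0 = Max {1, 2 * c2, 2 * c6 / t}"
  have T0: "T0 \<ge> 1" "T0 \<ge> 2 * c2" "T0 \<ge> 2 * c6 / t" by (auto simp: T0_def)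
  show ?thesis
  proof (rule that[of C T0])
    show "C > 0" using t c6 by (simp add: C_def)
    show "T0 \<ge> 1" by (rule T0)
    fix T u assume T: "T \<ge> T0" and e: "eigenpair V u (T powr m)"
    interpret schroedinger_solution u "\<lambda>x. V x - T powr m" "dq (T powr m)" by (rule eigenpair_solution[OF e])
    define lam where "lam = T powr m"
    have TT: "T > 0" "T \<ge> 1" using T T0 by auto
    have lamT: "lam \<ge> T" unfolding lam_def using TT powr_mono[of 1 m T] m by simp
    then have lam1: "lam \<ge> 1" "lam > 0" using TT by auto
    have "c2 \<le> (1 + \<epsilon>) / 2 * lam"
    proof -
      have "c2 \<le> 1 / 2 * lam" using T T0 lamT by linarith
      also have "\<dots> \<le> (1 + \<epsilon>) / 2 * lam" using \<epsilon> lam1 by (intro mult_right_mono) auto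
      finally show ?thesis .
    qed
    then obtain x0 where x0: "V x0 = (1 + \<epsilon>) / 2 * lam" by (rule ex_level_point)
    have "(1 + \<epsilon>) / 2 * lam \<le> 1 * lam" using \<epsilon> lam1 by (intro mult_right_mono) auto
    then have nx0: "norm x0 \<le> b * T" unfolding b_def using V_le_imp_norm[of x0 T] x0 TT by (simp add: lam_def)
    have Vnear: "\<bar>V y - V x0\<bar> \<le> \<delta> * lam" if y: "y \<in> square x0 (t * T)" for y
    proof -
      have "\<bar>V y - V x0\<bar> \<le> 2 * (t * T) * (D * T powr (m - 1))"
      proof (rule lipschitz_on_square[OF _ _ y])
        show "has_partial i V (dV i 1)" for i using dV_partial[of i 0] by (simp add: dV_0)
        fix i w assume w: "w \<in> square x0 (t * T)"
        have "norm w \<le> norm x0 + 2 * (t * T)"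
          using norm_le_square[OF w] norm_triangle_ineq[of x0 "w - x0"] by simp
        also have "2 * (t * T) \<le> 1 * T" unfolding mult.assoc[symmetric] using t TT by (intro mult_right_mono) auto
        finally have "1 + norm w \<le> (b + 2) * T" using nx0 TT by (simp add: algebra_simps)
        then have "(1 + norm w) powr (m - 1) \<le> ((b + 2) * T) powr (m - 1)" using m by (intro powr_mono2) auto
        also have "\<dots> = (b + 2) powr (m - 1) * T powr (m - 1)" by (rule powr_mult)
        finally have "c2 * (1 + norm w) powr (m - 1) \<le> c2 * ((b + 2) powr (m - 1) * T powr (m - 1))"
          using c2 by (intro mult_left_mono) auto
        then show "\<bar>dV i 1 w\<bar> \<le> D * T powr (m - 1)" using V_grad[of i w] by (simp add: D_def mult.assoc)
      qed
      also have "\<dots> = 2 * t * D * (T powr 1 * T powr (m - 1))" using TT by simp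
      also have "\<dots> = \<delta> * lam" unfolding t(3) powr_add[symmetric] lam_def by simp
      finally show ?thesis .
    qed
    define sl where "sl = sqrt lam"
    have sl: "sl > 0" "sl \<ge> 1" "sl\<^sup>2 = lam" using lam1 by (auto simp: sl_def)
    define l where "l = 3 / (sqrt \<delta> * sl)"
    define s where "s = 1 / (2 * sl)"
    define L where "L = c6 / sl"
    have l: "l > 0" "\<delta> * lam * l\<^sup>2 \<ge> 9" using de sl lam1 by (auto simp: l_def power_divide power_mult_distrib sl(3))
    have s: "s > 0" using sl by (simp add: s_def)
    have L: "L > 0" "l + 2 * s = L" "L \<le> c6"
    proof -
      show "L > 0" using c6 sl by (simp add: L_def)
      show "l + 2 * s = L" using sl de by (simp add: l_def s_def L_def c6_def field_simps)
      have "c6 * 1 \<le> c6 * sl" using c6 sl by (intro mult_left_mono) auto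
      then show "L \<le> c6" using sl by (simp add: L_def field_simps)
    qed
    have "2 * c6 \<le> T0 * t" using T0(3) t by (simp add: field_simps)
    also have "\<dots> \<le> T * t" using T t by (intro mult_right_mono) auto
    finally have Lt: "L \<le> t * T / 2" using L(3) by (simp add: mult.commute)
    \<comment> \<open>Centres are at most 4 L n from \<open>x0\<close> in each coordinate, hence
      within t T/2, which leaves t T/2 for the squares themselves.\<close>
    define n where "n = \<lfloor>t * T / (8 * L)\<rfloor>"
    have n0: "n \<ge> 0" using t TT L by (simp add: n_def)
    have n: "real_of_int n * (8 * L) \<le> t * T" "real_of_int n + 1 \<ge> t * T / (8 * L)"
    proof -
      have "real_of_int n \<le> t * T / (8 * L)" unfolding n_def by simp
      then show "real_of_int n * (8 * L) \<le> t * T" using L by (simp add: field_simps)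
      show "real_of_int n + 1 \<ge> t * T / (8 * L)" unfolding n_def by linarith
    qed
    define J where "J = {-n..n} \<times> {-n..n}"
    \<comment> \<open>Centres are 4 L apart while the squares have radius \<open>L\<close>, so
      pieces of different squares are at distance at least 2 L; this is the separation for
      \<open>hausdorff1_lower\<close> at scale \<open>L\<close>.\<close>
    define ctr where "ctr = cell x0 (2 * L)"
    have sub: "square (ctr c) L \<subseteq> square x0 (t * T)" if c: "c \<in> J" for c
    proof
      fix y assume y: "y \<in> square (ctr c) L"
      have "ctr c \<in> square x0 (t * T / 2)"
      proof -
        have "\<bar>real_of_int k\<bar> * (4 * L) \<le> t * T / 2" if "k \<in> {-n..n}" for k
        proof -
          have "\<bar>real_of_int k\<bar> \<le> real_of_int n" using that by (auto simp: abs_le_iff)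
          then have "\<bar>real_of_int k\<bar> * (4 * L) \<le> real_of_int n * (4 * L)" using L by (intro mult_right_mono) auto
          then show ?thesis using n(1) by simp
        qed
        then have "\<bar>2 * (2 * L) * real_of_int (fst c)\<bar> \<le> t * T / 2" "\<bar>2 * (2 * L) * real_of_int (snd c)\<bar> \<le> t * T / 2"
          using c L by (auto simp: J_def abs_mult mult.commute)
        then show ?thesis by (simp add: ctr_def cell_def square_def forall_2)
      qed
      then show "y \<in> square x0 (t * T)" using square_trans[OF _ y] Lt by simp
    qed
    have q: "V y - T powr m \<le> - (\<delta> * lam)" "\<bar>V y - T powr m\<bar> \<le> lam" "\<epsilon> * lam \<le> V y" "V y < lam"
      if "y \<in> square x0 (t * T)" for y
    proof -
      have v: "V y \<le> ((1 + \<epsilon>) / 2 + \<delta>) * lam" "((1 + \<epsilon>) / 2 - \<delta>) * lam \<le> V y"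
        using Vnear[OF that] x0 by (simp_all add: abs_le_iff algebra_simps)
      have "((1 + \<epsilon>) / 2 + \<delta>) * lam = lam - \<delta> * lam" by (simp add: \<delta>_def field_simps)
      then show 1: "V y - T powr m \<le> - (\<delta> * lam)" using v by (simp add: lam_def)
      have "\<epsilon> * lam \<le> ((1 + \<epsilon>) / 2 - \<delta>) * lam" using lam1 \<epsilon> by (intro mult_right_mono) (auto simp: \<delta>_def field_simps)
      then show "\<epsilon> * lam \<le> V y" using v by linarith
      have "\<delta> * lam > 0" using de lam1 by simp
      then show "V y < lam" "\<bar>V y - T powr m\<bar> \<le> lam" using 1 V_nonneg[of y] by (auto simp: lam_def abs_le_iff)
    qed
    have "\<exists>z\<in>square (ctr c) l. u z = 0" if c: "c \<in> J" for c
    proof (rule zero_exists_in_square[OF _ l])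
      fix y assume y: "y \<in> square (ctr c) l"
      have "l \<le> L" using L s by linarith
      then have "y \<in> square x0 (t * T)" using y sub[OF c] square_mono by blast
      then show "V y - T powr m \<le> - (\<delta> * lam)" by (rule q)
    qed
    then obtain z where z: "\<And>c. c \<in> J \<Longrightarrow> z c \<in> square (ctr c) l" "\<And>c. c \<in> J \<Longrightarrow> u (z c) = 0" by metis
    define Bs where "Bs c = {y \<in> square (z c) (2 * s). u y = 0}" for c
    have zL: "square (z c) (2 * s) \<subseteq> square (ctr c) L" if "c \<in> J" for c
      using square_trans[OF z(1)[OF that], of _ "2 * s" L] L(2) by auto
    have proj: "s / 2 \<le> (\<Sum>i\<in>UNIV. measure lborel ((\<lambda>y. y $ i) ` Bs c))" if c: "c \<in> J" for c
      unfolding Bs_def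
    proof (rule zero_projections[where \<Lambda> = lam and z = "z c"])
      show "\<bar>V y - T powr m\<bar> \<le> lam" if "y \<in> square (z c) (2 * s)" for y
        using q(2) sub[OF c] zL[OF c] that by blast
      show "2 * s * sqrt lam \<le> 1" using sl by (simp add: s_def sl_def[symmetric])
    qed (use s z(2)[OF c] center_in_square[of s "z c"] in auto)
    have fJ: "finite J" by (simp add: J_def)
    let ?A = "{x. u x = 0} \<inter> {x. \<epsilon> * T powr m \<le> V x \<and> V x < T powr m}"
    have "ennreal (1/4 * (\<Sum>c\<in>J. \<Sum>i\<in>UNIV. measure lborel ((\<lambda>y. y $ i) ` Bs c))) \<le> hausdorff1 ?A"
    proof (rule hausdorff1_lower[OF fJ _ _ L(1)])
      fix c assume c: "c \<in> J"
      have "Bs c = square (z c) (2 * s) \<inter> {y. u y = 0}" by (auto simp: Bs_def)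
      then have "compact (Bs c)"
        by (simp add: compact_Int_closed compact_square closed_Collect_eq[OF u_cont continuous_on_const])
      moreover have "Bs c \<subseteq> ?A" using q(3,4) sub[OF c] zL[OF c] unfolding Bs_def lam_def by blast
      ultimately show "compact (Bs c) \<and> Bs c \<subseteq> ?A" by blast
    next
      fix c c' x y assume c: "c \<in> J" "c' \<in> J" "c \<noteq> c'" "x \<in> Bs c" "y \<in> Bs c'"
      have xs: "x \<in> square (ctr c) L" "y \<in> square (ctr c') L" using c zL unfolding Bs_def by blast+
      obtain i where i: "\<bar>ctr c $ i - ctr c' $ i\<bar> \<ge> 4 * L"
      proof -
        have far: "4 * L \<le> \<bar>4 * L * real_of_int k - 4 * L * real_of_int k'\<bar>" if "k \<noteq> k'" for k k' :: int
        proof -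
          have "1 \<le> \<bar>real_of_int k - real_of_int k'\<bar>" using that by linarith
          then have "4 * L * 1 \<le> 4 * L * \<bar>real_of_int k - real_of_int k'\<bar>" using L by (intro mult_left_mono) auto
          also have "\<dots> = \<bar>4 * L * real_of_int k - 4 * L * real_of_int k'\<bar>"
            using L by (simp add: right_diff_distrib[symmetric] abs_mult)
          finally show ?thesis by simp
        qed
        have "fst c \<noteq> fst c' \<or> snd c \<noteq> snd c'" using c(3) by (simp add: prod_eq_iff)
        then show ?thesis
        proof
          assume "fst c \<noteq> fst c'"
          then show ?thesis using far[of "fst c" "fst c'"] that[of 1] by (simp add: ctr_def cell_def)
        next
          assume "snd c \<noteq> snd c'"
          then show ?thesis using far[of "snd c" "snd c'"] that[of 2] by (simp add: ctr_def cell_def)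
        qed
      qed
      have "\<bar>x $ i - ctr c $ i\<bar> \<le> L" "\<bar>y $ i - ctr c' $ i\<bar> \<le> L" using xs by (auto simp: square_def)
      then have "\<bar>(x - y) $ i\<bar> \<ge> 2 * L" using i by simp
      then show "dist x y > L" using component_le_norm_cart[of "x - y" i] L(1) by (simp add: dist_norm)
    qed
    moreover have "C * (T\<^sup>2 * sqrt (T powr m)) \<le> 1/4 * (\<Sum>c\<in>J. \<Sum>i\<in>UNIV. measure lborel ((\<lambda>y. y $ i) ` Bs c))"
    proof -
      have cJ: "real (card J) = (2 * real_of_int n + 1)\<^sup>2"
        using n0 by (simp add: J_def card_cartesian_product power2_eq_square)
      have "C * (T\<^sup>2 * sqrt (T powr m)) = 1/4 * ((t * T / (8 * L))\<^sup>2 * (s / 2))"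
        using sl c6 unfolding C_def L_def s_def lam_def[symmetric] sl_def[symmetric]
        by (simp add: power_divide power_mult_distrib field_simps power2_eq_square)
      also have "\<dots> \<le> 1/4 * ((2 * real_of_int n + 1)\<^sup>2 * (s / 2))"
        using n n0 t TT L s by (intro mult_left_mono mult_right_mono power_mono) auto
      also have "\<dots> = 1/4 * (\<Sum>c\<in>J. s / 2)" using cJ by simp
      also have "\<dots> \<le> 1/4 * (\<Sum>c\<in>J. \<Sum>i\<in>UNIV. measure lborel ((\<lambda>y. y $ i) ` Bs c))"
        by (intro mult_left_mono sum_mono proj) auto
      finally show ?thesis .
    qed
    ultimately show "ennreal (C * (T\<^sup>2 * sqrt (T powr m))) \<le> hausdorff1 ?A"
      using ennreal_leI order_trans by blast
  qed
qed

end

lemma hausdorff1_mono: "A \<subseteq> B \<Longrightarrow> hausdorff1 A \<le> hausdorff1 B"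
  unfolding hausdorff1_def hausdorff1_content_def
  by (intro SUP_mono' INF_superset_mono) auto

section \<open>Combining both bounds\<close>

context analytic_potential
begin

text \<open>The condition on \<open>a\<close> makes the shell avoid the central disc: where norm x <
  2 a T, once a T is at least 1, \<open>V\<close> is at most 3 a c2 \<lambda>, below \<epsilon>
  \<lambda>. All zeros to be counted then lie in the annulus of \<open>nodal_upper\<close>.\<close>

lemma nodal_length_order_holds:
  assumes \<epsilon>: "0 \<le> \<epsilon>" "\<epsilon> < 1" and small: "a = 0 \<or> 3 * a * c2 < \<epsilon>"
  shows "nodal_length_order V m \<epsilon>"
proof -
  obtain C T0 where C: "C \<ge> 0" "T0 \<ge> 1" and up: "\<And>T u. T \<ge> T0 \<Longrightarrow> eigenpair V u (T powr m) \<Longrightarrow>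
    hausdorff1 ({x. u x = 0} \<inter> {x. 2 * a * T \<le> norm x \<and> norm x \<le> 1 / c1 * T}) \<le> ennreal (C * (T\<^sup>2 * sqrt (T powr m)))"
    by (rule nodal_upper) blast
  obtain C' T0' where C': "C' > 0" "T0' \<ge> 1" and low: "\<And>T u. T \<ge> T0' \<Longrightarrow> eigenpair V u (T powr m) \<Longrightarrow>
    ennreal (C' * (T\<^sup>2 * sqrt (T powr m))) \<le> hausdorff1 ({x. u x = 0} \<inter> {x. \<epsilon> * T powr m \<le> V x \<and> V x < T powr m})"
    by (rule nodal_lower[OF \<epsilon>]) blast
  define K where "K = Max {1, C, 1 / C'}"
  have K: "K \<ge> 1" "K \<ge> C" "K \<ge> 1 / C'" by (auto simp: K_def)
  \<comment> \<open>The value 1 for \<open>a = 0\<close> is a dummy; for positive \<open>a\<close>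
    the entry ensures a T at least 1.\<close>
  define Tm where "Tm = Max {T0, T0', 1 / (if a = 0 then 1 else a)}"
  have Tm: "Tm \<ge> T0" "Tm \<ge> T0'" "a \<noteq> 0 \<Longrightarrow> Tm \<ge> 1 / a" "Tm \<ge> 1" using C by (auto simp: Tm_def)
  show ?thesis
    unfolding nodal_length_order_def
  proof (rule exI[of _ K], rule conjI[OF K(1)], rule exI[of _ "Tm powr m"], intro conjI allI impI)
    show "0 < Tm powr m" using Tm by simp
    fix u lam assume H: "eigenpair V u lam \<and> Tm powr m \<le> lam"
    define T where "T = lam powr (1 / m)"
    have lam0: "lam > 0" using H Tm by (smt (verit) powr_gt_zero)
    have Tlam: "T powr m = lam" using lam0 m by (simp add: T_def powr_powr)
    have "(Tm powr m) powr (1 / m) \<le> T" unfolding T_def using H m by (intro powr_mono2) auto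
    then have TTm: "T \<ge> Tm" using Tm m by (simp add: powr_powr)
    have T0: "T > 0" using TTm Tm by linarith
    have e: "eigenpair V u (T powr m)" using H Tlam by simp
    have size: "T\<^sup>2 * sqrt (T powr m) = lam powr (1/2 + 2/m)"
    proof -
      have "T\<^sup>2 = lam powr (2 / m)" using lam0 by (simp add: T_def powr_powr powr_numeral[symmetric])
      moreover have "sqrt (T powr m) = lam powr (1/2)" unfolding Tlam using lam0 by (simp add: powr_half_sqrt)
      ultimately show ?thesis by (simp add: powr_add)
    qed
    let ?S = "nodal_set u \<inter> (sublevel V lam - sublevel V (\<epsilon> * lam))"
    have cu: "continuous_on UNIV u" using H by (simp add: eigenpair_def)
    \<comment> \<open>The zero set of the continuous representative is already closed, so the
      closure in \<open>nodal_set\<close> adds nothing.\<close>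
    have "closed {x. u x = 0}" by (rule closed_Collect_eq[OF cu continuous_on_const])
    then have S: "?S = {x. u x = 0} \<inter> {x. \<epsilon> * T powr m \<le> V x \<and> V x < T powr m}"
      unfolding nodal_set_def sublevel_def Tlam by auto
    have "1 / K \<le> C'" using K C' by (simp add: field_simps)
    then have "ennreal (1 / K * lam powr (1/2 + 2/m)) \<le> ennreal (C' * (T\<^sup>2 * sqrt (T powr m)))"
      unfolding size by (intro ennreal_leI mult_right_mono) auto
    also have "\<dots> \<le> hausdorff1 ?S" unfolding S using low e TTm Tm by simp
    finally show "ennreal (1 / K * lam powr (1/2 + 2/m)) \<le> hausdorff1 ?S" .
    have "?S \<subseteq> {x. u x = 0} \<inter> {x. 2 * a * T \<le> norm x \<and> norm x \<le> 1 / c1 * T}"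
    proof
      fix x assume "x \<in> ?S"
      then have x: "u x = 0" "\<epsilon> * T powr m \<le> V x" "V x \<le> T powr m" unfolding S by auto
      have "2 * a * T \<le> norm x"
      proof (cases "a = 0")
        case False
        then have a0: "a > 0" using a by simp
        have a1: "3 * a \<le> 1"
        proof -
          have "a * 1 \<le> a * (32 * c2)" using a0 c2 by (intro mult_left_mono) auto
          then show ?thesis using a c2 by (simp add: field_simps)
        qed
        show ?thesis
        proof (rule ccontr)
          assume "\<not> 2 * a * T \<le> norm x"
          moreover have "1 \<le> a * T" using Tm(3)[OF False] TTm a0 by (simp add: field_simps) (smt (verit) divide_le_eq)
          ultimately have "1 + norm x \<le> (3 * a) * T" by simp
          then have "(1 + norm x) powr m \<le> 3 * a * T powr m" using a0 a1 T0 by (intro powr_scale_le m) auto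
          then have "V x \<le> c2 * (3 * a * T powr m)" using V_upper[of x] c2 by (smt (verit) mult_left_mono)
          also have "\<dots> < \<epsilon> * T powr m" using small False T0 by (simp add: mult.commute mult.left_commute)
          finally show False using x by simp
        qed
      qed simp
      moreover have "norm x \<le> 1 / c1 * T" by (rule V_le_imp_norm[OF x(3) T0])
      ultimately show "x \<in> {x. u x = 0} \<inter> {x. 2 * a * T \<le> norm x \<and> norm x \<le> 1 / c1 * T}" using x by simp
    qed
    then have "hausdorff1 ?S \<le> hausdorff1 ({x. u x = 0} \<inter> {x. 2 * a * T \<le> norm x \<and> norm x \<le> 1 / c1 * T})"
      by (rule hausdorff1_mono)
    also have "\<dots> \<le> ennreal (C * (T\<^sup>2 * sqrt (T powr m)))" using up e TTm Tm by simp
    also have "\<dots> \<le> ennreal (K * lam powr (1/2 + 2/m))" unfolding size using K by (intro ennreal_leI mult_right_mono) auto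
    finally show "hausdorff1 ?S \<le> ennreal (K * lam powr (1/2 + 2/m))" .
  qed
qed

end

section \<open>Potentials holomorphic in a conic neighbourhood\<close>

lemma japanese_bracket_bounds:
  fixes x :: "'a::real_normed_vector"
  shows "japanese_bracket x \<le> 1 + norm x" "1 + norm x \<le> 2 * japanese_bracket x" "japanese_bracket x \<ge> 1"
    "\<bar>japanese_bracket x - japanese_bracket y\<bar> \<le> norm (x - y)"
proof -
  have "sqrt (1 + (norm x)\<^sup>2) \<le> sqrt ((1 + norm x)\<^sup>2)" by (intro real_sqrt_le_mono) (simp add: power2_sum)
  then show "japanese_bracket x \<le> 1 + norm x" by (simp add: japanese_bracket_def)
  show one: "japanese_bracket x \<ge> 1" by (simp add: japanese_bracket_def)
  have "norm x = sqrt ((norm x)\<^sup>2)" by simp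
  also have "\<dots> \<le> japanese_bracket x" unfolding japanese_bracket_def by (intro real_sqrt_le_mono) simp
  finally show "1 + norm x \<le> 2 * japanese_bracket x" using one by linarith
  have "\<bar>japanese_bracket x - japanese_bracket y\<bar> \<le> \<bar>norm x - norm y\<bar>"
  proof -
    have "sqrt (1 + s\<^sup>2) - sqrt (1 + t\<^sup>2) \<le> \<bar>s - t\<bar>" for s t :: real
      using real_sqrt_sum_squares_triangle_ineq[of 1 0 t "s - t"] by (simp add: power2_eq_square[of 1]) 
    from this[of "norm x" "norm y"] this[of "norm y" "norm x"] show ?thesis
      unfolding japanese_bracket_def by (simp add: abs_le_iff abs_minus_commute)
  qed
  also have "\<dots> \<le> norm (x - y)" by (rule norm_triangle_ineq3)
  finally show "\<bar>japanese_bracket x - japanese_bracket y\<bar> \<le> norm (x - y)" .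
qed

text \<open>Cauchy's inequality for a difference serves twice: with \<open>g = 0\<close> it bounds
  the derivatives of a slice, with a neighbouring slice it shows that they depend continuously on
  the base point.\<close>

lemma holomorphic_coefficient_diff:
  assumes "f holomorphic_on ball 0 R" "g holomorphic_on ball 0 R" "0 < r" "r < R"
    and "\<And>z. norm z \<le> r \<Longrightarrow> norm (f z - g z) \<le> e"
  shows "norm ((deriv ^^ n) f 0 - (deriv ^^ n) g 0) \<le> fact n * e / r ^ n"
proof -
  have h: "(\<lambda>z. f z - g z) holomorphic_on ball 0 R" using assms by (intro holomorphic_intros)
  have "norm ((deriv ^^ n) (\<lambda>z. f z - g z) 0) \<le> fact n * e / r ^ n"
  proof (rule Cauchy_inequality)
    show "(\<lambda>z. f z - g z) holomorphic_on ball 0 r" by (rule holomorphic_on_subset[OF h]) (use assms in auto)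
    show "continuous_on (cball 0 r) (\<lambda>z. f z - g z)"
      by (rule continuous_on_subset[OF holomorphic_on_imp_continuous_on[OF h]]) (use assms in auto)
  qed (use assms in auto)
  moreover have "(deriv ^^ n) (\<lambda>z. f z - g z) 0 = (deriv ^^ n) f 0 - (deriv ^^ n) g 0"
    by (rule higher_deriv_diff[of f "ball 0 R"]) (use assms in auto)
  ultimately show ?thesis by simp
qed

locale conic_potential =
  fixes V :: "real^2 \<Rightarrow> real" and Vc :: "complex^2 \<Rightarrow> complex" and m \<epsilon>\<^sub>0 C C' :: real
  assumes m: "m \<ge> 1" and e0: "\<epsilon>\<^sub>0 > 0" and C: "C > 0" and C': "C' > 0"
    and extension: "\<And>x. Vc (complex_vec x) = complex_of_real (V x)"
    and holomorphic: "vec_holomorphic_on Vc (conic_nbhd \<epsilon>\<^sub>0)"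
    and upper: "\<And>z. z \<in> conic_nbhd \<epsilon>\<^sub>0 \<Longrightarrow> norm (Vc z) \<le> C * japanese_bracket (Re_vec z) powr m"
    and lower: "\<And>x. 1 / C' * japanese_bracket x powr m \<le> V x"
begin

text \<open>The solution of e1 = \<epsilon>0 (1 - e1): a complex displacement of size e1 <x> lowers
  the bracket of the real part to no less than (1 - e1) <x>, so its imaginary part still satisfies
  the cone condition.\<close>

definition "e1 = \<epsilon>\<^sub>0 / (1 + \<epsilon>\<^sub>0)"

lemma e1: "0 < e1" "e1 < 1" "e1 \<le> \<epsilon>\<^sub>0 * (1 - e1)"
  using e0 by (auto simp: e1_def field_simps)

text \<open>Restriction to the complex line through \<open>x\<close> along one axis; one-variable
  Cauchy theory then gives all pure derivatives.\<close>

definition "slice x i z = Vc (complex_vec x + z *s axis i 1)"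

definition "rad x = e1 * japanese_bracket x"

lemma rad_pos: "rad x > 0"
  using e1 japanese_bracket_bounds(3)[of x] by (simp add: rad_def)

lemma Re_slice: "Re_vec (complex_vec x + z *s axis i 1) = x + Re z *\<^sub>R axis i 1"
  by (simp add: Re_vec_def complex_vec_def vec_eq_iff axis_def)

lemma Im_slice: "Im_vec (complex_vec x + z *s axis i 1) = Im z *\<^sub>R axis i 1"
  by (simp add: Im_vec_def complex_vec_def vec_eq_iff axis_def)

lemma bracket_slice:
  fixes x :: "real^2"
  assumes "norm z \<le> rad x"
  shows "(1 - e1) * japanese_bracket x \<le> japanese_bracket (x + Re z *\<^sub>R axis i 1)"
    "japanese_bracket (x + Re z *\<^sub>R axis i 1) \<le> 2 * japanese_bracket x"
proof -
  have "\<bar>japanese_bracket (x + Re z *\<^sub>R axis i 1) - japanese_bracket x\<bar> \<le> norm (Re z *\<^sub>R axis i (1::real))"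
    using japanese_bracket_bounds(4)[of "x + Re z *\<^sub>R axis i 1" x] by (simp only: add_diff_cancel_left')
  also have "\<dots> = \<bar>Re z\<bar>" by (simp add: norm_axis_1)
  also have "\<dots> \<le> e1 * japanese_bracket x" using abs_Re_le_cmod[of z] assms by (simp add: rad_def)
  finally have d: "\<bar>japanese_bracket (x + Re z *\<^sub>R axis i 1) - japanese_bracket x\<bar> \<le> e1 * japanese_bracket x" .
  show "(1 - e1) * japanese_bracket x \<le> japanese_bracket (x + Re z *\<^sub>R axis i 1)"
    using abs_le_D2[OF d] by (simp add: algebra_simps)
  have "e1 * japanese_bracket x \<le> 1 * japanese_bracket x"
    using e1 japanese_bracket_bounds(3)[of x] by (intro mult_right_mono) auto
  then show "japanese_bracket (x + Re z *\<^sub>R axis i 1) \<le> 2 * japanese_bracket x" using abs_le_D1[OF d] by simp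
qed

lemma slice_in_cone:
  assumes "norm z \<le> rad x"
  shows "complex_vec x + z *s axis i 1 \<in> conic_nbhd \<epsilon>\<^sub>0"
proof -
  have "norm (Im_vec (complex_vec x + z *s axis i 1)) = \<bar>Im z\<bar>" by (simp add: Im_slice norm_axis_1)
  also have "\<dots> \<le> e1 * japanese_bracket x" using abs_Im_le_cmod[of z] assms by (simp add: rad_def)
  also have "\<dots> \<le> \<epsilon>\<^sub>0 * (1 - e1) * japanese_bracket x"
    using e1 japanese_bracket_bounds(3)[of x] by (intro mult_right_mono) auto
  also have "\<dots> \<le> \<epsilon>\<^sub>0 * japanese_bracket (x + Re z *\<^sub>R axis i 1)"
    unfolding mult.assoc using bracket_slice(1)[OF assms, of i] e0 by (intro mult_left_mono) auto
  finally show ?thesis by (simp add: conic_nbhd_def Re_slice)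
qed

lemma slice_bound:
  assumes "norm z \<le> rad x"
  shows "norm (slice x i z) \<le> C * 2 powr m * japanese_bracket x powr m"
proof -
  have "norm (slice x i z) \<le> C * japanese_bracket (x + Re z *\<^sub>R axis i 1) powr m"
    using upper[OF slice_in_cone[OF assms, of i]] by (simp add: slice_def Re_slice)
  also have "\<dots> \<le> C * (2 * japanese_bracket x) powr m"
    using bracket_slice(2)[OF assms, of i] C m japanese_bracket_bounds(3)[of "x + Re z *\<^sub>R axis i 1"]
    by (intro mult_left_mono powr_mono2) auto
  also have "(2 * japanese_bracket x) powr m = 2 powr m * japanese_bracket x powr m" by (rule powr_mult)
  finally show ?thesis by (simp add: mult.assoc)
qed

lemma slice_holomorphic: "slice x i holomorphic_on ball 0 (rad x)"
  unfolding holomorphic_on_def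
proof
  fix z :: complex assume z: "z \<in> ball 0 (rad x)"
  let ?h = "\<lambda>z. complex_vec x + z *s axis i (1::complex)"
  have "?h z \<in> conic_nbhd \<epsilon>\<^sub>0" using slice_in_cone[of z x i] z by simp
  then obtain f' where f': "(Vc has_derivative f') (at (?h z) within conic_nbhd \<epsilon>\<^sub>0)" "\<And>c v. f' (c *s v) = c * f' v"
    using holomorphic unfolding vec_holomorphic_on_def by blast
  have bl: "bounded_linear (\<lambda>z. z *s axis i (1::complex))"
    by (rule linear_conv_bounded_linear[THEN iffD1], rule linearI)
      (simp_all add: vec_eq_iff distrib_right)
  have hd: "(?h has_derivative (\<lambda>d. d *s axis i 1)) (at z within ball 0 (rad x))"
    using has_derivative_add[OF has_derivative_const bounded_linear.has_derivative[OF bl has_derivative_ident]] by simp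
  have sub: "?h ` ball 0 (rad x) \<subseteq> conic_nbhd \<epsilon>\<^sub>0" using slice_in_cone[of _ x i] by auto
  have "((\<lambda>z. Vc (?h z)) has_derivative (\<lambda>d. f' (d *s axis i 1))) (at z within ball 0 (rad x))"
    by (rule has_derivative_in_compose[OF hd has_derivative_subset[OF f'(1) sub]])
  then have "(slice x i has_field_derivative f' (axis i 1)) (at z within ball 0 (rad x))"
    unfolding has_field_derivative_def slice_def[abs_def] f'(2) by (simp add: mult.commute[of _ "f' (axis i 1)"])
  then show "slice x i field_differentiable at z within ball 0 (rad x)"
    by (auto simp: field_differentiable_def)
qed

definition "dV i n x = Re ((deriv ^^ n) (slice x i) 0)"

lemma dV_0: "dV i 0 x = V x"
  by (simp add: dV_def slice_def extension)

lemma dV_bound: "\<bar>dV i n x\<bar> \<le> C * 2 powr m * japanese_bracket x powr m * fact n * (2 / (e1 * japanese_bracket x)) ^ n"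
proof -
  have r: "rad x > 0" by (rule rad_pos)
  have "norm ((deriv ^^ n) (slice x i) 0 - (deriv ^^ n) (\<lambda>z. 0) 0) \<le> fact n * (C * 2 powr m * japanese_bracket x powr m) / (rad x / 2) ^ n"
    by (rule holomorphic_coefficient_diff[OF slice_holomorphic]) (use r slice_bound[of _ x i] in auto)
  then have "norm ((deriv ^^ n) (slice x i) 0) \<le> fact n * (C * 2 powr m * japanese_bracket x powr m) / (rad x / 2) ^ n"
    by (simp add: higher_deriv_const)
  then have "\<bar>dV i n x\<bar> \<le> fact n * (C * 2 powr m * japanese_bracket x powr m) / (rad x / 2) ^ n"
    unfolding dV_def using abs_Re_le_cmod order_trans by blast
  also have "\<dots> = C * 2 powr m * japanese_bracket x powr m * fact n * (2 / (e1 * japanese_bracket x)) ^ n"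
    using r by (simp add: rad_def power_divide power_mult_distrib)
  finally show ?thesis .
qed

lemma slice_shift: "slice (x + t *\<^sub>R axis i 1) i z = slice x i (z + of_real t)"
proof -
  have "complex_vec (x + t *\<^sub>R axis i 1) + z *s axis i 1 = complex_vec x + (z + of_real t) *s axis i 1"
    by (simp add: complex_vec_def vec_eq_iff axis_def algebra_simps)
  then show ?thesis unfolding slice_def by (rule arg_cong)
qed

text \<open>Moving the base point along the axis translates the slice, so the real derivative of
  \<open>dV i n\<close> along the axis is the next complex derivative of the same slice.\<close>

lemma dV_partial: "has_partial i (dV i n) (dV i (Suc n))"
  unfolding has_partial_def
proof
  fix x
  let ?f = "slice x i"
  have hol: "(deriv ^^ n) ?f holomorphic_on ball 0 (rad x)"
    by (rule holomorphic_higher_deriv[OF slice_holomorphic open_ball])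
  have shift: "(deriv ^^ n) (slice (x + t *\<^sub>R axis i 1) i) 0 = (deriv ^^ n) ?f (of_real t)" if t: "\<bar>t\<bar> < rad x" for t
  proof -
    have "slice (x + t *\<^sub>R axis i 1) i = (\<lambda>z. ?f (1 * z + of_real t))" by (auto simp: slice_shift)
    moreover have "(deriv ^^ n) (\<lambda>z. ?f (1 * z + of_real t)) 0 = 1 ^ n * (deriv ^^ n) ?f (1 * 0 + of_real t)"
    proof (rule higher_deriv_compose_linear'[where S = "ball (- of_real t) (rad x)" and T = "ball 0 (rad x)"])
      show "1 * w + complex_of_real t \<in> ball 0 (rad x)" if "w \<in> ball (- of_real t) (rad x)" for w
      proof -
        have "cmod (- w - complex_of_real t) = cmod (w + complex_of_real t)"
          using norm_minus_cancel[of "w + complex_of_real t"] by simp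
        then show ?thesis using that norm_minus_commute[of "- complex_of_real t" w] by (simp add: dist_norm)
      qed
    qed (use slice_holomorphic t in \<open>auto simp: dist_norm\<close>)
    ultimately show ?thesis by simp
  qed
  have "((deriv ^^ n) ?f has_field_derivative (deriv ^^ Suc n) ?f 0) (at 0)"
    using holomorphic_derivI[OF hol open_ball, of 0] rad_pos[of x] by simp
  then have d: "((deriv ^^ n) ?f has_derivative (\<lambda>h. h * (deriv ^^ Suc n) ?f 0)) (at (of_real 0))"
    by (simp add: has_field_derivative_def mult_commute_abs)
  have "((\<lambda>t. (deriv ^^ n) ?f (of_real t)) has_derivative (\<lambda>h. of_real h * (deriv ^^ Suc n) ?f 0)) (at (0::real))"
    by (rule has_derivative_compose[OF has_derivative_of_real[OF has_derivative_ident] d])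
  then have "((\<lambda>t. Re ((deriv ^^ n) ?f (of_real t))) has_derivative (\<lambda>h. Re (of_real h * (deriv ^^ Suc n) ?f 0))) (at (0::real))"
    by (rule has_derivative_Re)
  then have D: "((\<lambda>t. Re ((deriv ^^ n) ?f (of_real t))) has_real_derivative dV i (Suc n) x) (at 0)"
    unfolding has_field_derivative_def dV_def by (simp add: mult.commute[of _ "Re _"])
  have ev: "eventually (\<lambda>t. Re ((deriv ^^ n) ?f (of_real t)) = dV i n (x + t *\<^sub>R axis i 1)) (nhds 0)"
    using eventually_nhds_in_open[of "{- rad x<..<rad x}" 0] rad_pos[of x]
    by (auto simp: dV_def elim!: eventually_mono intro!: arg_cong[of _ _ Re] shift[symmetric])
  show "((\<lambda>t. dV i n (x + t *\<^sub>R axis i 1)) has_real_derivative dV i (Suc n) x) (at 0)"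
    by (rule DERIV_cong_ev[OF refl ev refl, THEN iffD1, OF D])
qed

lemma Vc_continuous: "continuous_on (conic_nbhd \<epsilon>\<^sub>0) Vc"
  using holomorphic unfolding vec_holomorphic_on_def continuous_on_eq_continuous_within
  by (metis has_derivative_continuous)

text \<open>The slices depend uniformly continuously on base point and variable over a compact
  product; the Cauchy estimate for differences carries this over to all derivatives.\<close>

lemma dV_cont: "continuous_on UNIV (dV i n)"
proof (rule continuous_at_imp_continuous_on, rule ballI)
  fix x0 :: "real^2"
  \<comment> \<open>A quarter of the radius leaves every slice with base point within
    \<open>r\<close> holomorphic on a disc of radius at least 2 r.\<close>
  define r where "r = rad x0 / 4"
  have r: "r > 0" using rad_pos[of x0] by (simp add: r_def)
  have rx: "2 * r \<le> rad x" if "norm (x - x0) \<le> r" for x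
  proof -
    have "japanese_bracket x0 - japanese_bracket x \<le> norm (x - x0)"
      using japanese_bracket_bounds(4)[of x x0] by (simp add: abs_le_iff)
    then have "e1 * (japanese_bracket x0 - japanese_bracket x) \<le> e1 * r"
      using e1 that by (intro mult_left_mono) auto
    also have "\<dots> \<le> 1 * r" using e1 r by (intro mult_right_mono) auto
    finally have "e1 * (japanese_bracket x0 - japanese_bracket x) \<le> 1 * r" .
    moreover have "0 < e1 * japanese_bracket x0" using rad_pos[of x0] by (simp add: rad_def)
    ultimately show ?thesis unfolding r_def rad_def right_diff_distrib by linarith
  qed
  define S where "S = cball x0 r \<times> cball (0::complex) r"
  have cS: "compact S" unfolding S_def by (intro compact_Times compact_cball)
  have "continuous_on S (\<lambda>(x, z). slice x i z)"
    unfolding slice_def split_beta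
  proof (rule continuous_on_compose2[OF Vc_continuous])
    show "continuous_on S (\<lambda>y. complex_vec (fst y) + snd y *s axis i 1)"
      unfolding complex_vec_def vector_scalar_mult_def
      by (intro continuous_on_vec_lambda continuous_intros continuous_on_add)
    show "(\<lambda>y. complex_vec (fst y) + snd y *s axis i 1) ` S \<subseteq> conic_nbhd \<epsilon>\<^sub>0"
    proof safe
      fix x and z :: complex assume "(x, z) \<in> S"
      then have "norm (x - x0) \<le> r" "norm z \<le> r" by (auto simp: S_def dist_norm norm_minus_commute)
      then show "complex_vec (fst (x, z)) + snd (x, z) *s axis i 1 \<in> conic_nbhd \<epsilon>\<^sub>0"
        using slice_in_cone[of z x i] rx[of x] r by simp
    qed
  qed
  then have uc: "uniformly_continuous_on S (\<lambda>(x, z). slice x i z)" by (rule compact_uniformly_continuous[OF _ cS])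
  show "isCont (dV i n) x0"
    unfolding continuous_at_eps_delta
  proof (intro allI impI)
    fix e :: real assume e: "e > 0"
    define e' where "e' = e * r ^ n / (2 * fact n)"
    have e': "e' > 0" using e r by (simp add: e'_def)
    obtain d where d: "d > 0" "\<And>p p'. p \<in> S \<Longrightarrow> p' \<in> S \<Longrightarrow> dist p' p < d \<Longrightarrow> dist ((\<lambda>(x, z). slice x i z) p') ((\<lambda>(x, z). slice x i z) p) < e'"
      using uc e' unfolding uniformly_continuous_on_def by blast
    show "\<exists>d>0. \<forall>x. dist x x0 < d \<longrightarrow> dist (dV i n x) (dV i n x0) < e"
    proof (intro exI[of _ "min d r"] conjI allI impI)
      fix x assume "dist x x0 < min d r"
      then have x: "norm (x - x0) < min d r" by (simp add: dist_norm)
      have sl: "slice y i holomorphic_on ball 0 (2 * r)" if "norm (y - x0) \<le> r" for y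
        by (rule holomorphic_on_subset[OF slice_holomorphic]) (use rx[OF that] in auto)
      have "norm ((deriv ^^ n) (slice x i) 0 - (deriv ^^ n) (slice x0 i) 0) \<le> fact n * e' / r ^ n"
      proof (rule holomorphic_coefficient_diff[OF sl sl])
        fix z :: complex assume z: "norm z \<le> r"
        have "(x, z) \<in> S" "(x0, z) \<in> S" using x z r by (auto simp: S_def dist_norm norm_minus_commute)
        moreover have "dist (x, z) (x0, z) < d" using x by (simp add: dist_Pair_Pair dist_norm)
        ultimately have "dist (slice x i z) (slice x0 i z) < e'" using d(2)[of "(x0, z)" "(x, z)"] by simp
        then show "norm (slice x i z - slice x0 i z) \<le> e'" by (simp add: dist_norm)
      qed (use x r in auto)
      also have "\<dots> = e / 2" using r by (simp add: e'_def)
      finally have "norm ((deriv ^^ n) (slice x i) 0 - (deriv ^^ n) (slice x0 i) 0) < e" using e by linarith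
      then show "dist (dV i n x) (dV i n x0) < e"
        unfolding dV_def dist_norm using abs_Re_le_cmod[of "(deriv ^^ n) (slice x i) 0 - (deriv ^^ n) (slice x0 i) 0"] by simp
    qed (use d r in auto)
  qed
qed

end

section \<open>Length of the nodal set\<close>

lemma real_polynomial_function_line:
  fixes V :: "real^2 \<Rightarrow> real"
  assumes "real_polynomial_function V"
  shows "\<exists>d. \<forall>x e. \<exists>p. degree p \<le> d \<and> (\<forall>t. V (x + t *\<^sub>R e) = poly p t)"
  using assms
proof induction
  case (linear f)
  then interpret bounded_linear f .
  have "degree [:f x, f e:] \<le> 1 \<and> (\<forall>t. f (x + t *\<^sub>R e) = poly [:f x, f e:] t)" for x e
    by (simp add: add scaleR)
  then show ?case by blast
next
  case (const c)
  have "degree [:c:] \<le> 0 \<and> (\<forall>t. c = poly [:c:] t)" by simp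
  then show ?case by blast
next
  case (add f g)
  then obtain d1 d2 where *: "\<forall>x e. \<exists>p. degree p \<le> d1 \<and> (\<forall>t. f (x + t *\<^sub>R e) = poly p t)"
    "\<forall>x e. \<exists>p. degree p \<le> d2 \<and> (\<forall>t. g (x + t *\<^sub>R e) = poly p t)" by blast
  show ?case
  proof (intro exI[of _ "max d1 d2"] allI)
    fix x e
    obtain p1 p2 where p: "degree p1 \<le> d1" "\<forall>t. f (x + t *\<^sub>R e) = poly p1 t" "degree p2 \<le> d2" "\<forall>t. g (x + t *\<^sub>R e) = poly p2 t"
      using * by metis
    then have "degree (p1 + p2) \<le> max d1 d2 \<and> (\<forall>t. f (x + t *\<^sub>R e) + g (x + t *\<^sub>R e) = poly (p1 + p2) t)"
      by (auto intro: degree_add_le)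
    then show "\<exists>p. degree p \<le> max d1 d2 \<and> (\<forall>t. f (x + t *\<^sub>R e) + g (x + t *\<^sub>R e) = poly p t)" by blast
  qed
next
  case (mult f g)
  then obtain d1 d2 where *: "\<forall>x e. \<exists>p. degree p \<le> d1 \<and> (\<forall>t. f (x + t *\<^sub>R e) = poly p t)"
    "\<forall>x e. \<exists>p. degree p \<le> d2 \<and> (\<forall>t. g (x + t *\<^sub>R e) = poly p t)" by blast
  show ?case
  proof (intro exI[of _ "d1 + d2"] allI)
    fix x e
    obtain p1 p2 where p: "degree p1 \<le> d1" "\<forall>t. f (x + t *\<^sub>R e) = poly p1 t" "degree p2 \<le> d2" "\<forall>t. g (x + t *\<^sub>R e) = poly p2 t"
      using * by metis
    then have "degree (p1 * p2) \<le> d1 + d2 \<and> (\<forall>t. f (x + t *\<^sub>R e) * g (x + t *\<^sub>R e) = poly (p1 * p2) t)"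
      using degree_mult_le[of p1 p2] by auto
    then show "\<exists>p. degree p \<le> d1 + d2 \<and> (\<forall>t. f (x + t *\<^sub>R e) * g (x + t *\<^sub>R e) = poly p t)" by blast
  qed
qed

text \<open>Norm equivalence in bounded degree, made explicit by interpolation at d + 1 equispaced
  nodes of the unit interval; \<open>K\<close> depends on \<open>d\<close> alone.\<close>

lemma coeff_bound_by_sup:
  obtains K where "K \<ge> 0" "\<And>p S j. degree (p::real poly) \<le> d \<Longrightarrow> (\<And>t. 0 \<le> t \<Longrightarrow> t \<le> 1 \<Longrightarrow> \<bar>poly p t\<bar> \<le> S) \<Longrightarrow> \<bar>coeff p j\<bar> \<le> K * S"
proof -
  define n where "n = Suc d"
  define t where "t i = real i / real n" for i
  have inj: "inj_on t {..<n}" by (auto simp: inj_on_def t_def n_def)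
  define K where "K = (\<Sum>i<n. \<Sum>k\<le>d. \<bar>coeff (lagrange_basis t n i) k\<bar>)"
  have K0: "K \<ge> 0" unfolding K_def by (intro sum_nonneg) auto
  show ?thesis
  proof (rule that[of K])
    fix p :: "real poly" and S j
    assume dp: "degree p \<le> d" and S: "\<And>t. 0 \<le> t \<Longrightarrow> t \<le> 1 \<Longrightarrow> \<bar>poly p t\<bar> \<le> S"
    have S0: "S \<ge> 0" using S[of 0] by simp
    show "\<bar>coeff p j\<bar> \<le> K * S"
    proof (cases "j \<le> d")
      case False
      then have "coeff p j = 0" using dp by (intro coeff_eq_0) auto
      then show ?thesis using K0 S0 by simp
    next
      case True
      have "p = lagrange t n (\<lambda>i. poly p (t i))"
      proof (rule poly_eqI_degree[of "t ` {..<n}"])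
        show "poly p x = poly (lagrange t n (\<lambda>i. poly p (t i))) x" if "x \<in> t ` {..<n}" for x
          using that poly_lagrange[OF inj] by auto
        have "card (t ` {..<n}) = n" using card_image[OF inj] by simp
        then show "card (t ` {..<n}) > degree p" "card (t ` {..<n}) > degree (lagrange t n (\<lambda>i. poly p (t i)))"
          using dp degree_lagrange[of t n "\<lambda>i. poly p (t i)"] by (auto simp: n_def)
      qed
      then have "coeff p j = coeff (lagrange t n (\<lambda>i. poly p (t i))) j" by (rule arg_cong)
      also have "\<dots> = (\<Sum>i<n. poly p (t i) * coeff (lagrange_basis t n i) j)"
        by (simp add: lagrange_def coeff_sum)
      finally have "\<bar>coeff p j\<bar> = \<bar>\<Sum>i<n. poly p (t i) * coeff (lagrange_basis t n i) j\<bar>" by simp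
      also have "\<dots> \<le> (\<Sum>i<n. \<bar>poly p (t i) * coeff (lagrange_basis t n i) j\<bar>)" by (rule sum_abs)
      also have "\<dots> \<le> (\<Sum>i<n. S * (\<Sum>k\<le>d. \<bar>coeff (lagrange_basis t n i) k\<bar>))"
      proof (intro sum_mono)
        fix i assume i: "i \<in> {..<n}"
        have "\<bar>poly p (t i)\<bar> \<le> S" using i by (intro S) (auto simp: t_def)
        moreover have "\<bar>coeff (lagrange_basis t n i) j\<bar> \<le> (\<Sum>k\<le>d. \<bar>coeff (lagrange_basis t n i) k\<bar>)"
          using True by (intro member_le_sum) auto
        ultimately show "\<bar>poly p (t i) * coeff (lagrange_basis t n i) j\<bar> \<le> S * (\<Sum>k\<le>d. \<bar>coeff (lagrange_basis t n i) k\<bar>)"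
          unfolding abs_mult using S0 by (intro mult_mono) auto
      qed
      also have "\<dots> = K * S" by (simp add: K_def sum_distrib_left mult.commute)
      finally show ?thesis .
    qed
  qed (rule K0)
qed

context conic_potential
begin

text \<open>The powers of 2 come from passing between 1 + norm x and the bracket and from the size
  of the slices on their discs; 2 / e1 is the Cauchy factor for the first derivative, and being at
  least 1 it also covers the bound on \<open>V\<close> itself.\<close>

definition "c1 = min 1 (1 / (C' * 2 powr m))"
definition "c2 = max 1 (C * 2 powr m * (2 / e1))"

lemma c1: "0 < c1" "c1 \<le> 1" using C' by (auto simp: c1_def)

lemma V_upper: "V x \<le> C * 2 powr m * (1 + norm x) powr m"
proof -
  have "V x \<le> C * 2 powr m * japanese_bracket x powr m"
    using dV_bound[of 1 0 x] by (simp add: dV_0)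
  also have "\<dots> \<le> C * 2 powr m * (1 + norm x) powr m"
    using C m japanese_bracket_bounds(1,3)[of x] by (intro mult_left_mono powr_mono2) auto
  finally show ?thesis .
qed

lemma growing: "growing_potential V dV m c1 c2"
proof
  have e2: "1 \<le> 2 / e1" using e1 by simp
  show "1 \<le> m" "0 < c1" "c1 \<le> 1" by (fact m c1)+
  show "1 \<le> c2" by (simp add: c2_def)
  fix i n and x :: "real^2"
  show "dV i 0 = V" by (rule ext) (rule dV_0)
  show "continuous_on UNIV (dV i n)" by (rule dV_cont)
  show "has_partial i (dV i n) (dV i (Suc n))" by (rule dV_partial)
  have J: "japanese_bracket x \<ge> 1" by (rule japanese_bracket_bounds)
  have "c1 * (1 + norm x) powr m \<le> 1 / (C' * 2 powr m) * (2 * japanese_bracket x) powr m"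
    using m C' japanese_bracket_bounds(2)[of x] by (intro mult_mono powr_mono2) (auto simp: c1_def)
  also have "\<dots> = 1 / C' * japanese_bracket x powr m" by (simp add: powr_mult)
  also have "\<dots> \<le> V x" by (rule lower)
  finally show "c1 * (1 + norm x) powr m \<le> V x" .
  have "C * 2 powr m * 1 \<le> C * 2 powr m * (2 / e1)" using C e2 by (intro mult_left_mono) auto
  then have "C * 2 powr m \<le> c2" by (simp add: c2_def)
  then have "C * 2 powr m * (1 + norm x) powr m \<le> c2 * (1 + norm x) powr m" by (intro mult_right_mono) auto
  then show "V x \<le> c2 * (1 + norm x) powr m" using V_upper[of x] by linarith
  have "\<bar>dV i 1 x\<bar> \<le> C * 2 powr m * japanese_bracket x powr m * fact 1 * (2 / (e1 * japanese_bracket x)) ^ 1" by (rule dV_bound)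
  also have "\<dots> = C * 2 powr m * (2 / e1) * (japanese_bracket x powr m / japanese_bracket x)" by simp
  also have "japanese_bracket x powr m / japanese_bracket x = japanese_bracket x powr (m - 1)"
    using J by (simp add: powr_diff)
  also have "C * 2 powr m * (2 / e1) * japanese_bracket x powr (m - 1) \<le> c2 * (1 + norm x) powr (m - 1)"
    using J m japanese_bracket_bounds(1)[of x] by (intro mult_mono powr_mono2) (auto simp: c2_def)
  finally show "\<bar>dV i 1 x\<bar> \<le> c2 * (1 + norm x) powr (m - 1)" .
qed

text \<open>At norm at least a T the analyticity radius e1 <x> is at least e1 a T, comparable to
  \<open>T\<close>. The constant 2 / (e1 a) blows up as \<open>a\<close> tends to 0, which is why
  general potentials keep a central disc.\<close>

lemma analytic_annulus:
  assumes a: "0 < a" "a \<le> 1 / (96 * c2)"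
  shows "analytic_potential V dV m c1 c2 a (C * 2 powr m * (1 / c1 + 2) powr m) (2 / (e1 * a)) 1"
proof (intro analytic_potential.intro growing analytic_potential_axioms.intro)
  fix T :: real and x :: "real^2" and i j
  assume T: "1 \<le> T" and x: "a * T \<le> norm x" "norm x \<le> (1 / c1 + 1) * T"
  have aT: "a * T > 0" using a T by simp
  have J: "a * T \<le> japanese_bracket x" "japanese_bracket x \<le> (1 / c1 + 2) * T" "japanese_bracket x \<ge> 1"
  proof -
    have "norm x = sqrt ((norm x)\<^sup>2)" by simp
    also have "\<dots> \<le> japanese_bracket x" unfolding japanese_bracket_def by (intro real_sqrt_le_mono) simp
    finally show "a * T \<le> japanese_bracket x" using x by linarith
    show "japanese_bracket x \<le> (1 / c1 + 2) * T" using japanese_bracket_bounds(1)[of x] x T by (simp add: algebra_simps)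
  qed (rule japanese_bracket_bounds)
  have "\<bar>dV i j x\<bar> \<le> C * 2 powr m * japanese_bracket x powr m * fact j * (2 / (e1 * japanese_bracket x)) ^ j" by (rule dV_bound)
  also have "\<dots> \<le> C * 2 powr m * ((1 / c1 + 2) * T) powr m * fact j * (2 / (e1 * a) / T) ^ j"
  proof (intro mult_mono power_mono powr_mono2)
    have "2 / (e1 * japanese_bracket x) \<le> 2 / (e1 * (a * T))"
      using aT J e1 by (intro divide_left_mono mult_left_mono) auto
    then show "2 / (e1 * japanese_bracket x) \<le> 2 / (e1 * a) / T" by (simp add: mult.assoc)
  qed (use J C m e1 in auto)
  also have "((1 / c1 + 2) * T) powr m = (1 / c1 + 2) powr m * T powr m" by (rule powr_mult)
  finally show "\<bar>dV i j x\<bar> \<le> C * 2 powr m * (1 / c1 + 2) powr m * T powr m * fact j * (2 / (e1 * a) / T) ^ j"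
    by (simp add: mult.assoc)
qed (use a C e1 in auto)

text \<open>Rescaling a line by \<open>T\<close> gives a polynomial of bounded degree on the unit
  interval, of size O(T^m); its coefficients are therefore O(T^m), which are the wanted derivative
  bounds at scale \<open>T\<close>, valid up to the origin.\<close>

lemma analytic_polynomial:
  assumes poly: "real_polynomial_function V"
  shows "\<exists>C3 B. analytic_potential V dV m c1 c2 0 C3 B 1"
proof -
  interpret growing_potential V dV m c1 c2 by (rule growing)
  obtain d where d: "\<And>x e. \<exists>p. degree p \<le> d \<and> (\<forall>t. V (x + t *\<^sub>R e) = poly p t)"
    using real_polynomial_function_line[OF poly] by blast
  obtain K where K: "K \<ge> 0" "\<And>p S j. degree (p::real poly) \<le> d \<Longrightarrow> (\<And>t. 0 \<le> t \<Longrightarrow> t \<le> 1 \<Longrightarrow> \<bar>poly p t\<bar> \<le> S) \<Longrightarrow> \<bar>coeff p j\<bar> \<le> K * S"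
    by (rule coeff_bound_by_sup[of d]) blast
  define C3 where "C3 = K * (C * 2 powr m * (1 / c1 + 3) powr m)"
  have "analytic_potential V dV m c1 c2 0 C3 1 1"
  proof (intro analytic_potential.intro growing analytic_potential_axioms.intro)
    fix T :: real and x :: "real^2" and i j
    assume T: "1 \<le> T" and x: "norm x \<le> (1 / c1 + 1) * T"
    obtain p where p: "degree p \<le> d" "\<And>t. V (x + t *\<^sub>R axis i 1) = poly p t" using d by metis
    have dp: "dV i k (x + t *\<^sub>R axis i 1) = poly ((pderiv ^^ k) p) t" for k t
    proof (induction k arbitrary: t)
      case 0
      then show ?case by (simp add: conic_potential.dV_0[OF conic_potential_axioms] p)
    next
      case (Suc k)
      have "((\<lambda>t. dV i k (x + t *\<^sub>R axis i 1)) has_real_derivative dV i (Suc k) (x + t *\<^sub>R axis i 1)) (at t)"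
        by (rule has_partialD[OF dV_partial])
      moreover have "(poly ((pderiv ^^ k) p) has_real_derivative poly ((pderiv ^^ Suc k) p) t) (at t)"
        by (simp add: poly_DERIV)
      ultimately show ?case using Suc.IH by (auto intro: DERIV_unique)
    qed
    have co: "dV i j x = fact j * coeff p j"
    proof -
      have "dV i j x = poly ((pderiv ^^ j) p) 0" using dp[of j 0] by simp
      also have "\<dots> = coeff ((pderiv ^^ j) p) 0" by (simp add: poly_0_coeff_0)
      also have "\<dots> = fact j * coeff p j" by (simp add: coeff_higher_pderiv pochhammer_fact)
      finally show ?thesis .
    qed
    define P where "P = pcompose p [:0, T:]"
    have P: "poly P t = V (x + (T * t) *\<^sub>R axis i 1)" for t
      by (simp add: P_def poly_pcompose p mult.commute)
    have "\<bar>coeff P j\<bar> \<le> K * (C * 2 powr m * ((1 / c1 + 3) * T) powr m)"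
    proof (rule K(2))
      show "degree P \<le> d" using p(1) T by (simp add: P_def degree_pcompose)
      fix t :: real assume t: "0 \<le> t" "t \<le> 1"
      let ?y = "x + (T * t) *\<^sub>R axis i (1::real)"
      have "norm ?y \<le> norm x + \<bar>T * t\<bar>" using norm_triangle_ineq[of x "(T * t) *\<^sub>R axis i (1::real)"] by (simp add: norm_axis_1)
      also have "\<bar>T * t\<bar> \<le> T * 1" using t T by (simp add: abs_mult mult_left_le)
      finally have "1 + norm ?y \<le> (1 / c1 + 3) * T" using x T by (simp add: algebra_simps)
      then have "C * 2 powr m * (1 + norm ?y) powr m \<le> C * 2 powr m * ((1 / c1 + 3) * T) powr m"
        using C m by (intro mult_left_mono powr_mono2) auto
      then show "\<bar>poly P t\<bar> \<le> C * 2 powr m * ((1 / c1 + 3) * T) powr m"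
        unfolding P using conic_potential.V_upper[OF conic_potential_axioms, of ?y] V_nonneg[of ?y] by linarith
    qed
    moreover have "coeff P j = coeff p j * T ^ j"
      by (simp add: P_def coeff_pcompose_linear)
    ultimately have "\<bar>coeff p j\<bar> * T ^ j \<le> C3 * T powr m"
      using T by (simp add: C3_def abs_mult powr_mult mult.assoc)
    then have "\<bar>coeff p j\<bar> \<le> C3 * T powr m * (1 / T) ^ j" using T by (simp add: power_divide field_simps)
    then have "fact j * \<bar>coeff p j\<bar> \<le> fact j * (C3 * T powr m * (1 / T) ^ j)" by (intro mult_left_mono) auto
    then show "\<bar>dV i j x\<bar> \<le> C3 * T powr m * fact j * (1 / T) ^ j" unfolding co by (simp add: abs_mult mult_ac)
  qed (use K(1) C c2 in \<open>auto simp: C3_def\<close>)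
  then show ?thesis by blast
qed

lemma nodal_length: "0 < \<epsilon> \<Longrightarrow> \<epsilon> < 1 \<Longrightarrow> nodal_length_order V m \<epsilon>"
  and nodal_length_polynomial: "real_polynomial_function V \<Longrightarrow> nodal_length_order V m 0"
proof -
  have c2: "c2 \<ge> 1" by (simp add: c2_def)
  show "nodal_length_order V m \<epsilon>" if e: "0 < \<epsilon>" "\<epsilon> < 1"
  proof -
    \<comment> \<open>Meets both constraints: it is at most 1/(96 c2) because \<epsilon> < 1, and 3
      a c2 equals \<epsilon>/32.\<close>
    define a where "a = \<epsilon> / (96 * c2)"
    have bounds: "0 < a" "a \<le> 1 / (96 * c2)" "3 * a * c2 < \<epsilon>"
      using e c2 by (auto simp: a_def divide_right_mono pos_divide_less_eq)
    interpret analytic_potential V dV m c1 c2 a "C * 2 powr m * (1 / c1 + 2) powr m" "2 / (e1 * a)" 1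
      by (rule analytic_annulus[OF bounds(1,2)])
    show ?thesis by (rule nodal_length_order_holds) (use e bounds in auto)
  qed
  show "nodal_length_order V m 0" if poly: "real_polynomial_function V"
  proof -
    obtain C3 B where "analytic_potential V dV m c1 c2 0 C3 B 1" using analytic_polynomial[OF poly] by blast
    then interpret analytic_potential V dV m c1 c2 0 C3 B 1 .
    show ?thesis by (rule nodal_length_order_holds) auto
  qed
qed

end

theorem proposition7p12:
  fixes V :: "real^2 \<Rightarrow> real" and Vc :: "complex^2 \<Rightarrow> complex"
    and m \<epsilon>\<^sub>0 C C' :: real
  assumes "m \<ge> 1" and "\<epsilon>\<^sub>0 > 0" and "C > 0" and "C' > 0"
    and extension: "\<And>x. Vc (complex_vec x) = complex_of_real (V x)"
    and holomorphic: "vec_holomorphic_on Vc (conic_nbhd \<epsilon>\<^sub>0)"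
    and upper: "\<And>z. z \<in> conic_nbhd \<epsilon>\<^sub>0 \<Longrightarrow> norm (Vc z) \<le> C * japanese_bracket (Re_vec z) powr m"
    and lower: "\<And>x. 1 / C' * japanese_bracket x powr m \<le> V x"
  shows "(\<forall>\<epsilon>. 0 < \<epsilon> \<and> \<epsilon> < 1 \<longrightarrow> nodal_length_order V m \<epsilon>) \<and>
         (real_polynomial_function V \<longrightarrow> nodal_length_order V m 0)"
proof -
  interpret conic_potential V Vc m \<epsilon>\<^sub>0 C C'
    by (rule conic_potential.intro) (fact assms)+
  show ?thesis using nodal_length nodal_length_polynomial by blast
qed

end
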